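(* The following two statements are equivalent. (i) For all $x,y,z,m\in\mathbb N$ (positive integers) with $m\ge3$, $$\lim_{\tau\to\infty}\frac1\tau\left\{\sum_{T<\gamma_n<\varphi_1^{-1}(T)}\int_{\gamma_n}^{\gamma_{n+1}}Z^2(t)\,dt\right\}\neq1,\qquad\text{where } T=\frac{x^m+y^m}{z^m}\,\frac{\tau}{1-c}.$$ (ii) (Fermat–Wiles theorem) There are no positive integers $x,y,z,m$ with $m\ge3$ and $x^m+y^m=z^m$. Here $c$ is Euler's constant, $\varphi_1$ is Jacob's ladder, and the sum runs over $n=1,\dots,N(T)$, where $\gamma_1<\dots<\gamma_{N(T)+1}$ are the zeros of $Z$ in $(T,\varphi_1^{-1}(T))$.
   Context: $Z(t)=e^{i\vartheta(t)}\zeta(\tfrac12+it)$ is Riemann's real function, with $\vartheta(t)=-\tfrac t2\ln\pi+\operatorname{Im}\ln\Gamma(\tfrac14+\tfrac{it}{2})$, so $|Z(t)|=|\zeta(\tfrac12+it)|$. $c$ denotes Euler's constant. The numbers $\frac{x^m+y^m}{z^m}$ with $x,y,z,m\in\mathbb N$, $m\ge3$, are called Fermat's rationals. Jacob's ladder: fix a smooth function $\mu$ increasing to $+\infty$ with $\mu(y)\ge 7y\ln y$. For all sufficiently large $T$ let $\varphi(T)$ be the (unique, large) solution $X=\varphi(T)$ of $\int_0^{\mu(X)}Z^2(t)e^{-2t/X}\,dt=\int_0^TZ^2(t)\,dt$, and put $\varphi_1(T)=\tfrac12\varphi(T)$. The function $\varphi_1$ is continuous and strictly increasing to $+\infty$,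 and $\varphi_1^{-1}$ is its inverse, defined for all large $T$; one has $\varphi_1^{-1}(T)>T$. Zeros: for large $T$, $\gamma_1<\gamma_2<\dots<\gamma_N<\gamma_{N+1}$, $N=N(T)$, are all the distinct zeros of $Z$ (equivalently of $\zeta(\tfrac12+it)$) lying in the open interval $(T,\varphi_1^{-1}(T))$, in increasing order (the index $n$ is relative to $T$). A sum over $T<\gamma_n<\varphi_1^{-1}(T)$ means the sum over $n=1,\dots,N(T)$. *)

theory Defs
  imports "HOL-Complex_Analysis.Complex_Analysis"
begin

(* The Riemann zeta function as the analytic continuation of its Dirichlet series. The choice
   is unique off the pole 1 by the identity theorem; the value at 1 is unspecified. *)
definition zeta :: "complex \<Rightarrow> complex" where
  "zeta = (SOME f. f holomorphic_on (- {1}) \<and>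
             (\<forall>s. Re s > 1 \<longrightarrow> (\<lambda>n. 1 / of_nat (Suc n) powr s) sums f s))"

(* The library's ln_Gamma is the holomorphic branch on the plane cut along the nonpositive
   reals that is real on the positive reals, so theta is continuous with theta 0 = 0. *)
definition RS_theta :: "real \<Rightarrow> real" where
  "RS_theta t = - (t / 2) * ln pi + Im (ln_Gamma (Complex (1/4) (t/2)))"

(* By the functional equation the complex number below is real, so taking Re
   only fixes the type. *)
definition RS_Z :: "real \<Rightarrow> real" where
  "RS_Z t = Re (exp (\<i> * of_real (RS_theta t)) * zeta (Complex (1/2) t))"

definition smooth_above :: "real \<Rightarrow> (real \<Rightarrow> real) \<Rightarrow> bool" where
  "smooth_above y0 \<mu> \<longleftrightarrow> (\<forall>k. (deriv ^^ k) \<mu> differentiable_on {y0<..})"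

definition ladder_eq :: "(real \<Rightarrow> real) \<Rightarrow> real \<Rightarrow> real \<Rightarrow> bool" where
  "ladder_eq \<mu> T X \<longleftrightarrow>
     integral {0..\<mu> X} (\<lambda>t. (RS_Z t)\<^sup>2 * exp (- 2 * t / X)) = integral {0..T} (\<lambda>t. (RS_Z t)\<^sup>2)"

(* y0 is the left end of the half-line on which mu is given. The domain consists of those T
   for which the ladder equation has a unique solution; it contains all large T. *)
definition ladder_dom :: "real \<Rightarrow> (real \<Rightarrow> real) \<Rightarrow> real set" where
  "ladder_dom y0 \<mu> = {T. T > 0 \<and> (\<exists>!X. X > y0 \<and> ladder_eq \<mu> T X)}"

definition ladder :: "real \<Rightarrow> (real \<Rightarrow> real) \<Rightarrow> real \<Rightarrow> real" where
  "ladder y0 \<mu> T = (THE X. X > y0 \<and> ladder_eq \<mu> T X)"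

definition ladder1 :: "real \<Rightarrow> (real \<Rightarrow> real) \<Rightarrow> real \<Rightarrow> real" where
  "ladder1 y0 \<mu> T = ladder y0 \<mu> T / 2"

definition ladder1_inv :: "real \<Rightarrow> (real \<Rightarrow> real) \<Rightarrow> real \<Rightarrow> real" where
  "ladder1_inv y0 \<mu> = the_inv_into (ladder_dom y0 \<mu>) (ladder1 y0 \<mu>)"

(* Finite on bounded intervals, since Z is real-analytic and not identically zero. *)
definition Z_zeros :: "real \<Rightarrow> real \<Rightarrow> real set" where
  "Z_zeros a b = {t. a < t \<and> t < b \<and> RS_Z t = 0}"

(* For n = 1, ..., card (Z_zeros a b): the n-th zero in increasing order. *)
definition zero_nth :: "real \<Rightarrow> real \<Rightarrow> nat \<Rightarrow> real" where
  "zero_nth a b n = sorted_list_of_set (Z_zeros a b) ! (n - 1)"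

(* The interval contains N + 1 zeros, so that the last summand ends at the last zero in it. *)
definition zero_sum :: "real \<Rightarrow> (real \<Rightarrow> real) \<Rightarrow> real \<Rightarrow> real" where
  "zero_sum y0 \<mu> T =
     (let b = ladder1_inv y0 \<mu> T; N = card (Z_zeros T b) - 1
      in \<Sum>n = 1..N. integral {zero_nth T b n..zero_nth T b (n + 1)} (\<lambda>t. (RS_Z t)\<^sup>2))"

end

(* The mean square
   F(T) of Z over [0, T] is T ln T + (2c - 1 - ln (2 pi)) T + o(T), and so its Laplace transform
   at 1/T is T ln T + (c - ln (2 pi)) T + o(T). The ladder equation at X = 2T equates F at
   b = inverse ladder of T with this transform up to a negligible tail, hence F(b) - F(T)
   is asymptotic to (1 - c) T. The sum over consecutive zeros telescopes to F(last zero) - F(first zero),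
   and zeros of Z occur in every interval of length T^(9/10) ln T around T, so the sum is also
   asymptotic to (1 - c) T. Substituting T = r tau / (1 - c), the limit is r = (x^m + y^m) / z^m,
   which equals 1 exactly for a counterexample to Fermat's theorem.

   Both the mean square and the zero gaps are obtained with Gaussian weights: Mellin inversion turns
   integrals of Gamma(s) w^(-s) sum la_k^(-s) against a Gaussian into theta-like sums, which are
   estimated from the divisor sum (for zeta squared) or trivially (for zeta). *)
theory Submission
  imports Defs "HOL-Probability.Probability" "HOL-Real_Asymp.Real_Asymp" "HOL-Complex_Analysis.Complex_Analysis"
begin

text \<open>The definition of \<open>zeta\<close> by choice says nothing until a continuation to the
  plane without 1 is exhibited. It is glued from \<open>kz s / (s - 1)\<close> on Re s > 0 and the
  functional equation, which comes from evaluating the Mellin transform of 1/x - 1/(exp x - 1) in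
  two ways.

  On the critical line Gamma(s) decays like exp (-pi |t| / 2). Taking w close to the imaginary axis
  makes w^(-s) undo this decay for t > 0 up to a factor exp (-2 de t), with de = 1/T in the end.
  Near w = 2 pi i the divisor series can be evaluated near 0 instead, by periodicity, and there the
  hyperbola bound O(sqrt x) for the divisor problem is good enough.

  The Gaussian width D = T^(9/10) meets three demands: the error T^(5/2) / D^2 of the smoothed mean
  square is o(D), D T^(-1/4) exceeds the bound T^(3/5) for the theta function, and D times powers of
  ln T is o(T), so that the smoothing can be removed.

  The constant 1 - c is Gamma'(2): the mean of v ln v under the density exp (-v/T) / T is T ln T +
  Gamma'(2) T.\<close>

lemmas bint_norm_bound = Bochner_Integration.integral_norm_bound_integral
lemmas bint_dominated = Bochner_Integration.integrable_bound


section \<open>The zeta function for Re s > 0, multiplied by s - 1\<close>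

text \<open>Mean value estimate along the real segment from N to x: the derivative has modulus |s|
  y^(-Re s - 1), which is largest at y = N because Re s >= -1.\<close>

lemma powr_diff_bound:
 fixes s :: complex and N x :: real
 assumes N: "N > 0" "N <= x" and s: "Re s >= -1"
 shows "norm (of_real x powr (-s) - of_real N powr (-s)) <= norm s * N powr (- Re s - 1) * (x - N)"
proof -
 let ?S = "closed_segment (of_real N) (of_real x) :: complex set"
 have seg: "\<exists>y. z = of_real y & N <= y & y <= x" if "z \<in> ?S" for z
  using that N by (auto simp: closed_segment_of_real closed_segment_eq_real_ivl)
 have "norm ((of_real x :: complex) powr (-s) - of_real N powr (-s))
     <= (norm s * N powr (- Re s - 1)) * norm (of_real x - of_real N :: complex)"
 proof (rule field_differentiable_bound[of ?S])
  fix z assume "z \<in> ?S"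
  then obtain y where y: "z = of_real y" "N <= y" "y <= x" using seg by blast
  have "z \<notin> \<real>\<^sub>\<le>\<^sub>0" using y N by (auto simp: complex_nonpos_Reals_iff)
  then show "((%z. z powr (-s)) has_field_derivative (-s) * z powr (-s-1)) (at z within ?S)"
   by (auto intro!: derivative_eq_intros simp: powr_diff)
  have "norm ((-s) * z powr (-s-1)) = norm s * y powr (- Re s - 1)"
   using y N by (simp add: norm_mult norm_powr_real_powr)
  also have "y powr (- Re s - 1) <= N powr (- Re s - 1)"
   using y N s by (intro powr_mono2') auto
  finally show "norm ((-s) * z powr (-s-1)) <= norm s * N powr (- Re s - 1)"
   by (simp add: mult_left_mono)
 qed (use N in auto)
 also have "norm (of_real x - of_real N :: complex) = x - N"
  using N by (metis abs_of_nonneg diff_ge_0_iff_ge norm_of_real of_real_diff)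
 finally show ?thesis by simp
qed

text \<open>With N = n + 1 this is (s - 1) times the difference between N^(-s) and the integral of
  y^(-s) over [N, N + 1]. The factor s - 1 removes the denominator of that integral and with it the
  pole at 1.\<close>

definition zterm :: "nat => complex => complex" where
 "zterm n s = (s - 1) * of_nat (Suc n) powr (-s)
   - (of_nat (Suc n) powr (1 - s) - of_nat (Suc (Suc n)) powr (1 - s))"

text \<open>The term is the increment over [N, N + 1] of a function whose derivative is (s - 1)
  (N^(-s) - z^(-s)). This derivative is already small by \<open>powr_diff_bound\<close>, so one
  power of N is gained over the term of the Dirichlet series.\<close>

lemma zterm_bound:
 assumes s: "Re s >= 0"
 shows "norm (zterm n s) <= norm (s - 1) * norm s * real (Suc n) powr (- Re s - 1)"
proof -
 define N where "N = real (Suc n)"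
 have N: "N > 0" by (simp add: N_def)
 define f where "f = (%z::complex. z powr (1 - s) + (s - 1) * of_real N powr (-s) * z)"
 let ?S = "closed_segment (of_real N) (of_real (N+1)) :: complex set"
 have seg: "\<exists>y. z = of_real y & N <= y & y <= N + 1" if "z \<in> ?S" for z
  using that N by (auto simp: closed_segment_of_real closed_segment_eq_real_ivl simp del: of_real_add)
 have "norm (f (of_real (N+1)) - f (of_real N))
     <= (norm (s-1) * norm s * N powr (- Re s - 1)) * norm (of_real (N+1) - of_real N :: complex)"
 proof (rule field_differentiable_bound[of ?S])
  fix z assume "z \<in> ?S"
  then obtain y where y: "z = of_real y" "N <= y" "y <= N+1" using seg by blast
  have nz: "z \<notin> \<real>\<^sub>\<le>\<^sub>0" using y N by (auto simp: complex_nonpos_Reals_iff)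
  have "((%z. z powr (1-s)) has_field_derivative (1-s) * z powr (1-s-1)) (at z within ?S)"
   by (rule has_field_derivative_at_within[OF has_field_derivative_powr[OF nz]])
  then have "(f has_field_derivative (1-s) * z powr (1-s-1) + (s - 1) * of_real N powr (-s)) (at z within ?S)"
   unfolding f_def by (rule DERIV_add[OF _ DERIV_cmult_Id])
  then show "(f has_field_derivative (s-1) * (of_real N powr (-s) - z powr (-s))) (at z within ?S)"
   by (simp add: algebra_simps)
  have "norm (of_real N powr (-s) - z powr (-s)) <= norm s * N powr (- Re s - 1) * (y - N)"
   using powr_diff_bound[of N y s] N s y by (simp add: norm_minus_commute)
  also have "... <= norm s * N powr (- Re s - 1) * 1"
   using y N by (intro mult_left_mono) auto
  finally show "norm ((s-1) * (of_real N powr (-s) - z powr (-s))) <= norm (s-1) * norm s * N powr (- Re s - 1)"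
   by (simp add: norm_mult mult_left_mono mult.assoc)
 qed auto
 also have "f (of_real (N+1)) - f (of_real N) = zterm n s"
  by (simp add: f_def zterm_def N_def algebra_simps)
 finally show ?thesis by (simp add: N_def del: of_nat_Suc)
qed

lemma zterm_holo: "zterm n holomorphic_on A"
 unfolding zterm_def by (intro holomorphic_intros)

lemma summable_Suc_powr: "a < -1 ==> summable (%n. real (Suc n) powr a)"
 using summable_real_powr_iff[of a] by (subst summable_Suc_iff) simp

text \<open>This is (s - 1) zeta(s), continued to Re s > 0. The summand 1 is s - 1 times the
  integral of y^(-s) over [1, oo).\<close>

definition kz :: "complex => complex" where "kz s = 1 + (\<Sum>n. zterm n s)"

lemma zterm_summable: "Re s > 0 ==> summable (%n. norm (zterm n s))"
 by (rule summable_comparison_test'[where N=0,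
    OF summable_mult[OF summable_Suc_powr[of "- Re s - 1"], of "norm (s - 1) * norm s"]])
   (use zterm_bound[of s] in auto)

lemma kz_holo: "kz holomorphic_on {s. Re s > 0}"
proof -
 let ?S = "{s::complex. Re s > 0}"
 have op: "open ?S" by (rule open_halfspace_Re_gt)
 obtain g where g: "\<forall>x\<in>?S. (%n. zterm n x) sums g x & g field_differentiable (at x)"
 proof (rule series_differentiable_comparison_complex[OF op, of zterm])
  show "zterm n field_differentiable (at x)" if "x \<in> ?S" for n x
   using zterm_holo[of n UNIV] that by (simp add: holomorphic_on_def)
  fix x :: complex assume x: "x \<in> ?S"
  define d where "d = Re x / 2"
  define B where "B = (norm x + d + 1) * (norm x + d)"
  define h where "h = (%n. complex_of_real (B * real (Suc n) powr (- d - 1)))"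
  have d: "d > 0" using x by (simp add: d_def)
  have B: "B >= 0" unfolding B_def using d by (intro mult_nonneg_nonneg) auto
  have "summable h" unfolding h_def summable_of_real_iff
   using d by (intro summable_mult summable_Suc_powr) auto
  moreover have "range h \<subseteq> \<real>\<^sub>\<ge>\<^sub>0" using B by (auto simp: h_def)
  moreover have "norm (zterm n y) <= norm (h n)" if y: "y \<in> ball x d" for n y
  proof -
   have dy: "norm (y - x) < d" using y by (simp add: dist_norm norm_minus_commute)
   have r: "\<bar>Re y - Re x\<bar> < d" using abs_Re_le_cmod[of "y - x"] dy by simp
   hence ry: "Re y >= d" unfolding d_def by linarith
   have n1: "norm y <= norm x + d" using norm_triangle_sub[of y x] dy by simp
   have n2: "norm (y-1) <= norm x + d + 1" using norm_triangle_ineq4[of y 1] n1 by simp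
   have "norm (zterm n y) <= norm (y - 1) * norm y * real (Suc n) powr (- Re y - 1)"
    using ry d by (intro zterm_bound) auto
   also have "... <= B * real (Suc n) powr (- d - 1)"
    unfolding B_def using n1 n2 ry d by (intro mult_mono powr_mono) auto
   finally show ?thesis using B by (simp add: h_def norm_mult)
  qed
  ultimately show "\<exists>d (h::nat=>complex). 0 < d & summable h & range h \<subseteq> \<real>\<^sub>\<ge>\<^sub>0 \<and>
     (\<forall>\<^sub>F n in sequentially. \<forall>y\<in>ball x d \<inter> ?S. norm (zterm n y) <= norm (h n))"
   using d by (intro exI[of _ d] exI[of _ h] conjI always_eventually) auto
 qed
 have "g holomorphic_on ?S" using g op by (auto simp: holomorphic_on_open field_differentiable_def)
 then have "(%s. 1 + g s) holomorphic_on ?S" by (intro holomorphic_intros)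
 then show ?thesis
  by (rule holomorphic_transform) (use g in \<open>auto simp: kz_def sums_iff\<close>)
qed

lemma kz_partial:
 "1 + (\<Sum>n<N. zterm n s) = (s - 1) * (\<Sum>n<N. of_nat (Suc n) powr (-s)) + of_nat (Suc N) powr (1 - s)"
 by (induction N) (simp_all add: zterm_def algebra_simps)

lemma kz_LIMSEQ:
 assumes "Re s > 0"
 shows "(%N. (s - 1) * (\<Sum>n<N. of_nat (Suc n) powr (-s)) + of_nat (Suc N) powr (1 - s)) \<longlonglongrightarrow> kz s"
proof -
 have "(%N. 1 + (\<Sum>n<N. zterm n s)) \<longlonglongrightarrow> kz s"
  unfolding kz_def
  by (intro tendsto_add tendsto_const summable_LIMSEQ summable_norm_cancel[OF zterm_summable[OF assms]])
 then show ?thesis unfolding kz_partial .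
qed

text \<open>For Re s > 1 the boundary term (N + 1)^(1 - s) in the partial sums of \<open>kz\<close>
  tends to 0, and only the Dirichlet series is left.\<close>

lemma kz_eq_Dirichlet:
 assumes "Re s > 1"
 shows "(%n. 1 / of_nat (Suc n) powr s) sums (kz s / (s - 1))"
proof -
 have "s ~= 1" using assms by auto
 have "(%N. norm (of_nat (Suc N) powr (1 - s))) \<longlonglongrightarrow> 0"
 proof -
  have "(%N. real (Suc N) powr (1 - Re s)) \<longlonglongrightarrow> 0"
   using assms by (intro tendsto_neg_powr filterlim_compose[OF filterlim_real_sequentially filterlim_Suc]) auto
  moreover have "norm ((of_nat (Suc N) :: complex) powr (1 - s)) = real (Suc N) powr (1 - Re s)" for N
   using norm_powr_real_powr[of "of_nat (Suc N)" "1 - s"] by simp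
  ultimately show ?thesis by (simp only:)
 qed
 then have "(%N. (of_nat (Suc N) :: complex) powr (1 - s)) \<longlonglongrightarrow> 0" by (rule tendsto_norm_zero_cancel)
 from tendsto_diff[OF kz_LIMSEQ[of s] this] assms
 have "(%N. (s - 1) * (\<Sum>n<N. of_nat (Suc n) powr (-s))) \<longlonglongrightarrow> kz s" by (simp del: of_nat_Suc)
 then have "(%N. (s - 1) * (\<Sum>n<N. of_nat (Suc n) powr (-s)) / (s - 1)) \<longlonglongrightarrow> kz s / (s - 1)"
  using \<open>s ~= 1\<close> by (intro tendsto_intros) auto
 moreover have "(of_nat (Suc n) :: complex) powr (-s) = 1 / of_nat (Suc n) powr s" for n
  by (simp add: powr_minus field_simps)
 ultimately show ?thesis using \<open>s ~= 1\<close> by (simp add: sums_def del: of_nat_Suc)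
qed

text \<open>Source of the crude growth O(1 + |t|) of zeta between the critical line and Re s = 2.
  Nothing sharper is needed for the contour shifts, since every integrand there carries a
  Gaussian.\<close>

lemma kz_bound:
 "\<exists>K\<ge>0. \<forall>s. Re s >= 1/2 --> norm (kz s) <= 1 + K * norm (s - 1) * norm s"
proof (intro exI conjI allI impI)
 let ?K = "\<Sum>n. real (Suc n) powr (-3/2)"
 have sm: "summable (%n. real (Suc n) powr (-3/2))" by (rule summable_Suc_powr) auto
 show "?K >= 0" by (intro suminf_nonneg sm) auto
 fix s :: complex assume s: "Re s >= 1/2"
 have "norm (\<Sum>n. zterm n s) <= (\<Sum>n. norm (s-1) * norm s * real (Suc n) powr (-3/2))"
 proof (rule norm_suminf_le)
  fix n
  have "norm (zterm n s) <= norm (s - 1) * norm s * real (Suc n) powr (- Re s - 1)"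
   using s by (intro zterm_bound) auto
  also have "... <= norm (s - 1) * norm s * real (Suc n) powr (-3/2)"
   using s by (intro mult_left_mono powr_mono) auto
  finally show "norm (zterm n s) <= norm (s-1) * norm s * real (Suc n) powr (-3/2)" .
 qed (intro summable_mult sm)
 also have "... = norm (s-1) * norm s * ?K" by (rule suminf_mult[OF sm])
 finally have "norm (\<Sum>n. zterm n s) <= norm (s-1) * norm s * ?K" .
 then show "norm (kz s) <= 1 + ?K * norm (s - 1) * norm s"
  unfolding kz_def using norm_triangle_ineq[of 1 "\<Sum>n. zterm n s"] by (simp add: mult_ac)
qed

section \<open>Gaussian integrals on vertical lines\<close>

text \<open>Read off from the characteristic function of the standard normal distribution, with the
  density written out.\<close>

lemma gauss_std:
 "integrable lborel (%x::real. complex_of_real (exp (- (x\<^sup>2 / 2))) * exp (\<i> * of_real (t * x)))"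
 "(\<integral>x. complex_of_real (exp (- (x\<^sup>2 / 2))) * exp (\<i> * of_real (t * x)) \<partial>lborel) = of_real (sqrt (2*pi) * exp (- (t\<^sup>2) / 2))"
proof -
 let ?g = "%x::real. complex_of_real (exp (- (x\<^sup>2 / 2))) * exp (\<i> * of_real (t * x))"
 have i: "integrable lborel (%x. std_normal_density x)" by (rule integrable_normal_density) simp
 have n: "std_normal_density x = exp (-(x\<^sup>2/2)) / sqrt (2*pi)" for x by (simp add: std_normal_density_def)
 have i2: "integrable lborel (%x. std_normal_density x *\<^sub>R exp (\<i> * of_real (t * x)))"
  by (rule bint_dominated[OF i]) (auto simp: norm_mult n)
 have eq: "?g x = sqrt (2*pi) *\<^sub>R (std_normal_density x *\<^sub>R exp (\<i> * of_real (t * x)))" for x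
  by (simp add: n scaleR_conv_of_real)
 show "integrable lborel ?g" unfolding eq using i2 by (rule integrable_scaleR_right)
 have "(\<integral>x. std_normal_density x *\<^sub>R exp (\<i> * of_real (t * x)) \<partial>lborel) = char std_normal_distribution t"
  unfolding char_def by (subst integral_density) (auto simp: normal_density_nonneg)
 also have "... = of_real (exp (- (t\<^sup>2) / 2))" by (simp add: char_std_normal_distribution)
 finally show "(\<integral>x. ?g x \<partial>lborel) = of_real (sqrt (2*pi) * exp (- (t\<^sup>2) / 2))"
  unfolding eq by (simp add: scaleR_conv_of_real)
qed

lemma gauss_ft:
 fixes D y :: real assumes D: "D > 0"
 shows "integrable lborel (%v::real. exp (\<i> * of_real (v * y)) * of_real (exp (- (v / D)\<^sup>2)))" (is ?A)
  "(\<integral>v. exp (\<i> * of_real (v * y)) * of_real (exp (- (v / D)\<^sup>2)) \<partial>lborel) = of_real (sqrt pi * D * exp (- (D * y)\<^sup>2 / 4))" (is ?B)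
proof -
 let ?t = "D * y / sqrt 2"
 let ?g = "%x::real. complex_of_real (exp (- (x\<^sup>2 / 2))) * exp (\<i> * of_real (?t * x))"
 have c: "sqrt 2 / D ~= 0" using D by simp
 have eq: "exp (\<i> * of_real (v * y)) * of_real (exp (- (v / D)\<^sup>2)) = ?g (0 + sqrt 2 / D * v)" for v
 proof -
  have "(0 + sqrt 2 / D * v)\<^sup>2 / 2 = (v/D)\<^sup>2" by (simp add: power_mult_distrib power_divide)
  moreover have "?t * (0 + sqrt 2 / D * v) = v * y" using D by (simp add: field_simps)
  ultimately show ?thesis by (simp only: mult.commute)
 qed
 show ?A unfolding eq by (rule lborel_integrable_real_affine[OF gauss_std(1) c])
 have "(\<integral>x. ?g x \<partial>lborel) = \<bar>sqrt 2 / D\<bar> *\<^sub>R (\<integral>v. ?g (0 + sqrt 2 / D * v) \<partial>lborel)"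
  by (rule lborel_integral_real_affine[OF c])
 then have "of_real (sqrt (2*pi) * exp (- (?t\<^sup>2) / 2)) = of_real (sqrt 2 / D) * (\<integral>v. ?g (0 + sqrt 2 / D * v) \<partial>lborel)"
  unfolding gauss_std(2) using D by (simp add: scaleR_conv_of_real)
 then have "(\<integral>v. ?g (0 + sqrt 2 / D * v) \<partial>lborel) = of_real (sqrt (2*pi) * exp (- (?t\<^sup>2) / 2)) / of_real (sqrt 2 / D)"
  using D by (simp add: field_simps)
 also have "... = of_real (sqrt (2*pi) * exp (- (?t\<^sup>2) / 2) / (sqrt 2 / D))" by simp
 also have "sqrt (2*pi) * exp (- (?t\<^sup>2) / 2) / (sqrt 2 / D) = sqrt pi * D * exp (- (D * y)\<^sup>2 / 4)"
  by (simp add: real_sqrt_mult power_divide)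
 finally show ?B unfolding eq .
qed

lemma gauss_integrable:
 fixes D :: real assumes D: "D > 0"
 shows "integrable lborel (%v::real. exp (- (v / D)\<^sup>2))" "(\<integral>v. exp (- (v / D)\<^sup>2) \<partial>lborel) = sqrt pi * D"
proof -
 have i: "integrable lborel (%v::real. complex_of_real (exp (- (v / D)\<^sup>2)))"
  using gauss_ft(1)[OF D, of 0] by simp
 show "integrable lborel (%v::real. exp (- (v / D)\<^sup>2))" using integrable_Re[OF i] by simp
 have "complex_of_real (\<integral>v. exp (- (v / D)\<^sup>2) \<partial>lborel) = of_real (sqrt pi * D)"
  using gauss_ft(2)[OF D, of 0] by (simp del: of_real_mult)
 then show "(\<integral>v. exp (- (v / D)\<^sup>2) \<partial>lborel) = sqrt pi * D" by (simp only: of_real_eq_iff)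
qed

lemma gauss_shift_integrable:
 fixes D ta :: real assumes D: "D > 0"
 shows "integrable lborel (%t::real. exp (- ((t - ta) / D)\<^sup>2))" "(\<integral>t. exp (- ((t - ta) / D)\<^sup>2) \<partial>lborel) = sqrt pi * D"
 using lborel_integrable_real_affine[OF gauss_integrable(1)[OF D], of 1 "-ta"]
  lborel_integral_real_affine[of 1 "%v. exp (- (v / D)\<^sup>2)" "-ta"] gauss_integrable(2)[OF D] by simp_all

lemma norm_gauss_line:
 fixes s1 :: complex
 shows "norm (exp ((Complex sg t - s1)\<^sup>2 / of_real (D\<^sup>2))) = exp (((sg - Re s1) / D)\<^sup>2) * exp (- ((t - Im s1) / D)\<^sup>2)"
proof -
 have "Re ((Complex sg t - s1)\<^sup>2 / of_real (D\<^sup>2)) = ((sg - Re s1) / D)\<^sup>2 - ((t - Im s1) / D)\<^sup>2"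
  by (simp add: Re_divide_of_real power2_eq_square)
   (simp add: diff_divide_distrib[of "(sg - Re s1) * (sg - Re s1)"])
 then show ?thesis by (simp only: norm_exp_eq_Re exp_diff exp_minus divide_inverse)
qed

text \<open>Translating t by Im s1 and completing the square reduces this to
  \<open>gauss_ft\<close>. The value does not depend on \<open>sg\<close>: for this entire integrand
  the shift of the contour is obtained by computation instead of Cauchy's theorem.\<close>

lemma gauss_line:
 fixes D sg y :: real and s1 :: complex assumes D: "D > 0"
 shows "(\<integral>t. exp (Complex sg t * of_real y) * exp ((Complex sg t - s1)\<^sup>2 / of_real (D\<^sup>2)) \<partial>lborel)
   = of_real (sqrt pi * D) * exp (s1 * of_real y - of_real ((D*y)\<^sup>2 / 4))"
proof -
 define a where "a = sg - Re s1"
 let ?f = "%t. exp (Complex sg t * of_real y) * exp ((Complex sg t - s1)\<^sup>2 / of_real (D\<^sup>2))"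
 have eq: "?f (Im s1 + 1 * v) = exp (s1 * of_real y + of_real (a*y + a\<^sup>2/D\<^sup>2)) *
   (exp (\<i> * of_real (v * (y + 2*a/D\<^sup>2))) * of_real (exp (- (v / D)\<^sup>2)))" for v
 proof -
  have 1: "Complex sg (Im s1 + 1 * v) = s1 + of_real a + \<i> * of_real v"
   by (auto simp: a_def complex_eq_iff)
  have "D ~= 0" using D by simp
  then have "Complex sg (Im s1 + 1 * v) * of_real y + (Complex sg (Im s1 + 1 * v) - s1)\<^sup>2 / of_real (D\<^sup>2)
    = s1 * of_real y + of_real (a*y + a\<^sup>2/D\<^sup>2) + \<i> * of_real (v * (y + 2*a/D\<^sup>2)) + of_real (- (v / D)\<^sup>2)"
   unfolding 1 by (simp add: field_simps power2_eq_square)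
  then show ?thesis by (simp add: exp_add[symmetric] exp_of_real[symmetric] mult.assoc add_ac add_diff_eq)
 qed
 have "(\<integral>t. ?f t \<partial>lborel) = (\<integral>v. ?f (Im s1 + 1 * v) \<partial>lborel)"
  by (subst lborel_integral_real_affine[of 1 _ "Im s1"]) auto
 also have "... = exp (s1 * of_real y + of_real (a*y + a\<^sup>2/D\<^sup>2)) * of_real (sqrt pi * D * exp (- (D * (y + 2*a/D\<^sup>2))\<^sup>2 / 4))"
  unfolding eq by (subst integral_mult_right_zero) (simp only: gauss_ft(2)[OF D])
 also have "... = of_real (sqrt pi * D) * exp (s1 * of_real y + of_real (a*y + a\<^sup>2/D\<^sup>2) + of_real (- (D * (y + 2*a/D\<^sup>2))\<^sup>2 / 4))"
  by (simp only: exp_add exp_of_real of_real_mult) (simp only: mult_ac)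
 also have "s1 * of_real y + of_real (a*y + a\<^sup>2/D\<^sup>2) + of_real (- (D * (y + 2*a/D\<^sup>2))\<^sup>2 / 4) = s1 * of_real y - complex_of_real ((D*y)\<^sup>2 / 4)"
 proof -
  have "a*y + a\<^sup>2/D\<^sup>2 + (- (D * (y + 2*a/D\<^sup>2))\<^sup>2 / 4) = - ((D*y)\<^sup>2 / 4)"
   using D by (simp add: field_simps power2_eq_square)
  then show ?thesis by (metis (no_types, lifting) add.assoc of_real_add of_real_minus uminus_add_conv_diff add.commute)
 qed
 finally show ?thesis .
qed

section \<open>Euler's integral for Gamma in a logarithmic variable\<close>

text \<open>Euler's integral under t = exp y. In this variable the Mellin transform is a Fourier
  transform over the whole line, and scaling of the argument of the exponential becomes a
  translation of y.\<close>

lemma Gamma_exp_integral: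
 assumes s: "Re s > 0"
 shows "integrable lborel (%y::real. of_real (exp (- exp y)) * exp (s * of_real y))"
  "(\<integral>y. of_real (exp (- exp y)) * exp (s * of_real y) \<partial>lborel) = Gamma s"
proof -
 let ?f = "%t. complex_of_real t powr (s - 1) / of_real (exp t)"
 let ?g = "%y::real. of_real (exp (- exp y)) * exp (s * of_real y) :: complex"
 have eq: "\<bar>exp y\<bar> *\<^sub>R ?f (exp y) = ?g y" for y :: real
 proof -
  have "complex_of_real (exp y) powr (s - 1) = exp ((s-1) * of_real y)"
   by (simp add: powr_def exp_of_real[symmetric])
  then show ?thesis
   by (simp add: scaleR_conv_of_real exp_minus field_simps exp_of_real[symmetric] exp_add[symmetric])
 qed
 have r: "range exp = {0::real<..}"
 proof -
  have "x \<in> range exp" if "x > 0" for x :: real using exp_ln[OF that] by (metis rangeI)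
  then show ?thesis by auto
 qed
 have "?f absolutely_integrable_on exp ` UNIV & integral (exp ` UNIV) ?f = Gamma s"
  unfolding r using absolutely_integrable_Gamma_integral'[OF s] integral_unique[OF Gamma_integral_complex'[OF s]] by simp
 then have *: "(%y. \<bar>exp y\<bar> *\<^sub>R ?f (exp y)) absolutely_integrable_on UNIV & integral UNIV (%y. \<bar>exp y\<bar> *\<^sub>R ?f (exp y)) = Gamma s"
  by (subst has_absolute_integral_change_of_variables_real) (auto intro!: derivative_eq_intros inj_onI)
 then have **: "?g absolutely_integrable_on UNIV" "integral UNIV ?g = Gamma s" unfolding eq by auto
 have m: "?g \<in> borel_measurable borel" by measurable
 have i: "integrable lebesgue ?g" using **(1) by (simp add: set_integrable_def)
 then show i': "integrable lborel ?g" by (subst (asm) integrable_completion) (use m in auto)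
 show "(\<integral>y. ?g y \<partial>lborel) = Gamma s"
  using has_integral_integral_lborel[OF i'] **(2) by (simp add: integral_unique)
qed


lemma Gamma_exp_integral_norm:
 fixes sg r :: real assumes s: "sg > 0" and r: "r > 0"
 shows "integrable lborel (%y::real. exp (- r * exp y) * exp (sg * y))"
  "(\<integral>y. exp (- r * exp y) * exp (sg * y) \<partial>lborel) = Gamma sg * r powr (-sg)"
proof -
 have eq: "exp (- r * exp y) * exp (sg * y) = r powr (-sg) * Re (of_real (exp (- exp (ln r + 1 * y))) * exp (of_real sg * of_real (ln r + 1 * y)))" for y
  using r by (simp add: exp_add Re_exp powr_def exp_minus field_simps flip: of_real_add of_real_mult of_real_minus exp_of_real)
 have i: "integrable lborel (%y. of_real (exp (- exp (ln r + 1 * y))) * exp (of_real sg * of_real (ln r + 1 * y)) :: complex)"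
  using lborel_integrable_real_affine[OF Gamma_exp_integral(1)[of "of_real sg"], of 1 "ln r"] s by simp
 show "integrable lborel (%y::real. exp (- r * exp y) * exp (sg * y))"
  unfolding eq by (intro integrable_mult_right integrable_Re i)
 have "(\<integral>y. exp (- r * exp y) * exp (sg * y) \<partial>lborel) = r powr (-sg) * Re (\<integral>y. of_real (exp (- exp (ln r + 1 * y))) * exp (of_real sg * of_real (ln r + 1 * y)) \<partial>lborel)"
  unfolding eq by (subst integral_mult_right_zero) (simp only: integral_Re[OF i])
 also have "(\<integral>y. of_real (exp (- exp (ln r + 1 * y))) * exp (of_real sg * of_real (ln r + 1 * y)) \<partial>lborel) = complex_of_real (Gamma sg)"
  using lborel_integral_real_affine[of 1 "%y. of_real (exp (- exp y)) * exp (of_real sg * of_real y) :: complex" "ln r"]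
   Gamma_exp_integral(2)[of "of_real sg"] s by (simp add: Gamma_complex_of_real)
 finally show "(\<integral>y. exp (- r * exp y) * exp (sg * y) \<partial>lborel) = Gamma sg * r powr (-sg)" by simp
qed

lemma Gamma_exp_integral_real:
 fixes s :: complex assumes s: "Re s > 0" and r: "r > 0"
 shows "integrable lborel (%y::real. of_real (exp (- r * exp y)) * exp (s * of_real y))"
  "(\<integral>y. of_real (exp (- r * exp y)) * exp (s * of_real y) \<partial>lborel) = Gamma s * of_real r powr (-s)"
proof -
 have eq: "of_real (exp (- r * exp y)) * exp (s * of_real y) = of_real r powr (-s) * (of_real (exp (- exp (ln r + 1 * y))) * exp (s * of_real (ln r + 1 * y)))" for y
 proof -
  have "of_real r powr (-s) * exp (s * of_real (ln r + 1 * y)) = exp (s * of_real y)"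
   using r by (simp add: powr_def Ln_of_real exp_add[symmetric] algebra_simps)
  moreover have "exp (- exp (ln r + 1 * y)) = exp (- r * exp y)" using r by (simp add: exp_add)
  ultimately show ?thesis by (metis mult.left_commute)
 qed
 have i: "integrable lborel (%y. of_real (exp (- exp (ln r + 1 * y))) * exp (s * of_real (ln r + 1 * y)) :: complex)"
  by (rule lborel_integrable_real_affine[OF Gamma_exp_integral(1)[OF s], of 1 "ln r"]) simp
 show "integrable lborel (%y::real. of_real (exp (- r * exp y)) * exp (s * of_real y))"
  unfolding eq by (intro integrable_mult_right i)
 have "(\<integral>y. of_real (exp (- r * exp y)) * exp (s * of_real y) \<partial>lborel) = of_real r powr (-s) * (\<integral>y. of_real (exp (- exp (ln r + 1 * y))) * exp (s * of_real (ln r + 1 * y)) \<partial>lborel)"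
  unfolding eq by (rule integral_mult_right_zero)
 also have "(\<integral>y. of_real (exp (- exp (ln r + 1 * y))) * exp (s * of_real (ln r + 1 * y)) \<partial>lborel) = Gamma s"
  using lborel_integral_real_affine[of 1 "%y. of_real (exp (- exp y)) * exp (s * of_real y) :: complex" "ln r"]
   Gamma_exp_integral(2)[OF s] by simp
 finally show "(\<integral>y. of_real (exp (- r * exp y)) * exp (s * of_real y) \<partial>lborel) = Gamma s * of_real r powr (-s)" by simp
qed

lemma Gamma_exp_integrable:
 assumes s: "Re s > 0" and w: "Re w > 0"
 shows "integrable lborel (%y::real. exp (- w * of_real (exp y)) * exp (s * of_real y))"
 by (rule bint_dominated[OF Gamma_exp_integral_norm(1)[OF s w]])
   (auto simp: norm_mult)

text \<open>Expanding around a real \<open>r\<close> so large that \<open>w\<close> lies in the disc of radius \<open>r\<close> about \<open>r\<close>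
  avoids analytic continuation in \<open>w\<close>.\<close>

lemma Gamma_exp_integral_complex:
 assumes s: "Re s > 0" and w: "Re w > 0"
 shows "(\<integral>y. exp (- w * of_real (exp y)) * exp (s * of_real y) \<partial>lborel) = Gamma s * w powr (-s)"
proof -
 \<comment> \<open>With this radius 2 r Re w = 2 |w|^2, so that |w - r|^2 = r^2 - |w|^2 <
   r^2.\<close>
 define r where "r = (norm w)\<^sup>2 / Re w"
 have w0: "w ~= 0" using w by auto
 have r: "r > 0" unfolding r_def using w w0 by simp
 define z where "z = (w - of_real r) / of_real r"
 have "(norm (w - of_real r))\<^sup>2 = (norm w)\<^sup>2 - 2 * r * Re w + r\<^sup>2"
  unfolding cmod_power2 by (simp add: power2_eq_square algebra_simps)
 also have "2 * r * Re w = 2 * (norm w)\<^sup>2" using w by (simp add: r_def)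
 also have "(norm w)\<^sup>2 - 2 * (norm w)\<^sup>2 + r\<^sup>2 < r\<^sup>2" using w0 by simp
 finally have "norm (w - of_real r) < r" using r by (simp add: power_less_imp_less_base)
 then have z: "norm z < 1" unfolding z_def using r by (simp add: norm_divide)
 have zr: "z * of_real r = w - of_real r" using r by (simp add: z_def)
 let ?f = "%k (y::real). (- (z * of_real r)) ^ k / fact k * (of_real (exp (- r * exp y)) * exp ((s + of_nat k) * of_real y))"
 have Rk: "Re (s + of_nat k) > 0" for k using s by (simp add: add_pos_nonneg)
 have int: "integrable lborel (?f k)" for k
  by (intro integrable_mult_right Gamma_exp_integral_real(1)[OF Rk r])
 have sumsf: "(%k. ?f k y) sums (exp (- w * of_real (exp y)) * exp (s * of_real y))" for y
 proof -
  have "(%k. (- (z * of_real r) * of_real (exp y)) ^ k /\<^sub>R fact k) sums exp (- (z * of_real r) * of_real (exp y))"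
   by (rule exp_converges)
  from sums_mult[OF this, of "of_real (exp (- r * exp y)) * exp (s * of_real y)"]
  have "(%k. of_real (exp (- r * exp y)) * exp (s * of_real y) * ((- (z * of_real r) * of_real (exp y)) ^ k /\<^sub>R fact k))
    sums (of_real (exp (- r * exp y)) * exp (s * of_real y) * exp (- (z * of_real r) * of_real (exp y)))" .
  moreover have "of_real (exp (- r * exp y)) * exp (s * of_real y) * ((- (z * of_real r) * of_real (exp y)) ^ k /\<^sub>R fact k) = ?f k y" for k
  proof -
   have "exp ((s + of_nat k) * of_real y) = exp (s * of_real y) * (of_real (exp y) :: complex) ^ k"
    by (simp add: distrib_right exp_add exp_of_nat_mult exp_of_real)
   then show ?thesis
    by (simp only: power_mult_distrib scaleR_conv_of_real) (simp add: field_simps)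
  qed
  moreover have "of_real (exp (- r * exp y)) * exp (s * of_real y) * exp (- (z * of_real r) * of_real (exp y)) = exp (- w * of_real (exp y)) * exp (s * of_real y)"
  proof -
   have "of_real (exp (- r * exp y)) * exp (- (z * of_real r) * of_real (exp y)) = exp (- w * complex_of_real (exp y))"
    unfolding zr by (simp add: exp_of_real[symmetric] exp_add[symmetric] algebra_simps)
   then show ?thesis by (metis mult.assoc mult.commute)
  qed
  ultimately show ?thesis by (simp only:)
 qed
 have nf: "norm (?f k y) = norm z ^ k * r ^ k / fact k * (exp (- r * exp y) * exp ((Re s + real k) * y))" for k y
  using r by (simp add: norm_mult norm_divide norm_power power_mult_distrib)
 have gp: "pochhammer (Re s) k = Gamma (Re s + real k) / Gamma (Re s)" for k
  using s by (intro pochhammer_Gamma) (auto elim!: nonpos_Ints_cases)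
 have gpc: "pochhammer s k = Gamma (s + of_nat k) / Gamma s" for k
  using s by (intro pochhammer_Gamma) (auto elim!: nonpos_Ints_cases)
 have G0: "Gamma (Re s) ~= 0" using Gamma_real_pos[OF s] by linarith
 have Gc0: "Gamma s ~= 0" using s by (auto simp: Gamma_eq_zero_iff elim!: nonpos_Ints_cases)
 have intn: "(\<integral>y. norm (?f k y) \<partial>lborel) = Gamma (Re s) * r powr (- Re s) * (norm z ^ k * pochhammer (Re s) k / fact k)" for k
 proof -
  have "r ^ k * r powr (- (Re s + real k)) = r powr (- Re s)"
   using r by (simp add: powr_realpow[symmetric] powr_add[symmetric])
  then show ?thesis
   unfolding nf using Gamma_exp_integral_norm(2)[of "Re s + real k" r] s r G0 gp[of k]
   by (simp add: add_pos_nonneg G0)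
 qed
 \<comment> \<open>The integrals of the norms are the terms of the binomial series of (1 - |z|)^(-
   Re s). All its terms are nonnegative, and it converges because |z| < 1.\<close>
 have sb: "summable (%k. norm z ^ k * pochhammer (Re s) k / fact k)"
 proof -
  have "(%n. ((- Re s) gchoose n) * (- norm z)^n) sums (1 + (- norm z)) powr (- Re s)"
   using gen_binomial_real[of "- norm z" "- Re s"] z by simp
  moreover have "((- Re s) gchoose n) * (- norm z)^n = norm z ^ n * pochhammer (Re s) n / fact n" for n
  proof -
   have "(-1)^n * (- norm z)^n = norm z ^ n" by (simp add: power_mult_distrib[symmetric])
   then show ?thesis unfolding gbinomial_pochhammer by (simp add: mult_ac)
  qed
  ultimately show ?thesis by (simp add: sums_iff)
 qed
 have "(%k. integral\<^sup>L lborel (?f k)) sums (\<integral>y. (\<Sum>k. ?f k y) \<partial>lborel)"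
 proof (rule sums_integral[OF int])
  show "AE y in lborel. summable (%k. norm (?f k y))"
  proof (rule AE_I2)
   fix y :: real
   have "summable (%k. (norm z * r * exp y) ^ k /\<^sub>R fact k)" by (rule summable_exp_generic)
   from summable_mult[OF this, of "exp (- r * exp y) * exp (Re s * y)"]
   show "summable (%k. norm (?f k y))"
   proof (rule back_subst[of summable])
    show "(%k. exp (- r * exp y) * exp (Re s * y) * ((norm z * r * exp y) ^ k /\<^sub>R fact k)) = (%k. norm (?f k y))"
     unfolding nf by (rule ext) (simp add: power_mult_distrib distrib_right exp_add exp_of_nat_mult exp_of_nat2_mult field_simps)
   qed
  qed
  show "summable (%k. \<integral>y. norm (?f k y) \<partial>lborel)"
   unfolding intn by (intro summable_mult sb)
 qed
 moreover have "(\<Sum>k. ?f k y) = exp (- w * of_real (exp y)) * exp (s * of_real y)" for y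
  using sumsf[of y] by (simp add: sums_iff)
 ultimately have 1: "(%k. integral\<^sup>L lborel (?f k)) sums (\<integral>y. exp (- w * of_real (exp y)) * exp (s * of_real y) \<partial>lborel)"
  by (simp only:)
 have 2: "integral\<^sup>L lborel (?f k) = Gamma s * of_real r powr (-s) * (((-s) gchoose k) * z ^ k)" for k
 proof -
  have a: "integral\<^sup>L lborel (?f k) = (- (z * of_real r)) ^ k / fact k * (Gamma (s + of_nat k) * of_real r powr (-(s + of_nat k)))"
   by (subst integral_mult_right_zero) (simp only: Gamma_exp_integral_real(2)[OF Rk r])
  have b: "complex_of_real r powr (-(s + of_nat k)) = of_real r powr (-s) / of_real r ^ k"
   using r by (simp add: powr_diff powr_nat' diff_conv_add_uminus[symmetric] del: diff_conv_add_uminus)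
  have c: "Gamma (s + of_nat k) = pochhammer s k * Gamma s" using gpc[of k] Gc0 by simp
  have d: "(- (z * of_real r)) ^ k = (-1)^k * z^k * of_real r ^ k"
   by (metis mult_minus1 power_mult_distrib mult.assoc)
  show ?thesis unfolding a unfolding b c d gbinomial_pochhammer using r by (simp add: field_simps)
 qed
 have "(%k. Gamma s * of_real r powr (-s) * (((-s) gchoose k) * z ^ k)) sums (Gamma s * of_real r powr (-s) * (1 + z) powr (-s))"
  by (intro sums_mult gen_binomial_complex z)
 with 1 have "(\<integral>y. exp (- w * of_real (exp y)) * exp (s * of_real y) \<partial>lborel) = Gamma s * (of_real r powr (-s) * (1 + z) powr (-s))"
  unfolding 2 by (simp add: sums_iff mult.assoc)
 also have "of_real r powr (-s) * (1 + z) powr (-s) = (of_real r * (1 + z)) powr (-s)"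
  using r by (subst powr_times_real_left) auto
 also have "of_real r * (1 + z) = w" using zr by (simp add: algebra_simps)
 finally show ?thesis .
qed


section \<open>Mellin inversion against a Gaussian\<close>

lemma gauss_lin:
 fixes D \<beta> :: real assumes D: "D > 0"
 shows "integrable lborel (%y::real. exp (\<beta> * y - (D*y)\<^sup>2/4))" "(\<integral>y. exp (\<beta> * y - (D*y)\<^sup>2/4) \<partial>lborel) = exp ((\<beta>/D)\<^sup>2) * sqrt pi * (2/D)"
proof -
 have eq: "exp (\<beta> * y - (D*y)\<^sup>2/4) = exp ((\<beta>/D)\<^sup>2) * exp (- ((y - 2*\<beta>/D\<^sup>2) / (2/D))\<^sup>2)" for y
  using D by (simp add: exp_add[symmetric] field_simps power2_eq_square)
 have D2: "2/D > 0" using D by simp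
 show "integrable lborel (%y::real. exp (\<beta> * y - (D*y)\<^sup>2/4))"
  unfolding eq by (intro integrable_mult_right gauss_shift_integrable(1)[OF D2])
 show "(\<integral>y. exp (\<beta> * y - (D*y)\<^sup>2/4) \<partial>lborel) = exp ((\<beta>/D)\<^sup>2) * sqrt pi * (2/D)"
  unfolding eq by (subst integral_mult_right_zero) (simp only: gauss_shift_integrable(2)[OF D2] mult.assoc)
qed

text \<open>Gamma(s) w^(-s) is written as an integral over y and the order of integration is
  exchanged; the integral over t is then the one computed in \<open>gauss_line\<close>. The majorant
  is a product of a function of t and a function of y, which makes Fubini immediate.\<close>

lemma mellin_gauss:
 fixes D sg :: real and s1 w :: complex
 assumes D: "D > 0" and sg: "sg > 0" and w: "Re w > 0"
 defines "g \<equiv> %t. exp ((Complex sg t - s1)\<^sup>2 / of_real (D\<^sup>2))"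
 shows "integrable lborel (%t. Gamma (Complex sg t) * w powr (- Complex sg t) * g t)"
  and "(\<integral>t. Gamma (Complex sg t) * w powr (- Complex sg t) * g t \<partial>lborel)
   = of_real (sqrt pi * D) * (\<integral>y. exp (- w * of_real (exp y)) * exp (s1 * of_real y - of_real ((D*y)\<^sup>2/4)) \<partial>lborel)"
proof -
 define f where "f = (%t y. exp (- w * of_real (exp y)) * exp (Complex sg t * of_real y) * g t)"
 define c where "c = exp (((sg - Re s1) / D)\<^sup>2)"
 have Ct[measurable]: "Complex sg \<in> borel_measurable borel"
  unfolding Complex_eq by measurable
 have gm[measurable]: "g \<in> borel_measurable borel" unfolding g_def by measurable
 have fm: "case_prod f \<in> borel_measurable (lborel \<Otimes>\<^sub>M lborel)"
  unfolding f_def by measurable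
 have nf: "norm (f t y) = c * exp (- ((t - Im s1) / D)\<^sup>2) * (exp (- Re w * exp y) * exp (sg * y))" for t y
  unfolding f_def norm_mult g_def norm_gauss_line c_def by simp
 have int: "integrable (lborel \<Otimes>\<^sub>M lborel) (case_prod f)"
 proof (rule lborel_pair.Fubini_integrable[OF fm])
  show "integrable lborel (%x. \<integral>y. norm (case_prod f (x, y)) \<partial>lborel)"
   unfolding prod.case nf integral_mult_right_zero
   by (intro integrable_mult_left integrable_mult_right gauss_shift_integrable(1)[OF D])
  show "AE x in lborel. integrable lborel (%y. case_prod f (x, y))"
   unfolding prod.case f_def
   by (intro AE_I2 integrable_mult_left Gamma_exp_integrable) (use sg w in auto)
 qed
 have 1: "(\<integral>y. f t y \<partial>lborel) = Gamma (Complex sg t) * w powr (- Complex sg t) * g t" for t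
  unfolding f_def by (subst integral_mult_left_zero, subst Gamma_exp_integral_complex) (use sg w in auto)
 show "integrable lborel (%t. Gamma (Complex sg t) * w powr (- Complex sg t) * g t)"
  using lborel_pair.integrable_fst'[OF int] unfolding prod.case 1 .
 have 2: "(\<integral>t. f t y \<partial>lborel) = of_real (sqrt pi * D) * (exp (- w * of_real (exp y)) * exp (s1 * of_real y - of_real ((D*y)\<^sup>2/4)))" for y
 proof -
  have "(\<integral>t. f t y \<partial>lborel) = exp (- w * of_real (exp y)) * (\<integral>t. exp (Complex sg t * of_real y) * g t \<partial>lborel)"
   unfolding f_def mult.assoc by (rule integral_mult_right_zero)
  then show ?thesis unfolding g_def gauss_line[OF D] by (simp only: mult_ac)
 qed
 have "(\<integral>t. (\<integral>y. f t y \<partial>lborel) \<partial>lborel) = (\<integral>y. (\<integral>t. f t y \<partial>lborel) \<partial>lborel)"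
  by (rule lborel_pair.Fubini_integral[symmetric, OF int])
 then show "(\<integral>t. Gamma (Complex sg t) * w powr (- Complex sg t) * g t \<partial>lborel)
   = of_real (sqrt pi * D) * (\<integral>y. exp (- w * of_real (exp y)) * exp (s1 * of_real y - of_real ((D*y)\<^sup>2/4)) \<partial>lborel)"
  unfolding 1 2 integral_mult_right_zero .
qed

text \<open>Trades exponential decay for a power. The exponent is chosen by the application so that
  the sum over the frequencies converges.\<close>

lemma exp_minus_le_powr:
 fixes x sg :: real assumes "sg > 0" "x > 0"
 shows "exp (-x) <= sg powr sg * x powr (-sg)"
proof -
 have "x / sg <= exp (x/sg)" using exp_ge_add_one_self[of "x/sg"] by linarith
 then have "(x/sg) powr sg <= exp (x/sg) powr sg" using assms by (intro powr_mono2) auto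
 also have "exp (x/sg) powr sg = exp x" using assms by (simp add: powr_def)
 finally have "inverse (exp x) <= inverse ((x/sg) powr sg)" using assms by (intro le_imp_inverse_le) auto
 then show ?thesis using assms by (simp add: exp_minus powr_minus powr_divide field_simps)
qed

text \<open>\<open>mellin_gauss\<close> for each \<open>la k * w\<close>, summed over k. Both
  exchanges of sum and integral are dominated by multiples of la_k^(-sg): on the side of t because
  |la_k^(-s)| is constant on the line, on the side of y by \<open>exp_minus_le_powr\<close>. The
  sequence is left general because it is used for the products \<open>pm\<close> as well as for the
  exponents pi n^2 of the theta function.\<close>

lemma mellin_gauss_sum:
 fixes D sg :: real and s1 w :: complex and la :: "nat => real"
 assumes D: "D > 0" and sg: "sg > 0" and w: "Re w > 0"
  and la: "!!k. la k > 0" and sm: "summable (%k. la k powr (-sg))"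
 defines "g \<equiv> %t. exp ((Complex sg t - s1)\<^sup>2 / of_real (D\<^sup>2))"
 shows "integrable lborel (%t. Gamma (Complex sg t) * w powr (- Complex sg t) * (\<Sum>k. of_real (la k) powr (- Complex sg t)) * g t)" (is ?A)
  and "integrable lborel (%y. (\<Sum>k. exp (- of_real (la k) * w * of_real (exp y))) * exp (s1 * of_real y - of_real ((D*y)\<^sup>2/4)))" (is ?B)
  and "(\<integral>t. Gamma (Complex sg t) * w powr (- Complex sg t) * (\<Sum>k. of_real (la k) powr (- Complex sg t)) * g t \<partial>lborel)
   = of_real (sqrt pi * D) * (\<integral>y. (\<Sum>k. exp (- of_real (la k) * w * of_real (exp y))) * exp (s1 * of_real y - of_real ((D*y)\<^sup>2/4)) \<partial>lborel)" (is ?C)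
proof -
 let ?h = "%t. Gamma (Complex sg t) * w powr (- Complex sg t) * g t"
 let ?f = "%k t. Gamma (Complex sg t) * (of_real (la k) * w) powr (- Complex sg t) * g t"
 let ?e = "%y. exp (s1 * of_real y - of_real ((D*y)\<^sup>2/4))"
 let ?u = "%k y. exp (- (of_real (la k) * w) * of_real (exp y)) * ?e y"
 have w0: "w ~= 0" using w by auto
 have Rw: "Re (of_real (la k) * w) > 0" for k using w la[of k] by simp
 have f_int: "integrable lborel (?f k)" for k
  unfolding g_def by (rule mellin_gauss(1)[OF D sg Rw])
 have f_eq: "?f k t = of_real (la k) powr (- Complex sg t) * ?h t" for k t
  using la[of k] by (subst powr_times_real_left) auto
 have nl: "norm (of_real (la k) powr (- Complex sg t)) = la k powr (-sg)" for k t
  using la[of k] by (subst norm_powr_real_powr) auto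
 have h_int: "integrable lborel ?h" unfolding g_def by (rule mellin_gauss(1)[OF D sg w])
 have sl: "summable (%k. of_real (la k) powr (- Complex sg t) :: complex)" for t
  by (rule summable_norm_cancel) (simp only: nl sm)
 have f_abs: "AE t in lborel. summable (%k. norm (?f k t))"
  unfolding f_eq norm_mult nl by (intro AE_I2 summable_mult2 sm)
 have f_sm: "summable (%k. \<integral>t. norm (?f k t) \<partial>lborel)"
  unfolding f_eq norm_mult nl integral_mult_right_zero by (intro summable_mult2 sm)
 have f_sum: "(\<Sum>k. ?f k t) = Gamma (Complex sg t) * w powr (- Complex sg t) * (\<Sum>k. of_real (la k) powr (- Complex sg t)) * g t" for t
  unfolding f_eq by (subst suminf_mult2[OF sl, symmetric]) (simp only: mult_ac)
 show ?A using integrable_suminf[OF f_int f_abs f_sm] unfolding f_sum .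
 define K where "K = sg powr sg * Re w powr (-sg)"
 have K: "K >= 0" by (simp add: K_def)
 have nu: "norm (?u k y) <= la k powr (-sg) * (K * exp ((Re s1 - sg) * y - (D*y)\<^sup>2/4))" for k y
 proof -
  have "norm (exp (- (of_real (la k) * w) * of_real (exp y))) = exp (- (la k * Re w * exp y))" by simp
  also have "... <= sg powr sg * (la k * Re w * exp y) powr (-sg)"
   using la[of k] w by (intro exp_minus_le_powr sg) auto
  also have "(la k * Re w * exp y) powr (-sg) = la k powr (-sg) * Re w powr (-sg) * exp (-sg*y)"
   using la[of k] w by (simp add: powr_mult) (simp add: powr_def)
  finally have 1: "norm (exp (- (of_real (la k) * w) * of_real (exp y))) <= sg powr sg * (la k powr (-sg) * Re w powr (-sg) * exp (-sg*y))" .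
  have "norm (?e y) = exp (Re s1 * y - (D*y)\<^sup>2/4)" by simp
  then have "norm (?u k y) <= sg powr sg * (la k powr (-sg) * Re w powr (-sg) * exp (-sg*y)) * exp (Re s1 * y - (D*y)\<^sup>2/4)"
   unfolding norm_mult by (intro mult_mono 1) auto
  also have "... = la k powr (-sg) * (K * exp ((Re s1 - sg) * y - (D*y)\<^sup>2/4))"
  proof -
   have "exp (-sg*y) * exp (Re s1 * y - (D*y)\<^sup>2/4) = exp ((Re s1 - sg) * y - (D*y)\<^sup>2/4)"
    by (simp add: exp_add[symmetric] algebra_simps)
   then show ?thesis unfolding K_def by (metis mult.assoc mult.left_commute)
  qed
  finally show ?thesis .
 qed
 have b_int: "integrable lborel (%y. K * exp ((Re s1 - sg) * y - (D*y)\<^sup>2/4))"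
  by (intro integrable_mult_right gauss_lin(1) D)
 have u_int: "integrable lborel (?u k)" for k
  by (rule bint_dominated[OF integrable_mult_right[OF b_int, of "la k powr (-sg)"]])
    (use nu[of k] K in \<open>auto simp: abs_mult\<close>)
 have u_abs: "AE y in lborel. summable (%k. norm (?u k y))"
  by (intro AE_I2 summable_comparison_test'[where N = 0, OF summable_mult2[OF sm]])
    (use nu in auto)
 have u_sm: "summable (%k. \<integral>y. norm (?u k y) \<partial>lborel)"
 proof (rule summable_comparison_test'[where N = 0, OF summable_mult2[OF sm]])
  fix k
  have "norm (\<integral>y. norm (?u k y) \<partial>lborel) = (\<integral>y. norm (?u k y) \<partial>lborel)"
   by (simp add: integral_nonneg_AE)
  also have "... <= (\<integral>y. la k powr (-sg) * (K * exp ((Re s1 - sg) * y - (D*y)\<^sup>2/4)) \<partial>lborel)"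
   by (intro integral_mono integrable_norm u_int integrable_mult_right[OF b_int] nu)
  also have "... = la k powr (-sg) * (\<integral>y. K * exp ((Re s1 - sg) * y - (D*y)\<^sup>2/4) \<partial>lborel)"
   by (rule integral_mult_right_zero)
  finally show "norm (\<integral>y. norm (?u k y) \<partial>lborel) <= la k powr (-sg) * (\<integral>y. K * exp ((Re s1 - sg) * y - (D*y)\<^sup>2/4) \<partial>lborel)" .
 qed
 have se: "summable (%k. exp (- (of_real (la k) * w) * of_real (exp y)))" for y
 proof -
  have "summable (%k. ?u k y)"
   by (rule summable_norm_cancel, rule summable_comparison_test'[where N = 0, OF summable_mult2[OF sm]])
     (use nu in auto)
  from summable_mult2[OF this, of "inverse (?e y)"] show ?thesis
   by (simp only: mult.assoc right_inverse[OF exp_not_eq_zero] mult_1_right)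
 qed
 have u_sum: "(\<Sum>k. ?u k y) = (\<Sum>k. exp (- of_real (la k) * w * of_real (exp y))) * ?e y" for y
  by (subst suminf_mult2[OF se, symmetric]) (simp only: mult_minus_left)
 show ?B using integrable_suminf[OF u_int u_abs u_sm] unfolding u_sum .
 have "(\<integral>t. (\<Sum>k. ?f k t) \<partial>lborel) = (\<Sum>k. integral\<^sup>L lborel (?f k))"
  by (rule integral_suminf[OF f_int f_abs f_sm])
 also have "... = (\<Sum>k. of_real (sqrt pi * D) * integral\<^sup>L lborel (?u k))"
  unfolding g_def by (subst mellin_gauss(2)[OF D sg Rw]) (rule refl)
 also have "... = of_real (sqrt pi * D) * (\<Sum>k. integral\<^sup>L lborel (?u k))"
  by (rule suminf_mult[OF summable_integral[OF u_int u_abs u_sm]])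
 also have "(\<Sum>k. integral\<^sup>L lborel (?u k)) = (\<integral>y. (\<Sum>k. ?u k y) \<partial>lborel)"
  by (rule integral_suminf[OF u_int u_abs u_sm, symmetric])
 finally show ?C unfolding u_sum f_sum .
qed

section \<open>Shifting a vertical half-line of integration\<close>

text \<open>A primitive on the convex upper half-plane takes the place of Cauchy's theorem. The
  half-lines start at height 1, which keeps them away from the pole of zeta; the price is the
  horizontal segment at height 1, while the one at height R vanishes in the limit because B tends to
  0.\<close>

lemma line_shift:
 fixes f :: "complex => complex" and B :: "real => real"
 assumes holo: "f holomorphic_on {s. Im s > 0}"
  and bound: "!!sg t. a <= sg ==> sg <= b ==> t >= 1 ==> norm (f (Complex sg t)) <= B t"
  and B: "set_integrable lborel {1..} B" "(B \<longlongrightarrow> 0) at_top" and ab: "a <= b"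
 shows "set_integrable lborel {1..} (%t. f (Complex a t))" "set_integrable lborel {1..} (%t. f (Complex b t))"
  "norm ((LINT t:{1..}|lborel. f (Complex a t)) - (LINT t:{1..}|lborel. f (Complex b t))) <= (b - a) * B 1"
proof -
 have cont: "continuous_on {1..} (%t. f (Complex sg t))" for sg
  unfolding Complex_eq
  by (rule continuous_on_compose2[OF holomorphic_on_imp_continuous_on[OF holo]]) (auto intro!: continuous_intros)
 have int: "set_integrable lborel {1..} (%t. f (Complex sg t))" if "sg \<in> {a..b}" for sg
  unfolding set_integrable_def
 proof (rule bint_dominated[OF B(1)[unfolded set_integrable_def]])
  show "(%t. indicator {1..} t *\<^sub>R f (Complex sg t)) \<in> borel_measurable lborel"
   using borel_measurable_continuous_on_indicator[OF _ cont] by simp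
  show "AE t in lborel. norm (indicator {1..} t *\<^sub>R f (Complex sg t)) <= norm (indicat_real {1..} t *\<^sub>R B t)"
   using that by (auto simp: indicator_def intro!: AE_I2 order_trans[OF bound abs_ge_self])
 qed
 show "set_integrable lborel {1..} (%t. f (Complex a t))" "set_integrable lborel {1..} (%t. f (Complex b t))"
  using int ab by auto
 have cvx: "convex {s::complex. Im s > 0}" and op: "open {s::complex. Im s > 0}"
  by (simp_all add: convex_halfspace_Im_gt open_halfspace_Im_gt)
 obtain P where P: "!!x. Im x > 0 ==> (P has_field_derivative f x) (at x)"
  using holomorphic_convex_primitive'[OF cvx op holo] op by (metis at_within_open mem_Collect_eq)
 have FTC: "(LINT t:{1..R}|lborel. f (Complex sg t)) = - \<i> * (P (Complex sg R) - P (Complex sg 1))" if "R >= 1" for R sg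
 proof -
  have "((%t. f (Complex sg t)) has_integral (- \<i> * P (Complex sg R) - (- \<i> * P (Complex sg 1)))) {1..R}"
  proof (rule fundamental_theorem_of_calculus[OF that])
   fix t assume t: "t \<in> {1..R}"
   have 1: "(Complex sg has_vector_derivative \<i>) (at t within {1..R})"
    unfolding Complex_eq by (auto intro!: derivative_eq_intros)
   have "(P has_field_derivative f (Complex sg t)) (at (Complex sg t))" using t by (intro P) auto
   from field_vector_diff_chain_within[OF 1 has_field_derivative_at_within[OF this]]
   have "((%t. P (Complex sg t)) has_vector_derivative \<i> * f (Complex sg t)) (at t within {1..R})"
    by (simp add: o_def)
   from has_vector_derivative_mult_right[OF this, of "-\<i>"]
   show "((%t. - \<i> * P (Complex sg t)) has_vector_derivative f (Complex sg t)) (at t within {1..R})"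
    by (simp add: mult.assoc[symmetric])
  qed
  moreover have "set_integrable lborel {1..R} (%t. f (Complex sg t))"
   by (rule borel_integrable_atLeastAtMost'[OF continuous_on_subset[OF cont]]) auto
  ultimately show ?thesis
   by (simp add: set_borel_integral_eq_integral(2) integral_unique algebra_simps)
 qed
 have lim: "((%R. LINT t:{1..R}|lborel. f (Complex sg t)) \<longlongrightarrow> (LINT t:{1..}|lborel. f (Complex sg t))) at_top" if "sg \<in> {a..b}" for sg
 proof -
  have eq: "indicator {..R} t *\<^sub>R (indicat_real {1..} t *\<^sub>R f (Complex sg t)) = indicat_real {1..R} t *\<^sub>R f (Complex sg t)" for R t
   by (auto simp: indicator_def)
  show ?thesis
   using tendsto_integral_at_top[OF sets_lborel int[OF that, unfolded set_integrable_def]]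
   unfolding set_lebesgue_integral_def eq .
 qed
 have horiz: "norm (P (Complex a R) - P (Complex b R)) <= (b - a) * B R" if "R >= 1" for R
 proof -
  let ?S = "closed_segment (Complex a R) (Complex b R)"
  have S: "\<exists>sg. z = Complex sg R & a <= sg & sg <= b" if "z \<in> ?S" for z
  proof -
   have "Im z = R" "Re z \<in> {a..b}"
    using that ab closed_segment_same_Im[of "Complex a R" "Complex b R"] by (auto simp: closed_segment_eq_real_ivl)
   then show ?thesis by (intro exI[of _ "Re z"]) (auto simp: complex_eq_iff)
  qed
  have "norm (P (Complex b R) - P (Complex a R)) <= B R * norm (Complex b R - Complex a R)"
  proof (rule field_differentiable_bound[of ?S])
   fix z assume z: "z \<in> ?S"
   then obtain sg where sg: "z = Complex sg R" "a <= sg" "sg <= b" using S by blast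
   show "(P has_field_derivative f z) (at z within ?S)"
    by (rule has_field_derivative_at_within[OF P]) (use sg that in auto)
   show "norm (f z) <= B R" using sg that bound by auto
  qed auto
  also have "norm (Complex b R - Complex a R) = b - a" using ab by (simp add: cmod_def)
  finally show ?thesis by (simp add: norm_minus_commute mult.commute)
 qed
 let ?L = "%R. norm ((LINT t:{1..R}|lborel. f (Complex a t)) - (LINT t:{1..R}|lborel. f (Complex b t)))"
 have le: "?L R <= (b - a) * B R + (b - a) * B 1" if "R >= 1" for R
 proof -
  have "?L R = norm (- \<i> * ((P (Complex a R) - P (Complex b R)) - (P (Complex a 1) - P (Complex b 1))))"
   unfolding FTC[OF that] by (simp add: algebra_simps)
  also have "... <= norm (P (Complex a R) - P (Complex b R)) + norm (P (Complex a 1) - P (Complex b 1))"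
   unfolding norm_mult using norm_triangle_ineq4 by simp
  finally show ?thesis using horiz[OF that] horiz[of 1] by simp
 qed
 have 1: "(?L \<longlongrightarrow> norm ((LINT t:{1..}|lborel. f (Complex a t)) - (LINT t:{1..}|lborel. f (Complex b t)))) at_top"
  using ab by (intro tendsto_intros lim) auto
 have 2: "((%R. (b - a) * B R + (b - a) * B 1) \<longlongrightarrow> (b - a) * 0 + (b - a) * B 1) at_top"
  by (intro tendsto_intros B)
 have "norm ((LINT t:{1..}|lborel. f (Complex a t)) - (LINT t:{1..}|lborel. f (Complex b t))) <= (b - a) * 0 + (b - a) * B 1"
  by (rule tendsto_le[OF trivial_limit_at_top_linorder 2 1])
    (auto intro!: le eventually_mono[OF eventually_ge_at_top[of 1]])
 then show "norm ((LINT t:{1..}|lborel. f (Complex a t)) - (LINT t:{1..}|lborel. f (Complex b t))) <= (b - a) * B 1"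
  by simp
qed


lemma powr_exp_integral:
 fixes a r :: real assumes a: "a > 0" and r: "r > 0"
 shows "set_integrable lborel {0<..} (%x. x powr (a - 1) * exp (- r * x))"
  "(LINT x:{0<..}|lborel. x powr (a - 1) * exp (- r * x)) = Gamma a * r powr (-a)"
proof -
 let ?f = "%x::real. x powr (a - 1) * exp (- r * x)"
 have eq: "\<bar>exp y\<bar> *\<^sub>R ?f (exp y) = exp (- r * exp y) * exp (a * y)" for y :: real
  by (simp add: powr_def exp_add[symmetric] algebra_simps)
 have rg: "range exp = {0::real<..}"
 proof -
  have "x \<in> range exp" if "x > 0" for x :: real using exp_ln[OF that] by (metis rangeI)
  then show ?thesis by auto
 qed
 have i: "integrable lborel (%y. exp (- r * exp y) * exp (a * y))" by (rule Gamma_exp_integral_norm(1)[OF a r])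
 have "(%y. exp (- r * exp y) * exp (a * y)) absolutely_integrable_on UNIV & integral UNIV (%y. exp (- r * exp y) * exp (a * y)) = Gamma a * r powr (-a)"
  using integrable_completion[of "%y. exp (- r * exp y) * exp (a * y)" lborel] i has_integral_integral_lborel[OF i] Gamma_exp_integral_norm(2)[OF a r]
  by (simp add: set_integrable_def integral_unique)
 then have "?f absolutely_integrable_on exp ` UNIV & integral (exp ` UNIV) ?f = Gamma a * r powr (-a)"
  unfolding eq[symmetric]
  by (subst (asm) has_absolute_integral_change_of_variables_real) (auto intro!: derivative_eq_intros inj_onI)
 then have 1: "?f absolutely_integrable_on {0<..}" "integral {0<..} ?f = Gamma a * r powr (-a)" unfolding rg by auto
 show 2: "set_integrable lborel {0<..} ?f"
  using 1(1) unfolding set_integrable_def by (subst (asm) integrable_completion) auto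
 show "(LINT x:{0<..}|lborel. ?f x) = Gamma a * r powr (-a)"
  using set_borel_integral_eq_integral(2)[OF 2] 1(2) by simp
qed

section \<open>Dirichlet's divisor problem\<close>

text \<open>A Cauchy product would group the pairs (m, n) by m + n. Enumerating them by the pairing
  bijection leaves them ungrouped, so that they can afterwards be counted according to their
  product.\<close>

lemma pair_sums:
 fixes f g :: "nat => 'a :: {banach, second_countable_topology, real_normed_field}"
 assumes f: "summable (%n. norm (f n))" and g: "summable (%n. norm (g n))"
 shows "summable (%k. norm (f (fst (prod_decode k)) * g (snd (prod_decode k))))"
  "(%k. f (fst (prod_decode k)) * g (snd (prod_decode k))) sums (suminf f * suminf g)"
proof -
 let ?h = "%p. f (fst p) * g (snd p)"
 have fs: "(f has_sum suminf f) UNIV" and gs: "(g has_sum suminf g) UNIV"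
  using f g by (auto intro!: norm_summable_imp_has_sum summable_sums summable_norm_cancel)
 have bij: "bij_betw prod_decode (UNIV::nat set) (UNIV \<times> UNIV)" by (simp add: bij_prod_decode)
 have fa: "(%n. norm (f n)) summable_on UNIV" and ga: "(%n. norm (g n)) summable_on UNIV"
  using f g by (simp_all add: summable_on_UNIV_nonneg_real_iff)
 have abs: "(%p. norm (?h p)) summable_on UNIV \<times> UNIV"
 proof (rule iffD2[OF Infinite_Sum.abs_summable_on_Sigma_iff[where f = ?h]], intro conjI ballI)
  show "(%y. norm (?h (x, y))) summable_on UNIV" for x
   using summable_on_cmult_right[OF ga, of "norm (f x)"] by (simp only: norm_mult fst_conv snd_conv)
  define G where "G = (\<Sum>\<^sub>\<infinity>y. norm (g y))"
  have G: "G >= 0" unfolding G_def by (rule infsum_nonneg) simp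
  have e: "(\<Sum>\<^sub>\<infinity>y. norm (?h (x, y))) = norm (f x) * G" for x
   unfolding G_def by (simp only: norm_mult fst_conv snd_conv infsum_cmult_right')
  have n: "norm (norm (f x) * G) = norm (f x) * G" for x using G by simp
  show "(%x. norm (\<Sum>\<^sub>\<infinity>y. norm (?h (x, y)))) summable_on UNIV"
   unfolding e n by (rule summable_on_cmult_left[OF fa])
 qed
 have "(?h has_sum (suminf f * suminf g)) (UNIV \<times> UNIV)"
 proof (rule has_sum_SigmaI)
  show "((%y. ?h (x, y)) has_sum (f x * suminf g)) UNIV" for x
   using has_sum_cmult_right[OF gs] by simp
  show "((%x. f x * suminf g) has_sum (suminf f * suminf g)) UNIV"
   by (rule has_sum_cmult_left[OF fs])
 qed (rule Infinite_Sum.abs_summable_summable[OF abs])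
 then have "((%k. ?h (prod_decode k)) has_sum (suminf f * suminf g)) UNIV"
  using has_sum_reindex_bij_betw[OF bij, of ?h] by simp
 then show "(%k. f (fst (prod_decode k)) * g (snd (prod_decode k))) sums (suminf f * suminf g)"
  by (rule has_sum_imp_sums)
 have "(%p. norm (?h p)) summable_on UNIV \<times> UNIV" by (rule abs)
 then have "(%k. norm (?h (prod_decode k))) summable_on UNIV"
  using summable_on_reindex_bij_betw[OF bij, of "%p. norm (?h p)"] by simp
 then show "summable (%k. norm (f (fst (prod_decode k)) * g (snd (prod_decode k))))"
  by (rule summable_on_imp_summable)
qed

text \<open>The index k encodes a pair of positive integers, and the value is their product. A
  positive integer N occurs d(N) times among the values, d being the number of divisors, so sums
  over k are divisor sums in which d itself does not appear.\<close>

definition pm :: "nat => real" where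
 "pm k = real (Suc (fst (prod_decode k))) * real (Suc (snd (prod_decode k)))"

lemma pm_ge_1: "pm k >= 1"
 using mult_mono[of 1 "real (Suc (fst (prod_decode k)))" 1 "real (Suc (snd (prod_decode k)))"]
 unfolding pm_def by simp

lemma pm_summable: "a < -1 ==> summable (%k. pm k powr a)"
 using pair_sums(1)[of "%n. real (Suc n) powr a" "%n. real (Suc n) powr a"] summable_real_powr_iff[of a]
  summable_Suc_iff[of "%n. real n powr a"]
 by (simp add: pm_def powr_mult)

definition divcount :: "real => real" where "divcount x = real (card {k. pm k <= x})"

text \<open>Dirichlet's hyperbola method. A lattice point with m n <= x cannot have both coordinates
  above q = floor (sqrt x); the regions m <= q and n <= q are mirror images of each other and
  overlap in a full square of q^2 points.\<close>

lemma divcount_hyperbola: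
 assumes x: "x >= 1"
 defines "q \<equiv> nat \<lfloor>sqrt x\<rfloor>"
 shows "finite {k. pm k <= x}" "divcount x = 2 * (\<Sum>m=1..q. of_int \<lfloor>x / real m\<rfloor>) - (real q)\<^sup>2"
proof -
 define A where "A = {(m, n). m >= 1 & n >= 1 & real m * real n <= x}"
 define N where "N = nat \<lfloor>x\<rfloor>"
 have N: "m <= N" if "m >= 1" "n >= 1" "real m * real n <= x" for m n
 proof -
  have "real m * 1 <= real m * real n" using that by (intro mult_left_mono) auto
  from order_trans[OF this that(3)] have "real m <= x" by simp
  then show ?thesis unfolding N_def by linarith
 qed
 have N': "n <= N" if "m >= 1" "n >= 1" "real m * real n <= x" for m n
  using N[of n m] that by (simp add: mult.commute)
 have finA: "finite A"
  by (rule finite_subset[of _ "{..N} \<times> {..N}"]) (auto simp: A_def N N')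
 let ?e = "%k. (Suc (fst (prod_decode k)), Suc (snd (prod_decode k)))"
 have inj: "inj ?e"
 proof (rule injI)
  fix j k assume "?e j = ?e k"
  then have "prod_decode j = prod_decode k" by (simp add: prod_eq_iff)
  then show "j = k" by (simp add: prod_decode_eq)
 qed
 have img: "?e ` {k. pm k <= x} = A"
 proof (intro equalityI subsetI)
  fix p assume "p \<in> ?e ` {k. pm k <= x}"
  then show "p \<in> A" by (auto simp: A_def pm_def)
 next
  fix p assume "p \<in> A"
  then obtain m n where mn: "p = (m, n)" "m >= 1" "n >= 1" "real m * real n <= x" by (auto simp: A_def)
  let ?k = "prod_encode (m - 1, n - 1)"
  have "?e ?k = p" "pm ?k <= x" using mn by (simp_all add: pm_def)
  then show "p \<in> ?e ` {k. pm k <= x}" by force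
 qed
 show "finite {k. pm k <= x}"
  by (rule finite_imageD[OF _ inj_on_subset[OF inj subset_UNIV]]) (simp only: img finA)
 have "card {k. pm k <= x} = card A"
  using card_image[OF inj_on_subset[OF inj subset_UNIV], of "{k. pm k <= x}"] unfolding img by (rule sym)
 have q: "real q <= sqrt x" "sqrt x < real q + 1" 
 proof -
  have "sqrt x >= 1" using x by simp
  then show "real q <= sqrt x" "sqrt x < real q + 1" unfolding q_def by linarith+
 qed
 have q2: "real q * real q <= x" using mult_mono[OF q(1) q(1)] x by simp
 define A1 where "A1 = {p \<in> A. fst p <= q}"
 define A2 where "A2 = {p \<in> A. snd p <= q}"
 have un: "A = A1 \<union> A2"
 proof -
  have False if "m > q" "n > q" "real m * real n <= x" for m n
  proof -
   have "sqrt x < real m" "sqrt x < real n" using q(2) that by linarith+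
   then have "sqrt x * sqrt x < real m * real n" using x by (intro mult_strict_mono') auto
   then show False using that x by simp
  qed
  then have "m <= q \<or> n <= q" if "(m, n) \<in> A" for m n
   using that unfolding A_def by (metis (mono_tags, lifting) case_prodD mem_Collect_eq not_le)
  then show ?thesis unfolding A1_def A2_def by fastforce
 qed
 have int: "A1 \<inter> A2 = {1..q} \<times> {1..q}"
 proof -
  have "real m * real n <= x" if "m <= q" "n <= q" for m n
   using mult_mono[of "real m" "real q" "real n" "real q"] that q2 by simp
  then show ?thesis by (auto simp: A1_def A2_def A_def)
 qed
 have A1: "A1 = Sigma {1..q} (%m. {1..nat \<lfloor>x / real m\<rfloor>})"
 proof -
  have "real m * real n <= x \<longleftrightarrow> n <= nat \<lfloor>x / real m\<rfloor>" if "m >= 1" "n >= 1" for m n :: nat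
  proof -
   have "real m * real n <= x \<longleftrightarrow> real n <= x / real m" using that by (simp add: field_simps)
   also have "... \<longleftrightarrow> n <= nat \<lfloor>x / real m\<rfloor>" using that le_nat_floor[of n "x / real m"] by linarith
   finally show ?thesis .
  qed
  then show ?thesis by (auto simp: A1_def A_def)
 qed
 have c1: "real (card A1) = (\<Sum>m=1..q. of_int \<lfloor>x / real m\<rfloor>)"
  unfolding A1 using x by (simp add: of_nat_nat)
 have "A2 = prod.swap ` A1" by (auto simp: A1_def A2_def A_def mult.commute image_iff)
 then have c2: "card A2 = card A1" by (metis card_image inj_on_subset inj_swap subset_UNIV)
 have "card A1 + card A2 = card (A1 \<union> A2) + card (A1 \<inter> A2)"
  using finA by (intro card_Un_Int) (auto simp: A1_def A2_def)
 then have "2 * real (card A1) = real (card A) + real (card (A1 \<inter> A2))"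
  unfolding un[symmetric] c2 by linarith
 then show "divcount x = 2 * (\<Sum>m=1..q. of_int \<lfloor>x / real m\<rfloor>) - (real q)\<^sup>2"
  unfolding divcount_def \<open>card {k. pm k <= x} = card A\<close> c1 int by (simp add: power2_eq_square)
qed

lemma divcount_small: "x < 1 ==> {k. pm k <= x} = {}"
 using pm_ge_1 by (auto simp: not_le intro: order.strict_trans2)

lemma finite_pm_le: "finite {k. pm k <= x}"
 using divcount_hyperbola(1)[of x] divcount_small[of x] by (cases "x >= 1") auto

text \<open>Dirichlet's main term for \<open>divcount\<close>. Its derivative ln x + 2 c is the
  density that reappears in \<open>Pm\<close> and, rescaled, in \<open>pp\<close>.\<close>

definition divmain :: "real => real" where
 "divmain x = x * ln x + (2 * euler_mascheroni - 1) * x"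

lemma harm_approx:
 assumes "q >= 1"
 shows "harm q >= ln (real q) + euler_mascheroni" "harm q <= ln (real q) + euler_mascheroni + 1 / real q"
proof -
 show "harm q >= ln (real q) + euler_mascheroni"
 proof -
  have "harm n - ln (real n) <= harm q - ln (real q)" if "n >= q" for n
   by (rule euler_mascheroni_sequence_decreasing) (use assms that in auto)
  then have "euler_mascheroni <= harm q - ln (real q)"
   by (intro tendsto_upperbound[OF euler_mascheroni_LIMSEQ] eventually_mono[OF eventually_ge_at_top[of q]]) auto
  then show ?thesis by simp
 qed
 show "harm q <= ln (real q) + euler_mascheroni + 1 / real q"
 proof -
  obtain n where n: "q = Suc n" using assms by (cases q) auto
  have "ln (real (n+2)) - ln (real (n + 1)) <= 1 / real (n + 1)"
   using ln_diff_le[of "real (n+2)" "real (n+1)"] by simp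
  moreover have "harm (Suc n) <= euler_mascheroni + ln (real (n+2))"
   using euler_mascheroni_lower[of n] by (smt (verit) of_nat_0_le_iff divide_nonneg_nonneg zero_le_one)
  ultimately show ?thesis using n by simp
 qed
qed

lemma ln_bounds_powr:
 fixes x :: real assumes "x > 0"
 shows "ln x <= 2 * x powr (1/2)" "- ln x <= 2 * x powr (-1/2)" "\<bar>ln x\<bar> <= 2 * x powr (1/2) + 2 * x powr (-1/2)"
proof -
 have "ln (x powr (1/2)) <= x powr (1/2) - 1" using assms by (intro ln_le_minus_one) auto
 then show 1: "ln x <= 2 * x powr (1/2)" using assms by (simp add: ln_powr)
 have "ln (x powr (-1/2)) <= x powr (-1/2) - 1" using assms by (intro ln_le_minus_one) auto
 then show 2: "- ln x <= 2 * x powr (-1/2)" using assms by (simp add: ln_powr)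
 show "\<bar>ln x\<bar> <= 2 * x powr (1/2) + 2 * x powr (-1/2)"
  using 1 2 powr_ge_zero[of x "1/2"] powr_ge_zero[of x "-1/2"] by linarith
qed

text \<open>Below 1 the count is 0 and the main term is itself O(sqrt x). The estimate is wanted on
  the whole of (0, oo) because it is inserted into Laplace integrals that start at 0.\<close>

lemma divcount_error: "\<exists>C\<ge>0. \<forall>x>0. \<bar>divcount x - divmain x\<bar> <= C * sqrt x"
proof (intro exI[of _ 20] conjI allI impI)
 have c: "0 < (euler_mascheroni::real)" "(euler_mascheroni::real) < 1"
  using euler_mascheroni_pos euler_mascheroni_less_13_over_22 by auto
 fix x :: real assume x0: "x > 0"
 show "\<bar>divcount x - divmain x\<bar> <= 20 * sqrt x"
 proof (cases "x >= 1")
  case False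
  have "divcount x = 0" unfolding divcount_def using divcount_small[of x] False by simp
  moreover have "\<bar>x * ln x\<bar> <= 2 * sqrt x"
  proof -
   have "x * (- ln x) <= x * (2 * x powr (-1/2))" using ln_bounds_powr(2)[OF x0] x0 by (intro mult_left_mono) auto
   also have "... = 2 * x powr (1 + -1/2)" using x0 by (subst powr_add) simp
   also have "... = 2 * sqrt x" using x0 by (simp add: powr_half_sqrt)
   finally show ?thesis using False x0 by (simp add: abs_mult)
  qed
  moreover have "\<bar>(2 * euler_mascheroni - 1) * x\<bar> <= sqrt x"
  proof -
   have "x <= sqrt x" using False x0 by (intro real_le_rsqrt) (simp add: power2_eq_square)
   moreover have "\<bar>(2 * euler_mascheroni - 1) * x\<bar> <= 1 * x"
    unfolding abs_mult using c x0 by (intro mult_mono) auto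
   ultimately show ?thesis by simp
  qed
  ultimately show ?thesis unfolding divmain_def using real_sqrt_ge_zero[of x] x0 by linarith
 next
  case True
  define q where "q = nat \<lfloor>sqrt x\<rfloor>"
  define Y where "Y = sqrt x"
  have Y: "Y >= 1" "Y\<^sup>2 = x" using True by (auto simp: Y_def)
  have q: "real q <= Y" "Y < real q + 1" "q >= 1"
   using Y unfolding q_def Y_def[symmetric] by linarith+
  have qr: "real q >= 1" "Y <= 2 * real q" using q by auto
  define F where "F = (\<Sum>m=1..q. real_of_int \<lfloor>x / real m\<rfloor>)"
  have H: "(\<Sum>m=1..q. x / real m) = x * harm q"
   by (simp add: harm_def sum_distrib_left divide_inverse)
  have F1: "F <= x * harm q" unfolding F_def H[symmetric] by (intro sum_mono) auto
  have "x * harm q - real q = (\<Sum>m=1..q. x / real m - 1)" unfolding sum_subtractf H by simp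
  also have "... <= F" unfolding F_def by (intro sum_mono) linarith
  finally have F2: "F >= x * harm q - real q" .
  have xq: "x / real q <= 2 * Y"
  proof -
   have "x = Y * Y" using Y by (simp add: power2_eq_square)
   also have "... <= Y * (2 * real q)" using qr Y by (intro mult_left_mono) auto
   finally show ?thesis using qr by (simp add: field_simps)
  qed
  have h1: "x * harm q >= x * ln q + x * euler_mascheroni"
   using mult_left_mono[OF harm_approx(1)[OF q(3)], of x] x0 by (simp add: algebra_simps)
  have h2: "x * harm q <= x * ln q + x * euler_mascheroni + 2 * Y"
   using mult_left_mono[OF harm_approx(2)[OF q(3)], of x] x0 xq by (simp add: algebra_simps)
  \<comment> \<open>The hyperbola sum produces 2 x ln q. It becomes x ln x because Y = sqrt x, and q
    differs from Y by less than 1, which costs only O(Y).\<close>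
  have lx: "ln x = 2 * ln Y" using Y by (metis ln_realpow order_less_le_trans zero_less_one of_nat_numeral)
  have l1: "ln (real q) <= ln Y" using q qr by simp
  have l2: "ln Y - ln (real q) <= 1 / real q"
  proof -
   have "ln Y - ln (real q) <= (Y - real q) / real q" using Y qr by (intro ln_diff_le) auto
   also have "... <= 1 / real q" using q by (intro divide_right_mono) auto
   finally show ?thesis .
  qed
  have l3: "x * (ln Y - ln (real q)) <= 2 * Y"
   using mult_left_mono[OF l2, of x] xq x0 by simp
  have l4: "x * (ln Y - ln (real q)) >= 0" using l1 x0 by simp
  have s1: "(real q)\<^sup>2 <= x" unfolding Y(2)[symmetric] using q by (intro power_mono) auto
  have s2: "(real q)\<^sup>2 >= x - 2 * Y"
  proof -
   have "(Y - 1)\<^sup>2 <= (real q)\<^sup>2" using q Y by (intro power_mono) auto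
   then show ?thesis using Y by (simp add: power2_eq_square algebra_simps)
  qed
  have D: "divcount x = 2 * F - (real q)\<^sup>2"
   using divcount_hyperbola(2)[OF True] unfolding F_def q_def .
  have e: "divmain x = 2 * (x * ln q) + 2 * (x * (ln Y - ln q)) + 2 * (x * euler_mascheroni) - x"
   unfolding divmain_def lx by (simp add: algebra_simps)
  have "\<bar>divcount x - divmain x\<bar> <= 20 * Y"
   unfolding D e using F1 F2 h1 h2 l3 l4 s1 s2 q Y(1) by linarith
  then show ?thesis by (simp add: Y_def)
 qed
qed auto


section \<open>The functional equation from two Mellin transforms\<close>

text \<open>By the reflection formula Gamma(z) Gamma(1 - z) sin (pi z) is constant, so its
  logarithmic derivative vanishes. This expresses pi cot (pi w) as Digamma(1 - w) - Digamma(w), for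
  which the series of Digamma is available.\<close>

lemma cot_partial_fractions:
 fixes w :: complex assumes w: "w \<notin> \<int>"
 shows "(%k. - 2 * w / ((of_nat (Suc k))\<^sup>2 - w\<^sup>2)) sums (of_real pi * cos (of_real pi * w) / sin (of_real pi * w) - 1 / w)"
proof -
 have w0: "w ~= 0" using w by auto
 have w': "1 - w \<notin> \<int>" using w by (metis Ints_1 Ints_diff diff_diff_eq2 add_diff_cancel_left')
 have np: "w \<notin> \<int>\<^sub>\<le>\<^sub>0" "1 - w \<notin> \<int>\<^sub>\<le>\<^sub>0" using w w' by (auto dest: nonpos_Ints_Int)
 have w0': "1 - w ~= 0" using w' by auto
 have sin0: "sin (of_real pi * w) ~= 0"
 proof
  assume "sin (of_real pi * w) = 0"
  then obtain n :: int where "of_real pi * w = of_real (of_int n * pi)" by (auto simp: sin_eq_0)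
  then have "w = of_int n" by (simp add: mult.commute)
  then show False using w by simp
 qed
 have ds: "(%k. inverse (of_nat (Suc k)) - inverse (z + of_nat k)) sums (Digamma z + euler_mascheroni)" if "z ~= 0" for z :: complex
  using summable_sums[OF summable_Digamma[OF that]] by (simp add: Digamma_def)
 let ?a = "%k. inverse (w + of_nat k)" and ?b = "%k. inverse (1 - w + of_nat k)"
 have "(%k. ?a k - ?b k) sums (Digamma (1 - w) - Digamma w)"
  using sums_diff[OF ds[OF w0'] ds[OF w0]] by (simp add: algebra_simps)
 then have 1: "(%N. \<Sum>k<N. ?a k - ?b k) \<longlonglongrightarrow> Digamma (1 - w) - Digamma w" by (simp add: sums_def)
 \<comment> \<open>Pairing 1/(w + k + 1) with 1/(1 - w + k) produces the symmetric denominator (k +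
   1)^2 - w^2. The shift of one index releases the term 1/w.\<close>
 have part: "(\<Sum>k<N. ?a (Suc k) - ?b k) = (\<Sum>k<N. ?a k - ?b k) - ?a 0 + ?a N" for N
  by (induction N) (simp_all add: algebra_simps)
 have "?a \<longlonglongrightarrow> 0"
  by (intro filterlim_compose[OF tendsto_inverse_0] tendsto_add_filterlim_at_infinity[OF tendsto_const] tendsto_of_nat)
 from tendsto_add[OF tendsto_diff[OF 1 tendsto_const[of "?a 0"]] this]
 have 2: "(%k. ?a (Suc k) - ?b k) sums (Digamma (1 - w) - Digamma w - 1 / w)"
  unfolding sums_def part by (simp add: divide_inverse)
 have 3: "?a (Suc k) - ?b k = - 2 * w / ((of_nat (Suc k))\<^sup>2 - w\<^sup>2)" for k
 proof -
  have "w + of_nat (Suc k) ~= 0"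
  proof
   assume "w + of_nat (Suc k) = 0"
   then have "w = - of_nat (Suc k)" by (simp add: eq_neg_iff_add_eq_0 del: of_nat_Suc)
   then show False using w by (metis Ints_minus Ints_of_nat)
  qed
  moreover have "of_nat (Suc k) - w ~= 0" using w by (metis Ints_of_nat right_minus_eq)
  moreover have "1 - w + of_nat k = of_nat (Suc k) - w" by simp
  moreover have "(of_nat (Suc k))\<^sup>2 - w\<^sup>2 = (w + of_nat (Suc k)) * (of_nat (Suc k) - w)"
   by (simp add: power2_eq_square algebra_simps)
  ultimately show ?thesis by (simp add: field_simps del: of_nat_Suc)
 qed
 have "Digamma (1 - w) - Digamma w = of_real pi * cos (of_real pi * w) / sin (of_real pi * w)"
 proof -
  let ?S = "- \<int> :: complex set"
  have op: "open ?S" using closed_Ints[where 'a=complex] by (simp add: open_Compl)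
  have "((%z. Gamma z * Gamma (1 - z) * sin (of_real pi * z)) has_field_derivative 
    Gamma w * Gamma (1 - w) * ((Digamma w - Digamma (1 - w)) * sin (of_real pi * w) + of_real pi * cos (of_real pi * w))) (at w)"
   using np by (auto intro!: derivative_eq_intros simp: algebra_simps)
  moreover have "((%z. Gamma z * Gamma (1 - z) * sin (of_real pi * z)) has_field_derivative 0) (at w)"
  proof (rule has_field_derivative_transform_within_open[of "%z. of_real pi" _ _ ?S])
   fix z :: complex assume z: "z \<in> ?S"
   have "sin (of_real pi * z) ~= 0"
   proof
    assume "sin (of_real pi * z) = 0"
    then obtain n :: int where "of_real pi * z = of_real (of_int n * pi)" by (auto simp: sin_eq_0)
    then have "z = of_int n" by (simp add: mult.commute)
    then show False using z by simp
   qed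
   then show "of_real pi = Gamma z * Gamma (1 - z) * sin (of_real pi * z)"
    using Gamma_reflection_complex[of z] by simp
  qed (use w op in auto)
  ultimately have "Gamma w * Gamma (1 - w) * ((Digamma w - Digamma (1 - w)) * sin (of_real pi * w) + of_real pi * cos (of_real pi * w)) = 0"
   by (rule DERIV_unique)
  then have "(Digamma w - Digamma (1 - w)) * sin (of_real pi * w) + of_real pi * cos (of_real pi * w) = 0"
   using np by (simp add: Gamma_eq_zero_iff)
  then show ?thesis using sin0 by (simp add: field_simps)
 qed
 with 2 show ?thesis unfolding 3 by simp
qed

text \<open>The cotangent expansion at w = i x / (2 pi), multiplied by i / (2 pi).\<close>

lemma coth_partial_fractions:
 fixes x :: real assumes x: "x > 0"
 shows "(%n. 2 * x / (x\<^sup>2 + (2 * pi * real (Suc n))\<^sup>2)) sums (1 / (exp x - 1) - 1 / x + 1/2)"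
proof -
 define w where "w = \<i> * of_real (x / (2 * pi))"
 have "Im w ~= 0" using x by (simp add: w_def)
 then have w: "w \<notin> \<int>" by (auto elim!: Ints_cases)
 have pw: "of_real pi * w = \<i> * of_real (x/2)" by (simp add: w_def)
 define E where "E = exp (x/2)"
 have E: "E > 1" using x by (simp add: E_def)
 have e1: "exp (\<i> * (\<i> * of_real (x/2))) = complex_of_real (inverse E)"
  unfolding E_def exp_minus[symmetric] by (simp add: mult.assoc[symmetric] exp_of_real[symmetric])
 have e2: "exp (- (\<i> * (\<i> * of_real (x/2)))) = complex_of_real E"
  unfolding E_def by (simp add: mult.assoc[symmetric] exp_of_real[symmetric])
 have ex: "exp x = E\<^sup>2" by (simp add: E_def exp_double[symmetric])
 have cot: "of_real pi * cos (of_real pi * w) / sin (of_real pi * w) = - \<i> * of_real (pi * (exp x + 1) / (exp x - 1))"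
 proof -
  have ne: "inverse E - E ~= 0" "E\<^sup>2 - 1 ~= 0" "E ~= 0" using E by (auto simp: field_simps power2_eq_square)
     (smt (verit) mult_less_cancel_left2)+
  have "of_real pi * cos (of_real pi * w) / sin (of_real pi * w) = \<i> * of_real (pi * (inverse E + E) / (inverse E - E))"
  proof -
   have frac: "p * (c / 2) / (d / (2 * \<i>)) = \<i> * (p * c / d)" if "d ~= 0" for p c d :: complex
    using that by (simp add: field_simps)
   have "complex_of_real (inverse E) - of_real E ~= 0"
    using ne(1) by (metis of_real_diff of_real_eq_0_iff)
   from frac[OF this] show ?thesis unfolding pw cos_exp_eq sin_exp_eq e1 e2 by simp
  qed
  also have "pi * (inverse E + E) / (inverse E - E) = - (pi * (exp x + 1) / (exp x - 1))"
   unfolding ex using ne by (simp add: field_simps power2_eq_square)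
  finally show ?thesis by simp
 qed
 have "(%k. (\<i> / (2 * of_real pi)) * (- 2 * w / ((of_nat (Suc k))\<^sup>2 - w\<^sup>2))) sums ((\<i> / (2 * of_real pi)) * (of_real pi * cos (of_real pi * w) / sin (of_real pi * w) - 1 / w))"
  by (rule sums_mult[OF cot_partial_fractions[OF w]])
 moreover have "(\<i> / (2 * of_real pi)) * (- 2 * w / ((of_nat (Suc k))\<^sup>2 - w\<^sup>2)) = complex_of_real (2 * x / (x\<^sup>2 + (2 * pi * real (Suc k))\<^sup>2))" for k
 proof -
  have "(\<i> / (2 * of_real pi)) * (- 2 * w / ((of_nat (Suc k))\<^sup>2 - w\<^sup>2)) = complex_of_real ((x / (2 * pi\<^sup>2)) / ((real (Suc k))\<^sup>2 + (x / (2*pi))\<^sup>2))"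
  proof -
   have w2: "w\<^sup>2 = - of_real ((x/(2*pi))\<^sup>2)" by (simp add: w_def power_mult_distrib power_divide)
   have iw: "\<i> * w = - of_real (x/(2*pi))" by (simp add: w_def mult.assoc[symmetric])
   have "(\<i> / (2 * of_real pi)) * (- 2 * w / ((of_nat (Suc k))\<^sup>2 - w\<^sup>2)) = (- 2 * (\<i> * w)) / (2 * of_real pi) / ((of_nat (Suc k))\<^sup>2 - w\<^sup>2)"
    by (simp del: of_nat_Suc)
   then show ?thesis unfolding iw w2 by (simp add: power2_eq_square mult.assoc del: of_nat_Suc)
  qed
  also have "(x / (2 * pi\<^sup>2)) / ((real (Suc k))\<^sup>2 + (x / (2*pi))\<^sup>2) = 2 * x / (x\<^sup>2 + (2 * pi * real (Suc k))\<^sup>2)"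
   using x by (simp add: field_simps power2_eq_square del: of_nat_Suc)
  finally show ?thesis .
 qed
 moreover have "(\<i> / (2 * of_real pi)) * (of_real pi * cos (of_real pi * w) / sin (of_real pi * w) - 1 / w) = complex_of_real (1 / (exp x - 1) - 1 / x + 1/2)"
 proof -
  have ne: "exp x - 1 ~= 0" using x by simp
  have "(\<i> / (2 * of_real pi)) * (of_real pi * cos (of_real pi * w) / sin (of_real pi * w) - 1 / w)
   = complex_of_real ((exp x + 1) / (exp x - 1) / 2 - 1 / x)"
   unfolding cot using x ne by (simp add: w_def field_simps)
  also have "(exp x + 1) / (exp x - 1) / 2 - 1 / x = 1 / (exp x - 1) - 1 / x + 1/2"
   using x ne by (simp add: field_simps)
  finally show ?thesis .
 qed
 ultimately have "(%k. complex_of_real (2 * x / (x\<^sup>2 + (2 * pi * real (Suc k))\<^sup>2))) sums complex_of_real (1 / (exp x - 1) - 1 / x + 1/2)"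
  by (simp only:)
 then show ?thesis by (simp only: sums_of_real_iff)
qed


text \<open>This is -zeta(sg) for 0 < sg < 1: on each interval the integrand is the gap between
  u^(-sg) and its value at the right end. All terms are nonnegative, and the type
  \<open>ennreal\<close> lets Tonelli be applied before finiteness is known.\<close>

definition zdef :: "real => ennreal" where
 "zdef sg = (\<Sum>n. \<integral>\<^sup>+u\<in>{real n<..<real n + 1}. ennreal (u powr (-sg) - (real n + 1) powr (-sg)) \<partial>lborel)"

text \<open>If k(u, x) has Mellin transform C u^(-sg) in x, then the same operation in u, integral
  over [n, n + 1] minus value at n + 1, summed over n, turns k into Phi(x) and u^(-sg) into
  \<open>zdef sg\<close>; Tonelli exchanges the two. Two kernels with the same Phi but exponents s
  and 1 - s then yield the functional equation.\<close>

lemma mellin_kernel: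
 fixes k :: "real => real => real" and s sg C :: real
 assumes meas[measurable]: "case_prod k \<in> borel_measurable (borel \<Otimes>\<^sub>M borel)"
  and nonneg: "!!u x. u >= 0 ==> x > 0 ==> k u x >= 0"
  and anti: "!!u v x. 0 <= u ==> u <= v ==> x > 0 ==> k v x <= k u x"
  and mellin: "!!u. u > 0 ==> (\<integral>\<^sup>+y. ennreal (k u (exp y) * exp (s * y)) \<partial>lborel) = ennreal (C * u powr (-sg))"
  and C: "C >= 0" and sg: "sg > 0"
  and prim: "!!n x. x > 0 ==> ((%u. k u x) has_integral P (real n + 1) x - P (real n) x) {real n..real n + 1}"
  and sums: "!!x. x > 0 ==> (%n. P (real n + 1) x - P (real n) x - k (real n + 1) x) sums \<Phi> x"
 shows "(\<integral>\<^sup>+y. ennreal (\<Phi> (exp y) * exp (s * y)) \<partial>lborel) = ennreal C * zdef sg"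
proof -
 let ?I = "%n. {real n<..<real n + 1}"
 let ?g = "%n u y. ennreal ((k u (exp y) - k (real n + 1) (exp y)) * exp (s * y)) * indicator (?I n) u"
 have gm[measurable]: "(%(u, y). ?g n u y) \<in> borel_measurable (lborel \<Otimes>\<^sub>M lborel)" for n by measurable
 have gm'[measurable]: "(%(y, u). ?g n u y) \<in> borel_measurable (lborel \<Otimes>\<^sub>M lborel)" for n by measurable
 have inner_u: "(\<integral>\<^sup>+u. ?g n u y \<partial>lborel) = ennreal ((P (real n + 1) (exp y) - P (real n) (exp y) - k (real n + 1) (exp y)) * exp (s * y))" for n y
 proof -
  let ?x = "exp y"
  have 1: "((%u. k u ?x - k (real n + 1) ?x) has_integral (P (real n + 1) ?x - P (real n) ?x - k (real n + 1) ?x)) {real n..real n + 1}"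
   using has_integral_diff[OF prim[of ?x n] has_integral_const_real[of "k (real n + 1) ?x" "real n" "real n + 1"]] by simp
  have 2: "((%u. (k u ?x - k (real n + 1) ?x) * exp (s*y)) has_integral (P (real n + 1) ?x - P (real n) ?x - k (real n + 1) ?x) * exp (s*y)) {real n..real n + 1}"
   by (rule has_integral_mult_left[OF 1])
  have 3: "((%u. (k u ?x - k (real n + 1) ?x) * exp (s*y)) has_integral (P (real n + 1) ?x - P (real n) ?x - k (real n + 1) ?x) * exp (s*y)) (?I n)"
   by (rule iffD1[OF has_integral_Icc_iff_Ioo, OF 2]) 
  have "(\<integral>\<^sup>+u. ennreal (indicator (?I n) u * ((k u ?x - k (real n + 1) ?x) * exp (s*y))) \<partial>lborel) = ennreal ((P (real n + 1) ?x - P (real n) ?x - k (real n + 1) ?x) * exp (s*y))"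
   by (rule nn_integral_has_integral_lebesgue[OF _ 3]) (auto simp: anti)
  also have "(%u. ennreal (indicator (?I n) u * ((k u ?x - k (real n + 1) ?x) * exp (s*y)))) = (%u. ?g n u y)"
   by (auto simp: indicator_def fun_eq_iff)
  finally show ?thesis .
 qed
 have inner_y: "(\<integral>\<^sup>+y. ?g n u y \<partial>lborel) = ennreal C * (ennreal (u powr (-sg) - (real n + 1) powr (-sg)) * indicator (?I n) u)" for n u
 proof (cases "u \<in> ?I n")
  case True
  let ?v = "real n + 1"
  have u: "u > 0" "u <= ?v" using True by auto
  have [measurable]: "(%x. k a x) \<in> borel_measurable borel" for a by measurable
  have "ennreal (C * u powr (-sg)) = (\<integral>\<^sup>+y. ennreal ((k u (exp y) - k ?v (exp y)) * exp (s * y)) + ennreal (k ?v (exp y) * exp (s * y)) \<partial>lborel)"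
   unfolding mellin[OF u(1), symmetric]
   by (intro nn_integral_cong) (use u in \<open>auto simp: ennreal_plus[symmetric] anti nonneg left_diff_distrib simp del: ennreal_plus\<close>)
  also have "... = (\<integral>\<^sup>+y. ennreal ((k u (exp y) - k ?v (exp y)) * exp (s * y)) \<partial>lborel) + (\<integral>\<^sup>+y. ennreal (k ?v (exp y) * exp (s * y)) \<partial>lborel)"
   by (rule nn_integral_add) auto
  also have "(\<integral>\<^sup>+y. ennreal (k ?v (exp y) * exp (s * y)) \<partial>lborel) = ennreal (C * ?v powr (-sg))"
   by (rule mellin) auto
  finally have *: "ennreal (C * u powr (-sg)) = (\<integral>\<^sup>+y. ennreal ((k u (exp y) - k ?v (exp y)) * exp (s * y)) \<partial>lborel) + ennreal (C * ?v powr (-sg))" .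
  have le: "?v powr (-sg) <= u powr (-sg)" using u sg by (intro powr_mono2') auto
  have "ennreal (C * (u powr (-sg) - ?v powr (-sg))) + ennreal (C * ?v powr (-sg)) = ennreal (C * u powr (-sg))"
   using C le by (subst ennreal_plus[symmetric]) (auto simp: algebra_simps mult_left_mono)
  with * have "ennreal (C * ?v powr (-sg)) + (\<integral>\<^sup>+y. ennreal ((k u (exp y) - k ?v (exp y)) * exp (s * y)) \<partial>lborel)
    = ennreal (C * ?v powr (-sg)) + ennreal (C * (u powr (-sg) - ?v powr (-sg)))"
   by (simp only: add.commute)
  then have "(\<integral>\<^sup>+y. ennreal ((k u (exp y) - k ?v (exp y)) * exp (s * y)) \<partial>lborel) = ennreal (C * (u powr (-sg) - ?v powr (-sg)))"
   by (simp only: ennreal_add_left_cancel infinity_ennreal_def ennreal_neq_top simp_thms)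
  then show ?thesis using True C le by (simp add: ennreal_mult)
 qed simp
 have dn: "0 <= (P (real n + 1) x - P (real n) x - k (real n + 1) x)" if "x > 0" for n x
 proof -
  have "((%u. k u x - k (real n + 1) x) has_integral (P (real n + 1) x - P (real n) x - k (real n + 1) x)) {real n..real n + 1}"
   using has_integral_diff[OF prim[OF that, of n] has_integral_const_real[of "k (real n + 1) x" "real n" "real n + 1"]] by simp
  then show ?thesis by (rule has_integral_nonneg) (use that anti in auto)
 qed
 have "(\<integral>\<^sup>+y. ennreal (\<Phi> (exp y) * exp (s * y)) \<partial>lborel) = (\<integral>\<^sup>+y. (\<Sum>n. (\<integral>\<^sup>+u. ?g n u y \<partial>lborel)) \<partial>lborel)"
 proof (rule nn_integral_cong)
  fix y :: real
  have "(%n. (P (real n + 1) (exp y) - P (real n) (exp y) - k (real n + 1) (exp y)) * exp (s * y)) sums (\<Phi> (exp y) * exp (s * y))"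
   by (intro sums_mult2 sums) simp
  then show "ennreal (\<Phi> (exp y) * exp (s * y)) = (\<Sum>n. (\<integral>\<^sup>+u. ?g n u y \<partial>lborel))"
   unfolding inner_u by (intro suminf_ennreal_eq[symmetric]) (auto intro!: mult_nonneg_nonneg dn)
 qed
 also have "... = (\<Sum>n. \<integral>\<^sup>+y. (\<integral>\<^sup>+u. ?g n u y \<partial>lborel) \<partial>lborel)"
  by (rule nn_integral_suminf) measurable
 also have "... = (\<Sum>n. \<integral>\<^sup>+u. (\<integral>\<^sup>+y. ?g n u y \<partial>lborel) \<partial>lborel)"
  by (intro suminf_cong lborel_pair.Fubini') (use gm' in \<open>simp add: case_prod_unfold\<close>)
 also have "... = (\<Sum>n. ennreal C * (\<integral>\<^sup>+u. ennreal (u powr (-sg) - (real n + 1) powr (-sg)) * indicator (?I n) u \<partial>lborel))"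
  unfolding inner_y by (intro suminf_cong nn_integral_cmult) measurable
 also have "... = ennreal C * zdef sg"
  unfolding zdef_def by (rule ennreal_suminf_cmult)
 finally show ?thesis .
qed

text \<open>Telescoping the integrals leaves N^(1 - sg) / (1 - sg) minus the partial sums of
  n^(-sg), which is the negative of the limit formula for \<open>kz\<close> divided by sg -
  1.\<close>

lemma zdef_eq:
 fixes sg :: real assumes sg: "0 < sg" "sg < 1"
 shows "kz (of_real sg) / (of_real sg - 1) = - of_real (enn2real (zdef sg))" "zdef sg < \<infinity>"
proof -
 define a where "a = (%n. ((real n + 1) powr (1 - sg) - real n powr (1 - sg)) / (1 - sg) - (real n + 1) powr (-sg))"
 have hi: "((%u. u powr (-sg) - (real n + 1) powr (-sg)) has_integral a n) {real n..real n + 1}" for n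
 proof -
  have "((%u. u powr (-sg)) has_integral ((real n + 1) powr (1 - sg) / (1 - sg) - real n powr (1 - sg) / (1 - sg))) {real n..real n + 1}"
  proof (rule fundamental_theorem_of_calculus_interior)
   show "continuous_on {real n..real n + 1} (%u. u powr (1 - sg) / (1 - sg))"
    using sg by (intro continuous_intros continuous_on_powr') auto
   fix u assume "u \<in> {real n<..<real n + 1}"
   then have "u > 0" by auto
   then have "((%u. u powr (1 - sg) / (1 - sg)) has_field_derivative u powr (-sg)) (at u)"
    using DERIV_cdivide[OF has_real_derivative_powr[of u "1 - sg"], of "1 - sg"] sg by simp
   then show "((%u. u powr (1 - sg) / (1 - sg)) has_vector_derivative u powr (-sg)) (at u)"
    by (rule has_real_derivative_iff_has_vector_derivative[THEN iffD1])
  qed simp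
  from has_integral_diff[OF this has_integral_const_real[of "(real n + 1) powr (-sg)" "real n" "real n + 1"]]
  show ?thesis by (simp add: a_def diff_divide_distrib)
 qed
 have hi': "((%u. u powr (-sg) - (real n + 1) powr (-sg)) has_integral a n) {real n<..<real n + 1}" for n
  by (rule iffD1[OF has_integral_Icc_iff_Ioo, OF hi])
 have nn: "u powr (-sg) - (real n + 1) powr (-sg) >= 0" if "u \<in> {real n<..<real n + 1}" for n u
 proof -
  have "0 < u" "u <= real n + 1" using that by auto
  then have "(real n + 1) powr (-sg) <= u powr (-sg)" using sg by (intro powr_mono2') auto
  then show ?thesis by simp
 qed
 have an: "a n >= 0" for n by (rule has_integral_nonneg[OF hi' nn])
 have z1: "zdef sg = (\<Sum>n. ennreal (a n))"
 proof -
  have "(\<integral>\<^sup>+u\<in>{real n<..<real n + 1}. ennreal (u powr (-sg) - (real n + 1) powr (-sg)) \<partial>lborel) = ennreal (a n)" for n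
  proof -
   have "(\<integral>\<^sup>+u. ennreal (indicator {real n<..<real n + 1} u * (u powr (-sg) - (real n + 1) powr (-sg))) \<partial>lborel) = ennreal (a n)"
    by (rule nn_integral_has_integral_lebesgue[OF _ hi']) (use nn in auto)
   also have "(%u. ennreal (indicator {real n<..<real n + 1} u * (u powr (-sg) - (real n + 1) powr (-sg)))) = (%u. ennreal (u powr (-sg) - (real n + 1) powr (-sg)) * indicator {real n<..<real n + 1} u)"
    by (auto simp: indicator_def fun_eq_iff)
   finally show ?thesis .
  qed
  then show ?thesis by (simp add: zdef_def)
 qed
 have ps: "(\<Sum>n<N. a n) = real N powr (1 - sg) / (1 - sg) - (\<Sum>n<N. real (Suc n) powr (-sg))" for N
  using sg by (induction N) (simp_all add: a_def diff_divide_distrib add_ac)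
 let ?L = "kz (of_real sg) / (of_real sg - 1)"
 have s1: "complex_of_real sg - 1 ~= 0" using sg by (metis eq_iff_diff_eq_0 less_irrefl of_real_1 of_real_eq_iff)
 have "(%N. ((of_real sg - 1) * (\<Sum>n<N. of_nat (Suc n) powr (- of_real sg)) + of_nat (Suc N) powr (1 - of_real sg)) / (of_real sg - 1)) \<longlonglongrightarrow> ?L"
  using sg s1 by (intro tendsto_divide kz_LIMSEQ tendsto_const) auto
 moreover have "((of_real sg - 1) * (\<Sum>n<N. of_nat (Suc n) powr (- of_real sg)) + of_nat (Suc N) powr (1 - of_real sg)) / (of_real sg - 1)
   = complex_of_real ((\<Sum>n<N. real (Suc n) powr (-sg)) - real (Suc N) powr (1 - sg) / (1 - sg))" for N
 proof -
  have "(of_nat (Suc m) :: complex) powr (of_real r) = of_real (real (Suc m) powr r)" for m and r :: real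
   using powr_of_real[of "real (Suc m)" r] by (simp del: of_nat_Suc)
  from this[of _ "-sg"] this[of N "1 - sg"] show ?thesis
   using s1 sg by (simp add: add_divide_distrib del: of_nat_Suc) (simp add: divide_simps del: of_nat_Suc, simp add: algebra_simps del: of_nat_Suc)
 qed
 ultimately have l1: "(%N. complex_of_real ((\<Sum>n<N. real (Suc n) powr (-sg)) - real (Suc N) powr (1 - sg) / (1 - sg))) \<longlonglongrightarrow> ?L"
  by (simp only:)
 \<comment> \<open>The limit formula for \<open>kz\<close> carries (N + 1)^(1 - sg), the telescoped
   sum N^(1 - sg); the discrepancy is at most N^(-sg).\<close>
 have l2: "(%N. (real (Suc N) powr (1 - sg) - real N powr (1 - sg)) / (1 - sg)) \<longlonglongrightarrow> 0"
 proof (rule Lim_null_comparison[where g = "%N. real N powr (-sg)"])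
  show "(%N. real N powr (-sg)) \<longlonglongrightarrow> 0"
   using sg by (intro tendsto_neg_powr filterlim_real_sequentially) auto
  show "\<forall>\<^sub>F N in sequentially. norm ((real (Suc N) powr (1 - sg) - real N powr (1 - sg)) / (1 - sg)) <= real N powr (-sg)"
  proof (intro eventually_mono[OF eventually_ge_at_top[of 1]])
   fix N :: nat assume N: "N >= 1"
   have p: "(real (Suc N) powr (1 - sg) - real N powr (1 - sg)) / (1 - sg) = a N + real (Suc N) powr (-sg)"
    by (simp add: a_def add_ac)
   have "a N <= real N powr (-sg) - real (Suc N) powr (-sg)"
   proof (rule has_integral_le[OF hi])
    show "((%u. real N powr (-sg) - real (Suc N) powr (-sg)) has_integral real N powr (-sg) - real (Suc N) powr (-sg)) {real N..real N + 1}"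
     using has_integral_const_real[of "real N powr (-sg) - real (Suc N) powr (-sg)" "real N" "real N + 1"] by simp
    fix u assume "u \<in> {real N..real N + 1}"
    then have "u powr (-sg) <= real N powr (-sg)" using N sg by (intro powr_mono2') auto
    then show "u powr (-sg) - (real N + 1) powr (-sg) <= real N powr (-sg) - real (Suc N) powr (-sg)" by (simp add: add_ac)
   qed
   then show "norm ((real (Suc N) powr (1 - sg) - real N powr (1 - sg)) / (1 - sg)) <= real N powr (-sg)"
    unfolding p using an[of N] by (simp add: abs_of_nonneg)
  qed
 qed
 have "(%N. - (\<Sum>n<N. a n)) \<longlonglongrightarrow> Re ?L + 0"
  using tendsto_add[OF tendsto_Re[OF l1] l2] sg by (simp add: ps diff_divide_distrib)
 then have sa: "a sums (- Re ?L)" using tendsto_minus by (fastforce simp: sums_def)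
 have "zdef sg = ennreal (- Re ?L)" unfolding z1 by (rule suminf_ennreal_eq[OF an sa])
 moreover have "- Re ?L >= 0" using sums_le[OF _ sums_zero sa] an by auto
 ultimately have e: "enn2real (zdef sg) = - Re ?L" "zdef sg < \<infinity>" by auto
 have "(%N. 0) \<longlonglongrightarrow> Im ?L" using tendsto_Im[OF l1] by simp
 then have "Im ?L = 0" by (simp add: LIMSEQ_const_iff)
 then show "?L = - of_real (enn2real (zdef sg))" "zdef sg < \<infinity>" using e by (auto simp: complex_eq_iff)
qed


lemma nn_powr_exp:
 fixes a b :: real assumes "a > 0" "b > 0"
 shows "(\<integral>\<^sup>+r. ennreal (r powr (a - 1) * exp (- b * r)) * indicator {0<..} r \<partial>lborel) = ennreal (Gamma a * b powr (-a))"
proof -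
 have "(\<integral>\<^sup>+r. ennreal (indicator {0<..} r *\<^sub>R (r powr (a - 1) * exp (- b * r))) \<partial>lborel) = ennreal (Gamma a * b powr (-a))"
  using powr_exp_integral[OF assms] unfolding set_integrable_def set_lebesgue_integral_def
  by (subst nn_integral_eq_integral) auto
 moreover have "ennreal (indicator {0<..} r *\<^sub>R (r powr (a - 1) * exp (- b * r))) = ennreal (r powr (a - 1) * exp (- b * r)) * indicator {0<..} r" for r
  by (auto simp: indicator_def)
 ultimately show ?thesis by simp
qed

text \<open>The kernel is exp (-u x): its integral over all u > 0 is 1/x, and its sum over the
  positive integers u is 1/(exp x - 1).\<close>

lemma mellin_exp_kernel:
 fixes s :: real assumes s: "0 < s" "s < 1"
 shows "(\<integral>\<^sup>+y. ennreal ((1 / exp y - 1 / (exp (exp y) - 1)) * exp (s * y)) \<partial>lborel) = ennreal (Gamma s) * zdef s"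
proof (rule mellin_kernel[where k = "%u x. exp (- u * x)" and P = "%u x. - exp (- u * x) / x" and \<Phi> = "%x. 1 / x - 1 / (exp x - 1)"])
 show "(\<integral>\<^sup>+y. ennreal (exp (- u * exp y) * exp (s * y)) \<partial>lborel) = ennreal (Gamma s * u powr (-s))" if "u > 0" for u
  using Gamma_exp_integral_norm[OF s(1) that] by (subst nn_integral_eq_integral) auto
 show "((%u. exp (- u * x)) has_integral - exp (- (real n + 1) * x) / x - - exp (- real n * x) / x) {real n..real n + 1}" if "x > 0" for n x
  by (rule fundamental_theorem_of_calculus)
    (use that in \<open>auto intro!: derivative_eq_intros simp: has_real_derivative_iff_has_vector_derivative[symmetric]\<close>)
 show "(%n. - exp (- (real n + 1) * x) / x - - exp (- real n * x) / x - exp (- (real n + 1) * x)) sums (1 / x - 1 / (exp x - 1))" if x: "x > 0" for x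
 proof -
  have e: "exp (- real n * x) = exp (-x) ^ n" for n by (simp add: exp_of_nat_mult[symmetric])
  have e': "exp (- (real n + 1) * x) = exp (-x) ^ Suc n" for n using e[of "Suc n"] by (simp add: add_ac)
  have lt: "norm (exp (-x)) < 1" using x by simp
  have "(%n. exp (-x) ^ n / x - exp (-x) ^ Suc n / x) sums (exp (-x) ^ 0 / x - 0)"
   by (rule telescope_sums') (use lt in \<open>auto intro!: tendsto_eq_intros LIMSEQ_power_zero simp: divide_inverse\<close>)
  moreover have "(%n. exp (-x) * exp (-x) ^ n) sums (exp (-x) * (1 / (1 - exp (-x))))"
   by (intro sums_mult geometric_sums lt)
  moreover have "exp (-x) * (1 / (1 - exp (-x))) = 1 / (exp x - 1)"
   using x by (simp add: exp_minus field_simps)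
  ultimately show ?thesis unfolding e e' using sums_diff by fastforce
 qed
qed (use s in \<open>auto intro!: Gamma_real_nonneg\<close>)

text \<open>The denominator is removed by writing 1/(x^2 + a^2) as the integral of exp (-(x^2 + a^2)
  r) over r > 0. After the exchange both integrations are Gamma integrals, with parameters p = (1 +
  s)/2 and 1 - p, and no Beta function is involved.\<close>

lemma mellin_rational_kernel:
 fixes s a :: real assumes s: "0 < s" "s < 1" and a: "a > 0"
 shows "(\<integral>\<^sup>+y. ennreal (2 * exp y / ((exp y)\<^sup>2 + a\<^sup>2) * exp (s * y)) \<partial>lborel)
   = ennreal (Gamma ((1 + s)/2) * Gamma ((1 - s)/2) * a powr (s - 1))"
proof -
 define p where "p = (1 + s)/2"
 have p: "p > 0" "1 - p > 0" "1 - p = (1 - s)/2" using s by (auto simp: p_def field_simps)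
 let ?g = "%y r. ennreal (2 * exp ((s + 1) * y) * exp (- ((exp y)\<^sup>2 + a\<^sup>2) * r)) * indicator {0<..} r"
 have "(\<integral>\<^sup>+y. ennreal (2 * exp y / ((exp y)\<^sup>2 + a\<^sup>2) * exp (s * y)) \<partial>lborel) = (\<integral>\<^sup>+y. (\<integral>\<^sup>+r. ?g y r \<partial>lborel) \<partial>lborel)"
 proof (rule nn_integral_cong)
  fix y :: real
  have b: "(exp y)\<^sup>2 + a\<^sup>2 > 0" using a by (simp add: add_pos_pos)
  have "(\<integral>\<^sup>+r. ?g y r \<partial>lborel) = (\<integral>\<^sup>+r. ennreal (2 * exp ((s + 1) * y)) * (ennreal (r powr (1 - 1) * exp (- ((exp y)\<^sup>2 + a\<^sup>2) * r)) * indicator {0<..} r) \<partial>lborel)"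
   by (intro nn_integral_cong) (auto simp: indicator_def ennreal_mult[symmetric])
  also have "... = ennreal (2 * exp ((s + 1) * y)) * ennreal (Gamma 1 * ((exp y)\<^sup>2 + a\<^sup>2) powr (-1))"
   by (subst nn_integral_cmult) (auto simp only: nn_powr_exp[OF zero_less_one b], measurable)
  also have "... = ennreal (2 * exp y / ((exp y)\<^sup>2 + a\<^sup>2) * exp (s * y))"
  proof -
   have "2 * exp ((s + 1) * y) * (Gamma 1 * ((exp y)\<^sup>2 + a\<^sup>2) powr (-1)) = 2 * exp y / ((exp y)\<^sup>2 + a\<^sup>2) * exp (s * y)"
    using b by (simp add: powr_minus distrib_right exp_add divide_inverse)
   then show ?thesis by (subst ennreal_mult[symmetric]) (auto simp: Gamma_1)
  qed
  finally show "ennreal (2 * exp y / ((exp y)\<^sup>2 + a\<^sup>2) * exp (s * y)) = (\<integral>\<^sup>+r. ?g y r \<partial>lborel)" by simp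
 qed
 also have "... = (\<integral>\<^sup>+r. (\<integral>\<^sup>+y. ?g y r \<partial>lborel) \<partial>lborel)"
  by (rule lborel_pair.Fubini') measurable
 also have "... = (\<integral>\<^sup>+r. ennreal (Gamma p) * (ennreal (r powr ((1 - p) - 1) * exp (- a\<^sup>2 * r)) * indicator {0<..} r) \<partial>lborel)"
 proof (rule nn_integral_cong)
  fix r :: real
  show "(\<integral>\<^sup>+y. ?g y r \<partial>lborel) = ennreal (Gamma p) * (ennreal (r powr ((1 - p) - 1) * exp (- a\<^sup>2 * r)) * indicator {0<..} r)"
  proof (cases "r > 0")
   case True
   have "(\<integral>\<^sup>+y. ?g y r \<partial>lborel) = ennreal \<bar>1/2\<bar> * (\<integral>\<^sup>+y. ?g (0 + (1/2) * y) r \<partial>lborel)"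
    by (rule nn_integral_real_affine) auto
   also have "(\<integral>\<^sup>+y. ?g (0 + (1/2) * y) r \<partial>lborel) = (\<integral>\<^sup>+y. ennreal (2 * exp (- a\<^sup>2 * r)) * ennreal (exp (- r * exp y) * exp (p * y)) \<partial>lborel)"
   proof (rule nn_integral_cong)
    fix y :: real
    have "(exp (0 + (1/2) * y))\<^sup>2 = exp y" by (simp add: exp_double[symmetric])
    moreover have "(s + 1) * (0 + (1/2) * y) = p * y" by (simp add: p_def field_simps)
    moreover have "exp (- (exp y + a\<^sup>2) * r) = exp (- r * exp y) * exp (- a\<^sup>2 * r)" by (simp add: exp_add[symmetric] algebra_simps)
    ultimately show "?g (0 + (1/2) * y) r = ennreal (2 * exp (- a\<^sup>2 * r)) * ennreal (exp (- r * exp y) * exp (p * y))"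
     using True by (simp only:) (simp add: ennreal_mult[symmetric] mult_ac)
   qed
   also have "... = ennreal (2 * exp (- a\<^sup>2 * r)) * ennreal (Gamma p * r powr (-p))"
    using Gamma_exp_integral_norm[OF p(1) True] by (subst nn_integral_cmult) (auto simp: nn_integral_eq_integral)
   also have "ennreal \<bar>1/2\<bar> * ... = ennreal (1/2 * ((2 * exp (- a\<^sup>2 * r)) * (Gamma p * r powr (-p))))"
   proof -
    have "ennreal \<bar>1/2\<bar> * (ennreal X * ennreal Y) = ennreal (\<bar>1/2\<bar> * (X * Y))" if "X >= 0" "Y >= 0" for X Y :: real
     using that by (simp only: ennreal_mult abs_ge_zero mult_nonneg_nonneg)
    from this[of "2 * exp (- a\<^sup>2 * r)" "Gamma p * r powr (-p)"] show ?thesis using p by (simp add: Gamma_real_nonneg)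
   qed
   also have "1/2 * ((2 * exp (- a\<^sup>2 * r)) * (Gamma p * r powr (-p))) = Gamma p * (r powr ((1 - p) - 1) * exp (- a\<^sup>2 * r))"
    by simp
   finally have *: "(\<integral>\<^sup>+y. ?g y r \<partial>lborel) = ennreal (Gamma p * (r powr ((1 - p) - 1) * exp (- a\<^sup>2 * r)))" .
   have "ennreal (Gamma p * (r powr ((1 - p) - 1) * exp (- a\<^sup>2 * r))) = ennreal (Gamma p) * ennreal (r powr ((1 - p) - 1) * exp (- a\<^sup>2 * r))"
    by (rule ennreal_mult) (use p in \<open>auto simp: Gamma_real_nonneg\<close>)
   moreover have "indicator {0<..} r = (1::ennreal)" using True by simp
   ultimately show ?thesis unfolding * by (simp only: mult_1_right)
  qed simp
 qed
 also have "... = ennreal (Gamma p) * ennreal (Gamma (1 - p) * (a\<^sup>2) powr (-(1 - p)))"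
  using a by (subst nn_integral_cmult) (auto simp only: nn_powr_exp[OF p(2), of "a\<^sup>2"] zero_less_power, measurable)
 also have "(a\<^sup>2) powr (-(1 - p)) = a powr (s - 1)"
 proof -
  have "a\<^sup>2 = a powr 2" using a by simp
  moreover have "2 * (-(1 - p)) = s - 1" by (simp add: p_def field_simps)
  ultimately show ?thesis by (simp only: powr_powr)
 qed
 also have "ennreal (Gamma p) * ennreal (Gamma (1 - p) * a powr (s - 1)) = ennreal (Gamma p * Gamma (1 - p) * a powr (s - 1))"
  using p by (subst ennreal_mult[symmetric]) (auto simp: mult.assoc Gamma_real_nonneg)
 finally show ?thesis unfolding p(3) by (simp add: p_def)
qed

text \<open>The kernel is 2 x / (x^2 + (2 pi u)^2). Its integral over all u > 0 is 1/2, by the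
  arctangent, and its sum over the positive integers is the expansion of the hyperbolic cotangent;
  the difference is again 1/x - 1/(exp x - 1), the function of
  \<open>mellin_exp_kernel\<close>.\<close>

lemma mellin_rational_kernel_sum:
 fixes s :: real assumes s: "0 < s" "s < 1"
 shows "(\<integral>\<^sup>+y. ennreal ((1 / exp y - 1 / (exp (exp y) - 1)) * exp (s * y)) \<partial>lborel)
  = ennreal ((2*pi) powr (s - 1) * Gamma ((1 + s)/2) * Gamma ((1 - s)/2)) * zdef (1 - s)"
proof (rule mellin_kernel[where k = "%u x. 2 * x / (x\<^sup>2 + (2 * pi * u)\<^sup>2)" and P = "%u x. arctan (2 * pi * u / x) / pi" and \<Phi> = "%x. 1 / x - 1 / (exp x - 1)"])
 show "(\<integral>\<^sup>+y. ennreal (2 * exp y / ((exp y)\<^sup>2 + (2 * pi * u)\<^sup>2) * exp (s * y)) \<partial>lborel)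
   = ennreal ((2*pi) powr (s - 1) * Gamma ((1 + s)/2) * Gamma ((1 - s)/2) * u powr (-(1 - s)))" if "u > 0" for u
  using that by (subst mellin_rational_kernel[OF s]) (auto simp: powr_mult mult_ac)
 show "0 <= (2*pi) powr (s - 1) * Gamma ((1 + s)/2) * Gamma ((1 - s)/2)"
  using s by (intro mult_nonneg_nonneg Gamma_real_nonneg) auto
 show "2 * x / (x\<^sup>2 + (2 * pi * v)\<^sup>2) <= 2 * x / (x\<^sup>2 + (2 * pi * u)\<^sup>2)" if "0 <= u" "u <= v" "x > 0" for u v x :: real
  using that by (intro divide_left_mono add_left_mono power_mono mult_left_mono mult_pos_pos add_pos_nonneg) auto
 show "((%u. 2 * x / (x\<^sup>2 + (2 * pi * u)\<^sup>2)) has_integral arctan (2 * pi * (real n + 1) / x) / pi - arctan (2 * pi * real n / x) / pi) {real n..real n + 1}" if x: "x > 0" for n x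
 proof (rule fundamental_theorem_of_calculus)
  fix u :: real
  have "((%u. arctan (2 * pi * u / x) / pi) has_real_derivative (inverse (1 + (2 * pi * u / x)\<^sup>2) * (2 * pi / x)) / pi) (at u)"
   using x by (auto intro!: derivative_eq_intros)
  also have "(inverse (1 + (2 * pi * u / x)\<^sup>2) * (2 * pi / x)) / pi = 2 * x / (x\<^sup>2 + (2 * pi * u)\<^sup>2)"
  proof -
   have "1 + (2 * pi * u / x)\<^sup>2 = (x\<^sup>2 + (2 * pi * u)\<^sup>2) / x\<^sup>2" using x by (simp add: field_simps)
   moreover have "x\<^sup>2 + (2 * pi * u)\<^sup>2 > 0" using x by (simp add: add_pos_nonneg)
   moreover have "(inverse (q / x\<^sup>2) * (2 * pi / x)) / pi = 2 * x / q" if "q > 0" for q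
    using that x by (simp add: field_simps power2_eq_square)
   ultimately show ?thesis by simp
  qed
  finally show "((%u. arctan (2 * pi * u / x) / pi) has_vector_derivative 2 * x / (x\<^sup>2 + (2 * pi * u)\<^sup>2)) (at u within {real n..real n + 1})"
   by (simp add: has_real_derivative_iff_has_vector_derivative has_vector_derivative_at_within)
 qed simp
 show "(%n. arctan (2 * pi * (real n + 1) / x) / pi - arctan (2 * pi * real n / x) / pi - 2 * x / (x\<^sup>2 + (2 * pi * (real n + 1))\<^sup>2)) sums (1 / x - 1 / (exp x - 1))" if x: "x > 0" for x
 proof -
  have "filterlim (%n. 2 * pi / x * real n) at_top sequentially"
   using x by (intro filterlim_tendsto_pos_mult_at_top[OF tendsto_const] filterlim_real_sequentially) auto
  then have "filterlim (%n. 2 * pi * real n / x) at_top sequentially" by simp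
  from filterlim_compose[OF tendsto_arctan_at_top this]
  have "(%n. arctan (2 * pi * real n / x) / pi) \<longlonglongrightarrow> (pi / 2) / pi"
   by (intro tendsto_divide) auto
  from telescope_sums[OF this]
  have "(%n. arctan (2 * pi * (real n + 1) / x) / pi - arctan (2 * pi * real n / x) / pi) sums (1/2)"
   by (simp add: add_ac)
  from sums_diff[OF this coth_partial_fractions[OF x]] show ?thesis by (simp add: add_ac)
 qed
qed (use s in auto)

text \<open>The two evaluations of one Mellin transform are compared. On the real segment all
  quantities are finite and nonnegative, so the identity passes from \<open>ennreal\<close> to the
  reals; the strip is left to the identity theorem.\<close>

lemma FE_real:
 fixes s :: real assumes s: "0 < s" "s < 1"
 shows "Gamma (of_real s) * (kz (of_real s) / (of_real s - 1))
   = (2 * of_real pi) powr (of_real s - 1) * Gamma ((1 + of_real s)/2) * Gamma ((1 - of_real s)/2) * (kz (1 - of_real s) / (- of_real s))"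
proof -
 let ?C = "(2*pi) powr (s - 1) * Gamma ((1 + s)/2) * Gamma ((1 - s)/2)"
 have C: "?C >= 0" using s by (intro mult_nonneg_nonneg Gamma_real_nonneg) auto
 have eq: "ennreal (Gamma s) * zdef s = ennreal ?C * zdef (1 - s)"
  using mellin_exp_kernel[OF s] mellin_rational_kernel_sum[OF s] by simp
 have s': "0 < 1 - s" "1 - s < 1" using s by auto
 have "enn2real (ennreal (Gamma s) * zdef s) = enn2real (ennreal ?C * zdef (1 - s))" by (simp only: eq)
 then have *: "Gamma s * enn2real (zdef s) = ?C * enn2real (zdef (1 - s))"
  using s C by (simp only: enn2real_mult enn2real_ennreal Gamma_real_nonneg less_imp_le)
 have k1: "kz (of_real s) / (of_real s - 1) = - of_real (enn2real (zdef s))" by (rule zdef_eq(1)[OF s])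
 have k2: "kz (1 - of_real s) / (- of_real s) = - of_real (enn2real (zdef (1 - s)))"
  using zdef_eq(1)[OF s'] by simp
 have p: "(2 * of_real pi) powr (of_real s - 1) = complex_of_real ((2*pi) powr (s - 1))"
  using powr_of_real[of "2*pi" "s - 1"] by simp
 have g: "Gamma (of_real s) = complex_of_real (Gamma s)" "Gamma ((1 + of_real s)/2) = complex_of_real (Gamma ((1+s)/2))"
  "Gamma ((1 - of_real s)/2) = complex_of_real (Gamma ((1-s)/2))"
  using Gamma_complex_of_real[of s] Gamma_complex_of_real[of "(1+s)/2"] Gamma_complex_of_real[of "(1-s)/2"] by simp_all
 show ?thesis unfolding k1 k2 p g using * by (metis (no_types, lifting) mult_minus_right of_real_mult)
qed


section \<open>Continuation of zeta and the reality of Z\<close>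

lemma holomorphic_Gamma_Re: 
 assumes "f holomorphic_on A" "!!z. z \<in> A ==> Re (f z) > 0"
 shows "(%z. Gamma (f z)) holomorphic_on A"
proof (rule holomorphic_Gamma'[OF assms(1)])
 show "f z \<notin> \<int>\<^sub>\<le>\<^sub>0" if "z \<in> A" for z
  using assms(2)[OF that] by (auto elim!: nonpos_Ints_cases)
qed

lemma holomorphic_kz:
 assumes "f holomorphic_on A" "!!z. z \<in> A ==> Re (f z) > 0"
 shows "(%z. kz (f z)) holomorphic_on A"
 using holomorphic_on_compose_gen[OF assms(1) kz_holo] assms(2) by (auto simp: o_def)

lemma FE_strip:
 assumes s: "0 < Re s" "Re s < 1"
 shows "Gamma s * (kz s / (s - 1))
   = (2 * of_real pi) powr (s - 1) * Gamma ((1 + s)/2) * Gamma ((1 - s)/2) * (kz (1 - s) / (- s))"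
proof -
 let ?S = "{s::complex. 0 < Re s & Re s < 1}"
 let ?f = "%s::complex. Gamma s * (kz s / (s - 1)) - (2 * of_real pi) powr (s - 1) * Gamma ((1 + s)/2) * Gamma ((1 - s)/2) * (kz (1 - s) / (- s))"
 have S: "?S = {s. Re s > 0} \<inter> {s. Re s < 1}" by auto
 have "?f s = 0"
 proof (rule analytic_continuation[of ?f ?S "of_real ` {0<..<1}" "1/2"])
  show "?f holomorphic_on ?S"
   by (intro holomorphic_intros holomorphic_Gamma_Re holomorphic_kz) auto
  show "open ?S" unfolding S by (intro open_Int open_halfspace_Re_gt open_halfspace_Re_lt)
  show "connected ?S" unfolding S by (intro convex_connected convex_Int convex_halfspace_Re_gt convex_halfspace_Re_lt)
  show "(1/2::complex) islimpt of_real ` {0<..<1::real}"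
   unfolding islimpt_approachable
  proof (intro allI impI)
   fix e :: real assume e: "e > 0"
   define x where "x = 1/2 + min (e/2) (1/4)"
   have "x \<in> {0<..<1}" "x ~= 1/2" "\<bar>x - 1/2\<bar> < e" using e by (auto simp: x_def min_def)
   moreover have h: "(1/2::complex) = of_real (1/2)" by simp
   moreover have "dist (of_real x) (1/2::complex) = \<bar>x - 1/2\<bar>"
    unfolding h dist_of_real dist_real_def ..
   moreover have "complex_of_real x ~= 1/2" using \<open>x ~= 1/2\<close> unfolding h of_real_eq_iff .
   ultimately show "\<exists>x'\<in>of_real ` {0<..<1}. x' ~= (1/2::complex) & dist x' (1/2) < e"
    by (intro bexI[of _ "of_real x"]) auto
  qed
  show "?f z = 0" if "z \<in> of_real ` {0<..<1}" for z
   using that FE_real by auto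
 qed (use s in auto)
 then show ?thesis by (rule iffD1[OF right_minus_eq])
qed

text \<open>Legendre's duplication formula at s/2 exchanges Gamma(s) / Gamma((1 + s)/2) for
  Gamma(s/2). The powers of 2 it introduces cancel those in (2 pi)^(s - 1).\<close>

lemma FE_sym:
 assumes s: "0 < Re s" "Re s < 1"
 shows "Gamma (s/2) * (kz s / (s - 1)) = of_real pi powr (s - 1/2) * Gamma ((1 - s)/2) * (kz (1 - s) / (- s))"
proof -
 have np: "s/2 \<notin> \<int>\<^sub>\<le>\<^sub>0" "s/2 + 1/2 \<notin> \<int>\<^sub>\<le>\<^sub>0" "(1+s)/2 \<notin> \<int>\<^sub>\<le>\<^sub>0" using s by (auto elim!: nonpos_Ints_cases simp: complex_eq_iff)
 define G where "G = Gamma ((1 + s)/2)"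
 have G: "G ~= 0" using np by (simp add: G_def Gamma_eq_zero_iff)
 have dup: "Gamma (s/2) * G = exp ((1 - s) * of_real (ln 2)) * of_real (sqrt pi) * Gamma s"
  using Gamma_legendre_duplication[OF np(1,2)] by (simp add: G_def add_divide_distrib add.commute)
 have p2: "(2 * of_real pi) powr (s - 1) = exp ((s - 1) * of_real (ln 2)) * of_real pi powr (s - 1)"
 proof -
  have "(complex_of_real 2 * of_real pi) powr (s - 1) = of_real 2 powr (s - 1) * of_real pi powr (s - 1)"
   by (rule powr_times_real_left) auto
  also have "complex_of_real 2 powr (s - 1) = exp ((s - 1) * of_real (ln 2))"
   unfolding powr_def using Ln_of_real[of 2] by simp
  finally show ?thesis by simp
 qed
 have e: "exp ((1 - s) * of_real (ln 2)) * exp ((s - 1) * of_real (ln 2)) = 1"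
  by (simp add: exp_add[symmetric] algebra_simps)
 have sp: "of_real (sqrt pi) * of_real pi powr (s - 1) = of_real pi powr (s - 1/2)"
 proof -
  have "complex_of_real (sqrt pi) = of_real pi powr (1/2)"
   using powr_of_real[of pi "1/2"] by (simp add: powr_half_sqrt)
  then show ?thesis by (simp add: powr_add[symmetric])
 qed
 have "G * (Gamma (s/2) * (kz s / (s - 1))) = exp ((1 - s) * of_real (ln 2)) * of_real (sqrt pi) * (Gamma s * (kz s / (s - 1)))"
  using dup by (simp add: mult_ac)
 also have "... = G * (of_real pi powr (s - 1/2) * Gamma ((1 - s)/2) * (kz (1 - s) / (- s)))"
  unfolding FE_strip[OF s] p2 sp[symmetric] G_def[symmetric] using e by (simp add: mult_ac)
 finally show ?thesis by (rule iffD1[OF mult_left_cancel[OF G]])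
qed

text \<open>On Re s <= 0 this is the symmetric functional equation solved for zeta. Its factor -1/s
  is absorbed through 1/Gamma(s/2) = (s/2) / Gamma(1 + s/2), and \<open>rGamma\<close> is entire, so
  the second branch is holomorphic for all Re s < 1, including s = 0.\<close>

definition zc :: "complex => complex" where
 "zc s = (if Re s > 0 then kz s / (s - 1)
   else - (1/2) * of_real pi powr (s - 1/2) * rGamma (1 + s/2) * Gamma ((1 - s)/2) * kz (1 - s))"

lemma zc_left:
 assumes s: "Re s < 1"
 shows "zc s = - (1/2) * of_real pi powr (s - 1/2) * rGamma (1 + s/2) * Gamma ((1 - s)/2) * kz (1 - s)"
proof (cases "Re s > 0")
 case True
 have s0: "s ~= 0" using True by auto
 have np: "s/2 \<notin> \<int>\<^sub>\<le>\<^sub>0" using True by (auto elim!: nonpos_Ints_cases simp: complex_eq_iff)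
 have r: "rGamma (s/2) = (s/2) * rGamma (1 + s/2)" using rGamma_plus1[of "s/2"] by (simp add: add.commute)
 have "kz s / (s - 1) = rGamma (s/2) * (Gamma (s/2) * (kz s / (s - 1)))"
  using np by (simp add: rGamma_inverse_Gamma Gamma_eq_zero_iff)
 also have "... = - (1/2) * of_real pi powr (s - 1/2) * rGamma (1 + s/2) * Gamma ((1 - s)/2) * kz (1 - s)"
  unfolding FE_sym[OF True s] r using s0 by simp
 finally show ?thesis using True by (simp add: zc_def)
qed (simp add: zc_def)

lemma zc_holo: "zc holomorphic_on - {1}"
proof -
 let ?A = "{s::complex. Re s > 0} - {1}" and ?B = "{s::complex. Re s < 1}"
 have "zc holomorphic_on ?A"
  by (rule holomorphic_transform[of "%s. kz s / (s - 1)"])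
    (auto intro!: holomorphic_intros holomorphic_kz simp: zc_def)
 moreover have "zc holomorphic_on ?B"
  by (rule holomorphic_transform[of "%s. - (1/2) * of_real pi powr (s - 1/2) * rGamma (1 + s/2) * Gamma ((1 - s)/2) * kz (1 - s)"])
    (auto intro!: holomorphic_intros holomorphic_kz holomorphic_Gamma_Re simp: zc_left)
 moreover have "open ?A" by (intro open_delete open_halfspace_Re_gt)
 moreover have "open ?B" by (rule open_halfspace_Re_lt)
 ultimately have "zc holomorphic_on (?A \<union> ?B)" by (intro holomorphic_on_Un)
 moreover have "- {1} \<subseteq> ?A \<union> ?B" by (auto simp: not_less)
 ultimately show ?thesis by (rule holomorphic_on_subset)
qed

text \<open>\<open>zc\<close> is the witness required by the choice in the definition of
  \<open>zeta\<close>. Everything later about zeta is derived from these two properties.\<close>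

lemma zeta_spec:
 "zeta holomorphic_on - {1}" "!!s. Re s > 1 ==> (%n. 1 / of_nat (Suc n) powr s) sums zeta s"
proof -
 let ?P = "%f. f holomorphic_on (- {1}) & (\<forall>s. Re s > 1 --> (%n. 1 / of_nat (Suc n) powr s) sums f s)"
 have "?P zc" using zc_holo kz_eq_Dirichlet by (auto simp: zc_def)
 then have "?P zeta" unfolding zeta_def by (rule someI[of ?P])
 then show "zeta holomorphic_on - {1}" "!!s. Re s > 1 ==> (%n. 1 / of_nat (Suc n) powr s) sums zeta s" by auto
qed

lemma zeta_eq:
 assumes s: "Re s > 0" "s ~= 1"
 shows "zeta s = kz s / (s - 1)"
proof -
 let ?S = "{s::complex. Re s > 0} - {1}"
 let ?f = "%s. zeta s - kz s / (s - 1)"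
 have "?f s = 0"
 proof (rule analytic_continuation_open[of "{s. Re s > 1}" ?S zeta "%s. kz s / (s - 1)", THEN iffD2[OF right_minus_eq]])
  show "open {s::complex. Re s > 1}" by (rule open_halfspace_Re_gt)
  show "open ?S" by (intro open_delete open_halfspace_Re_gt)
  have "complex_of_real 2 \<in> {s. Re s > 1}" by simp
  then show "{s::complex. Re s > 1} ~= {}" by blast
  show "connected ?S"
   by (intro connected_open_delete convex_connected convex_halfspace_Re_gt open_halfspace_Re_gt) simp
  show "zeta holomorphic_on ?S" by (rule holomorphic_on_subset[OF zeta_spec(1)]) auto
  show "(%s. kz s / (s - 1)) holomorphic_on ?S" by (intro holomorphic_intros holomorphic_kz) auto
  show "zeta z = kz z / (z - 1)" if "z \<in> {s. Re s > 1}" for z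
   using sums_unique2[OF zeta_spec(2) kz_eq_Dirichlet] that by auto
 qed (use s in auto)
 then show ?thesis by simp
qed

lemma kz_cnj: "Re s > 0 ==> kz (cnj s) = cnj (kz s)"
proof -
 assume s: "Re s > 0"
 have p: "(of_nat (Suc n)) powr (cnj r) = cnj (of_nat (Suc n) powr r)" for n r
  by (subst cnj_powr) auto
 have "zterm n (cnj s) = cnj (zterm n s)" for n
  unfolding zterm_def using p[of n "-s"] p[of n "1 - s"] p[of "Suc n" "1 - s"] by (simp del: of_nat_Suc)
 then show ?thesis
  unfolding kz_def
  using bounded_linear.suminf[OF bounded_linear_cnj summable_norm_cancel[OF zterm_summable[OF s]]] by simp
qed

text \<open>The asymmetric functional equation. The reflection formula turns Gamma((1 + s)/2)
  Gamma((1 - s)/2) into pi / cos (pi s / 2). The cosine is what later splits the square of Z into a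
  large and an exponentially smaller part.\<close>

lemma zeta_reflect:
 assumes s: "0 < Re s" "Re s < 1"
 shows "zeta (1 - s) = 2 * (2 * of_real pi) powr (- s) * cos (of_real pi * s / 2) * Gamma s * zeta s"
proof -
 have s1: "s ~= 1" "1 - s ~= 1" using s by auto
 have z: "zeta s = kz s / (s - 1)" "zeta (1 - s) = kz (1 - s) / (- s)"
  using zeta_eq[of s] zeta_eq[of "1 - s"] s s1 by simp_all
 have r: "Gamma ((1 + s)/2) * Gamma ((1 - s)/2) = of_real pi / cos (of_real pi * s / 2)"
 proof -
  have a: "1 - (1 + s)/2 = (1 - s)/2" by (simp add: complex_eq_iff field_simps)
  have b: "sin (of_real pi * ((1 + s)/2)) = cos (of_real pi * s / 2)"
   by (simp add: sin_cos_eq field_simps)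
  show ?thesis using Gamma_reflection_complex[of "(1 + s)/2"] unfolding a b .
 qed
 have G0: "Gamma ((1 + s)/2) * Gamma ((1 - s)/2) ~= 0"
 proof -
  have "(1 + s)/2 \<notin> \<int>\<^sub>\<le>\<^sub>0" "(1 - s)/2 \<notin> \<int>\<^sub>\<le>\<^sub>0" using s by (auto elim!: nonpos_Ints_cases simp: complex_eq_iff)
  then show ?thesis by (simp add: Gamma_eq_zero_iff)
 qed
 then have c: "cos (of_real pi * s / 2) ~= 0" unfolding r by auto
 have "Gamma s * zeta s = (2 * of_real pi) powr (s - 1) * (of_real pi / cos (of_real pi * s / 2)) * zeta (1 - s)"
  using FE_strip[OF s] unfolding z r[symmetric] by (simp add: mult_ac)
 moreover have "(2 * of_real pi) powr (- s) * (2 * of_real pi) powr (s - 1) = 1 / (2 * complex_of_real pi)"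
 proof -
  have e: "- s + (s - 1) = - 1" by simp
  have f: "(2 * complex_of_real pi) powr (- 1) = inverse (2 * complex_of_real pi)"
   using powr_minus[of "2 * complex_of_real pi" 1] by (simp only: powr_to_1)
  show ?thesis using powr_add[of "2 * complex_of_real pi" "- s" "s - 1"] unfolding e f by (simp only: divide_inverse mult_1_left)
 qed
 ultimately show ?thesis using c
  by (simp add: mult.assoc) (simp add: field_simps)
qed

lemma zeta_cnj_line: "zeta (Complex (1/2) t) = cnj (zeta (1 - Complex (1/2) t))"
proof -
 let ?s = "Complex (1/2) t"
 have c: "1 - ?s = cnj ?s" by (simp add: complex_eq_iff)
 have "?s ~= 1" "cnj ?s ~= 1" by (auto simp: complex_eq_iff)
 then have "zeta (cnj ?s) = cnj (zeta ?s)" by (simp add: zeta_eq kz_cnj)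
 then show ?thesis unfolding c by simp
qed

definition Lam :: "complex => complex" where
 "Lam s = of_real pi powr (- s/2) * Gamma (s/2) * zeta s"

lemma Lam_reflect:
 assumes s: "0 < Re s" "Re s < 1"
 shows "Lam (1 - s) = Lam s"
proof -
 have s1: "s ~= 1" "1 - s ~= 1" using s by auto
 have z: "zeta s = kz s / (s - 1)" "zeta (1 - s) = kz (1 - s) / (- s)"
  using zeta_eq[of s] zeta_eq[of "1 - s"] s s1 by simp_all
 have "of_real pi powr (- s/2) * complex_of_real pi powr (s - 1/2) = of_real pi powr (- (1 - s)/2)"
 proof -
  have "- s/2 + (s - 1/2) = - (1 - s)/2" by (simp add: complex_eq_iff)
  then show ?thesis by (simp only: powr_add[symmetric])
 qed
 moreover have "Lam s = of_real pi powr (- s/2) * (of_real pi powr (s - 1/2) * Gamma ((1 - s)/2) * (kz (1 - s) / (- s)))"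
  unfolding Lam_def z(1) mult.assoc FE_sym[OF s, unfolded mult.assoc] ..
 ultimately show ?thesis unfolding Lam_def z(2) by (simp only: mult.assoc[symmetric])
qed

text \<open>\<open>RS_theta\<close> is the argument of pi^(-s/2) Gamma(s/2) at s = 1/2 + it, because
  \<open>ln_Gamma\<close> is a logarithm of Gamma. So exp (i theta) zeta is the completed function
  \<open>Lam\<close> divided by a positive number. \<open>Lam\<close> is real on the critical line,
  where 1 - s is the conjugate of s, and hence the real part in \<open>RS_Z\<close> loses
  nothing.\<close>

lemma RS_Z_Lam:
 shows "Lam (Complex (1/2) t) = of_real (pi powr (-1/4) * norm (Gamma (Complex (1/4) (t/2))) * RS_Z t)"
  and "\<bar>RS_Z t\<bar> = norm (zeta (Complex (1/2) t))"
proof -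
 let ?s = "Complex (1/2) t" and ?h = "Complex (1/4) (t/2)"
 have h: "?s / 2 = ?h" by (simp add: complex_eq_iff)
 have np: "?h \<notin> \<int>\<^sub>\<le>\<^sub>0" by (auto elim!: nonpos_Ints_cases simp: complex_eq_iff)
 have G: "Gamma ?h = exp (ln_Gamma ?h)" using np by (simp add: Gamma_complex_altdef)
 have nG: "norm (Gamma ?h) = exp (Re (ln_Gamma ?h))" unfolding G by simp
 have G': "Gamma ?h = of_real (norm (Gamma ?h)) * exp (\<i> * of_real (Im (ln_Gamma ?h)))"
  unfolding nG G by (subst (1) complex_eq[of "ln_Gamma ?h"]) (simp add: exp_add exp_of_real)
 have P: "of_real pi powr (- ?s/2) = of_real (pi powr (-1/4)) * exp (\<i> * of_real (- (t/2) * ln pi))"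
 proof -
  have "- ?s/2 = of_real (-1/4) + \<i> * of_real (- (t/2))" by (simp add: complex_eq_iff)
  then have "of_real pi powr (- ?s/2) = of_real pi powr (of_real (-1/4)) * complex_of_real pi powr (\<i> * of_real (- (t/2)))"
   by (simp only: powr_add)
  also have "complex_of_real pi powr (of_real (-1/4)) = of_real (pi powr (-1/4))" by (rule powr_of_real) simp
  also have "complex_of_real pi powr (\<i> * of_real (- (t/2))) = exp (\<i> * of_real (- (t/2) * ln pi))"
   by (simp add: powr_def Ln_of_real mult_ac)
  finally show ?thesis .
 qed
 define r where "r = pi powr (-1/4) * norm (Gamma ?h)"
 have r: "r > 0" unfolding r_def using np by (simp add: Gamma_eq_zero_iff)
 let ?w = "exp (\<i> * of_real (RS_theta t)) * zeta ?s"
 have L: "Lam ?s = of_real r * ?w"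
 proof -
  have e: "exp (\<i> * of_real (RS_theta t)) = exp (\<i> * of_real (- (t/2) * ln pi)) * exp (\<i> * of_real (Im (ln_Gamma ?h)))"
   unfolding RS_theta_def by (simp only: of_real_add distrib_left exp_add)
  show ?thesis unfolding Lam_def P h r_def e by (subst (1) G') (simp only: of_real_mult mult_ac)
 qed
 have c: "1 - ?s = cnj ?s" by (simp add: complex_eq_iff)
 have "cnj (Lam ?s) = Lam (cnj ?s)"
 proof -
  have 1: "cnj (of_real pi powr (- ?s/2)) = of_real pi powr (- cnj ?s/2)"
   by (subst cnj_powr) auto
  have 2: "cnj (Gamma (?s/2)) = Gamma (cnj ?s/2)" by (simp add: cnj_Gamma)
  show ?thesis unfolding Lam_def using 1 2 zeta_cnj_line[of t] c by simp
 qed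
 also have "Lam (cnj ?s) = Lam ?s" using Lam_reflect[of ?s] c by simp
 finally have "Lam ?s \<in> \<real>" by (simp add: Reals_cnj_iff)
 moreover have "?w = Lam ?s / of_real r" unfolding L using r by simp
 ultimately have "?w \<in> \<real>" by (metis Reals_divide Reals_of_real)
 then have w: "?w = of_real (RS_Z t)" unfolding RS_Z_def by (simp add: complex_is_Real_iff complex_eq_iff)
 show "Lam ?s = of_real (pi powr (-1/4) * norm (Gamma ?h) * RS_Z t)"
  unfolding L w r_def by simp
 have "norm ?w = \<bar>RS_Z t\<bar>" unfolding w by simp
 then show "\<bar>RS_Z t\<bar> = norm (zeta ?s)" by (simp add: norm_mult)
qed


section \<open>The divisor series near the origin\<close>

text \<open>For Re u > 0 this is the Lambert series of the divisor function, the sum of d(n) exp (-n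
  u).\<close>

definition Sd :: "complex => complex" where "Sd u = (\<Sum>k. exp (- of_real (pm k) * u))"

text \<open>The expected value of \<open>Sd\<close> near u = 0, with the sum over pairs replaced by
  the density ln v + 2 c. Its closed form is (c - ln u) / u, but the integral is kept because what
  follows uses only bounds and Fubini.\<close>

definition Pm :: "complex => complex" where
 "Pm u = (LINT v:{0<..}|lborel. of_real (ln v + 2 * euler_mascheroni) * exp (- u * of_real v))"

lemma exp_tail_integral:
 fixes u :: complex and a :: real
 assumes u: "Re u > 0" and a: "a >= 0"
 shows "set_integrable lborel {a<..} (%x. exp (- u * of_real x))"
  "(LINT x:{a<..}|lborel. exp (- u * of_real x)) = exp (- u * of_real a) / u"
proof -
 have u0: "u ~= 0" using u by auto
 have 1: "set_integrable lborel {a<..} (%x. x powr (1 - 1) * exp (- Re u * x))"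
  by (rule set_integrable_subset[OF powr_exp_integral(1)[OF zero_less_one u]]) (use a in auto)
 show si: "set_integrable lborel {a<..} (%x. exp (- u * of_real x))"
  by (rule set_integrable_bound[OF 1]) (use a in \<open>auto simp: set_borel_measurable_def\<close>)
 have ei: "einterval (ereal a) \<infinity> = {a<..}" by (auto simp: einterval_def)
 have l1: "(((%x. - exp (- u * of_real x) / u) \<circ> real_of_ereal) \<longlongrightarrow> - exp (- u * of_real a) / u) (at_right (ereal a))"
  unfolding ereal_tendsto_simps by (intro tendsto_intros) (auto simp: u0)
 have l2: "(((%x. - exp (- u * of_real x) / u) \<circ> real_of_ereal) \<longlongrightarrow> 0) (at_left \<infinity>)"
  unfolding ereal_tendsto_simps
 proof (rule Lim_null_comparison)
  show "\<forall>\<^sub>F x in at_top. norm (- exp (- u * complex_of_real x) / u) <= exp (- Re u * x) / norm u"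
   by (simp add: norm_divide)
  have "((%x. exp (- Re u * x)) \<longlongrightarrow> 0) at_top" using u by real_asymp
  then show "((%x. exp (- Re u * x) / norm u) \<longlongrightarrow> 0) at_top" by (rule tendsto_divide_zero)
 qed
 have "(LBINT x=ereal a..\<infinity>. exp (- u * of_real x)) = 0 - (- exp (- u * of_real a) / u)"
 proof (rule interval_integral_FTC_integrable[OF _ _ _ _ l1 l2])
  show "((%x. - exp (- u * complex_of_real x) / u) has_vector_derivative exp (- u * complex_of_real x)) (at x)" for x
   by (rule has_vector_derivative_real_field) (use u0 in \<open>auto intro!: derivative_eq_intros\<close>)
 qed (use si in \<open>auto simp: ei\<close>)
 then show "(LINT x:{a<..}|lborel. exp (- u * of_real x)) = exp (- u * of_real a) / u"
  by (simp add: interval_lebesgue_integral_def ei)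
qed

lemma mono_divcount: "mono divcount"
 unfolding divcount_def by (intro monoI of_nat_mono card_mono finite_pm_le) auto

lemma measurable_divcount[measurable]: "divcount \<in> borel_measurable borel"
 by (rule borel_measurable_mono[OF mono_divcount])

lemma divmain_bound: "x > 0 ==> \<bar>divmain x\<bar> <= 2 * x powr (3/2) + 2 * x powr (1/2) + x powr 1"
proof -
 assume x: "x > 0"
 have c: "0 < (euler_mascheroni::real)" "(euler_mascheroni::real) < 1"
  using euler_mascheroni_pos euler_mascheroni_less_13_over_22 by auto
 have p: "x * x powr (1/2) = x powr (3/2)" "x * x powr (-1/2) = x powr (1/2)"
  using powr_add[of x 1 "1/2"] powr_add[of x 1 "-1/2"] x by simp_all
 have "\<bar>x * ln x\<bar> = x * \<bar>ln x\<bar>" using x by (simp add: abs_mult)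
 also have "... <= x * (2 * x powr (1/2) + 2 * x powr (-1/2))"
  using x by (intro mult_left_mono ln_bounds_powr(3)) auto
 also have "... = 2 * x powr (3/2) + 2 * x powr (1/2)" using p by (simp add: algebra_simps)
 finally have 1: "\<bar>x * ln x\<bar> <= 2 * x powr (3/2) + 2 * x powr (1/2)" .
 have "\<bar>(2 * euler_mascheroni - 1) * x\<bar> = \<bar>2 * euler_mascheroni - 1\<bar> * x" using x by (simp add: abs_mult)
 also have "... <= 1 * x" using c x by (intro mult_right_mono) auto
 finally show ?thesis using 1 x unfolding divmain_def by simp
qed

lemma powr_exp_set_integrable:
 fixes a r :: real assumes "a > -1" "r > 0"
 shows "set_integrable lborel {0<..} (%x. x powr a * exp (- r * x))"
 using powr_exp_integral(1)[of "a + 1" r] assms by simp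

lemma ln_exp_bound: "x > 0 ==> \<bar>ln x + 2 * euler_mascheroni\<bar> <= 2 * x powr (1/2) + 2 * x powr (-1/2) + 2 * x powr (0::real)"
proof -
 assume x: "x > 0"
 have c: "0 < (euler_mascheroni::real)" "(euler_mascheroni::real) < 1"
  using euler_mascheroni_pos euler_mascheroni_less_13_over_22 by auto
 show ?thesis using ln_bounds_powr(3)[OF x] c x by simp
qed

lemma Laplace_integrable:
 fixes u :: complex assumes u: "Re u > 0"
 shows "set_integrable lborel {0<..} (%x. of_real (divmain x) * exp (- u * of_real x))"
  "set_integrable lborel {0<..} (%x. of_real (ln x + 2 * euler_mascheroni) * exp (- u * of_real x) :: complex)"
  "set_integrable lborel {0<..} (%x. of_real (divcount x) * exp (- u * of_real x))"
proof -
 have 1: "set_integrable lborel {0<..} (%x. (2 * x powr (3/2) + 2 * x powr (1/2) + x powr 1) * exp (- Re u * x))"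
  unfolding distrib_right mult.assoc
  by (intro set_integral_add set_integrable_mult_right powr_exp_set_integrable u) auto
 show m: "set_integrable lborel {0<..} (%x. of_real (divmain x) * exp (- u * of_real x))"
 proof (rule set_integrable_bound[OF 1])
  show "AE x in lborel. x \<in> {0<..} --> norm (of_real (divmain x) * exp (- u * of_real x)) <= norm ((2 * x powr (3/2) + 2 * x powr (1/2) + x powr 1) * exp (- Re u * x))"
  proof (intro AE_I2 impI)
   fix x :: real assume "x \<in> {0<..}"
   then have "\<bar>divmain x\<bar> * exp (- Re u * x) <= (2 * x powr (3/2) + 2 * x powr (1/2) + x powr 1) * exp (- Re u * x)"
    by (intro mult_right_mono divmain_bound) auto
   then show "norm (of_real (divmain x) * exp (- u * of_real x)) <= norm ((2 * x powr (3/2) + 2 * x powr (1/2) + x powr 1) * exp (- Re u * x))"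
    by (simp add: norm_mult abs_mult)
  qed
 qed (auto simp: set_borel_measurable_def divmain_def)
 have 2: "set_integrable lborel {0<..} (%x. (2 * x powr (1/2) + 2 * x powr (-1/2) + 2 * x powr 0) * exp (- Re u * x))"
  unfolding distrib_right mult.assoc
  by (intro set_integral_add set_integrable_mult_right powr_exp_set_integrable u) auto
 show "set_integrable lborel {0<..} (%x. of_real (ln x + 2 * euler_mascheroni) * exp (- u * of_real x) :: complex)"
 proof (rule set_integrable_bound[OF 2])
  show "AE x in lborel. x \<in> {0<..} --> norm (of_real (ln x + 2 * euler_mascheroni) * exp (- u * of_real x) :: complex) <= norm ((2 * x powr (1/2) + 2 * x powr (-1/2) + 2 * x powr 0) * exp (- Re u * x))"
  proof (intro AE_I2 impI)
   fix x :: real assume "x \<in> {0<..}"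
   then have "\<bar>ln x + 2 * euler_mascheroni\<bar> * exp (- Re u * x) <= (2 * x powr (1/2) + 2 * x powr (-1/2) + 2 * x powr 0) * exp (- Re u * x)"
    by (intro mult_right_mono ln_exp_bound) auto
   then show "norm (of_real (ln x + 2 * euler_mascheroni) * exp (- u * of_real x) :: complex) <= norm ((2 * x powr (1/2) + 2 * x powr (-1/2) + 2 * x powr 0) * exp (- Re u * x))"
    unfolding norm_mult norm_of_real by (simp add: abs_mult del: of_real_add)
  qed
 qed (auto simp: set_borel_measurable_def)
 obtain C where C: "C >= 0" "!!x. x > 0 ==> \<bar>divcount x - divmain x\<bar> <= C * sqrt x" using divcount_error by auto
 have 3: "set_integrable lborel {0<..} (%x. (C * x powr (1/2)) * exp (- Re u * x))"
  unfolding mult.assoc by (intro set_integrable_mult_right powr_exp_set_integrable u) auto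
 have "set_integrable lborel {0<..} (%x. of_real (divcount x - divmain x) * exp (- u * of_real x) :: complex)"
 proof (rule set_integrable_bound[OF 3])
  show "AE x in lborel. x \<in> {0<..} --> norm (of_real (divcount x - divmain x) * exp (- u * of_real x) :: complex) <= norm ((C * x powr (1/2)) * exp (- Re u * x))"
  proof (intro AE_I2 impI)
   fix x :: real assume "x \<in> {0<..}"
   then have "\<bar>divcount x - divmain x\<bar> * exp (- Re u * x) <= (C * x powr (1/2)) * exp (- Re u * x)"
    using C(2)[of x] by (intro mult_right_mono) (auto simp: powr_half_sqrt)
   then show "norm (of_real (divcount x - divmain x) * exp (- u * of_real x) :: complex) <= norm ((C * x powr (1/2)) * exp (- Re u * x))"
    unfolding norm_mult norm_of_real using C by (simp add: abs_mult del: of_real_diff)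
  qed
 qed (auto simp: set_borel_measurable_def divmain_def)
 from set_integral_add(1)[OF this m]
 show "set_integrable lborel {0<..} (%x. of_real (divcount x) * exp (- u * of_real x))"
  by (simp add: algebra_simps)
qed

text \<open>Integration by parts: ln x + 2 c is the derivative of \<open>divmain\<close>, and the
  boundary terms vanish at 0 and at infinity.\<close>

lemma Pm_Laplace:
 assumes u: "Re u > 0"
 shows "Pm u = u * (LINT x:{0<..}|lborel. of_real (divmain x) * exp (- u * of_real x))"
proof -
 have ei: "einterval 0 \<infinity> = {0<..}" by (auto simp: einterval_def)
 let ?F = "%x. of_real (divmain x) * exp (- u * of_real x)"
 let ?f = "%x. of_real (ln x + 2 * euler_mascheroni) * exp (- u * of_real x) - u * ?F x"
 have nF: "norm (?F x) = \<bar>divmain x * exp (- Re u * x)\<bar>" for x by (simp add: norm_mult abs_mult)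
 have l1: "((?F \<circ> real_of_ereal) \<longlongrightarrow> 0) (at_right 0)"
 proof -
  have "((%x. divmain x * exp (- Re u * x)) \<longlongrightarrow> 0) (at_right 0)"
   unfolding divmain_def using u by real_asymp
  then have "((%x. norm (?F x)) \<longlongrightarrow> 0) (at_right 0)" unfolding nF by (rule tendsto_rabs_zero)
  then show ?thesis unfolding zero_ereal_def ereal_tendsto_simps by (rule tendsto_norm_zero_cancel)
 qed
 have l2: "((?F \<circ> real_of_ereal) \<longlongrightarrow> 0) (at_left \<infinity>)"
 proof -
  have "((%x. divmain x * exp (- Re u * x)) \<longlongrightarrow> 0) at_top"
   unfolding divmain_def using u by real_asymp
  then have "((%x. norm (?F x)) \<longlongrightarrow> 0) at_top" unfolding nF by (rule tendsto_rabs_zero)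
  then show ?thesis unfolding ereal_tendsto_simps by (rule tendsto_norm_zero_cancel)
 qed
 have i2: "set_integrable lborel {0<..} (%x. u * ?F x)" by (intro set_integrable_mult_right Laplace_integrable(1)[OF u])
 have int: "set_integrable lborel {0<..} ?f"
  by (intro set_integral_diff(1) Laplace_integrable(2)[OF u] i2)
 have "(LBINT x=0..\<infinity>. ?f x) = 0 - 0"
 proof (rule interval_integral_FTC_integrable[OF _ _ _ _ l1 l2])
  fix x :: real assume "0 < ereal x"
  then have x: "x > 0" by simp
  have "(divmain has_real_derivative (ln x + 2 * euler_mascheroni)) (at x)"
   unfolding divmain_def using x by (auto intro!: derivative_eq_intros)
  then have 1: "((%x. of_real (divmain x) :: complex) has_vector_derivative of_real (ln x + 2 * euler_mascheroni)) (at x)"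
   by (simp add: has_vector_derivative_of_real has_real_derivative_iff_has_vector_derivative del: of_real_add)
  have 2: "((%x. exp (- u * complex_of_real x)) has_vector_derivative (- u * exp (- u * of_real x))) (at x)"
   by (rule has_vector_derivative_real_field) (auto intro!: derivative_eq_intros)
  show "(?F has_vector_derivative ?f x) (at x)"
   using has_vector_derivative_mult[OF 1 2] by (simp add: algebra_simps del: of_real_add)
  show "isCont ?f x" unfolding divmain_def using x by (auto intro!: continuous_intros)
 qed (use int in \<open>auto simp: ei\<close>)
 then have "0 = (LINT x:{0<..}|lborel. ?f x)"
  by (simp add: interval_lebesgue_integral_def ei)
 also have "... = Pm u - u * (LINT x:{0<..}|lborel. ?F x)"
  unfolding Pm_def by (subst set_integral_diff(2)[OF Laplace_integrable(2)[OF u] i2]) simp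
 finally show ?thesis by simp
qed

text \<open>Abel summation in integral form: exp (-p u) is u times the integral of exp (-u x) over x
  > p. After the exchange, the number of products p below x appears under the integral.\<close>

lemma Sd_Laplace:
 assumes u: "Re u > 0"
 shows "Sd u = u * (LINT x:{0<..}|lborel. of_real (divcount x) * exp (- u * of_real x))"
proof -
 have u0: "u ~= 0" using u by auto
 let ?f = "%k x. indicator {pm k<..} x *\<^sub>R exp (- u * of_real x)"
 have pm0: "pm k >= 0" for k using pm_ge_1[of k] by linarith
 have int: "integrable lborel (?f k)" for k
  using exp_tail_integral(1)[OF u pm0] unfolding set_integrable_def .
 have nf: "(\<integral>x. norm (?f k x) \<partial>lborel) = exp (- Re u * pm k) / Re u" for k
 proof -
  have 1: "Re (of_real (Re u)) > 0" using u by simp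
  have "complex_of_real (\<integral>x. norm (?f k x) \<partial>lborel) = (\<integral>x. of_real (norm (?f k x)) \<partial>lborel)"
   by (rule integral_complex_of_real[symmetric])
  also have "... = (LINT x:{pm k<..}|lborel. exp (- of_real (Re u) * complex_of_real x))"
   unfolding set_lebesgue_integral_def
   by (rule Bochner_Integration.integral_cong) (auto simp: indicator_def exp_of_real[symmetric])
  also have "... = complex_of_real (exp (- Re u * pm k) / Re u)"
   unfolding exp_tail_integral(2)[OF 1 pm0] by (simp add: exp_of_real[symmetric])
  finally show ?thesis by (simp only: of_real_eq_iff)
 qed
 have sum_exp: "summable (%k. exp (- Re u * pm k))"
 proof (rule summable_comparison_test'[where N = 0, OF summable_mult[OF pm_summable[of "-2"], of "2 powr 2 * Re u powr (-2)"]])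
  fix k
  have "exp (- (Re u * pm k)) <= 2 powr 2 * (Re u * pm k) powr (-2)"
  proof -
   have x: "Re u * pm k > 0" using u pm_ge_1[of k] by (intro mult_pos_pos) auto
   define x where "x = Re u * pm k"
   have "x / 2 <= exp (x/2)" using exp_ge_add_one_self[of "x/2"] by linarith
   then have "(x/2) ^ 2 <= exp (x/2) ^ 2" using x by (intro power_mono) (auto simp: x_def)
   also have "exp (x/2) ^ 2 = exp x" by (simp add: exp_double[symmetric])
   finally show ?thesis using x unfolding x_def[symmetric]
    by (simp add: exp_minus powr_minus field_simps)
  qed
  then show "norm (exp (- Re u * pm k)) <= 2 powr 2 * Re u powr - 2 * pm k powr - 2"
   using u pm0[of k] by (simp add: powr_mult)
 qed simp
 have abs: "AE x in lborel. summable (%k. norm (?f k x))"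
 proof (intro AE_I2)
  fix x :: real
  have "finite {k. norm (?f k x) ~= 0}" by (rule finite_subset[OF _ finite_pm_le[of x]]) (auto simp: indicator_def)
  then show "summable (%k. norm (?f k x))" by (rule summable_finite) auto
 qed
 have sums: "summable (%k. \<integral>x. norm (?f k x) \<partial>lborel)" unfolding nf by (intro summable_divide sum_exp)
 have "(%k. integral\<^sup>L lborel (?f k)) sums (\<integral>x. (\<Sum>k. ?f k x) \<partial>lborel)"
  by (rule sums_integral[OF int abs sums])
 moreover have "integral\<^sup>L lborel (?f k) = exp (- of_real (pm k) * u) / u" for k
  using exp_tail_integral(2)[OF u pm0] unfolding set_lebesgue_integral_def by (simp add: mult.commute)
 ultimately have "(%k. exp (- of_real (pm k) * u) / u) sums (\<integral>x. (\<Sum>k. ?f k x) \<partial>lborel)" by simp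
 from sums_mult[OF this, of u] have "Sd u = u * (\<integral>x. (\<Sum>k. ?f k x) \<partial>lborel)"
  unfolding Sd_def using u0 by (simp add: sums_iff)
 also have "(\<integral>x. (\<Sum>k. ?f k x) \<partial>lborel) = (\<integral>x. indicator {0<..} x *\<^sub>R (of_real (divcount x) * exp (- u * of_real x)) \<partial>lborel)"
 proof (rule integral_cong_AE)
  show "(%x. \<Sum>k. ?f k x) \<in> borel_measurable lborel" by measurable
  \<comment> \<open>The half-lines exclude their end point \<open>pm k\<close>, whereas
    \<open>divcount\<close> counts it. The two integrands differ only on the countable range of
    \<open>pm\<close>.\<close>
  have "countable (range pm)" by simp
  then have "range pm \<in> null_sets lborel" by (rule countable_imp_null_set_lborel)
  then have "AE x in lborel. x \<notin> range pm" by (rule AE_not_in)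
  then show "AE x in lborel. (\<Sum>k. ?f k x) = indicator {0<..} x *\<^sub>R (of_real (divcount x) * exp (- u * of_real x))"
  proof (rule AE_mp, intro AE_I2 impI)
   fix x assume x: "x \<notin> range pm"
   have "(\<Sum>k. ?f k x) = (\<Sum>k\<in>{k. pm k <= x}. ?f k x)"
    by (rule suminf_finite[OF finite_pm_le]) (auto simp: indicator_def)
   also have "... = (\<Sum>k\<in>{k. pm k <= x}. exp (- u * of_real x))"
    using x by (intro sum.cong) (auto simp: indicator_def less_le)
   also have "... = of_real (divcount x) * exp (- u * of_real x)" by (simp add: divcount_def)
   also have "... = indicator {0<..} x *\<^sub>R (of_real (divcount x) * exp (- u * of_real x))"
    using divcount_small[of x] by (auto simp: indicator_def divcount_def)
   finally show "(\<Sum>k. ?f k x) = indicator {0<..} x *\<^sub>R (of_real (divcount x) * exp (- u * of_real x))" .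
  qed
 qed measurable
 finally show ?thesis unfolding set_lebesgue_integral_def .
qed

text \<open>Both sides are u times a Laplace transform, of \<open>divcount\<close> and of
  \<open>divmain\<close>, whose difference is O(sqrt x) and has transform O((Re u)^(-3/2)). The
  remaining factor |u| is what makes the bound effective near the origin.\<close>

lemma Sd_Pm_bound:
 "\<exists>C\<ge>0. \<forall>u. Re u > 0 --> norm (Sd u - Pm u) <= C * norm u * Re u powr (-3/2)"
proof -
 obtain C where C: "C >= 0" "!!x. x > 0 ==> \<bar>divcount x - divmain x\<bar> <= C * sqrt x" using divcount_error by auto
 show ?thesis
 proof (intro exI[of _ "C * Gamma (3/2)"] conjI allI impI)
  show "C * Gamma (3/2) >= 0" using C by (intro mult_nonneg_nonneg Gamma_real_nonneg) auto
  fix u :: complex assume u: "Re u > 0"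
  let ?d = "%x. of_real (divcount x - divmain x) * exp (- u * of_real x) :: complex"
  have a: "Sd u - Pm u = u * (LINT x:{0<..}|lborel. ?d x)"
   unfolding Sd_Laplace[OF u] Pm_Laplace[OF u] right_diff_distrib[symmetric]
   by (subst set_integral_diff(2)[OF Laplace_integrable(3)[OF u] Laplace_integrable(1)[OF u], symmetric]) (simp add: algebra_simps)
  have b: "norm (LINT x:{0<..}|lborel. ?d x) <= (LINT x:{0<..}|lborel. C * (x powr (3/2 - 1) * exp (- Re u * x)))"
   unfolding set_lebesgue_integral_def
  proof (rule bint_norm_bound)
   show "integrable lborel (%x. indicator {0<..} x *\<^sub>R ?d x)"
    using set_integral_diff(1)[OF Laplace_integrable(3)[OF u] Laplace_integrable(1)[OF u]]
    unfolding set_integrable_def by (simp add: algebra_simps)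
   show "integrable lborel (%x. indicat_real {0<..} x *\<^sub>R (C * (x powr (3/2 - 1) * exp (- Re u * x))))"
    using set_integrable_mult_right[OF powr_exp_integral(1)[of "3/2" "Re u"], of C] u unfolding set_integrable_def by simp
   show "norm (indicator {0<..} x *\<^sub>R ?d x) <= indicat_real {0<..} x *\<^sub>R (C * (x powr (3/2 - 1) * exp (- Re u * x)))" for x
   proof (cases "x > 0")
    case True
    then have "\<bar>divcount x - divmain x\<bar> * exp (- Re u * x) <= (C * x powr (1/2)) * exp (- Re u * x)"
     using C(2)[of x] by (intro mult_right_mono) (auto simp: powr_half_sqrt)
    then show ?thesis using True by (simp add: norm_mult mult.assoc del: of_real_diff)
   qed simp
  qed
  have c: "(LINT x:{0<..}|lborel. C * (x powr (3/2 - 1) * exp (- Re u * x))) = C * Gamma (3/2) * Re u powr (-3/2)"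
   using powr_exp_integral(2)[of "3/2" "Re u"] u by simp
  have "norm (Sd u - Pm u) <= norm u * (C * Gamma (3/2) * Re u powr (-3/2))"
   unfolding a norm_mult c[symmetric] by (rule mult_left_mono[OF b norm_ge_zero])
  then show "norm (Sd u - Pm u) <= C * Gamma (3/2) * norm u * Re u powr (-3/2)" by (simp add: mult_ac)
 qed
qed

text \<open>Differentiation in u brings down a factor v. With ln v bounded by powers v^(1/2) and
  v^(-1/2), the worst term is of order r^(-5/2), and it dominates the others because r <= 1.\<close>

lemma Pm_Lipschitz:
 "\<exists>K\<ge>0. \<forall>u v r. 0 < r & r <= 1 & r <= Re u & r <= Re v --> norm (Pm u - Pm v) <= K * norm (u - v) * r powr (-5/2)"
proof -
 let ?K = "2 * Gamma (5/2) + 2 * Gamma (3/2) + 2 * Gamma (2::real)"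
 show ?thesis
 proof (intro exI[of _ ?K] conjI allI impI, goal_cases)
  case 1 show ?case by (intro add_nonneg_nonneg mult_nonneg_nonneg Gamma_real_nonneg) auto
 next
  case (2 u v r)
  then have r: "0 < r" "r <= 1" "r <= Re u" "r <= Re v" and u: "Re u > 0" and v: "Re v > 0" by auto
  let ?l = "%x. complex_of_real (ln x + 2 * euler_mascheroni)"
  let ?d = "%x. ?l x * exp (- u * of_real x) - ?l x * exp (- v * of_real x)"
  let ?b = "%x. norm (u - v) * (2 * (x powr (5/2 - 1) * exp (- r * x)) + 2 * (x powr (3/2 - 1) * exp (- r * x)) + 2 * (x powr (2 - 1) * exp (- r * x)))"
  have a: "Pm u - Pm v = (LINT x:{0<..}|lborel. ?d x)"
   unfolding Pm_def by (rule set_integral_diff(2)[OF Laplace_integrable(2)[OF u] Laplace_integrable(2)[OF v], symmetric])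
  have ib: "set_integrable lborel {0<..} ?b"
   by (intro set_integrable_mult_right set_integral_add(1) powr_exp_integral(1) r) auto
  have b: "norm (LINT x:{0<..}|lborel. ?d x) <= (LINT x:{0<..}|lborel. ?b x)"
   unfolding set_lebesgue_integral_def
  proof (rule bint_norm_bound)
   show "integrable lborel (%x. indicator {0<..} x *\<^sub>R ?d x)"
    using set_integral_diff(1)[OF Laplace_integrable(2)[OF u] Laplace_integrable(2)[OF v]] unfolding set_integrable_def .
   show "integrable lborel (%x. indicat_real {0<..} x *\<^sub>R ?b x)" using ib unfolding set_integrable_def .
   show "norm (indicator {0<..} x *\<^sub>R ?d x) <= indicat_real {0<..} x *\<^sub>R ?b x" for x :: real
   proof (cases "x > 0")
    case True
    have e: "norm (exp (- u * of_real x) - exp (- v * of_real x)) <= (x * exp (- r * x)) * norm (u - v)"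
    proof (rule field_differentiable_bound[of "{z. Re z >= r}"])
     show "convex {z. Re z >= r}" by (rule convex_halfspace_Re_ge)
     show "((%z. exp (- z * of_real x)) has_field_derivative (- of_real x) * exp (- z * of_real x)) (at z within {z. Re z >= r})" for z
      by (auto intro!: derivative_eq_intros)
     show "norm ((- of_real x) * exp (- z * of_real x)) <= x * exp (- r * x)" if "z \<in> {z. Re z >= r}" for z
      using that True by (simp add: norm_mult)
    qed (use r in auto)
    have "norm (?d x) = \<bar>ln x + 2 * euler_mascheroni\<bar> * norm (exp (- u * of_real x) - exp (- v * of_real x))"
     by (simp only: right_diff_distrib[symmetric] norm_mult norm_of_real)
    also have "... <= (2 * x powr (1/2) + 2 * x powr (-1/2) + 2 * x powr 0) * ((x * exp (- r * x)) * norm (u - v))"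
     by (intro mult_mono e ln_exp_bound True) auto
    also have "... = ?b x"
    proof -
     have p: "x powr (5/2 - 1) = x * x powr (1/2)" "x powr (3/2 - 1) = x * x powr (-1/2)"
      using powr_add[of x 1 "1/2"] powr_add[of x 1 "-1/2"] True by simp_all
     show ?thesis unfolding p using True by (simp add: algebra_simps)
    qed
    finally show ?thesis using True by simp
   qed simp
  qed
  have c: "(LINT x:{0<..}|lborel. ?b x) = norm (u - v) * (2 * (Gamma (5/2) * r powr (-5/2)) + 2 * (Gamma (3/2) * r powr (-3/2)) + 2 * (Gamma 2 * r powr (-2)))"
  proof -
   have i: "set_integrable lborel {0<..} (%x. 2 * (x powr (a - 1) * exp (- r * x)))" if "a > 0" for a
    by (intro set_integrable_mult_right powr_exp_integral(1) r that)
   have e: "(LINT x:{0<..}|lborel. 2 * (x powr (a - 1) * exp (- r * x))) = 2 * (Gamma a * r powr (-a))" if "a > 0" for a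
    using powr_exp_integral(2)[OF that r(1)] by simp
   show ?thesis
    using set_integral_add(2)[OF set_integral_add(1)[OF i[of "5/2"] i[of "3/2"]] i[of 2]] set_integral_add(2)[OF i[of "5/2"] i[of "3/2"]]
     e[of "5/2"] e[of "3/2"] e[of 2] by simp
  qed
  also have "... <= norm (u - v) * (?K * r powr (-5/2))"
  proof (intro mult_left_mono)
   have "r powr (-3/2) <= r powr (-5/2)" "r powr (-2) <= r powr (-5/2)" using r by (auto intro!: powr_mono')
   then have "2 * (Gamma (5/2) * r powr (-5/2)) + 2 * (Gamma (3/2) * r powr (-3/2)) + 2 * (Gamma 2 * r powr (-2))
     <= 2 * (Gamma (5/2) * r powr (-5/2)) + 2 * (Gamma (3/2) * r powr (-5/2)) + 2 * (Gamma 2 * r powr (-5/2))"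
    by (intro add_mono mult_left_mono Gamma_real_nonneg) auto
   then show "2 * (Gamma (5/2) * r powr (-5/2)) + 2 * (Gamma (3/2) * r powr (-3/2)) + 2 * (Gamma 2 * r powr (-2)) <= ?K * r powr (-5/2)"
    by (simp add: algebra_simps)
  qed simp
  finally have d: "(LINT x:{0<..}|lborel. ?b x) <= norm (u - v) * (?K * r powr (-5/2))" .
  have "norm (Pm u - Pm v) <= norm (u - v) * (?K * r powr (-5/2))"
   unfolding a by (rule order_trans[OF b d])
  then show ?case by (simp only: mult_ac)
 qed
qed


section \<open>Growth bounds and the contour shift for the square of zeta\<close>

text \<open>\<open>kz_bound\<close> divided by s - 1, which is harmless where |s - 1| >= 1/2: in the
  strip at heights of modulus at least 1, and at all heights on the lines Re s = 1/2 and Re s =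
  2.\<close>

lemma zeta_bounds:
 "\<exists>K\<ge>1. (\<forall>s. 1/2 <= Re s & Re s <= 2 & \<bar>Im s\<bar> >= 1 --> norm (zeta s) <= K * (1 + \<bar>Im s\<bar>)) \<and>
   (\<forall>t. norm (zeta (Complex (1/2) t)) <= K * (1 + \<bar>t\<bar>)) & (\<forall>t. norm (zeta (Complex 2 t)) <= K * (1 + \<bar>t\<bar>))"
proof -
 obtain K where K: "K >= 0" "!!s. Re s >= 1/2 ==> norm (kz s) <= 1 + K * norm (s - 1) * norm s" using kz_bound by auto
 have main: "norm (zeta s) <= (2 + 2 * K) * (1 + \<bar>Im s\<bar>)" if s: "1/2 <= Re s" "Re s <= 2" "norm (s - 1) >= 1/2" for s
 proof -
  have s1: "s ~= 1" using s by auto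
  have ns: "norm s <= 2 + \<bar>Im s\<bar>" using cmod_le[of s] s by linarith
  have z: "zeta s = kz s / (s - 1)" using s s1 by (intro zeta_eq) auto
  have "norm (zeta s) <= (1 + K * norm (s - 1) * norm s) / norm (s - 1)"
   unfolding z norm_divide using K(2)[OF s(1)] by (intro divide_right_mono) auto
  also have "... = 1 / norm (s - 1) + K * norm s" using s1 by (simp add: add_divide_distrib)
  also have "1 / norm (s - 1) <= 2" using divide_left_mono[of "1/2" "norm (s - 1)" 1] s s1 by simp
  also have "K * norm s <= K * (2 + \<bar>Im s\<bar>)" using ns K by (intro mult_left_mono) auto
  also have "2 + K * (2 + \<bar>Im s\<bar>) <= (2 + 2 * K) * (1 + \<bar>Im s\<bar>)" using K by (simp add: algebra_simps)
  finally show ?thesis by simp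
 qed
 show ?thesis
 proof (intro exI[of _ "2 + 2 * K"] conjI allI impI, goal_cases)
  case (2 s)
  have "\<bar>Im (s - 1)\<bar> <= norm (s - 1)" by (rule abs_Im_le_cmod)
  then show ?case using 2 by (intro main) auto
 next
  case (3 t)
  have "\<bar>Re (Complex (1/2) t - 1)\<bar> <= norm (Complex (1/2) t - 1)" by (rule abs_Re_le_cmod)
  then show ?case using main[of "Complex (1/2) t"] by auto
 next
  case (4 t)
  have "\<bar>Re (Complex 2 t - 1)\<bar> <= norm (Complex 2 t - 1)" by (rule abs_Re_le_cmod)
  then show ?case using main[of "Complex 2 t"] by auto
 qed (use K in auto)
qed

lemma norm_Gamma_le: "Re s > 0 ==> norm (Gamma s) <= Gamma (Re s)"
proof -
 assume s: "Re s > 0"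
 have "norm (Gamma s) = norm (\<integral>y. of_real (exp (- exp y)) * exp (s * of_real y) \<partial>lborel)"
  using Gamma_exp_integral(2)[OF s] by simp
 also have "... <= (\<integral>y. exp (- 1 * exp y) * exp (Re s * y) \<partial>lborel)"
  by (rule bint_norm_bound[OF Gamma_exp_integral(1)[OF s] Gamma_exp_integral_norm(1)[OF s zero_less_one]])
    (simp add: norm_mult)
 also have "... = Gamma (Re s)" using Gamma_exp_integral_norm(2)[OF s zero_less_one] by simp
 finally show ?thesis .
qed

lemma Gamma_strip_bound: "a > 0 ==> \<exists>G\<ge>0. \<forall>s. a <= Re s & Re s <= b --> norm (Gamma s) <= G"
proof -
 assume a: "a > 0"
 have "continuous_on {a..b} (Gamma :: real => real)"
  using a by (intro continuous_on_Gamma) (auto elim!: nonpos_Ints_cases)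
 then have "bounded (Gamma ` {a..b})" by (intro compact_imp_bounded compact_continuous_image) auto
 then obtain G where "\<forall>y\<in>Gamma ` {a..b}. norm (y::real) <= G" unfolding bounded_iff by blast
 then have G: "!!x. x \<in> {a..b} ==> norm (Gamma x) <= G" by blast
 show ?thesis
 proof (intro exI[of _ "max G 0"] conjI allI impI)
  fix s assume s: "a <= Re s & Re s <= b"
  have "norm (Gamma s) <= Gamma (Re s)" using s a by (intro norm_Gamma_le) auto
  also have "... <= G" using G[of "Re s"] s by auto
  finally show "norm (Gamma s) <= max G 0" by simp
 qed auto
qed

text \<open>\<open>wd \<delta>\<close> is \<open>2 \<pi> \<i>\<close> rotated slightly into the right half-plane, so that
  \<open>exp (- wd \<delta> * n)\<close> decays while staying close to 1 for integers \<open>n\<close>.\<close>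

definition wd :: "real => complex" where "wd de = 2 * of_real pi * exp (\<i> * of_real (pi/2 - 2 * de))"

lemma wd_powr:
 assumes "0 < de" "de < 1/4"
 shows "wd de powr (- s) = exp (- s * (of_real (ln (2*pi)) + \<i> * of_real (pi/2 - 2 * de)))"
proof -
 have "Ln (wd de) = of_real (ln (2*pi)) + \<i> * of_real (pi/2 - 2 * de)"
 proof (rule Ln_unique)
  show "exp (of_real (ln (2*pi)) + \<i> * of_real (pi/2 - 2 * de)) = wd de"
   unfolding wd_def exp_add exp_of_real by (simp add: exp_ln)
 qed (use assms pi_gt3 in auto)
 moreover have "wd de ~= 0" by (simp add: wd_def)
 ultimately show ?thesis by (simp add: powr_def)
qed

lemma norm_wd_powr:
 assumes "0 < de" "de < 1/4"
 shows "norm (wd de powr (- Complex sg t)) = (2*pi) powr (-sg) * exp (t * (pi/2 - 2*de))"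
 unfolding wd_powr[OF assms] by (simp add: powr_def exp_add[symmetric] exp_diff[symmetric] algebra_simps)

lemma wd_eq: "wd de = 2 * of_real pi * \<i> * exp (- (\<i> * of_real (2 * de)))"
proof -
 have "exp (\<i> * of_real (pi/2 - 2 * de)) = exp (\<i> * of_real (pi/2)) * exp (- (\<i> * of_real (2 * de)))"
  by (simp add: exp_add[symmetric] algebra_simps)
 also have "exp (\<i> * of_real (pi/2)) = \<i>" by (metis cis_conv_exp cis_pi_half)
 finally show ?thesis unfolding wd_def by (simp add: mult_ac)
qed

lemma Re_wd: "Re (wd de) = 2 * pi * sin (2 * de)"
 unfolding wd_eq by (simp add: Re_exp Im_exp)

text \<open>The Mellin integrand belonging to \<open>Sd\<close>. On the critical line, for t > 0,
  Gamma(s) times the power of \<open>wd de\<close> has size about exp (-2 de t), so zeta squared is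
  weighted by a Gaussian around Im s1 and a slowly decaying exponential.\<close>

definition hh :: "real => real => complex => complex => complex" where
 "hh de D s1 s = Gamma s * wd de powr (- s) * (zeta s)\<^sup>2 * exp ((s - s1)\<^sup>2 / of_real (D\<^sup>2))"

lemma exp_gauss_integrable:
 fixes D ta \<beta> :: real assumes D: "D > 0"
 shows "integrable lborel (%t::real. exp (\<beta> * t) * exp (- ((t - ta) / D)\<^sup>2))"
proof -
 have eq: "exp (\<beta> * t) * exp (- ((t - ta) / D)\<^sup>2) = exp (- (ta/D)\<^sup>2) * exp ((\<beta> + 2*ta/D\<^sup>2) * t - ((2/D) * t)\<^sup>2 / 4)" for t
  using D by (simp add: exp_add[symmetric] field_simps power2_eq_square)
 show ?thesis unfolding eq by (intro integrable_mult_right gauss_lin(1)) (use D in auto)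
qed

lemma Complex_measurable[measurable]: "Complex sg \<in> borel_measurable borel"
 unfolding Complex_eq by measurable

lemma zeta_pm_sum:
 assumes s: "Re s > 1"
 shows "(\<Sum>k. of_real (pm k) powr (- s)) = (zeta s)\<^sup>2"
proof -
 let ?f = "%n. (of_nat (Suc n) :: complex) powr (- s)"
 have nf: "norm (?f n) = real (Suc n) powr (- Re s)" for n
  using norm_powr_real_powr[of "of_nat (Suc n)" "- s"] by simp
 have sm: "summable (%n. norm (?f n))" unfolding nf using s by (intro summable_Suc_powr) auto
 have "?f sums zeta s"
  using zeta_spec(2)[OF s] by (simp add: powr_minus divide_inverse del: of_nat_Suc)
 then have "suminf ?f = zeta s" by (simp add: sums_iff)
 with pair_sums(2)[OF sm sm] have "(%k. ?f (fst (prod_decode k)) * ?f (snd (prod_decode k))) sums (zeta s)\<^sup>2"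
  by (simp add: power2_eq_square)
 moreover have "?f (fst (prod_decode k)) * ?f (snd (prod_decode k)) = of_real (pm k) powr (- s)" for k
  unfolding pm_def by (simp add: powr_times_real del: of_nat_Suc)
 ultimately show ?thesis by (simp add: sums_iff)
qed

text \<open>On Re s = 2 the double Dirichlet series of zeta squared converges absolutely, so
  \<open>mellin_gauss_sum\<close> applies with the products \<open>pm\<close> as
  frequencies.\<close>

lemma hh_line_2:
 assumes d: "0 < de" "de < 1/4" and D: "D > 0"
 shows "integrable lborel (%t. hh de D s1 (Complex 2 t))"
  "integrable lborel (%y. Sd (wd de * of_real (exp y)) * exp (s1 * of_real y - of_real ((D*y)\<^sup>2/4)))"
  "(\<integral>t. hh de D s1 (Complex 2 t) \<partial>lborel) = of_real (sqrt pi * D) *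
    (\<integral>y. Sd (wd de * of_real (exp y)) * exp (s1 * of_real y - of_real ((D*y)\<^sup>2/4)) \<partial>lborel)"
proof -
 have "sin (2*de) > 0" using d pi_gt3 by (intro sin_gt_zero) auto
 then have w: "Re (wd de) > 0" unfolding Re_wd by simp
 have pm0: "pm k > 0" for k using pm_ge_1[of k] by linarith
 have sm: "summable (%k. pm k powr (-2))" by (rule pm_summable) simp
 have z: "(\<Sum>k. of_real (pm k) powr (- Complex 2 t)) = (zeta (Complex 2 t))\<^sup>2" for t
  by (rule zeta_pm_sum) simp
 have S: "(\<Sum>k. exp (- of_real (pm k) * wd de * of_real (exp y))) = Sd (wd de * of_real (exp y))" for y
  unfolding Sd_def by (simp only: mult.assoc)
 note * = mellin_gauss_sum[OF D zero_less_numeral w pm0 sm, of s1, unfolded z S]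
 show "integrable lborel (%t. hh de D s1 (Complex 2 t))" using *(1) unfolding hh_def .
 show "integrable lborel (%y. Sd (wd de * of_real (exp y)) * exp (s1 * of_real y - of_real ((D*y)\<^sup>2/4)))" by (rule *(2))
 show "(\<integral>t. hh de D s1 (Complex 2 t) \<partial>lborel) = of_real (sqrt pi * D) *
    (\<integral>y. Sd (wd de * of_real (exp y)) * exp (s1 * of_real y - of_real ((D*y)\<^sup>2/4)) \<partial>lborel)"
  using *(3) unfolding hh_def .
qed

text \<open>The constant exp (9/4) is exp ((3/2)^2): the strip has width 3/2 and D >= 1, which
  limits the growth of the Gaussian factor away from the critical line.\<close>

lemma hh_bound:
 "\<exists>C\<ge>0. \<forall>de D s1 sg t. 0 < de & de < 1/4 & D >= 1 & Re s1 = 1/2 & 1/2 <= sg & sg <= 2 & (t >= 1 \<or> sg = 2) -->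
   norm (hh de D s1 (Complex sg t)) <= C * (1 + \<bar>t\<bar>)\<^sup>2 * exp (t * (pi/2 - 2*de)) * exp (- ((t - Im s1) / D)\<^sup>2)"
proof -
 obtain K where K: "K >= 1" "!!s. 1/2 <= Re s ==> Re s <= 2 ==> \<bar>Im s\<bar> >= 1 ==> norm (zeta s) <= K * (1 + \<bar>Im s\<bar>)"
   "!!t. norm (zeta (Complex 2 t)) <= K * (1 + \<bar>t\<bar>)"
  using zeta_bounds by blast
 obtain G where G: "G >= 0" "!!s. 1/2 <= Re s ==> Re s <= 2 ==> norm (Gamma s) <= G"
  using Gamma_strip_bound[of "1/2" 2] by auto
 show ?thesis
 proof (intro exI[of _ "G * K\<^sup>2 * exp (9/4)"] conjI allI impI)
  show "0 <= G * K\<^sup>2 * exp (9/4)" using G by simp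
  fix de D sg t :: real and s1 :: complex
  assume a: "0 < de & de < 1/4 & D >= 1 & Re s1 = 1/2 & 1/2 <= sg & sg <= 2 & (t >= 1 \<or> sg = 2)"
  let ?s = "Complex sg t"
  have z: "norm (zeta ?s) <= K * (1 + \<bar>t\<bar>)" using K(2)[of ?s] K(3)[of t] a by auto
  have "norm (hh de D s1 ?s) = norm (Gamma ?s) * ((2*pi) powr (-sg) * exp (t * (pi/2 - 2*de))) * (norm (zeta ?s))\<^sup>2 *
    (exp (((sg - 1/2) / D)\<^sup>2) * exp (- ((t - Im s1) / D)\<^sup>2))"
   unfolding hh_def norm_mult norm_gauss_line norm_power using a by (simp add: norm_wd_powr)
  also have "... <= G * (1 * exp (t * (pi/2 - 2*de))) * (K * (1 + \<bar>t\<bar>))\<^sup>2 * (exp (9/4) * exp (- ((t - Im s1) / D)\<^sup>2))"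
  proof (intro mult_mono power_mono z G)
   have "(2*pi) powr (-sg) <= (2*pi) powr 0" using a pi_gt3 by (intro powr_mono) auto
   then show "(2*pi) powr (-sg) <= 1" using pi_gt3 by simp
   have "((sg - 1/2) / D)\<^sup>2 <= (3/2)\<^sup>2"
   proof (rule power_mono)
    have "(sg - 1/2) / D <= (sg - 1/2) / 1" using a by (intro divide_left_mono) auto
    then show "(sg - 1/2) / D <= 3/2" by (rule order_trans) (use a in simp)
   qed (use a in auto)
   then show "exp (((sg - 1/2) / D)\<^sup>2) <= exp (9/4)" by (simp add: power2_eq_square)
  qed (use a G K in auto)
  also have "... = G * K\<^sup>2 * exp (9/4) * (1 + \<bar>t\<bar>)\<^sup>2 * exp (t * (pi/2 - 2*de)) * exp (- ((t - Im s1) / D)\<^sup>2)"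
   by (simp add: power_mult_distrib mult_ac)
  finally show "norm (hh de D s1 ?s) <= ..." .
 qed
qed

text \<open>The full line Re s = 2 replaces the half-line t >= 1 on Re s = 1/2. Two pieces are lost:
  the horizontal segment at height 1, which is O(1), and the part t < 1 of the line Re s = 2, which
  lies in the tail of the Gaussian.\<close>

lemma hh_shift:
 "\<exists>C\<ge>0. \<forall>de D s1. 0 < de & de < 1/4 & D >= 1 & Re s1 = 1/2 & Im s1 >= 1 -->
   set_integrable lborel {1..} (%t. hh de D s1 (Complex (1/2) t)) \<and>
   norm ((LINT t:{1..}|lborel. hh de D s1 (Complex (1/2) t)) - (\<integral>t. hh de D s1 (Complex 2 t) \<partial>lborel))
    <= C * (1 + D * exp (- ((Im s1 - 1) / D)\<^sup>2 / 2))"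
proof -
 obtain C where C: "C >= 0" "!!de D s1 sg t. 0 < de ==> de < 1/4 ==> D >= 1 ==> Re s1 = 1/2 ==> 1/2 <= sg ==> sg <= 2 ==> (t >= 1 \<or> sg = 2) ==>
   norm (hh de D s1 (Complex sg t)) <= C * (1 + \<bar>t\<bar>)\<^sup>2 * exp (t * (pi/2 - 2*de)) * exp (- ((t - Im s1) / D)\<^sup>2)"
  using hh_bound by blast
 define C2 where "C2 = C * exp 4 * (3/2) + C * 4 * exp 2 * 64 * sqrt pi * 2"
 show ?thesis
 proof (intro exI[of _ C2] conjI allI impI)
  show "C2 >= 0" unfolding C2_def using C by simp
  fix de D :: real and s1 :: complex assume "0 < de & de < 1/4 & D >= 1 & Re s1 = 1/2 & Im s1 >= 1"
  then have a: "0 < de" "de < 1/4" "D >= 1" "Re s1 = 1/2" "Im s1 >= 1" by auto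
  let ?ta = "Im s1"
  define B where "B = (%t. C * (exp (4 * t) * exp (- ((t - ?ta) / D)\<^sup>2)))"
  have D0: "D > 0" using a by simp
  have holo: "hh de D s1 holomorphic_on {s. Im s > 0}"
  proof -
   have "zeta holomorphic_on {s. Im s > 0}" by (rule holomorphic_on_subset[OF zeta_spec(1)]) auto
   moreover have "Gamma holomorphic_on {s. Im s > 0}"
    by (rule holomorphic_Gamma'[of "%z. z"]) (auto intro!: holomorphic_on_ident elim!: nonpos_Ints_cases)
   ultimately show ?thesis unfolding hh_def wd_powr[OF a(1,2)]
    by (intro holomorphic_intros) (use a in \<open>auto elim!: nonpos_Ints_cases\<close>)
  qed
  have bnd: "norm (hh de D s1 (Complex sg t)) <= B t" if "1/2 <= sg" "sg <= 2" "t >= 1" for sg t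
  proof -
   have "norm (hh de D s1 (Complex sg t)) <= C * (1 + \<bar>t\<bar>)\<^sup>2 * exp (t * (pi/2 - 2*de)) * exp (- ((t - ?ta) / D)\<^sup>2)"
    using C(2)[of de D s1 sg t] a that by auto
   also have "... <= C * (exp t)\<^sup>2 * exp (t * 2) * exp (- ((t - ?ta) / D)\<^sup>2)"
   proof (intro mult_right_mono mult_mono mult_left_mono power_mono)
    show "1 + \<bar>t\<bar> <= exp t" using exp_ge_add_one_self[of t] that by simp
    show "exp (t * (pi/2 - 2*de)) <= exp (t * 2)" using that a pi_less_4 by (simp add: mult_left_mono)
   qed (use C in auto)
   also have "... = B t" by (simp add: B_def exp_double[symmetric] exp_add[symmetric] mult.assoc)
   finally show ?thesis .
  qed
  have Bi: "set_integrable lborel {1..} B"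
   unfolding set_integrable_def B_def
   by (intro integrable_mult_indicator integrable_mult_right exp_gauss_integrable D0) auto
  have Bl: "(B \<longlongrightarrow> 0) at_top"
  proof -
   have "((%t. exp (4 * t) * exp (- ((t - ?ta) / D)\<^sup>2)) \<longlongrightarrow> 0) at_top" using D0 by real_asymp
   from tendsto_mult_right_zero[OF this] show ?thesis unfolding B_def .
  qed
  note ls = line_shift[OF holo bnd Bi Bl, of "1/2" 2, simplified]
  show "set_integrable lborel {1..} (%t. hh de D s1 (Complex (1/2) t))"
   using line_shift(1)[OF holo bnd Bi Bl] by simp
  have i2: "integrable lborel (%t. hh de D s1 (Complex 2 t))" by (rule hh_line_2(1)[OF a(1,2) D0])
  have si: "set_integrable lborel A (%t. hh de D s1 (Complex 2 t))" if "A \<in> sets borel" for A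
   unfolding set_integrable_def using that i2 by (intro integrable_mult_indicator) auto
  have split: "(\<integral>t. hh de D s1 (Complex 2 t) \<partial>lborel) = (LINT t:{1..}|lborel. hh de D s1 (Complex 2 t)) + (LINT t:{..<1}|lborel. hh de D s1 (Complex 2 t))"
  proof -
   have "(LINT t:{1..} \<union> {..<1}|lborel. hh de D s1 (Complex 2 t)) = (LINT t:{1..}|lborel. hh de D s1 (Complex 2 t)) + (LINT t:{..<1}|lborel. hh de D s1 (Complex 2 t))"
    by (rule set_integral_Un[OF _ si si]) auto
   moreover have "{1..} \<union> {..<1} = (UNIV::real set)" by auto
   ultimately show ?thesis by (simp add: set_lebesgue_integral_def)
  qed
  have n1: "norm ((LINT t:{1..}|lborel. hh de D s1 (Complex (1/2) t)) - (LINT t:{1..}|lborel. hh de D s1 (Complex 2 t))) <= (2 - 1/2) * B 1"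
   by (rule line_shift(3)[OF holo bnd Bi Bl]) auto
  have B1: "B 1 <= C * exp 4"
  proof -
   have "exp (- ((1 - ?ta) / D)\<^sup>2) <= (1::real)" by simp
   then have "exp 4 * exp (- ((1 - ?ta) / D)\<^sup>2) <= exp 4 * (1::real)" by (intro mult_left_mono) auto
   then show ?thesis unfolding B_def using C(1) by (simp add: mult_left_mono)
  qed
  \<comment> \<open>For t < 1 one has |t - ta| >= ta - 1. Half of the Gaussian exponent is spent on
    the small factor in front, and a quarter of it remains as a Gaussian of width 2 D.\<close>
  let ?q = "%t. C * 4 * exp 2 * 64 * exp (- ((?ta - 1) / D)\<^sup>2 / 2) * exp (- ((t - ?ta) / (2 * D))\<^sup>2)"
  have qi: "integrable lborel ?q" by (intro integrable_mult_right gauss_shift_integrable(1)) (use D0 in auto)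
  have n2: "norm (LINT t:{..<1}|lborel. hh de D s1 (Complex 2 t)) <= (\<integral>t. ?q t \<partial>lborel)"
   unfolding set_lebesgue_integral_def
  proof (rule bint_norm_bound[OF _ qi])
   show "integrable lborel (%t. indicator {..<1} t *\<^sub>R hh de D s1 (Complex 2 t))"
    using si[of "{..<1}"] unfolding set_integrable_def by simp
   fix t :: real
   show "norm (indicator {..<1} t *\<^sub>R hh de D s1 (Complex 2 t)) <= ?q t"
   proof (cases "t < 1")
    case True
    define P where "P = pi/2 - 2*de"
    have P: "1 <= P" "P <= 2" using a pi_gt3 pi_less_4 by (auto simp: P_def)
    have "norm (hh de D s1 (Complex 2 t)) <= C * (1 + \<bar>t\<bar>)\<^sup>2 * exp (t * P) * exp (- ((t - ?ta) / D)\<^sup>2)"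
     using C(2)[of de D s1 2 t] a unfolding P_def by auto
    also have "(1 + \<bar>t\<bar>)\<^sup>2 * exp (t * P) <= 4 * exp 2 * 64"
    proof (cases "t >= 0")
     case True
     have "(1 + \<bar>t\<bar>)\<^sup>2 <= 2\<^sup>2" using True \<open>t < 1\<close> by (intro power_mono) auto
     moreover have "t * P <= 1 * 2" using True \<open>t < 1\<close> P by (intro mult_mono) auto
     ultimately have "(1 + \<bar>t\<bar>)\<^sup>2 * exp (t * P) <= 2\<^sup>2 * exp 2" by (intro mult_mono) auto
     also have "... <= 4 * exp 2 * (64::real)" by simp
     finally show ?thesis .
    next
     case False
     have "1 + \<bar>t\<bar> <= 2 * (1 + \<bar>t\<bar>/2)" by simp
     also have "... <= 2 * exp (\<bar>t\<bar>/2)" by (intro mult_left_mono exp_ge_add_one_self) auto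
     finally have "(1 + \<bar>t\<bar>)\<^sup>2 <= (2 * exp (\<bar>t\<bar>/2))\<^sup>2" by (intro power_mono) auto
     also have "... = 4 * exp \<bar>t\<bar>" by (simp add: power_mult_distrib exp_double[symmetric])
     finally have e: "(1 + \<bar>t\<bar>)\<^sup>2 <= 4 * exp \<bar>t\<bar>" .
     have "t * P <= t * 1" using False P by (intro mult_left_mono_neg) auto
     then have "exp (t * P) <= exp (- \<bar>t\<bar>)" using False by simp
     with e have "(1 + \<bar>t\<bar>)\<^sup>2 * exp (t * P) <= (4 * exp \<bar>t\<bar>) * exp (- \<bar>t\<bar>)" by (intro mult_mono) auto
     also have "... = 4" by (simp add: exp_minus)
     also have "... <= 4 * exp 2 * (64::real)" using exp_ge_add_one_self[of "2::real"] by simp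
     finally show ?thesis .
    qed
    then have "C * (1 + \<bar>t\<bar>)\<^sup>2 * exp (t * P) * exp (- ((t - ?ta) / D)\<^sup>2) <= C * 4 * exp 2 * 64 * exp (- ((t - ?ta) / D)\<^sup>2)"
     using C(1) by (intro mult_right_mono) (auto simp: mult.assoc intro!: mult_left_mono)
    also have "exp (- ((t - ?ta) / D)\<^sup>2) <= exp (- ((?ta - 1) / D)\<^sup>2 / 2) * exp (- ((t - ?ta) / (2 * D))\<^sup>2)"
    proof -
     have "((?ta - 1) / D)\<^sup>2 <= ((?ta - t) / D)\<^sup>2"
      using True a by (intro power_mono divide_right_mono) auto
     moreover have "((?ta - t) / D)\<^sup>2 = ((t - ?ta) / D)\<^sup>2" by (simp add: power_divide power2_commute)
     moreover have "((t - ?ta) / (2 * D))\<^sup>2 = ((t - ?ta) / D)\<^sup>2 / 4" by (simp add: power_divide power_mult_distrib)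
     moreover have "((t - ?ta) / D)\<^sup>2 >= 0" by simp
     ultimately have "- ((t - ?ta) / D)\<^sup>2 <= - ((?ta - 1) / D)\<^sup>2 / 2 + - ((t - ?ta) / (2 * D))\<^sup>2" by linarith
     then show ?thesis by (simp only: exp_add[symmetric] exp_le_cancel_iff)
    qed
    finally show ?thesis using True C(1) by (simp add: mult_left_mono mult.assoc)
   next
    case False
    then show ?thesis using C(1) by simp
   qed
  qed
  have q: "(\<integral>t. ?q t \<partial>lborel) = C * 4 * exp 2 * 64 * exp (- ((?ta - 1) / D)\<^sup>2 / 2) * (sqrt pi * (2 * D))"
   by (subst integral_mult_right_zero, subst gauss_shift_integrable(2)) (use D0 in auto)
  have "norm ((LINT t:{1..}|lborel. hh de D s1 (Complex (1/2) t)) - (\<integral>t. hh de D s1 (Complex 2 t) \<partial>lborel))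
   <= norm ((LINT t:{1..}|lborel. hh de D s1 (Complex (1/2) t)) - (LINT t:{1..}|lborel. hh de D s1 (Complex 2 t))) + norm (LINT t:{..<1}|lborel. hh de D s1 (Complex 2 t))"
   unfolding split diff_diff_add[symmetric] by (rule norm_triangle_ineq4)
  also have "... <= C * exp 4 * (3/2) + C * 4 * exp 2 * 64 * sqrt pi * 2 * (D * exp (- ((?ta - 1) / D)\<^sup>2 / 2))"
   using n1 n2 B1 unfolding q by (simp add: mult_ac)
  also have "... <= C2 * (1 + D * exp (- ((?ta - 1) / D)\<^sup>2 / 2))"
  proof -
   have "a + b * X <= (a + b) * (1 + X)" if "a >= 0" "b >= 0" "X >= 0" for a b X :: real
    using that by (simp add: algebra_simps)
   from this[of "C * exp 4 * (3/2)" "C * 4 * exp 2 * 64 * sqrt pi * 2" "D * exp (- ((?ta - 1) / D)\<^sup>2 / 2)"]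
   show ?thesis unfolding C2_def using C(1) D0 by simp
  qed
  finally show "norm ((LINT t:{1..}|lborel. hh de D s1 (Complex (1/2) t)) - (\<integral>t. hh de D s1 (Complex 2 t) \<partial>lborel))
    <= C2 * (1 + D * exp (- ((Im s1 - 1) / D)\<^sup>2 / 2))" .
 qed
qed


section \<open>The divisor series near 2 pi i\<close>

text \<open>Each power of |y| is worth a factor 1/D: (D |y|)^k <= 2 exp (D |y|) for k <= 2, and the
  exponential disappears on completing the square. Since D >= 1, the factor exp (a |y|) costs only a
  constant depending on a.\<close>

lemma gauss_moment:
 fixes a D :: real assumes a: "a >= 0" and D: "D >= 1" and k: "k <= 2"
 shows "integrable lborel (%y::real. \<bar>y\<bar> ^ k * exp (a * \<bar>y\<bar>) * exp (- (D*y)\<^sup>2/4))"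
  "(\<integral>y. \<bar>y\<bar> ^ k * exp (a * \<bar>y\<bar>) * exp (- (D*y)\<^sup>2/4) \<partial>lborel) <= 8 * sqrt pi * exp ((a+1)\<^sup>2) / D ^ (k+1)"
proof -
 have D0: "D > 0" using D by simp
 let ?b = "%y. 2 / D ^ k * (exp ((a+D) * y - (D*y)\<^sup>2/4) + exp (-(a+D) * y - (D*y)\<^sup>2/4))"
 have bi: "integrable lborel ?b" by (intro integrable_mult_right Bochner_Integration.integrable_add gauss_lin(1) D0)
 have bnd: "\<bar>y\<bar> ^ k * exp (a * \<bar>y\<bar>) * exp (- (D*y)\<^sup>2/4) <= ?b y" for y
 proof -
  define x where "x = D * \<bar>y\<bar>"
  have x: "x >= 0" using D0 by (simp add: x_def)
  have "x ^ k <= 2 * exp x"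
  proof -
   consider "k = 0" | "k = 1" | "k = 2" using k by linarith
   then show ?thesis
   proof cases
    case 1 then show ?thesis using x by (simp add: order_trans[of _ "exp x"])
   next
    case 2
    have "x <= 2 * exp x" using exp_ge_add_one_self[of x] exp_gt_zero[of x] by linarith
    then show ?thesis using 2 by simp
   next
    case 3 then show ?thesis using exp_lower_Taylor_quadratic[OF x] x by simp
   qed
  qed
  then have "\<bar>y\<bar> ^ k <= 2 / D ^ k * exp (D * \<bar>y\<bar>)"
   using D0 by (simp add: x_def power_mult_distrib field_simps)
  then have "\<bar>y\<bar> ^ k * exp (a * \<bar>y\<bar>) <= 2 / D ^ k * exp (D * \<bar>y\<bar>) * exp (a * \<bar>y\<bar>)" by (intro mult_right_mono) auto
  also have "... = 2 / D ^ k * exp ((a+D) * \<bar>y\<bar>)" by (simp add: exp_add[symmetric] algebra_simps)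
  also have "... <= 2 / D ^ k * (exp ((a+D) * y) + exp (-(a+D) * y))"
  proof (intro mult_left_mono)
   show "exp ((a+D) * \<bar>y\<bar>) <= exp ((a+D) * y) + exp (-(a+D) * y)"
   proof (cases "y >= 0")
    case False
    then have "(a+D) * \<bar>y\<bar> = -(a+D) * y" by (simp add: abs_if algebra_simps)
    then show ?thesis using exp_gt_zero[of "(a+D) * y"] by (simp only:)
   qed simp
  qed (use D0 in simp)
  finally have "\<bar>y\<bar> ^ k * exp (a * \<bar>y\<bar>) * exp (- (D*y)\<^sup>2/4) <= 2 / D ^ k * (exp ((a+D) * y) + exp (-(a+D) * y)) * exp (- (D*y)\<^sup>2/4)"
   by (intro mult_right_mono) auto
  also have "... = ?b y"
  proof -
   have e: "exp (c - q/4) = exp c * exp (- q/4)" for c q :: real by (simp add: exp_add[symmetric])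
   show ?thesis by (simp only: e distrib_right mult.assoc)
  qed
  finally show ?thesis .
 qed
 show i: "integrable lborel (%y::real. \<bar>y\<bar> ^ k * exp (a * \<bar>y\<bar>) * exp (- (D*y)\<^sup>2/4))"
 proof (rule bint_dominated[OF bi])
  show "AE y in lborel. norm (\<bar>y\<bar> ^ k * exp (a * \<bar>y\<bar>) * exp (- (D*y)\<^sup>2/4)) <= norm (?b y)"
  proof (rule AE_I2)
   fix y :: real
   have "\<bar>y\<bar> ^ k * exp (a * \<bar>y\<bar>) * exp (- (D*y)\<^sup>2/4) >= 0" by simp
   then show "norm (\<bar>y\<bar> ^ k * exp (a * \<bar>y\<bar>) * exp (- (D*y)\<^sup>2/4)) <= norm (?b y)"
    unfolding real_norm_def using bnd[of y] by linarith
  qed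
 qed measurable
 have "(\<integral>y. \<bar>y\<bar> ^ k * exp (a * \<bar>y\<bar>) * exp (- (D*y)\<^sup>2/4) \<partial>lborel) <= (\<integral>y. ?b y \<partial>lborel)"
  by (rule integral_mono[OF i bi bnd])
 also have "... = 2 / D ^ k * (exp (((a+D)/D)\<^sup>2) * sqrt pi * (2/D) + exp ((-(a+D)/D)\<^sup>2) * sqrt pi * (2/D))"
  by (subst integral_mult_right_zero, subst Bochner_Integration.integral_add[OF gauss_lin(1)[OF D0] gauss_lin(1)[OF D0]]) (simp only: gauss_lin(2)[OF D0])
 also have "(-(a+D)/D)\<^sup>2 = ((a+D)/D)\<^sup>2" by (simp add: power_divide power2_eq_square algebra_simps)
 also have "2 / D ^ k * (exp (((a+D)/D)\<^sup>2) * sqrt pi * (2/D) + exp (((a+D)/D)\<^sup>2) * sqrt pi * (2/D)) = 8 * sqrt pi / D ^ (k+1) * exp (((a+D)/D)\<^sup>2)"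
  using D0 by (simp add: field_simps)
 also have "... <= 8 * sqrt pi / D ^ (k+1) * exp ((a+1)\<^sup>2)"
 proof -
  have "(a+D)/D = a/D + 1" using D0 by (simp add: add_divide_distrib)
  also have "a / D <= a / 1" using a D by (intro divide_left_mono) auto
  finally have "((a+D)/D)\<^sup>2 <= (a+1)\<^sup>2" using a D0 by (intro power_mono) auto
  then show ?thesis using D0 by (intro mult_left_mono) auto
 qed
 finally show "(\<integral>y. \<bar>y\<bar> ^ k * exp (a * \<bar>y\<bar>) * exp (- (D*y)\<^sup>2/4) \<partial>lborel) <= 8 * sqrt pi * exp ((a+1)\<^sup>2) / D ^ (k+1)"
  by simp
qed

lemma Pm_bound:
 "\<exists>K\<ge>0. \<forall>u r. 0 < r & r <= 1 & r <= Re u --> norm (Pm u) <= K * r powr (-3/2)"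
proof -
 let ?K = "2 * Gamma (3/2) + 2 * Gamma (1/2) + 2 * Gamma (1::real)"
 show ?thesis
 proof (intro exI[of _ ?K] conjI allI impI, goal_cases)
  case 1 show ?case by (intro add_nonneg_nonneg mult_nonneg_nonneg Gamma_real_nonneg) auto
 next
  case (2 u r)
  then have r: "0 < r" "r <= 1" "r <= Re u" and u: "Re u > 0" by auto
  let ?b = "%x. 2 * (x powr (3/2 - 1) * exp (- r * x)) + 2 * (x powr (1/2 - 1) * exp (- r * x)) + 2 * (x powr (1 - 1) * exp (- r * x))"
  have ib: "set_integrable lborel {0<..} ?b"
   by (intro set_integrable_mult_right set_integral_add(1) powr_exp_integral(1) r) auto
  have "norm (Pm u) <= (LINT x:{0<..}|lborel. ?b x)"
   unfolding Pm_def set_lebesgue_integral_def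
  proof (rule bint_norm_bound)
   show "integrable lborel (%x. indicator {0<..} x *\<^sub>R (of_real (ln x + 2 * euler_mascheroni) * exp (- u * of_real x) :: complex))"
    using Laplace_integrable(2)[OF u] unfolding set_integrable_def .
   show "integrable lborel (%x. indicat_real {0<..} x *\<^sub>R ?b x)" using ib unfolding set_integrable_def .
   show "norm (indicator {0<..} x *\<^sub>R (of_real (ln x + 2 * euler_mascheroni) * exp (- u * of_real x) :: complex)) <= indicat_real {0<..} x *\<^sub>R ?b x" for x :: real
   proof (cases "x > 0")
    case True
    have "norm (of_real (ln x + 2 * euler_mascheroni) * exp (- u * of_real x) :: complex) = \<bar>ln x + 2 * euler_mascheroni\<bar> * exp (- Re u * x)"
     by (simp only: norm_mult norm_of_real) simp
    also have "... <= (2 * x powr (1/2) + 2 * x powr (-1/2) + 2 * x powr 0) * exp (- r * x)"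
     using True r by (intro mult_mono ln_exp_bound) auto
    also have "... = ?b x" by (simp add: algebra_simps)
    finally show ?thesis using True by simp
   qed simp
  qed
  also have "(LINT x:{0<..}|lborel. ?b x) = 2 * (Gamma (3/2) * r powr (-3/2)) + 2 * (Gamma (1/2) * r powr (-1/2)) + 2 * (Gamma 1 * r powr (-1))"
  proof -
   have i: "set_integrable lborel {0<..} (%x. 2 * (x powr (a - 1) * exp (- r * x)))" if "a > 0" for a
    by (intro set_integrable_mult_right powr_exp_integral(1) r that)
   have e: "(LINT x:{0<..}|lborel. 2 * (x powr (a - 1) * exp (- r * x))) = 2 * (Gamma a * r powr (-a))" if "a > 0" for a
    using powr_exp_integral(2)[OF that r(1)] by simp
   show ?thesis
    using set_integral_add(2)[OF set_integral_add(1)[OF i[of "3/2"] i[of "1/2"]] i[of 1]] set_integral_add(2)[OF i[of "3/2"] i[of "1/2"]]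
     e[of "3/2"] e[of "1/2"] e[of 1] by simp
  qed
  also have "... <= 2 * (Gamma (3/2) * r powr (-3/2)) + 2 * (Gamma (1/2) * r powr (-3/2)) + 2 * (Gamma 1 * r powr (-3/2))"
   using r by (intro add_mono mult_left_mono Gamma_real_nonneg powr_mono') auto
  also have "... = ?K * r powr (-3/2)" by (simp add: algebra_simps)
  finally show ?case .
 qed
qed

text \<open>The exponents \<open>pm k\<close> are integers. This moves the argument from the
  neighbourhood of 2 pi i, where the Mellin integral puts it, to the neighbourhood of 0, where
  \<open>Pm\<close> approximates the series.\<close>

lemma Sd_periodic: "Sd (u + 2 * of_real pi * \<i>) = Sd u"
proof -
 have "exp (- of_real (pm k) * (u + 2 * of_real pi * \<i>)) = exp (- of_real (pm k) * u)" for k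
 proof -
  have 1: "pm k = real (Suc (fst (prod_decode k)) * Suc (snd (prod_decode k)))" unfolding pm_def by (simp only: of_nat_mult)
  have 2: "exp (- (of_real (pm k) * (2 * of_real pi * \<i>))) = 1"
   unfolding exp_minus 1 using exp_of_nat_mult[of "Suc (fst (prod_decode k)) * Suc (snd (prod_decode k))" "2 * of_real pi * \<i>"] by (simp del: of_nat_mult of_nat_Suc)
  have "- of_real (pm k) * (u + 2 * of_real pi * \<i>) = - of_real (pm k) * u + - (of_real (pm k) * (2 * of_real pi * \<i>))"
   by (simp add: distrib_left)
  then show ?thesis by (simp only: exp_add 2 mult_1_right)
 qed
 then show ?thesis unfolding Sd_def by simp
qed

lemma
 fixes z :: complex
 shows norm_exp_minus_one_le: "norm (exp z - 1) <= norm z * exp (norm z)"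
 and norm_exp_minus_one_diff_le: "norm (exp z - 1 - z) <= (norm z)\<^sup>2 * exp (norm z)"
proof -
 have A: "norm (exp z - 1) <= norm z * exp (norm z)" for z :: complex
 proof -
  have "norm (exp z - exp 0) <= exp (norm z) * norm (z - 0)"
  proof (rule field_differentiable_bound[of "cball 0 (norm z)"])
   show "(exp has_field_derivative exp x) (at x within cball 0 (norm z))" for x :: complex
    by (rule DERIV_exp[THEN has_field_derivative_at_within])
   show "norm (exp x) <= exp (norm z)" if "x \<in> cball 0 (norm z)" for x :: complex
    using that complex_Re_le_cmod[of x] by simp
  qed auto
  then show ?thesis by (simp add: mult.commute)
 qed
 show "norm (exp z - 1) <= norm z * exp (norm z)" by (rule A)
 have "norm ((exp z - z) - (exp 0 - 0)) <= (norm z * exp (norm z)) * norm (z - 0)"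
 proof (rule field_differentiable_bound[of "cball 0 (norm z)"])
  show "((%z. exp z - z) has_field_derivative exp x - 1) (at x within cball 0 (norm z))" for x :: complex
   by (auto intro!: derivative_eq_intros)
  show "norm (exp x - 1) <= norm z * exp (norm z)" if "x \<in> cball 0 (norm z)" for x :: complex
  proof -
   have "norm x * exp (norm x) <= norm z * exp (norm z)" using that by (intro mult_mono) auto
   then show ?thesis using A[of x] by simp
  qed
 qed auto
 then show "norm (exp z - 1 - z) <= (norm z)\<^sup>2 * exp (norm z)" by (simp add: power2_eq_square algebra_simps)
qed

text \<open>With z = y - 2 i de the argument is 2 pi i exp z. Periodicity reduces it to u = 2 pi i
  (exp z - 1), whose linear part u0 = 2 pi i z has real part 4 pi de and imaginary part 2 pi y. The
  error consists of the divisor error at u, the change from u to u0 in \<open>Pm\<close>, and the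
  replacement of exp (y/2) by 1.\<close>

lemma main_pointwise:
 "\<exists>C\<ge>0. \<forall>de y. 0 < de & de < 1/16 -->
   norm (Sd (wd de * of_real (exp y)) * of_real (exp (y/2)) - Pm (Complex (4*pi*de) (2*pi*y)))
   <= C * exp (5 * \<bar>y\<bar>) * (de powr (-3/2) * (\<bar>y\<bar> + de) + de powr (-5/2) * (\<bar>y\<bar>\<^sup>2 + de\<^sup>2))"
proof -
 obtain C1 where C1: "C1 >= 0" "!!u. Re u > 0 ==> norm (Sd u - Pm u) <= C1 * norm u * Re u powr (-3/2)" using Sd_Pm_bound by blast
 obtain K where K: "K >= 0" "!!u v r. 0 < r ==> r <= 1 ==> r <= Re u ==> r <= Re v ==> norm (Pm u - Pm v) <= K * norm (u - v) * r powr (-5/2)" using Pm_Lipschitz by blast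
 obtain K2 where K2: "K2 >= 0" "!!u r. 0 < r ==> r <= 1 ==> r <= Re u ==> norm (Pm u) <= K2 * r powr (-3/2)" using Pm_bound by blast
 define C where "C = C1 * (2 * pi * 2 * exp 1) + K * (2 * pi * 8 * exp 1) + K2"
 show ?thesis
 proof (intro exI[of _ C] conjI allI impI)
  show "C >= 0" unfolding C_def using C1 K K2 by (intro add_nonneg_nonneg mult_nonneg_nonneg) auto
  fix de y :: real assume "0 < de & de < 1/16"
  then have d: "0 < de" "de < 1/16" by auto
  define a where "a = \<bar>y\<bar>"
  have a0: "a >= 0" by (simp add: a_def)
  define z where "z = Complex y (- 2 * de)"
  define u where "u = 2 * of_real pi * \<i> * (exp z - 1)"
  define u0 where "u0 = 2 * of_real pi * \<i> * z"
  \<comment> \<open>A common lower bound for Re u and Re u0. The factor exp (-a) allows for negative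
    y; its negative powers are collected in exp (5 a), which the Gaussian absorbs.\<close>
  define r where "r = de * exp (- a)"
  have wd: "wd de * of_real (exp y) = u + 2 * of_real pi * \<i>"
  proof -
   have "exp z = exp (- (\<i> * of_real (2 * de))) * of_real (exp y)"
    unfolding exp_of_real[symmetric] exp_add[symmetric] by (rule arg_cong[of _ _ exp]) (simp add: z_def complex_eq_iff)
   then show ?thesis unfolding wd_eq u_def by (simp add: algebra_simps)
  qed
  have Sd: "Sd (wd de * of_real (exp y)) = Sd u" unfolding wd by (rule Sd_periodic)
  have u0': "Complex (4*pi*de) (2*pi*y) = u0" by (simp add: u0_def z_def complex_eq_iff)
  have r: "0 < r" "r <= 1" using d a0 unfolding r_def by (auto intro!: mult_le_one)
  have Reu: "Re u = 2 * pi * exp y * sin (2*de)"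
   unfolding u_def z_def by (simp add: Re_exp Im_exp)
  have sn: "sin (2 * de) >= de"
  proof -
   have "sin 0 - 0/2 <= sin (2*de) - (2*de)/2"
   proof (rule DERIV_nonneg_imp_nondecreasing[of 0 "2*de" "%x. sin x - x/2"])
    show "0 <= 2 * de" using d by simp
    fix x :: real assume x: "0 <= x" "x <= 2 * de"
    have "cos (pi/3) <= cos x" using x d pi_gt3 by (intro cos_monotone_0_pi_le) auto
    then have "cos x - 1/2 >= 0" by (simp add: cos_60)
    moreover have "((%x. sin x - x/2) has_real_derivative (cos x - 1/2)) (at x)"
     by (auto intro!: derivative_eq_intros)
    ultimately show "\<exists>y. ((%x. sin x - x/2) has_real_derivative y) (at x) & 0 <= y" by blast
   qed
   then show ?thesis by simp
  qed
  have ey: "exp (- a) <= exp y" by (simp add: a_def)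
  have Reu_r: "r <= Re u"
  proof -
   have "r = exp (- a) * de" by (simp add: r_def)
   also have "... <= exp y * sin (2*de)" using ey sn d by (intro mult_mono) auto
   also have "... <= (2 * pi) * (exp y * sin (2*de))" using sn d pi_gt3 mult_right_mono[of 1 "2*pi" "exp y * sin (2*de)"] by simp
   finally show ?thesis by (simp add: Reu mult.assoc)
  qed
  have Reu0_r: "r <= Re u0"
  proof -
   have "r <= de * 1" unfolding r_def using d a0 by (intro mult_left_mono) auto
   also have "... <= de * (4 * pi)" using d pi_gt3 by (intro mult_left_mono) auto
   finally show ?thesis unfolding u0'[symmetric] by (simp add: mult.commute)
  qed
  have nz: "norm z <= a + 2 * de" using cmod_le[of z] d by (simp add: z_def a_def)
  have enz: "exp (norm z) <= exp 1 * exp a" using nz d by (simp add: exp_add[symmetric])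
  have nu: "norm u <= 2 * pi * 2 * exp 1 * (a + de) * exp a"
  proof -
   have "norm u = 2 * pi * norm (exp z - 1)" by (simp add: u_def norm_mult)
   also have "... <= 2 * pi * (norm z * exp (norm z))" by (intro mult_left_mono norm_exp_minus_one_le) auto
   also have "... <= 2 * pi * ((2 * (a + de)) * (exp 1 * exp a))" using nz enz d a0 by (intro mult_left_mono mult_mono) auto
   finally show ?thesis by (simp add: mult_ac)
  qed
  have nd: "norm (u - u0) <= 2 * pi * 8 * exp 1 * (a\<^sup>2 + de\<^sup>2) * exp a"
  proof -
   have "u - u0 = 2 * of_real pi * \<i> * (exp z - 1 - z)" by (simp add: u_def u0_def algebra_simps)
   then have "norm (u - u0) = 2 * pi * norm (exp z - 1 - z)" by (simp add: norm_mult)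
   also have "... <= 2 * pi * ((norm z)\<^sup>2 * exp (norm z))" by (intro mult_left_mono norm_exp_minus_one_diff_le) auto
   also have "... <= 2 * pi * ((8 * (a\<^sup>2 + de\<^sup>2)) * (exp 1 * exp a))"
   proof (intro mult_left_mono mult_mono enz)
    have "(norm z)\<^sup>2 <= (a + 2 * de)\<^sup>2" using nz by (intro power_mono) auto
    also have "... = 2 * a\<^sup>2 + 8 * de\<^sup>2 - (a - 2 * de)\<^sup>2" by (simp add: power2_eq_square algebra_simps)
    also have "... <= 8 * (a\<^sup>2 + de\<^sup>2)"
    proof -
     have gen: "2 * A + 8 * B - X <= 8 * (A + B)" if "A >= 0" "X >= 0" for A B X :: real using that by simp
     show ?thesis by (rule gen) simp_all
    qed
    finally show "(norm z)\<^sup>2 <= 8 * (a\<^sup>2 + de\<^sup>2)" .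
   qed auto
   finally show ?thesis by (simp add: mult_ac)
  qed
  have rp: "r powr (-q) = de powr (-q) * exp (q * a)" for q
   unfolding r_def using d by (simp add: powr_mult) (simp add: powr_def)
  have eh: "exp (y/2) <= exp (a/2)" by (simp add: a_def)
  have t1: "norm (Sd u - Pm u) * exp (y/2) <= C1 * (2 * pi * 2 * exp 1) * exp (5*a) * (de powr (-3/2) * (a + de))"
  proof -
   have "norm (Sd u - Pm u) <= C1 * norm u * Re u powr (-3/2)" using Reu_r r by (intro C1) auto
   also have "... <= C1 * (2 * pi * 2 * exp 1 * (a + de) * exp a) * r powr (-3/2)"
    using C1(1) nu Reu_r r a0 d by (intro mult_mono powr_mono2') auto
   finally have "norm (Sd u - Pm u) * exp (y/2) <= C1 * (2 * pi * 2 * exp 1 * (a + de) * exp a) * r powr (-3/2) * exp (a/2)"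
    using eh C1 a0 d by (intro mult_mono) auto
   also have "... = C1 * (2 * pi * 2 * exp 1) * (exp a * exp (3/2 * a) * exp (a/2)) * (de powr (-3/2) * (a + de))"
    using rp[of "3/2"] by simp
   also have "exp a * exp (3/2 * a) * exp (a/2) = exp (3 * a)" by (simp add: exp_add[symmetric])
   also have "C1 * (2 * pi * 2 * exp 1) * exp (3 * a) * (de powr (-3/2) * (a + de)) <= C1 * (2 * pi * 2 * exp 1) * exp (5 * a) * (de powr (-3/2) * (a + de))"
    using C1 a0 d by (intro mult_right_mono mult_left_mono) auto
   finally show ?thesis .
  qed
  have t2: "norm (Pm u - Pm u0) * exp (y/2) <= K * (2 * pi * 8 * exp 1) * exp (5*a) * (de powr (-5/2) * (a\<^sup>2 + de\<^sup>2))"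
  proof -
   have "norm (Pm u - Pm u0) <= K * norm (u - u0) * r powr (-5/2)" by (rule K(2)[OF r Reu_r Reu0_r])
   also have "... <= K * (2 * pi * 8 * exp 1 * (a\<^sup>2 + de\<^sup>2) * exp a) * r powr (-5/2)"
    using K nd by (intro mult_right_mono mult_left_mono) auto
   finally have "norm (Pm u - Pm u0) * exp (y/2) <= K * (2 * pi * 8 * exp 1 * (a\<^sup>2 + de\<^sup>2) * exp a) * r powr (-5/2) * exp (a/2)"
    using eh K a0 d by (intro mult_mono) auto
   also have "... = K * (2 * pi * 8 * exp 1) * (exp a * exp (5/2 * a) * exp (a/2)) * (de powr (-5/2) * (a\<^sup>2 + de\<^sup>2))"
    using rp[of "5/2"] by simp
   also have "exp a * exp (5/2 * a) * exp (a/2) = exp (4 * a)" by (simp add: exp_add[symmetric])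
   also have "K * (2 * pi * 8 * exp 1) * exp (4 * a) * (de powr (-5/2) * (a\<^sup>2 + de\<^sup>2)) <= K * (2 * pi * 8 * exp 1) * exp (5 * a) * (de powr (-5/2) * (a\<^sup>2 + de\<^sup>2))"
    using K a0 by (intro mult_right_mono mult_left_mono) auto
   finally show ?thesis .
  qed
  have t3: "norm (Pm u0) * \<bar>exp (y/2) - 1\<bar> <= K2 * exp (5*a) * (de powr (-3/2) * (a + de))"
  proof -
   have "de <= Re u0" unfolding u0'[symmetric] using d pi_gt3 mult_right_mono[of 1 "4*pi" de] by simp
   then have 1: "norm (Pm u0) <= K2 * de powr (-3/2)" using d by (intro K2) auto
   have "norm (exp (of_real (y/2)) - 1 :: complex) <= norm (of_real (y/2) :: complex) * exp (norm (of_real (y/2) :: complex))"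
    by (rule norm_exp_minus_one_le)
   moreover have "exp (of_real (y/2)) - 1 = complex_of_real (exp (y/2) - 1)" by (simp only: of_real_diff of_real_1 exp_of_real)
   ultimately have "\<bar>exp (y/2) - 1\<bar> <= a/2 * exp (a/2)" unfolding a_def by (simp only: norm_of_real) simp
   also have "... <= (a + de) * exp (5*a)" using a0 d by (intro mult_mono) auto
   finally have "\<bar>exp (y/2) - 1\<bar> <= (a + de) * exp (5*a)" .
   with 1 have "norm (Pm u0) * \<bar>exp (y/2) - 1\<bar> <= (K2 * de powr (-3/2)) * ((a + de) * exp (5*a))"
    using K2 by (intro mult_mono) auto
   then show ?thesis by (simp add: mult_ac)
  qed
  have "Sd u * of_real (exp (y/2)) - Pm u0 = (Sd u - Pm u) * of_real (exp (y/2)) + (Pm u - Pm u0) * of_real (exp (y/2)) + Pm u0 * of_real (exp (y/2) - 1)"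
   by (simp add: algebra_simps)
  then have "norm (Sd u * of_real (exp (y/2)) - Pm u0) <= norm ((Sd u - Pm u) * of_real (exp (y/2))) + norm ((Pm u - Pm u0) * of_real (exp (y/2))) + norm (Pm u0 * of_real (exp (y/2) - 1))"
   using norm_triangle_le[OF add_right_mono[OF norm_triangle_ineq]] by (metis order_refl)
  also have "... = norm (Sd u - Pm u) * exp (y/2) + norm (Pm u - Pm u0) * exp (y/2) + norm (Pm u0) * \<bar>exp (y/2) - 1\<bar>"
   by (simp only: norm_mult norm_of_real) simp
  also have "... <= C1 * (2 * pi * 2 * exp 1) * exp (5*a) * (de powr (-3/2) * (a + de)) + K * (2 * pi * 8 * exp 1) * exp (5*a) * (de powr (-5/2) * (a\<^sup>2 + de\<^sup>2)) + K2 * exp (5*a) * (de powr (-3/2) * (a + de))"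
   by (intro add_mono t1 t2 t3)
  also have "... <= C * exp (5*a) * (de powr (-3/2) * (a + de) + de powr (-5/2) * (a\<^sup>2 + de\<^sup>2))"
  proof -
   define X where "X = exp (5*a) * (de powr (-3/2) * (a + de))"
   define Y where "Y = exp (5*a) * (de powr (-5/2) * (a\<^sup>2 + de\<^sup>2))"
   define p where "p = C1 * (2 * pi * 2 * exp 1)"
   define q where "q = K * (2 * pi * 8 * exp 1)"
   have nn: "X >= 0" "Y >= 0" "p >= 0" "q >= 0" using a0 d C1 K by (auto simp: X_def Y_def p_def q_def)
   have "p * X + q * Y + K2 * X <= (p + q + K2) * (X + Y)" using nn K2 by (simp add: algebra_simps)
   then show ?thesis unfolding C_def p_def[symmetric] q_def[symmetric] X_def Y_def by (simp add: mult.assoc distrib_left)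
  qed
  finally show "norm (Sd (wd de * of_real (exp y)) * of_real (exp (y/2)) - Pm (Complex (4*pi*de) (2*pi*y)))
   <= C * exp (5 * \<bar>y\<bar>) * (de powr (-3/2) * (\<bar>y\<bar> + de) + de powr (-5/2) * (\<bar>y\<bar>\<^sup>2 + de\<^sup>2))"
   unfolding Sd u0' a_def .
 qed
qed


section \<open>The main term as a Gaussian average of a logarithm\<close>

lemma Pm_line_cont:
 assumes d: "0 < de" "de < 1/16"
 shows "continuous_on UNIV (%y. Pm (Complex (4*pi*de) (2*pi*y)))"
proof -
 obtain K where K: "K >= 0" "!!u v r. 0 < r ==> r <= 1 ==> r <= Re u ==> r <= Re v ==> norm (Pm u - Pm v) <= K * norm (u - v) * r powr (-5/2)" using Pm_Lipschitz by blast
 have le: "de <= 4*pi*de" using d pi_gt3 mult_right_mono[of 1 "4*pi" de] by simp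
 have "(K * (2*pi) * de powr (-5/2))-lipschitz_on UNIV (%y. Pm (Complex (4*pi*de) (2*pi*y)))"
 proof (rule lipschitz_onI)
  fix x y :: real
  have "norm (Pm (Complex (4*pi*de) (2*pi*x)) - Pm (Complex (4*pi*de) (2*pi*y))) <= K * norm (Complex (4*pi*de) (2*pi*x) - Complex (4*pi*de) (2*pi*y)) * de powr (-5/2)"
   using d le by (intro K) auto
  also have "norm (Complex (4*pi*de) (2*pi*x) - Complex (4*pi*de) (2*pi*y)) = 2*pi * \<bar>x - y\<bar>"
   by (simp add: cmod_def right_diff_distrib[symmetric] abs_mult)
  finally show "dist (Pm (Complex (4*pi*de) (2*pi*x))) (Pm (Complex (4*pi*de) (2*pi*y))) <= K * (2*pi) * de powr (-5/2) * dist x y"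
   by (simp add: dist_norm mult_ac)
 qed (use K in simp)
 then show ?thesis by (rule lipschitz_on_continuous_on)
qed

text \<open>The crude size de^(-3/2) / D suffices, because this integral enters the error only
  multiplied by de, when the constant phase exp (i de) is removed.\<close>

lemma Pm_line_integrable:
 "\<exists>C\<ge>0. \<forall>de D ta. 0 < de & de < 1/16 & D >= 1 -->
  integrable lborel (%y. Pm (Complex (4*pi*de) (2*pi*y)) * exp (\<i> * of_real (ta * y) - of_real ((D*y)\<^sup>2/4))) \<and>
  norm (\<integral>y. Pm (Complex (4*pi*de) (2*pi*y)) * exp (\<i> * of_real (ta * y) - of_real ((D*y)\<^sup>2/4)) \<partial>lborel) <= C * de powr (-3/2) / D"
proof -
 obtain K where K: "K >= 0" "!!u r. 0 < r ==> r <= 1 ==> r <= Re u ==> norm (Pm u) <= K * r powr (-3/2)" using Pm_bound by blast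
 show ?thesis
 proof (intro exI[of _ "K * (8 * sqrt pi * exp 1)"] conjI allI impI)
  show "K * (8 * sqrt pi * exp 1) >= 0" using K by simp
  fix de D ta :: real assume "0 < de & de < 1/16 & D >= 1"
  then have d: "0 < de" "de < 1/16" and D: "D >= 1" by auto
  let ?f = "%y. Pm (Complex (4*pi*de) (2*pi*y)) * exp (\<i> * of_real (ta * y) - of_real ((D*y)\<^sup>2/4))"
  let ?b = "%y. K * de powr (-3/2) * (\<bar>y\<bar> ^ 0 * exp (0 * \<bar>y\<bar>) * exp (- (D*y)\<^sup>2/4))"
  have bi: "integrable lborel ?b" by (intro integrable_mult_right gauss_moment(1) D) auto
  have le: "de <= 4*pi*de" using d pi_gt3 mult_right_mono[of 1 "4*pi" de] by simp
  have bnd: "norm (?f y) <= ?b y" for y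
  proof -
   have "norm (Pm (Complex (4*pi*de) (2*pi*y))) <= K * de powr (-3/2)" using d le by (intro K) auto
   moreover have "norm (exp (\<i> * of_real (ta * y) - of_real ((D*y)\<^sup>2/4))) = exp (- (D*y)\<^sup>2/4)" by simp
   ultimately have "norm (?f y) <= K * de powr (-3/2) * exp (- (D*y)\<^sup>2/4)" unfolding norm_mult by (intro mult_mono) (use K in auto)
   then show ?thesis by simp
  qed
  have m: "?f \<in> borel_measurable borel"
   by (intro borel_measurable_times borel_measurable_continuous_onI[OF Pm_line_cont[OF d]]) measurable
  show i: "integrable lborel ?f"
  proof (rule bint_dominated[OF bi])
   show "AE y in lborel. norm (?f y) <= norm (?b y)" by (intro AE_I2 order_trans[OF bnd]) simp
  qed (use m in simp)
  have "norm (\<integral>y. ?f y \<partial>lborel) <= (\<integral>y. ?b y \<partial>lborel)"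
   by (rule bint_norm_bound[OF i bi bnd])
  also have "... = K * de powr (-3/2) * (\<integral>y. \<bar>y\<bar> ^ 0 * exp (0 * \<bar>y\<bar>) * exp (- (D*y)\<^sup>2/4) \<partial>lborel)"
   by (rule integral_mult_right_zero)
  also have "... <= K * de powr (-3/2) * (8 * sqrt pi * exp ((0+1)\<^sup>2) / D ^ (0+1))"
   using K by (intro mult_left_mono gauss_moment(2) D) auto
  finally show "norm (\<integral>y. ?f y \<partial>lborel) <= K * (8 * sqrt pi * exp 1) * de powr (-3/2) / D" by (simp add: mult_ac)
 qed
qed

text \<open>\<open>main_pointwise\<close> integrated against exp (-(D y)^2 / 4), under which |y|^k
  contributes D^(-k-1). The powers of de and D are kept separate until their sizes are
  chosen.\<close>

lemma Sd_integral_approx: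
 "\<exists>C\<ge>0. \<forall>de D ta. 0 < de & de < 1/16 & D >= 1 -->
  norm ((\<integral>y. Sd (wd de * of_real (exp y)) * exp (Complex (1/2) ta * of_real y - of_real ((D*y)\<^sup>2/4)) \<partial>lborel)
    - (\<integral>y. Pm (Complex (4*pi*de) (2*pi*y)) * exp (\<i> * of_real (ta * y) - of_real ((D*y)\<^sup>2/4)) \<partial>lborel))
   <= C * (de powr (-3/2) * (1/D^2 + de/D) + de powr (-5/2) * (1/D^3 + de\<^sup>2/D))"
proof -
 obtain C where C: "C >= 0" "!!de y. 0 < de ==> de < 1/16 ==>
   norm (Sd (wd de * of_real (exp y)) * of_real (exp (y/2)) - Pm (Complex (4*pi*de) (2*pi*y)))
   <= C * exp (5 * \<bar>y\<bar>) * (de powr (-3/2) * (\<bar>y\<bar> + de) + de powr (-5/2) * (\<bar>y\<bar>\<^sup>2 + de\<^sup>2))"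
  using main_pointwise by blast
 define M where "M = 8 * sqrt pi * exp ((5+1)\<^sup>2)"
 have M: "M >= 0" by (simp add: M_def)
 show ?thesis
 proof (intro exI[of _ "C * M"] conjI allI impI)
  show "C * M >= 0" using C M by simp
  fix de D ta :: real assume "0 < de & de < 1/16 & D >= 1"
  then have d: "0 < de" "de < 1/16" and D: "D >= 1" by auto
  have D0: "D > 0" using D by simp
  let ?f = "%y. Sd (wd de * of_real (exp y)) * exp (Complex (1/2) ta * of_real y - of_real ((D*y)\<^sup>2/4))"
  let ?g = "%y. Pm (Complex (4*pi*de) (2*pi*y)) * exp (\<i> * of_real (ta * y) - of_real ((D*y)\<^sup>2/4))"
  have fi: "integrable lborel ?f" using d D0 by (intro hh_line_2(2)) auto
  have gi: "integrable lborel ?g" using Pm_line_integrable d D by blast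
  let ?m = "%k y. \<bar>y\<bar> ^ k * exp (5 * \<bar>y\<bar>) * exp (- (D*y)\<^sup>2/4)"
  let ?p = "de powr (-3/2)" and ?q = "de powr (-5/2)"
  let ?b = "%y. C * ((?p * ?m 1 y + ?p * de * ?m 0 y) + (?q * ?m 2 y + ?q * de\<^sup>2 * ?m 0 y))"
  have mi: "integrable lborel (?m k)" if "k <= 2" for k by (intro gauss_moment(1) D that) auto
  have ml: "(\<integral>y. ?m k y \<partial>lborel) <= M / D ^ (k+1)" if "k <= 2" for k unfolding M_def by (intro gauss_moment(2) D that) auto
  have i1: "integrable lborel (%y. ?p * ?m 1 y + ?p * de * ?m 0 y)" "integrable lborel (%y. ?q * ?m 2 y + ?q * de\<^sup>2 * ?m 0 y)"
   by (intro Bochner_Integration.integrable_add integrable_mult_right mi; simp)+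
  have bi: "integrable lborel ?b" by (intro integrable_mult_right Bochner_Integration.integrable_add[OF i1])
  have bnd: "norm (?f y - ?g y) <= ?b y" for y
  proof -
   have e1: "exp (Complex (1/2) ta * of_real y - of_real ((D*y)\<^sup>2/4)) = of_real (exp (y/2)) * exp (\<i> * of_real (ta * y) - of_real ((D*y)\<^sup>2/4))"
    unfolding exp_of_real[symmetric] exp_add[symmetric] by (rule arg_cong[of _ _ exp]) (simp add: complex_eq_iff)
   have "?f y - ?g y = (Sd (wd de * of_real (exp y)) * of_real (exp (y/2)) - Pm (Complex (4*pi*de) (2*pi*y))) * exp (\<i> * of_real (ta * y) - of_real ((D*y)\<^sup>2/4))"
    unfolding e1 by (simp only: left_diff_distrib mult.assoc)
   moreover have "norm (exp (\<i> * of_real (ta * y) - of_real ((D*y)\<^sup>2/4))) = exp (- (D*y)\<^sup>2/4)" by simp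
   ultimately have "norm (?f y - ?g y) = norm (Sd (wd de * of_real (exp y)) * of_real (exp (y/2)) - Pm (Complex (4*pi*de) (2*pi*y))) * exp (- (D*y)\<^sup>2/4)"
    by (simp only: norm_mult)
   also have "... <= (C * exp (5 * \<bar>y\<bar>) * (?p * (\<bar>y\<bar> + de) + ?q * (\<bar>y\<bar>\<^sup>2 + de\<^sup>2))) * exp (- (D*y)\<^sup>2/4)"
    by (intro mult_right_mono C(2) d) auto
   also have "... = ?b y" by (simp add: algebra_simps)
   finally show ?thesis .
  qed
  have "norm ((\<integral>y. ?f y \<partial>lborel) - (\<integral>y. ?g y \<partial>lborel)) = norm (\<integral>y. ?f y - ?g y \<partial>lborel)"
   by (subst Bochner_Integration.integral_diff[OF fi gi]) simp
  also have "... <= (\<integral>y. ?b y \<partial>lborel)"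
   by (rule bint_norm_bound[OF Bochner_Integration.integrable_diff[OF fi gi] bi bnd])
  also have "... = C * ((?p * (\<integral>y. ?m 1 y \<partial>lborel) + ?p * de * (\<integral>y. ?m 0 y \<partial>lborel)) + (?q * (\<integral>y. ?m 2 y \<partial>lborel) + ?q * de\<^sup>2 * (\<integral>y. ?m 0 y \<partial>lborel)))"
   unfolding integral_mult_right_zero
   by (subst Bochner_Integration.integral_add[OF i1], subst Bochner_Integration.integral_add, (intro integrable_mult_right mi; simp)+,
     subst Bochner_Integration.integral_add, (intro integrable_mult_right mi; simp)+) (simp only: integral_mult_right_zero)
  also have "... <= C * ((?p * (M / D ^ (1+1)) + ?p * de * (M / D ^ (0+1))) + (?q * (M / D ^ (2+1)) + ?q * de\<^sup>2 * (M / D ^ (0+1))))"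
   using C d by (intro mult_left_mono add_mono ml) auto
  also have "... = C * M * (?p * (1/D^2 + de/D) + ?q * (1/D^3 + de\<^sup>2/D))"
  proof -
   have [simp]: "D ^ (1+1) = D^2" "D ^ (2+1) = D^3" "D ^ (0+1) = D" by (simp_all add: numeral_eq_Suc)
   show ?thesis by (simp only: \<open>D ^ (1+1) = D^2\<close> \<open>D ^ (2+1) = D^3\<close> \<open>D ^ (0+1) = D\<close>) (simp add: algebra_simps)
  qed
  finally show "norm ((\<integral>y. ?f y \<partial>lborel) - (\<integral>y. ?g y \<partial>lborel)) <= C * M * (?p * (1/D^2 + de/D) + ?q * (1/D^3 + de\<^sup>2/D))" .
 qed
qed

text \<open>The density of the mean square at height t, that is, the derivative of t ln t + (2 c - 1
  - ln (2 pi)) t. It is the density ln v + 2 c of the divisor sum at v = t / (2 pi).\<close>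

definition pp :: "real => real" where "pp t = ln (t / (2*pi)) + 2 * euler_mascheroni"

text \<open>Integrating over y inside the defining integral of \<open>Pm\<close> gives the Fourier
  transform of a Gaussian at the frequency ta - 2 pi v. It concentrates v near ta / (2 pi), and the
  substitution t = 2 pi v produces a Gaussian of width D around ta.\<close>

lemma Pm_fubini:
 assumes d: "0 < de" and D: "D > 0"
 shows "(\<integral>y. Pm (Complex (4*pi*de) (2*pi*y)) * exp (\<i> * of_real (ta * y) - of_real ((D*y)\<^sup>2/4)) \<partial>lborel)
   = of_real (1 / (sqrt pi * D) * (LINT t:{0<..}|lborel. pp t * exp (- 2 * de * t) * exp (- ((t - ta) / D)\<^sup>2)))"
  "set_integrable lborel {0<..} (%t. pp t * exp (- 2 * de * t) * exp (- ((t - ta) / D)\<^sup>2))"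
proof -
 have d4: "4*pi*de > 0" using d by simp
 let ?l = "%v. ln v + 2 * euler_mascheroni"
 define f where "f = (%y v. (indicat_real {0<..} v *\<^sub>R (of_real (?l v) * exp (- Complex (4*pi*de) (2*pi*y) * of_real v))) * exp (\<i> * of_real (ta * y) - of_real ((D*y)\<^sup>2/4)))"
 have Cm[measurable]: "(%y. Complex (4*pi*de) (2*pi*y)) \<in> borel_measurable borel"
  unfolding Complex_eq by measurable
 have fm: "case_prod f \<in> borel_measurable (lborel \<Otimes>\<^sub>M lborel)" unfolding f_def by measurable
 have bi: "integrable lborel (%v. indicat_real {0<..} v * (\<bar>?l v\<bar> * exp (- (4*pi*de) * v)))"
 proof -
  have "integrable lborel (%v. norm (indicat_real {0<..} v *\<^sub>R (complex_of_real (?l v) * exp (- of_real (4*pi*de) * of_real v))))"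
   using integrable_norm[OF Laplace_integrable(2)[of "of_real (4*pi*de)", unfolded set_integrable_def]] d4 by simp
  moreover have "norm (indicat_real {0<..} v *\<^sub>R (complex_of_real (?l v) * exp (- of_real (4*pi*de) * of_real v))) = indicat_real {0<..} v * (\<bar>?l v\<bar> * exp (- (4*pi*de) * v))" for v
   unfolding norm_scaleR norm_mult norm_of_real by simp
  ultimately show ?thesis by (simp only:)
 qed
 have nf: "norm (f y v) = indicat_real {0<..} v * (\<bar>?l v\<bar> * exp (- (4*pi*de) * v)) * exp (0 * y - (D*y)\<^sup>2/4)" for y v
  unfolding f_def norm_mult norm_scaleR norm_of_real by simp
 have gi: "integrable lborel (%y. exp (0 * y - (D*y)\<^sup>2/4))" by (rule gauss_lin(1)[OF D])
 have int: "integrable (lborel \<Otimes>\<^sub>M lborel) (case_prod f)"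
 proof (rule lborel_pair.Fubini_integrable[OF fm])
  show "integrable lborel (%x. \<integral>y. norm (case_prod f (x, y)) \<partial>lborel)"
   unfolding prod.case nf integral_mult_left_zero
   by (intro integrable_mult_right gi)
  show "AE x in lborel. integrable lborel (%y. case_prod f (x, y))"
  proof (rule AE_I2)
   fix x :: real
   have [measurable]: "(%v. f x v) \<in> borel_measurable borel" unfolding f_def by measurable
   show "integrable lborel (%y. case_prod f (x, y))"
    unfolding prod.case
    by (rule bint_dominated[OF integrable_mult_left[OF bi, of "exp (0 * x - (D*x)\<^sup>2/4)"]])
      (auto simp: nf abs_mult)
  qed
 qed
 have 1: "(\<integral>v. f y v \<partial>lborel) = Pm (Complex (4*pi*de) (2*pi*y)) * exp (\<i> * of_real (ta * y) - of_real ((D*y)\<^sup>2/4))" for y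
  unfolding f_def Pm_def set_lebesgue_integral_def by (rule integral_mult_left_zero)
 have D2: "2/D > 0" using D by simp
 have 2: "(\<integral>y. f y v \<partial>lborel) = of_real (2 * sqrt pi / D * (indicator {0<..} v * (?l v * exp (- (4*pi*de) * v) * exp (- ((2*pi * v - ta)/D)\<^sup>2))))" for v
 proof -
  have eq: "f y v = of_real (indicator {0<..} v * (?l v * exp (- (4*pi*de) * v))) * (exp (\<i> * of_real (y * (ta - 2*pi * v))) * of_real (exp (- (y / (2/D))\<^sup>2)))" for y
  proof -
   have e: "exp (- Complex (4*pi*de) (2*pi*y) * of_real v) * exp (\<i> * of_real (ta * y) - of_real ((D*y)\<^sup>2/4))
     = of_real (exp (- (4*pi*de) * v)) * (exp (\<i> * of_real (y * (ta - 2*pi * v))) * of_real (exp (- (y / (2/D))\<^sup>2)))"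
    unfolding exp_of_real[symmetric] exp_add[symmetric]
    by (rule arg_cong[of _ _ exp]) (simp add: complex_eq_iff power_mult_distrib power_divide algebra_simps)
   have gen: "(I *\<^sub>R (of_real l * E1)) * E2 = of_real (I * (l * x)) * G" if "E1 * E2 = of_real x * G"
    for I l x :: real and E1 E2 G :: complex
   proof -
    have "(I *\<^sub>R (of_real l * E1)) * E2 = of_real I * (of_real l * (E1 * E2))" by (simp only: scaleR_conv_of_real mult.assoc)
    then show ?thesis unfolding that by (simp only: of_real_mult mult.assoc)
   qed
   show ?thesis unfolding f_def by (rule gen[OF e])
  qed
  have "(\<integral>y. f y v \<partial>lborel) = of_real (indicator {0<..} v * (?l v * exp (- (4*pi*de) * v))) * of_real (sqrt pi * (2/D) * exp (- ((2/D) * (ta - 2*pi * v))\<^sup>2 / 4))"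
   unfolding eq by (subst integral_mult_right_zero) (simp only: gauss_ft(2)[OF D2])
  also have "- ((2/D) * (ta - 2*pi * v))\<^sup>2 / 4 = - ((2*pi * v - ta)/D)\<^sup>2"
  proof -
   have gen: "- ((2/D) * x)\<^sup>2 / 4 = - ((- x)/D)\<^sup>2" for x :: real by (simp add: power_mult_distrib power_divide)
   show ?thesis using gen[of "ta - 2*pi * v"] unfolding minus_diff_eq .
  qed
  finally show ?thesis by (simp only: of_real_mult[symmetric]) (simp add: mult_ac)
 qed
 have i2: "integrable lborel (%v. \<integral>y. f y v \<partial>lborel)" using lborel_pair.integrable_snd[OF int] .
 let ?h = "%v. indicator {0<..} v * (?l v * exp (- (4*pi*de) * v) * exp (- ((2*pi * v - ta)/D)\<^sup>2))"
 let ?k = "%t. indicator {0<..} t *\<^sub>R (pp t * exp (- 2 * de * t) * exp (- ((t - ta) / D)\<^sup>2))"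
 have hk: "?h (0 + 1/(2*pi) * t) = ?k t" for t :: real
 proof -
  have "indicator {0<..} (0 + 1/(2*pi) * t) = (indicator {0<..} t :: real)"
   by (auto simp: indicator_def zero_less_divide_iff)
  moreover have "?l (0 + 1/(2*pi) * t) = pp t" by (simp add: pp_def)
  ultimately show ?thesis by simp
 qed
 have ih: "integrable lborel ?h"
 proof -
  have "integrable lborel (%v. Re (of_real (2 * sqrt pi / D * ?h v) :: complex))"
   using integrable_Re[OF i2] unfolding 2 .
  then have "integrable lborel (%v. (2 * sqrt pi / D) * ?h v)" by (simp only: Re_complex_of_real)
  then have "integrable lborel (%v. D / (2 * sqrt pi) * ((2 * sqrt pi / D) * ?h v))" by (rule integrable_mult_right)
  moreover have "D / (2 * sqrt pi) * ((2 * sqrt pi / D) * x) = x" for x using D by simp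
  ultimately show ?thesis by (simp only:)
 qed
 have "integrable lborel (%t. ?h (0 + 1/(2*pi) * t))" by (rule lborel_integrable_real_affine[OF ih]) simp
 then show "set_integrable lborel {0<..} (%t. pp t * exp (- 2 * de * t) * exp (- ((t - ta) / D)\<^sup>2))"
  unfolding hk set_integrable_def .
 have hs: "(\<integral>v. ?h v \<partial>lborel) = 1/(2*pi) * (\<integral>t. ?k t \<partial>lborel)"
  using lborel_integral_real_affine[of "1/(2*pi)" ?h 0] unfolding hk by simp
 have "(\<integral>y. (\<integral>v. f y v \<partial>lborel) \<partial>lborel) = (\<integral>v. (\<integral>y. f y v \<partial>lborel) \<partial>lborel)"
  by (rule lborel_pair.Fubini_integral[symmetric, OF int])
 also have "... = of_real (2 * sqrt pi / D * (1/(2*pi) * (\<integral>t. ?k t \<partial>lborel)))"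
  unfolding 2 integral_complex_of_real integral_mult_right_zero hs ..
 also have "2 * sqrt pi / D * (1/(2*pi) * (\<integral>t. ?k t \<partial>lborel)) = 1 / (sqrt pi * D) * (\<integral>t. ?k t \<partial>lborel)"
 proof -
  have gen: "2 * q / D * (1/(2*(q*q))) = 1 / (q * D)" if "q > 0" for q :: real
   using that by (simp add: field_simps)
  have "2 * sqrt pi / D * (1/(2*pi)) = 1 / (sqrt pi * D)" using gen[of "sqrt pi"] by simp
  then show ?thesis by (simp only: mult.assoc[symmetric])
 qed
 finally show "(\<integral>y. Pm (Complex (4*pi*de) (2*pi*y)) * exp (\<i> * of_real (ta * y) - of_real ((D*y)\<^sup>2/4)) \<partial>lborel)
   = of_real (1 / (sqrt pi * D) * (LINT t:{0<..}|lborel. pp t * exp (- 2 * de * t) * exp (- ((t - ta) / D)\<^sup>2)))"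
  unfolding 1 set_lebesgue_integral_def .
qed


section \<open>The mean square of Z with a Gaussian weight\<close>

text \<open>Gamma(s) (2 pi i)^(-s) zeta(s)^2 at s = 1/2 + it, which is \<open>hh\<close> without its
  Gaussian and with de = 0.\<close>

definition EE :: "real => complex" where
 "EE t = Gamma (Complex (1/2) t) * exp (- Complex (1/2) t * (of_real (ln (2*pi)) + \<i> * of_real (pi/2))) * (zeta (Complex (1/2) t))\<^sup>2"

text \<open>On the critical line the square of Z is zeta(s) zeta(1 - s), and
  \<open>zeta_reflect\<close> introduces cos (pi s / 2). Of its two exponentials the dominant one
  gives \<open>EE\<close>, and the other is smaller by the factor i exp (-pi t).\<close>

lemma EE_eq: "EE t * (1 + \<i> * of_real (exp (- pi * t))) = of_real ((RS_Z t)\<^sup>2)"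
proof -
 let ?s = "Complex (1/2) t"
 have "complex_of_real ((RS_Z t)\<^sup>2) = of_real ((norm (zeta ?s))\<^sup>2)"
  by (simp only: RS_Z_Lam(2)[symmetric] power2_abs)
 also have "... = zeta ?s * cnj (zeta ?s)" by (rule complex_norm_square)
 also have "cnj (zeta ?s) = zeta (1 - ?s)" using zeta_cnj_line[of t] by (metis complex_cnj_cnj)
 also have "... = 2 * (2 * of_real pi) powr (- ?s) * cos (of_real pi * ?s / 2) * Gamma ?s * zeta ?s"
  by (rule zeta_reflect) auto
 also have "(2 * of_real pi) powr (- ?s) = exp (- ?s * of_real (ln (2*pi)))"
  using Ln_of_real[of "2*pi"] by (simp add: powr_def)
 also have "2 * exp (- ?s * of_real (ln (2*pi))) * cos (of_real pi * ?s / 2)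
   = exp (- ?s * (of_real (ln (2*pi)) + \<i> * of_real (pi/2))) * (1 + \<i> * of_real (exp (- pi * t)))"
 proof -
  have e1: "exp (\<i> * (of_real pi * ?s / 2)) = exp (- ?s * (\<i> * of_real (pi/2))) * (\<i> * of_real (exp (- pi * t)))"
  proof -
   have "exp (\<i> * (of_real pi * ?s / 2)) = exp (- ?s * (\<i> * of_real (pi/2))) * exp (\<i> * of_real pi * ?s)"
    by (simp add: exp_add[symmetric] algebra_simps)
   also have "\<i> * of_real pi * ?s = \<i> * of_real (pi/2) + of_real (- pi * t)" by (simp add: complex_eq_iff)
   also have "exp (\<i> * of_real (pi/2) + of_real (- pi * t)) = \<i> * of_real (exp (- pi * t))"
    unfolding exp_add exp_of_real by (metis cis_conv_exp cis_pi_half)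
   finally show ?thesis .
  qed
  have e2: "exp (- (\<i> * (of_real pi * ?s / 2))) = exp (- ?s * (\<i> * of_real (pi/2)))" by (simp add: mult_ac)
  have "2 * exp (- ?s * of_real (ln (2*pi))) * cos (of_real pi * ?s / 2)
    = exp (- ?s * of_real (ln (2*pi))) * (exp (\<i> * (of_real pi * ?s / 2)) + exp (- (\<i> * (of_real pi * ?s / 2))))"
   unfolding cos_exp_eq by simp
  also have "... = exp (- ?s * of_real (ln (2*pi))) * exp (- ?s * (\<i> * of_real (pi/2))) * (1 + \<i> * of_real (exp (- pi * t)))"
   unfolding e1 e2 by (simp only: distrib_left distrib_right mult_1_right mult.assoc add.commute)
  also have "exp (- ?s * of_real (ln (2*pi))) * exp (- ?s * (\<i> * of_real (pi/2))) = exp (- ?s * (of_real (ln (2*pi)) + \<i> * of_real (pi/2)))"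
   unfolding exp_add[symmetric] distrib_left ..
  finally show ?thesis .
 qed
 finally show ?thesis unfolding EE_def by (simp only: power2_eq_square mult_ac)
qed

text \<open>Writing q = exp (-pi t), the relation EE (1 + i q) = Z^2 gives Re EE = Z^2 / (1 + q^2),
  so that the error is quadratic in q.\<close>

lemma EE_approx:
 assumes t: "t >= 1"
 shows "\<bar>(RS_Z t)\<^sup>2 - Re (EE t)\<bar> <= (RS_Z t)\<^sup>2 * exp (- 2 * t)"
proof -
 define q where "q = exp (- pi * t)"
 define Z where "Z = (RS_Z t)\<^sup>2"
 have Z: "Z >= 0" by (simp add: Z_def)
 have "EE t * (1 + \<i> * of_real q) = of_real Z" using EE_eq[of t] unfolding q_def Z_def .
 then have 1: "Re (EE t) - q * Im (EE t) = Z" "Im (EE t) + q * Re (EE t) = 0" by (auto simp: complex_eq_iff algebra_simps)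
 have "Im (EE t) = - q * Re (EE t)" using 1(2) by linarith
 then have 2: "Re (EE t) * (1 + q\<^sup>2) = Z" using 1(1) by (simp add: power2_eq_square algebra_simps)
 then have R: "Re (EE t) = Z / (1 + q\<^sup>2)" by (smt (verit) nonzero_eq_divide_eq zero_le_power2)
 have "Z - Re (EE t) = Re (EE t) * q\<^sup>2" using 2 by (simp add: algebra_simps)
 moreover have "Re (EE t) >= 0" "Re (EE t) <= Z"
 proof -
  have q: "1 + q\<^sup>2 > 0" by (simp add: add_pos_nonneg)
  then have "Z / (1 + q\<^sup>2) <= Z / 1" using Z by (intro divide_left_mono) auto
  then show "Re (EE t) >= 0" "Re (EE t) <= Z" unfolding R using Z q by auto
 qed
 moreover have "q\<^sup>2 <= exp (- 2 * t)"
 proof -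
  have "q\<^sup>2 = exp (- (2 * pi) * t)" by (simp add: q_def exp_double[symmetric])
  also have "... <= exp (- 2 * t)" using t pi_gt3 by simp
  finally show ?thesis .
 qed
 ultimately show ?thesis unfolding Z_def[symmetric] by (simp add: mult_mono)
qed

text \<open>Multiplying a Gaussian centred at ta + de D^2 by exp (-2 de t) moves its centre to ta
  and produces only a constant. Starting from the displaced centre thus compensates the rotation of
  \<open>wd\<close>, up to the phase exp (i de).\<close>

lemma hh_half_line:
 assumes d: "0 < de" "de < 1/4" and D: "D > 0"
 shows "hh de D (Complex (1/2) (ta + de * D\<^sup>2)) (Complex (1/2) t)
   = exp (\<i> * of_real de) * of_real (exp (- 2 * de * ta - (de * D)\<^sup>2)) * (EE t * of_real (exp (- ((t - ta) / D)\<^sup>2)))"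
proof -
 let ?s = "Complex (1/2) t" and ?s1 = "Complex (1/2) (ta + de * D\<^sup>2)"
 define A where "A = - ?s * (of_real (ln (2*pi)) + \<i> * of_real (pi/2))"
 have 1: "wd de powr (- ?s) = exp A * exp (\<i> * of_real de + of_real (- 2 * de * t))"
  unfolding wd_powr[OF d] exp_add[symmetric] A_def by (rule arg_cong[of _ _ exp]) (simp add: complex_eq_iff algebra_simps)
 have 2: "(?s - ?s1)\<^sup>2 / of_real (D\<^sup>2) = of_real (- ((t - (ta + de * D\<^sup>2)) / D)\<^sup>2)"
 proof -
  have "?s - ?s1 = \<i> * of_real (t - (ta + de * D\<^sup>2))" by (simp add: complex_eq_iff)
  then show ?thesis by (simp add: power_mult_distrib power_divide)
 qed
 have 3: "- ((t - (ta + de * D\<^sup>2)) / D)\<^sup>2 - 2 * de * t = (- 2 * de * ta - (de * D)\<^sup>2) + - ((t - ta) / D)\<^sup>2"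
  using D by (simp add: field_simps power2_eq_square)
 have "exp (\<i> * of_real de + of_real (- 2 * de * t)) * exp ((?s - ?s1)\<^sup>2 / of_real (D\<^sup>2))
   = exp (\<i> * of_real de) * (of_real (exp (- 2 * de * ta - (de * D)\<^sup>2)) * of_real (exp (- ((t - ta) / D)\<^sup>2)))"
  unfolding 2 exp_of_real[symmetric] exp_add[symmetric] of_real_add[symmetric] 3[symmetric]
  by (rule arg_cong[of _ _ exp]) (simp add: algebra_simps)
 then show ?thesis
  unfolding hh_def 1 EE_def A_def[symmetric] by (simp only: mult_ac)
qed

lemma RS_Z_bound: "\<exists>K\<ge>1. \<forall>t. \<bar>RS_Z t\<bar> <= K * (1 + \<bar>t\<bar>)"
 using zeta_bounds unfolding RS_Z_Lam(2) by blast

text \<open>Z is \<open>Lam\<close> on the critical line divided by a positive continuous function.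
  This avoids discussing continuity of the phase \<open>RS_theta\<close>.\<close>

lemma RS_Z_cont: "continuous_on UNIV RS_Z"
proof -
 let ?L = "%t. Lam (Complex (1/2) t)"
 let ?r = "%t. pi powr (-1/4) * norm (Gamma (Complex (1/4) (t/2)))"
 have np: "Complex (1/4) (t/2) \<notin> \<int>\<^sub>\<le>\<^sub>0" for t by (auto elim!: nonpos_Ints_cases simp: complex_eq_iff)
 have h: "Complex (1/2) t / 2 = Complex (1/4) (t/2)" for t by (simp add: complex_eq_iff)
 have n0: "?r t ~= 0" for t using np[of t] by (simp add: Gamma_eq_zero_iff)
 have cl1: "continuous_on UNIV (%t. Complex (1/4) (t/2))" unfolding Complex_eq by (intro continuous_intros) auto
 have cl2: "continuous_on UNIV (Complex (1/2))" unfolding Complex_eq by (intro continuous_intros)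
 note cl = cl1 cl2
 have cG: "continuous_on UNIV (%t. Gamma (Complex (1/4) (t/2)))"
  using np by (intro continuous_on_compose2[OF continuous_on_Gamma[of "- \<int>\<^sub>\<le>\<^sub>0"] cl(1)]) auto
 have cz: "continuous_on UNIV (%t. zeta (Complex (1/2) t))"
  by (rule continuous_on_compose2[OF holomorphic_on_imp_continuous_on[OF zeta_spec(1)] cl(2)]) (auto simp: complex_eq_iff)
 have cL: "continuous_on UNIV ?L"
  unfolding Lam_def h by (intro continuous_intros cG cz cl) auto
 have "RS_Z t = Re (?L t) / ?r t" for t using RS_Z_Lam(1)[of t] n0[of t] by simp
 then have eq: "RS_Z = (%t. Re (?L t) / ?r t)" by (rule ext)
 show ?thesis unfolding eq using n0 by (intro continuous_intros cL cG) auto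
qed

lemma RS_Z_measurable[measurable]: "RS_Z \<in> borel_measurable borel"
 by (rule borel_measurable_continuous_onI[OF RS_Z_cont])

lemma Z2_gauss_integrable:
 fixes D ta :: real assumes D: "D > 0"
 shows "integrable lborel (%t. (RS_Z t)\<^sup>2 * exp (- ((t - ta) / D)\<^sup>2))"
proof -
 obtain K where K: "K >= 1" "!!t. \<bar>RS_Z t\<bar> <= K * (1 + \<bar>t\<bar>)" using RS_Z_bound by blast
 let ?b = "%t. K\<^sup>2 * (exp (2 * t) * exp (- ((t - ta) / D)\<^sup>2) + exp (-2 * t) * exp (- ((t - ta) / D)\<^sup>2))"
 have bi: "integrable lborel ?b" by (intro integrable_mult_right Bochner_Integration.integrable_add exp_gauss_integrable D)
 show ?thesis
 proof (rule bint_dominated[OF bi])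
  show "AE t in lborel. norm ((RS_Z t)\<^sup>2 * exp (- ((t - ta) / D)\<^sup>2)) <= norm (?b t)"
  proof (rule AE_I2)
   fix t :: real
   have "\<bar>RS_Z t\<bar> <= K * exp \<bar>t\<bar>"
    using K(2)[of t] mult_left_mono[OF exp_ge_add_one_self[of "\<bar>t\<bar>"], of K] K(1) by linarith
   then have "\<bar>RS_Z t\<bar>\<^sup>2 <= (K * exp \<bar>t\<bar>)\<^sup>2" by (intro power_mono) auto
   also have "... = K\<^sup>2 * exp (2 * \<bar>t\<bar>)" by (simp add: power_mult_distrib exp_double[symmetric])
   also have "... <= K\<^sup>2 * (exp (2 * t) + exp (- 2 * t))" by (intro mult_left_mono) (auto simp: abs_if)
   finally have "(RS_Z t)\<^sup>2 <= K\<^sup>2 * (exp (2 * t) + exp (- 2 * t))" by simp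
   then have "(RS_Z t)\<^sup>2 * exp (- ((t - ta) / D)\<^sup>2) <= K\<^sup>2 * (exp (2 * t) + exp (- 2 * t)) * exp (- ((t - ta) / D)\<^sup>2)"
    by (intro mult_right_mono) auto
   then show "norm ((RS_Z t)\<^sup>2 * exp (- ((t - ta) / D)\<^sup>2)) <= norm (?b t)"
    by (simp only: real_norm_def abs_mult power2_abs abs_exp_cancel abs_power2) (simp add: algebra_simps)
  qed
 qed measurable
qed

text \<open>The factor exp (-2 de t) occurs both with the square of Z and with \<open>pp\<close>. On
  each side it moves the centre of the Gaussian and releases the same constant kappa, and division
  by kappa explains the exponential in front of the error. That exponential is bounded when de is of
  order 1/ta and D is at most of order ta.\<close>

lemma mean_square_core:
 "\<exists>C\<ge>0. \<forall>de D ta. 0 < de & de < 1/16 & D >= 1 & ta >= 1 -->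
  \<bar>(LINT t:{1..}|lborel. (RS_Z t)\<^sup>2 * exp (- ((t - ta) / D)\<^sup>2)) - (LINT t:{0<..}|lborel. pp t * exp (- ((t - ta) / D)\<^sup>2))\<bar>
   <= C * exp (2 * de * ta + (de * D)\<^sup>2) * (1 + D * exp (- ((ta - 1) / D)\<^sup>2 / 2)
     + D * (de powr (-3/2) * (1/D^2 + de/D) + de powr (-5/2) * (1/D^3 + de\<^sup>2/D)))"
proof -
 obtain C1 where C1: "C1 >= 0" "!!de D s1. 0 < de ==> de < 1/4 ==> D >= 1 ==> Re s1 = 1/2 ==> Im s1 >= 1 ==>
   set_integrable lborel {1..} (%t. hh de D s1 (Complex (1/2) t)) \<and>
   norm ((LINT t:{1..}|lborel. hh de D s1 (Complex (1/2) t)) - (\<integral>t. hh de D s1 (Complex 2 t) \<partial>lborel))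
    <= C1 * (1 + D * exp (- ((Im s1 - 1) / D)\<^sup>2 / 2))"
  using hh_shift by blast
 obtain C2 where C2: "C2 >= 0" "!!de D ta. 0 < de ==> de < 1/16 ==> D >= 1 ==>
  norm ((\<integral>y. Sd (wd de * of_real (exp y)) * exp (Complex (1/2) ta * of_real y - of_real ((D*y)\<^sup>2/4)) \<partial>lborel)
    - (\<integral>y. Pm (Complex (4*pi*de) (2*pi*y)) * exp (\<i> * of_real (ta * y) - of_real ((D*y)\<^sup>2/4)) \<partial>lborel))
   <= C2 * (de powr (-3/2) * (1/D^2 + de/D) + de powr (-5/2) * (1/D^3 + de\<^sup>2/D))"
  using Sd_integral_approx by blast
 obtain C3 where C3: "C3 >= 0" "!!de D ta. 0 < de ==> de < 1/16 ==> D >= 1 ==>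
  norm (\<integral>y. Pm (Complex (4*pi*de) (2*pi*y)) * exp (\<i> * of_real (ta * y) - of_real ((D*y)\<^sup>2/4)) \<partial>lborel) <= C3 * de powr (-3/2) / D"
  using Pm_line_integrable by blast
 obtain K where K: "K >= 1" "!!t. \<bar>RS_Z t\<bar> <= K * (1 + \<bar>t\<bar>)" using RS_Z_bound by blast
 define C where "C = 2 * (C1 + sqrt pi * C2 + sqrt pi * C3 + 4 * K\<^sup>2)"
 show ?thesis
 proof (intro exI[of _ C] conjI allI impI)
  show "C >= 0" unfolding C_def using C1(1) C2(1) C3(1) by (intro add_nonneg_nonneg mult_nonneg_nonneg) auto
  fix de D ta :: real assume "0 < de & de < 1/16 & D >= 1 & ta >= 1"
  then have d: "0 < de" "de < 1/16" and D: "D >= 1" and tau: "ta >= 1" by auto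
  have d4: "de < 1/4" and D0: "D > 0" using d D by auto
  \<comment> \<open>The displaced centre required by \<open>hh_half_line\<close>.\<close>
  define ta1 where "ta1 = ta + de * D\<^sup>2"
  have tau1: "ta1 >= ta" using d by (simp add: ta1_def)
  define s1 where "s1 = Complex (1/2) ta1"
  define \<kappa> where "\<kappa> = exp (- 2 * de * ta - (de * D)\<^sup>2)"
  have "0 <= 2 * de * ta" using d tau by simp
  then have "- 2 * de * ta - (de * D)\<^sup>2 <= 0" using zero_le_power2[of "de * D"] by linarith
  then have \<kappa>: "0 < \<kappa>" "\<kappa> <= 1" by (auto simp: \<kappa>_def)
  have \<kappa>inv: "1 / \<kappa> = exp (2 * de * ta + (de * D)\<^sup>2)" unfolding \<kappa>_def by (simp add: exp_minus[symmetric] divide_inverse)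
  define g where "g = (%t. exp (- ((t - ta) / D)\<^sup>2))"
  have g1: "0 <= g t" "g t <= 1" for t by (simp_all add: g_def)
  define Y where "Y = (LINT t:{0<..}|lborel. pp t * g t)"
  define X where "X = (LINT t:{1..}|lborel. EE t * of_real (g t))"
  have hl: "hh de D s1 (Complex (1/2) t) = exp (\<i> * of_real de) * of_real \<kappa> * (EE t * of_real (g t))" for t
   unfolding s1_def ta1_def \<kappa>_def g_def by (rule hh_half_line[OF d(1) d4 D0])
  have sh: "set_integrable lborel {1..} (%t. hh de D s1 (Complex (1/2) t))"
   and ns: "norm ((LINT t:{1..}|lborel. hh de D s1 (Complex (1/2) t)) - (\<integral>t. hh de D s1 (Complex 2 t) \<partial>lborel))
    <= C1 * (1 + D * exp (- ((ta1 - 1) / D)\<^sup>2 / 2))"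
   using C1(2)[of de D s1] d d4 D tau tau1 by (auto simp: s1_def)
  have c0: "exp (\<i> * of_real de) * of_real \<kappa> ~= 0" using \<kappa> by simp
  have Xi: "set_integrable lborel {1..} (%t. EE t * of_real (g t))"
   using sh unfolding hl set_integrable_mult_right_iff[OF c0] .
  have hX: "(LINT t:{1..}|lborel. hh de D s1 (Complex (1/2) t)) = exp (\<i> * of_real de) * of_real \<kappa> * X"
   unfolding hl X_def by (rule set_integral_mult_right)
  define IP where "IP = (\<integral>y. Pm (Complex (4*pi*de) (2*pi*y)) * exp (\<i> * of_real (ta1 * y) - of_real ((D*y)\<^sup>2/4)) \<partial>lborel)"
  have IP: "IP = of_real (1 / (sqrt pi * D) * (\<kappa> * Y))"
  proof -
   have "pp t * exp (- 2 * de * t) * exp (- ((t - ta1) / D)\<^sup>2) = \<kappa> * (pp t * g t)" for t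
   proof -
    have "- 2 * de * t + - ((t - ta1) / D)\<^sup>2 = (- 2 * de * ta - (de * D)\<^sup>2) + - ((t - ta) / D)\<^sup>2"
     unfolding ta1_def using D0 by (simp add: field_simps power2_eq_square)
    then have "exp (- 2 * de * t) * exp (- ((t - ta1) / D)\<^sup>2) = \<kappa> * g t"
     unfolding \<kappa>_def g_def exp_add[symmetric] by simp
    then show ?thesis by (simp only: mult.assoc mult.left_commute)
   qed
   then have "(LINT t:{0<..}|lborel. pp t * exp (- 2 * de * t) * exp (- ((t - ta1) / D)\<^sup>2)) = \<kappa> * Y"
    unfolding Y_def by (simp only: set_integral_mult_right)
   then show ?thesis unfolding IP_def Pm_fubini(1)[OF d(1) D0] by (simp only:)
  qed
  define R where "R = de powr (-3/2) * (1/D^2 + de/D) + de powr (-5/2) * (1/D^3 + de\<^sup>2/D)"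
  have R0: "R >= 0" using d D0 by (simp add: R_def)
  define G where "G = exp (- ((ta - 1) / D)\<^sup>2 / 2)"
  have nIP: "norm ((\<integral>t. hh de D s1 (Complex 2 t) \<partial>lborel) - of_real (sqrt pi * D) * IP) <= sqrt pi * D * (C2 * R)"
  proof -
   have "(\<integral>t. hh de D s1 (Complex 2 t) \<partial>lborel) - of_real (sqrt pi * D) * IP = of_real (sqrt pi * D) *
     ((\<integral>y. Sd (wd de * of_real (exp y)) * exp (s1 * of_real y - of_real ((D*y)\<^sup>2/4)) \<partial>lborel) - IP)"
    unfolding hh_line_2(3)[OF d(1) d4 D0] by (simp only: right_diff_distrib)
   then have "norm ((\<integral>t. hh de D s1 (Complex 2 t) \<partial>lborel) - of_real (sqrt pi * D) * IP) = sqrt pi * D *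
     norm ((\<integral>y. Sd (wd de * of_real (exp y)) * exp (s1 * of_real y - of_real ((D*y)\<^sup>2/4)) \<partial>lborel) - IP)"
    using D0 by (simp only: norm_mult norm_of_real) simp
   also have "... <= sqrt pi * D * (C2 * R)"
    unfolding IP_def s1_def R_def using D0 by (intro mult_left_mono C2(2) d D) auto
   finally show ?thesis .
  qed
  have sIP: "of_real (sqrt pi * D) * IP = of_real \<kappa> * of_real Y"
   unfolding IP of_real_mult[symmetric] using D0 by simp
  have G': "exp (- ((ta1 - 1) / D)\<^sup>2 / 2) <= G"
  proof -
   have "((ta - 1) / D)\<^sup>2 <= ((ta1 - 1) / D)\<^sup>2" using tau tau1 D0 by (intro power_mono divide_right_mono) auto
   then show ?thesis by (simp add: G_def)
  qed
  have main: "norm (exp (\<i> * of_real de) * of_real \<kappa> * X - of_real \<kappa> * of_real Y) <= C1 * (1 + D * G) + sqrt pi * D * (C2 * R)"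
  proof -
   have "norm (exp (\<i> * of_real de) * of_real \<kappa> * X - of_real \<kappa> * of_real Y) <= C1 * (1 + D * exp (- ((ta1 - 1) / D)\<^sup>2 / 2)) + sqrt pi * D * (C2 * R)"
    using norm_triangle_le[OF add_mono[OF ns nIP]] unfolding hX sIP by simp
   also have "C1 * (1 + D * exp (- ((ta1 - 1) / D)\<^sup>2 / 2)) <= C1 * (1 + D * G)"
    using C1(1) D0 G' by (intro mult_left_mono add_left_mono) auto
   finally show ?thesis by simp
  qed
  have nY: "\<kappa> * \<bar>Y\<bar> <= sqrt pi * C3 * de powr (-3/2)"
  proof -
   have "\<kappa> * \<bar>Y\<bar> = norm (of_real \<kappa> * of_real Y :: complex)" using \<kappa> by (simp add: norm_mult)
   also have "... = sqrt pi * D * norm IP" unfolding sIP[symmetric] norm_mult norm_of_real using D0 by simp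
   also have "... <= sqrt pi * D * (C3 * de powr (-3/2) / D)"
    unfolding IP_def using D0 by (intro mult_left_mono C3(2) d D) auto
   also have "... = sqrt pi * C3 * de powr (-3/2)" using D0 by simp
   finally show ?thesis .
  qed
  \<comment> \<open>The phase exp (i de) multiplies only X. Removing it costs de times the size of
    kappa Y, for which \<open>Pm_line_integrable\<close> is enough.\<close>
  have rot: "norm (X - of_real Y) <= (C1 * (1 + D * G) + sqrt pi * D * (C2 * R) + de * (sqrt pi * C3 * de powr (-3/2)) * 2) / \<kappa>"
  proof -
   have e1: "norm (exp (\<i> * of_real de) - 1) <= de * 2"
   proof -
    have "norm (exp (\<i> * of_real de) - 1) <= norm (\<i> * of_real de :: complex) * exp (norm (\<i> * of_real de :: complex))"
     by (rule norm_exp_minus_one_le)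
    also have "... = de * exp de" using d by (simp add: norm_mult)
    also have "exp de <= 2" using exp_bound_half[of de] d by simp
    finally show ?thesis using d by simp
   qed
   have "exp (\<i> * of_real de) * (of_real \<kappa> * (X - of_real Y)) = (exp (\<i> * of_real de) * of_real \<kappa> * X - of_real \<kappa> * of_real Y) - (exp (\<i> * of_real de) - 1) * (of_real \<kappa> * of_real Y)"
    by (simp add: algebra_simps)
   then have "norm (exp (\<i> * of_real de) * (of_real \<kappa> * (X - of_real Y))) <= norm (exp (\<i> * of_real de) * of_real \<kappa> * X - of_real \<kappa> * of_real Y) + norm ((exp (\<i> * of_real de) - 1) * (of_real \<kappa> * of_real Y))"
    by (simp only: norm_triangle_ineq4)
   also have "... <= (C1 * (1 + D * G) + sqrt pi * D * (C2 * R)) + (de * 2) * (sqrt pi * C3 * de powr (-3/2))"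
   proof (intro add_mono main)
    have "norm ((exp (\<i> * of_real de) - 1) * (of_real \<kappa> * of_real Y)) = norm (exp (\<i> * of_real de) - 1) * (\<kappa> * \<bar>Y\<bar>)"
     using \<kappa> by (simp add: norm_mult)
    also have "... <= (de * 2) * (sqrt pi * C3 * de powr (-3/2))"
     by (rule mult_mono[OF e1 nY]) (use \<kappa> d in auto)
    finally show "norm ((exp (\<i> * of_real de) - 1) * (of_real \<kappa> * of_real Y)) <= (de * 2) * (sqrt pi * C3 * de powr (-3/2))" .
   qed
   finally have "\<kappa> * norm (X - of_real Y) <= C1 * (1 + D * G) + sqrt pi * D * (C2 * R) + de * (sqrt pi * C3 * de powr (-3/2)) * 2"
    using \<kappa> by (simp add: norm_mult mult_ac)
   then show ?thesis using \<kappa> by (simp add: pos_le_divide_eq mult.commute)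
  qed
  have ReX: "Re X = (LINT t:{1..}|lborel. Re (EE t) * g t)"
   unfolding X_def set_lebesgue_integral_def
   using integral_Re[OF Xi[unfolded set_integrable_def]] by simp
  have ReXi: "set_integrable lborel {1..} (%t. Re (EE t) * g t)"
   using integrable_Re[OF Xi[unfolded set_integrable_def]] unfolding set_integrable_def by simp
  have Zi: "set_integrable lborel {1..} (%t. (RS_Z t)\<^sup>2 * g t)"
   unfolding set_integrable_def g_def by (intro integrable_mult_indicator Z2_gauss_integrable D0) auto
  have e4: "set_integrable lborel {0<..} (%t::real. exp (- 1 * t) :: real)" "(LINT t:{0<..}|lborel. exp (- 1 * t)) = (1::real)"
  proof -
   have "indicator {0<..} t *\<^sub>R (t powr (1 - 1) * exp (- 1 * t)) = indicator {0<..} t *\<^sub>R (exp (- 1 * t) :: real)" for t :: real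
    by (auto simp: indicator_def)
   then show "set_integrable lborel {0<..} (%t::real. exp (- 1 * t) :: real)" "(LINT t:{0<..}|lborel. exp (- 1 * t)) = (1::real)"
    using powr_exp_integral[of 1 1] unfolding set_integrable_def set_lebesgue_integral_def by (simp_all only: zero_less_one simp_thms) auto
  qed
  \<comment> \<open>Passing from Re EE to the square of Z costs O(1) in all: Z^2 exp (-2 t) is at
    most 4 K^2 exp (-t) by the linear growth of Z.\<close>
  have diff: "\<bar>(LINT t:{1..}|lborel. (RS_Z t)\<^sup>2 * g t) - Re X\<bar> <= 4 * K\<^sup>2"
  proof -
   have "(LINT t:{1..}|lborel. (RS_Z t)\<^sup>2 * g t) - Re X = (LINT t:{1..}|lborel. (RS_Z t)\<^sup>2 * g t - Re (EE t) * g t)"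
    unfolding ReX by (rule set_integral_diff(2)[OF Zi ReXi, symmetric])
   moreover have "norm (LINT t:{1..}|lborel. (RS_Z t)\<^sup>2 * g t - Re (EE t) * g t) <= (LINT t:{0<..}|lborel. 4 * K\<^sup>2 * exp (- 1 * t))"
    unfolding set_lebesgue_integral_def
   proof (rule bint_norm_bound)
    show "integrable lborel (%t. indicator {1..} t *\<^sub>R ((RS_Z t)\<^sup>2 * g t - Re (EE t) * g t))"
     using set_integral_diff(1)[OF Zi ReXi] unfolding set_integrable_def .
    show "integrable lborel (%t. indicator {0<..} t *\<^sub>R (4 * K\<^sup>2 * exp (- 1 * t)))"
     using set_integrable_mult_right[OF e4(1), of "4 * K\<^sup>2"] unfolding set_integrable_def by simp
    fix t :: real
    show "norm (indicator {1..} t *\<^sub>R ((RS_Z t)\<^sup>2 * g t - Re (EE t) * g t)) <= indicator {0<..} t *\<^sub>R (4 * K\<^sup>2 * exp (- 1 * t))"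
    proof (cases "t >= 1")
     case True
     have "\<bar>(RS_Z t)\<^sup>2 * g t - Re (EE t) * g t\<bar> = \<bar>(RS_Z t)\<^sup>2 - Re (EE t)\<bar> * g t"
      using g1[of t] by (simp add: left_diff_distrib[symmetric] abs_mult)
     also have "... <= ((RS_Z t)\<^sup>2 * exp (- 2 * t)) * 1" using g1[of t] by (intro mult_mono EE_approx True) auto
     also have "... <= (4 * K\<^sup>2 * exp t) * exp (- 2 * t) * 1"
     proof (intro mult_right_mono)
      have "\<bar>RS_Z t\<bar> <= K * (2 * (1 + t/2))" using K(2)[of t] True K(1) by (simp add: algebra_simps)
      also have "... <= K * (2 * exp (t/2))" using K(1) exp_ge_add_one_self[of "t/2"] by (intro mult_left_mono) auto
      finally have "\<bar>RS_Z t\<bar>\<^sup>2 <= (K * (2 * exp (t/2)))\<^sup>2" by (intro power_mono) auto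
      also have "... = 4 * K\<^sup>2 * exp t" by (simp add: power_mult_distrib exp_double[symmetric])
      finally show "(RS_Z t)\<^sup>2 <= 4 * K\<^sup>2 * exp t" by simp
     qed auto
     also have "... = 4 * K\<^sup>2 * exp (- 1 * t)" by (simp add: exp_add[symmetric])
     finally show ?thesis using True by simp
    qed simp
   qed
   moreover have "(LINT t:{0<..}|lborel. 4 * K\<^sup>2 * exp (- 1 * t)) = 4 * K\<^sup>2" using e4(2) by simp
   ultimately show ?thesis by (metis real_norm_def)
  qed
  have RY: "\<bar>Re X - Y\<bar> <= norm (X - of_real Y)" using abs_Re_le_cmod[of "X - of_real Y"] by simp
  have dd: "de * de powr (-3/2) <= D * R"
  proof -
   have "de * de powr (-3/2) = D * (de powr (-3/2) * (de/D))" using D0 by simp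
   also have "... <= D * R" unfolding R_def using D0 d by (intro mult_left_mono) (auto simp: distrib_left)
   finally show ?thesis .
  qed
  have "\<bar>(LINT t:{1..}|lborel. (RS_Z t)\<^sup>2 * g t) - Y\<bar> <= 4 * K\<^sup>2 + (C1 * (1 + D * G) + sqrt pi * D * (C2 * R) + de * (sqrt pi * C3 * de powr (-3/2)) * 2) / \<kappa>"
   using diff RY rot by linarith
  also have "... <= (4 * K\<^sup>2) / \<kappa> + (C1 * (1 + D * G) + sqrt pi * D * (C2 * R) + de * (sqrt pi * C3 * de powr (-3/2)) * 2) / \<kappa>"
   using \<kappa> by (intro add_right_mono) (simp add: pos_le_divide_eq mult_left_le)
  also have "... = (4 * K\<^sup>2 + C1 * (1 + D * G) + sqrt pi * C2 * (D * R) + 2 * (sqrt pi * C3) * (de * de powr (-3/2))) / \<kappa>"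
   by (simp add: add_divide_distrib mult_ac)
  also have "... <= (C * (1 + D * G + D * R)) / \<kappa>"
  proof (rule divide_right_mono)
   define p where "p = sqrt pi * C2"
   define q where "q = sqrt pi * C3"
   define h where "h = D * G"
   define r where "r = D * R"
   have nn: "p >= 0" "q >= 0" "h >= 0" "r >= 0" using C2 C3 D0 R0 by (auto simp: p_def q_def h_def r_def G_def)
   have "4 * K\<^sup>2 + C1 * (1 + h) + p * r + 2 * q * (de * de powr (-3/2)) <= 4 * K\<^sup>2 + C1 * (1 + h) + p * r + 2 * q * r"
    using dd nn by (intro add_left_mono mult_left_mono) (auto simp: r_def)
   also have "... <= 2 * (C1 + p + q + 4 * K\<^sup>2) * (1 + h + r)"
    using nn C1(1) by (simp add: algebra_simps)
   finally show "4 * K\<^sup>2 + C1 * (1 + D * G) + sqrt pi * C2 * (D * R) + 2 * (sqrt pi * C3) * (de * de powr (-3/2)) <= C * (1 + D * G + D * R)"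
    unfolding C_def p_def q_def h_def r_def .
  qed (use \<kappa> in simp)
  also have "... = C * exp (2 * de * ta + (de * D)\<^sup>2) * (1 + D * G + D * R)"
   unfolding \<kappa>inv[symmetric] by simp
  finally show "\<bar>(LINT t:{1..}|lborel. (RS_Z t)\<^sup>2 * exp (- ((t - ta) / D)\<^sup>2)) - (LINT t:{0<..}|lborel. pp t * exp (- ((t - ta) / D)\<^sup>2))\<bar>
   <= C * exp (2 * de * ta + (de * D)\<^sup>2) * (1 + D * exp (- ((ta - 1) / D)\<^sup>2 / 2)
     + D * (de powr (-3/2) * (1/D^2 + de/D) + de powr (-5/2) * (1/D^3 + de\<^sup>2/D)))"
   unfolding g_def Y_def G_def R_def .
 qed
qed


definition gg :: "real => real => real => real" where "gg D ta t = exp (- ((t - ta) / D)\<^sup>2)"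

definition AZ :: "real => real => real" where "AZ D ta = (LINT t:{1..}|lborel. (RS_Z t)\<^sup>2 * gg D ta t)"

text \<open>The common way of treating Gaussian tails: half of the exponent becomes a small constant
  factor, and a quarter is kept as a Gaussian of twice the width, so that the remaining integral is
  again of the same kind.\<close>

lemma exp_neg_gg: "\<bar>t - ta\<bar> >= x ==> x >= 0 ==> D > 0 ==> gg D ta t <= exp (- (x/D)\<^sup>2 / 2) * gg (2 * D) ta t"
proof -
 assume a: "\<bar>t - ta\<bar> >= x" "x >= 0" "D > 0"
 have "(x/D)\<^sup>2 <= (\<bar>t - ta\<bar>/D)\<^sup>2" using a by (intro power_mono divide_right_mono) auto
 then have "(x/D)\<^sup>2 <= ((t - ta)/D)\<^sup>2" by (simp add: power_divide)
 moreover have "((t - ta) / (2 * D))\<^sup>2 = ((t - ta) / D)\<^sup>2 / 4" by (simp add: power_divide power_mult_distrib)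
 moreover have "((t - ta) / D)\<^sup>2 >= 0" by simp
 ultimately have "- ((t - ta) / D)\<^sup>2 <= - (x/D)\<^sup>2 / 2 + - ((t - ta) / (2 * D))\<^sup>2" by linarith
 then show ?thesis unfolding gg_def by (simp only: exp_add[symmetric] exp_le_cancel_iff)
qed

lemma gg_integrable: "D > 0 ==> integrable lborel (gg D ta)" "D > 0 ==> (\<integral>t. gg D ta t \<partial>lborel) = sqrt pi * D"
 unfolding gg_def using gauss_shift_integrable by auto

lemma gg_measurable[measurable]: "gg D ta \<in> borel_measurable borel"
 unfolding gg_def by measurable

text \<open>The difference of the densities is ln (t / ta). For t >= ta/4 it is at most 4 |t - ta| /
  ta, and the Gaussian turns |t - ta| into D. For t < ta/4 the singularity at 0 is bounded by
  (ta/t)^(1/2), and the harmless factor exp (1 - t/ta) >= 1 makes the majorant integrable over the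
  half-line in closed form.\<close>

lemma pp_integral_approx:
 assumes D: "D > 0" and tau: "ta > 0"
 shows "\<bar>(LINT t:{0<..}|lborel. pp t * gg D ta t) - sqrt pi * D * pp ta\<bar>
   <= 8 * sqrt pi * D\<^sup>2 / ta + 2 * exp 1 * sqrt pi * ta * exp (- (ta / (2*D))\<^sup>2) + \<bar>pp ta\<bar> * (2 * sqrt pi * D * exp (- (ta/D)\<^sup>2/2))"
proof -
 let ?b = "%t. 4 * D / ta * gg (2 * D) ta t + 2 * sqrt ta * exp 1 * exp (- (ta / (2*D))\<^sup>2) * (indicator {0<..} t *\<^sub>R (t powr (1/2 - 1) * exp (- (1/ta) * t)))"
 have D2: "2 * D > 0" using D by simp
 have b1: "integrable lborel (%t. 4 * D / ta * gg (2 * D) ta t)" by (intro integrable_mult_right gg_integrable D2)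
 have b2: "integrable lborel (%t. 2 * sqrt ta * exp 1 * exp (- (ta / (2*D))\<^sup>2) * (indicator {0<..} t *\<^sub>R (t powr (1/2 - 1) * exp (- (1/ta) * t))))"
  using powr_exp_integral(1)[of "1/2" "1/ta"] tau unfolding set_integrable_def by (intro integrable_mult_right) auto
 have bi: "integrable lborel ?b" by (rule Bochner_Integration.integrable_add[OF b1 b2])
 have xg: "\<bar>t - ta\<bar> * gg D ta t <= D * gg (2 * D) ta t" for t
 proof -
  define x where "x = \<bar>t - ta\<bar> / D"
  have x: "x >= 0" using D by (simp add: x_def)
  have x2: "((t - ta) / D)\<^sup>2 = x\<^sup>2" by (simp add: x_def power_divide)
  have x3: "((t - ta) / (2*D))\<^sup>2 = x\<^sup>2/4" by (simp add: x_def power_divide power_mult_distrib)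
  have "x <= 1 + 3/4 * x\<^sup>2" using zero_le_power2[of "x - 2/3"] by (simp add: power2_eq_square algebra_simps)
  also have "... <= exp (3/4 * x\<^sup>2)" by (rule exp_ge_add_one_self)
  finally have "x * exp (- x\<^sup>2) <= exp (3/4 * x\<^sup>2) * exp (- x\<^sup>2)" by (intro mult_right_mono) auto
  also have "... = exp (- (x\<^sup>2/4))" by (simp add: exp_add[symmetric])
  finally have "x * exp (- x\<^sup>2) <= exp (- (x\<^sup>2/4))" .
  then have "D * (x * exp (- x\<^sup>2)) <= D * exp (- (x\<^sup>2/4))" using D by (intro mult_left_mono) auto
  moreover have "\<bar>t - ta\<bar> = D * x" using D by (simp add: x_def)
  ultimately show ?thesis unfolding gg_def x2 x3 by (simp add: mult.assoc)
 qed
 have bnd: "\<bar>pp t - pp ta\<bar> * gg D ta t <= ?b t" if t: "t > 0" for t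
 proof -
  have e: "pp t - pp ta = ln t - ln ta" unfolding pp_def using t tau by (simp add: ln_div)
  have g0: "gg D ta t >= 0" "gg (2*D) ta t >= 0" by (simp_all add: gg_def)
  show ?thesis
  proof (cases "t >= ta/4")
   case True
   have l1: "ln t - ln ta <= \<bar>t - ta\<bar> / ta" using ln_diff_le[of t ta] t tau by (smt (verit) divide_right_mono)
   have l2: "ln ta - ln t <= 4 * \<bar>t - ta\<bar> / ta"
   proof -
    have "ln ta - ln t <= (ta - t) / t" using ln_diff_le[of ta t] t tau by simp
    also have "... <= \<bar>t - ta\<bar> / t" using t by (intro divide_right_mono) auto
    also have "... <= \<bar>t - ta\<bar> / (ta/4)" using True tau t by (intro divide_left_mono) auto
    finally show ?thesis by (simp add: mult.commute)
   qed
   have "\<bar>t - ta\<bar> / ta <= 4 * \<bar>t - ta\<bar> / ta" using tau by (intro divide_right_mono) auto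
   then have "\<bar>pp t - pp ta\<bar> <= 4 / ta * \<bar>t - ta\<bar>" unfolding e using l1 l2 by simp
   then have "\<bar>pp t - pp ta\<bar> * gg D ta t <= 4 / ta * \<bar>t - ta\<bar> * gg D ta t" using g0 by (intro mult_right_mono)
   also have "... <= 4 / ta * (D * gg (2 * D) ta t)" unfolding mult.assoc using xg[of t] tau by (intro mult_left_mono) auto
   also have "... <= ?b t" using tau t by (simp add: mult.assoc)
   finally show ?thesis .
  next
   case False
   have "\<bar>pp t - pp ta\<bar> = ln (ta/t)" unfolding e using False t tau by (simp add: ln_div)
   also have "... <= 2 * (ta/t) powr (1/2)" using t tau by (intro ln_bounds_powr(1)) auto
   also have "... = 2 * sqrt ta * t powr (1/2 - 1)"
   proof -
    have "t powr (1/2 - 1) = inverse (t powr (1/2))" by (subst powr_minus[symmetric]) simp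
    moreover have "(ta/t) powr (1/2) = sqrt ta / t powr (1/2)" using t tau by (simp add: powr_divide powr_half_sqrt)
    ultimately show ?thesis by (simp only: divide_inverse mult_ac)
   qed
   finally have 1: "\<bar>pp t - pp ta\<bar> <= 2 * sqrt ta * t powr (1/2 - 1)" .
   have 2: "gg D ta t <= exp (- (ta / (2*D))\<^sup>2)"
   proof -
    have "(ta / (2*D))\<^sup>2 <= ((ta - t)/D)\<^sup>2"
    proof (rule power_mono)
     have "ta / (2*D) = (ta/2) / D" by simp
     also have "... <= (ta - t) / D" using False D t by (intro divide_right_mono) auto
     finally show "ta / (2*D) <= (ta - t) / D" .
    qed (use tau D in auto)
    also have "... = ((t - ta)/D)\<^sup>2" by (simp add: power_divide power2_commute)
    finally show ?thesis by (simp add: gg_def)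
   qed
   have 3: "1 <= exp 1 * exp (- (1/ta) * t)" using False t tau by (simp add: exp_add[symmetric] field_simps)
   have "\<bar>pp t - pp ta\<bar> * gg D ta t <= (2 * sqrt ta * t powr (1/2 - 1)) * exp (- (ta / (2*D))\<^sup>2) * 1"
    using mult_mono[OF 1 2] g0 tau by simp
   also have "... <= (2 * sqrt ta * t powr (1/2 - 1)) * exp (- (ta / (2*D))\<^sup>2) * (exp 1 * exp (- (1/ta) * t))"
    using tau by (intro mult_left_mono 3) auto
   also have "... <= ?b t" using g0 tau D t by (simp add: mult_ac)
   finally show ?thesis .
  qed
 qed
 have ig: "set_integrable lborel {0<..} (%t. pp ta * gg D ta t)"
  unfolding set_integrable_def using integrable_mult_right[OF gg_integrable(1)[OF D], of "pp ta"] by (intro integrable_mult_indicator) auto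
 have id: "set_integrable lborel {0<..} (%t. pp t * gg D ta t - pp ta * gg D ta t)"
  unfolding set_integrable_def
 proof (rule bint_dominated[OF bi])
  show "(%t. indicat_real {0<..} t *\<^sub>R (pp t * gg D ta t - pp ta * gg D ta t)) \<in> borel_measurable lborel"
   unfolding pp_def by measurable
  show "AE t in lborel. norm (indicat_real {0<..} t *\<^sub>R (pp t * gg D ta t - pp ta * gg D ta t)) <= norm (?b t)"
  proof (rule AE_I2)
   fix t :: real
   show "norm (indicat_real {0<..} t *\<^sub>R (pp t * gg D ta t - pp ta * gg D ta t)) <= norm (?b t)"
   proof (cases "t > 0")
    case True
    have "norm (indicat_real {0<..} t *\<^sub>R (pp t * gg D ta t - pp ta * gg D ta t)) = \<bar>pp t - pp ta\<bar> * gg D ta t"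
     using True by (simp add: left_diff_distrib[symmetric] abs_mult gg_def)
    also have "... <= ?b t" by (rule bnd[OF True])
    also have "... <= norm (?b t)" by simp
    finally show ?thesis .
   qed simp
  qed
 qed
 have ip: "set_integrable lborel {0<..} (%t. pp t * gg D ta t)"
  using set_integral_add(1)[OF id ig] by simp
 have n1: "norm (LINT t:{0<..}|lborel. pp t * gg D ta t - pp ta * gg D ta t) <= (\<integral>t. ?b t \<partial>lborel)"
  unfolding set_lebesgue_integral_def
 proof (rule bint_norm_bound[OF id[unfolded set_integrable_def] bi])
  fix t :: real
  show "norm (indicat_real {0<..} t *\<^sub>R (pp t * gg D ta t - pp ta * gg D ta t)) <= ?b t"
  proof (cases "t > 0")
   case True
   have "norm (indicat_real {0<..} t *\<^sub>R (pp t * gg D ta t - pp ta * gg D ta t)) = \<bar>pp t - pp ta\<bar> * gg D ta t"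
    using True by (simp add: left_diff_distrib[symmetric] abs_mult gg_def)
   also have "... <= ?b t" by (rule bnd[OF True])
   finally show ?thesis .
  qed (use D tau in \<open>simp add: gg_def\<close>)
 qed
 have bv: "(\<integral>t. ?b t \<partial>lborel) = 8 * sqrt pi * D\<^sup>2 / ta + 2 * exp 1 * sqrt pi * ta * exp (- (ta / (2*D))\<^sup>2)"
 proof -
  have "(\<integral>t. ?b t \<partial>lborel) = 4 * D / ta * (sqrt pi * (2 * D)) + 2 * sqrt ta * exp 1 * exp (- (ta / (2*D))\<^sup>2) * (Gamma (1/2) * (1/ta) powr (-(1/2)))"
   using Bochner_Integration.integral_add[OF b1 b2] gg_integrable(2)[OF D2, of ta] powr_exp_integral(2)[of "1/2" "1/ta"] tau
   unfolding set_lebesgue_integral_def by simp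
  also have "(1/ta) powr (-(1/2)) = sqrt ta" using tau by (simp add: powr_minus powr_divide powr_half_sqrt)
  also have "Gamma (1/2) = sqrt pi" by (rule Gamma_one_half_real)
  also have "2 * sqrt ta * exp 1 * exp (- (ta / (2*D))\<^sup>2) * (sqrt pi * sqrt ta) = 2 * exp 1 * sqrt pi * (sqrt ta * sqrt ta) * exp (- (ta / (2*D))\<^sup>2)" by (simp only: mult_ac)
  also have "sqrt ta * sqrt ta = ta" using tau by simp
  also have "4 * D / ta * (sqrt pi * (2 * D)) = 8 * sqrt pi * D\<^sup>2 / ta" by (simp add: power2_eq_square)
  finally show ?thesis .
 qed
 have n2: "\<bar>(LINT t:{0<..}|lborel. gg D ta t) - sqrt pi * D\<bar> <= 2 * sqrt pi * D * exp (- (ta/D)\<^sup>2/2)"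
 proof -
  have s1: "set_integrable lborel {0<..} (gg D ta)" "set_integrable lborel {..0} (gg D ta)"
   unfolding set_integrable_def by (intro integrable_mult_indicator gg_integrable D; simp)+
  have "(LINT t:{0<..} \<union> {..0}|lborel. gg D ta t) = (LINT t:{0<..}|lborel. gg D ta t) + (LINT t:{..0}|lborel. gg D ta t)"
   by (rule set_integral_Un[OF _ s1]) auto
  moreover have "{0<..} \<union> {..0} = (UNIV :: real set)" by auto
  ultimately have "sqrt pi * D = (LINT t:{0<..}|lborel. gg D ta t) + (LINT t:{..0}|lborel. gg D ta t)"
   using gg_integrable(2)[OF D, of ta] by (simp add: set_lebesgue_integral_def)
  moreover have "norm (LINT t:{..0}|lborel. gg D ta t) <= (\<integral>t. exp (- (ta/D)\<^sup>2/2) * gg (2*D) ta t \<partial>lborel)"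
   unfolding set_lebesgue_integral_def
  proof (rule bint_norm_bound[OF s1(2)[unfolded set_integrable_def]])
   show "integrable lborel (%t. exp (- (ta/D)\<^sup>2/2) * gg (2*D) ta t)" by (intro integrable_mult_right gg_integrable D2)
   show "norm (indicat_real {..0} t *\<^sub>R gg D ta t) <= exp (- (ta/D)\<^sup>2/2) * gg (2*D) ta t" for t
    using exp_neg_gg[of ta t ta D] tau D by (auto simp: indicator_def gg_def)
  qed
  moreover have "(\<integral>t. exp (- (ta/D)\<^sup>2/2) * gg (2*D) ta t \<partial>lborel) = 2 * sqrt pi * D * exp (- (ta/D)\<^sup>2/2)"
   using gg_integrable(2)[OF D2, of ta] by simp
  ultimately show ?thesis unfolding real_norm_def by linarith
 qed
 let ?I = "LINT t:{0<..}|lborel. pp t * gg D ta t - pp ta * gg D ta t" and ?J = "(LINT t:{0<..}|lborel. gg D ta t) - sqrt pi * D"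
 have "(LINT t:{0<..}|lborel. pp t * gg D ta t) - sqrt pi * D * pp ta = ?I + pp ta * ?J"
  by (subst set_integral_diff(2)[OF ip ig]) (simp add: algebra_simps)
 moreover have "\<bar>?I + pp ta * ?J\<bar> <= \<bar>?I\<bar> + \<bar>pp ta\<bar> * \<bar>?J\<bar>"
  unfolding abs_mult[symmetric] by (rule abs_triangle_ineq)
 moreover have "\<bar>?I\<bar> + \<bar>pp ta\<bar> * \<bar>?J\<bar> <= (8 * sqrt pi * D\<^sup>2 / ta + 2 * exp 1 * sqrt pi * ta * exp (- (ta / (2*D))\<^sup>2)) + \<bar>pp ta\<bar> * (2 * sqrt pi * D * exp (- (ta/D)\<^sup>2/2))"
  by (rule add_mono[OF n1[unfolded bv real_norm_def] mult_left_mono[OF n2 abs_ge_zero]])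
 ultimately show ?thesis by linarith
qed

text \<open>\<open>mean_square_core\<close> with de = 1/T and D = T^(9/10). The divisor errors are
  at most T^(7/10); the exponent 4/5 is that of D^2 / T, the variation of \<open>pp\<close> over the
  width of the Gaussian. The constant exp 7 comes from 2 ta / T <= 6 and (D/T)^2 <= 1.\<close>

lemma AZ_approx:
 "\<exists>C T0. C >= 0 & T0 >= 1 & (\<forall>T ta. T >= T0 & T/2 <= ta & ta <= 3*T -->
   \<bar>AZ (T powr (9/10)) ta - sqrt pi * T powr (9/10) * pp ta\<bar> <= C * T powr (4/5))"
proof -
 obtain C where C: "C >= 0" "!!de D ta. 0 < de ==> de < 1/16 ==> D >= 1 ==> ta >= 1 ==>
  \<bar>(LINT t:{1..}|lborel. (RS_Z t)\<^sup>2 * exp (- ((t - ta) / D)\<^sup>2)) - (LINT t:{0<..}|lborel. pp t * exp (- ((t - ta) / D)\<^sup>2))\<bar>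
   <= C * exp (2 * de * ta + (de * D)\<^sup>2) * (1 + D * exp (- ((ta - 1) / D)\<^sup>2 / 2)
     + D * (de powr (-3/2) * (1/D^2 + de/D) + de powr (-5/2) * (1/D^3 + de\<^sup>2/D)))"
  using mean_square_core by blast
 have ev1: "\<forall>\<^sub>F T::real in at_top. 1 + T powr (9/10) * exp (- ((T/2 - 1) / T powr (9/10))\<^sup>2 / 2)
     + T powr (9/10) * ((1/T) powr (-3/2) * (1/(T powr (9/10))^2 + (1/T)/T powr (9/10)) + (1/T) powr (-5/2) * (1/(T powr (9/10))^3 + (1/T)\<^sup>2/T powr (9/10))) <= T powr (4/5)"
  by real_asymp
 have ev2: "\<forall>\<^sub>F T::real in at_top. 8 * sqrt pi * (T powr (9/10))\<^sup>2 / (T/2) + 2 * exp 1 * sqrt pi * (3*T) * exp (- ((T/2) / (2*T powr (9/10)))\<^sup>2)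
   + (T + 5) * (2 * sqrt pi * T powr (9/10) * exp (- ((T/2)/T powr (9/10))\<^sup>2/2)) <= 40 * T powr (4/5)"
 proof -
  have sp: "sqrt pi < 2"
  proof -
   have "sqrt pi < sqrt 4" using pi_less_4 by (intro real_sqrt_less_mono)
   then show ?thesis by simp
  qed
  have "\<forall>\<^sub>F T::real in at_top. 2 * exp 1 * 2 * (3*T) * exp (- ((T/2) / (2*T powr (9/10)))\<^sup>2) <= 1/2 * T powr (4/5)" by real_asymp
  moreover have "\<forall>\<^sub>F T::real in at_top. (T + 5) * (2 * 2 * T powr (9/10) * exp (- ((T/2)/T powr (9/10))\<^sup>2/2)) <= 1/2 * T powr (4/5)" by real_asymp
  ultimately have "\<forall>\<^sub>F T::real in at_top. 2 * exp 1 * 2 * (3*T) * exp (- ((T/2) / (2*T powr (9/10)))\<^sup>2) + (T + 5) * (2 * 2 * T powr (9/10) * exp (- ((T/2)/T powr (9/10))\<^sup>2/2)) <= T powr (4/5)"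
   by eventually_elim linarith
  then show ?thesis
  proof (rule eventually_rev_mp[OF _ eventually_mono[OF eventually_gt_at_top[of 0]]], intro impI)
   fix T :: real assume T: "T > 0" and le: "2 * exp 1 * 2 * (3*T) * exp (- ((T/2) / (2*T powr (9/10)))\<^sup>2) + (T + 5) * (2 * 2 * T powr (9/10) * exp (- ((T/2)/T powr (9/10))\<^sup>2/2)) <= T powr (4/5)"
   have "(T powr (9/10))\<^sup>2 = T powr (4/5) * T"
    using T powr_add[of T "4/5" 1] powr_add[of T "9/10" "9/10"] by (simp add: power2_eq_square)
   then have e: "8 * sqrt pi * (T powr (9/10))\<^sup>2 / (T/2) = 16 * sqrt pi * T powr (4/5)" using T by simp
   have "2 * exp 1 * sqrt pi * (3*T) * exp (- ((T/2) / (2*T powr (9/10)))\<^sup>2) + (T + 5) * (2 * sqrt pi * T powr (9/10) * exp (- ((T/2)/T powr (9/10))\<^sup>2/2)) <= 2 * exp 1 * 2 * (3*T) * exp (- ((T/2) / (2*T powr (9/10)))\<^sup>2) + (T + 5) * (2 * 2 * T powr (9/10) * exp (- ((T/2)/T powr (9/10))\<^sup>2/2))"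
    using T sp by (intro add_mono divide_right_mono mult_right_mono mult_left_mono) auto
   moreover have "16 * sqrt pi * T powr (4/5) <= 16 * 2 * T powr (4/5)" using sp by (intro mult_right_mono mult_left_mono) auto
   ultimately show "8 * sqrt pi * (T powr (9/10))\<^sup>2 / (T/2) + 2 * exp 1 * sqrt pi * (3*T) * exp (- ((T/2) / (2*T powr (9/10)))\<^sup>2)
   + (T + 5) * (2 * sqrt pi * T powr (9/10) * exp (- ((T/2)/T powr (9/10))\<^sup>2/2)) <= 40 * T powr (4/5)"
    using le zero_le_numeral powr_ge_zero[of T "4/5"] unfolding e by linarith
  qed
 qed
 obtain T0 where T0: "!!T. T >= T0 ==> 1 + T powr (9/10) * exp (- ((T/2 - 1) / T powr (9/10))\<^sup>2 / 2)
     + T powr (9/10) * ((1/T) powr (-3/2) * (1/(T powr (9/10))^2 + (1/T)/T powr (9/10)) + (1/T) powr (-5/2) * (1/(T powr (9/10))^3 + (1/T)\<^sup>2/T powr (9/10))) <= T powr (4/5)"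
   "!!T. T >= T0 ==> 8 * sqrt pi * (T powr (9/10))\<^sup>2 / (T/2) + 2 * exp 1 * sqrt pi * (3*T) * exp (- ((T/2) / (2*T powr (9/10)))\<^sup>2)
   + (T + 5) * (2 * sqrt pi * T powr (9/10) * exp (- ((T/2)/T powr (9/10))\<^sup>2/2)) <= 40 * T powr (4/5)"
  using eventually_conj[OF ev1 ev2] unfolding eventually_at_top_linorder by blast
 show ?thesis
 proof (rule exI[of _ "C * exp 7 + 40"], rule exI[of _ "max T0 100"], intro conjI allI impI)
  show "0 <= C * exp 7 + 40" using C by simp
  fix T ta :: real assume "max T0 100 <= T & T/2 <= ta & ta <= 3 * T"
  then have T: "T >= T0" "T >= 100" and tau: "T/2 <= ta" "ta <= 3*T" by auto
  define D where "D = T powr (9/10)"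
  have D1: "D >= 1" unfolding D_def using T by (intro ge_one_powr_ge_zero) auto
  have DT: "D <= T" unfolding D_def using T powr_mono[of "9/10" 1 T] by simp
  have ta0: "ta > 0" "ta >= 1" using T tau by auto
  let ?G = "%ta. 1 + D * exp (- ((ta - 1) / D)\<^sup>2 / 2) + D * ((1/T) powr (-3/2) * (1/D^2 + (1/T)/D) + (1/T) powr (-5/2) * (1/D^3 + (1/T)\<^sup>2/D))"
  have 1: "\<bar>AZ D ta - (LINT t:{0<..}|lborel. pp t * gg D ta t)\<bar> <= C * exp 7 * T powr (4/5)"
  proof -
   have "\<bar>AZ D ta - (LINT t:{0<..}|lborel. pp t * gg D ta t)\<bar> <= C * exp (2 * (1/T) * ta + ((1/T) * D)\<^sup>2) * ?G ta"
    unfolding AZ_def gg_def using T tau ta0 D1 by (intro C(2)) auto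
   also have "... <= C * exp 7 * ?G (T/2)"
   proof (intro mult_mono mult_left_mono add_mono)
    have "2 * (1/T) * ta <= 6" using T tau by (simp add: field_simps)
    moreover have "((1/T) * D)\<^sup>2 <= 1" using T DT D1 by (intro power_le_one) (auto simp: field_simps)
    ultimately show "exp (2 * (1/T) * ta + ((1/T) * D)\<^sup>2) <= exp 7" by simp
    have "((T/2 - 1) / D)\<^sup>2 <= ((ta - 1) / D)\<^sup>2" using T tau D1 by (intro power_mono divide_right_mono) auto
    then show "exp (- ((ta - 1) / D)\<^sup>2 / 2) <= exp (- ((T/2 - 1) / D)\<^sup>2 / 2)" by simp
   qed (use C D1 T in auto)
   also have "... <= C * exp 7 * T powr (4/5)" using T0(1)[OF T(1)] C unfolding D_def by (intro mult_left_mono) auto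
   finally show ?thesis .
  qed
  have 2: "\<bar>(LINT t:{0<..}|lborel. pp t * gg D ta t) - sqrt pi * D * pp ta\<bar> <= 40 * T powr (4/5)"
  proof -
   have ppb: "\<bar>pp ta\<bar> <= T + 5"
   proof -
    have x: "ta / (2*pi) > 0" using ta0 by simp
    have "ta / (2*pi) >= 1"
    proof -
     have "2 * pi <= ta" using T tau pi_less_4 by linarith
     then show ?thesis by simp
    qed
    then have "ln (ta / (2*pi)) >= 0" by simp
    moreover have "ln (ta / (2*pi)) <= ta / (2*pi) - 1" by (rule ln_le_minus_one[OF x])
    moreover have "ta / (2*pi) <= T"
    proof -
     have "ta <= T * (2 * pi)" using tau T pi_gt3 mult_left_mono[of 3 "2*pi" T] by linarith
     then show ?thesis by (simp add: divide_le_eq)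
    qed
    moreover have "0 < (euler_mascheroni::real)" "(euler_mascheroni::real) < 1"
     using euler_mascheroni_pos euler_mascheroni_less_13_over_22 by auto
    ultimately show ?thesis unfolding pp_def by linarith
   qed
   have "\<bar>(LINT t:{0<..}|lborel. pp t * gg D ta t) - sqrt pi * D * pp ta\<bar>
     <= 8 * sqrt pi * D\<^sup>2 / ta + 2 * exp 1 * sqrt pi * ta * exp (- (ta / (2*D))\<^sup>2) + \<bar>pp ta\<bar> * (2 * sqrt pi * D * exp (- (ta/D)\<^sup>2/2))"
    using D1 ta0 by (intro pp_integral_approx) auto
   also have "... <= 8 * sqrt pi * D\<^sup>2 / (T/2) + 2 * exp 1 * sqrt pi * (3*T) * exp (- ((T/2) / (2*D))\<^sup>2) + (T + 5) * (2 * sqrt pi * D * exp (- ((T/2)/D)\<^sup>2/2))"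
   proof (intro add_mono mult_mono mult_left_mono divide_left_mono ppb tau)
    have "((T/2) / (2*D))\<^sup>2 <= (ta / (2*D))\<^sup>2" using T tau D1 by (intro power_mono divide_right_mono) auto
    then show "exp (- (ta / (2*D))\<^sup>2) <= exp (- ((T/2) / (2*D))\<^sup>2)" by simp
    have "((T/2) / D)\<^sup>2 <= (ta / D)\<^sup>2" using T tau D1 by (intro power_mono divide_right_mono) auto
    then show "exp (- (ta / D)\<^sup>2 / 2) <= exp (- ((T/2) / D)\<^sup>2 / 2)" by simp
   qed (use T ta0 D1 in auto)
   also have "... <= 40 * T powr (4/5)" using T0(2)[OF T(1)] unfolding D_def .
   finally show ?thesis .
  qed
  have "\<bar>AZ D ta - sqrt pi * D * pp ta\<bar> <= C * exp 7 * T powr (4/5) + 40 * T powr (4/5)" using 1 2 by linarith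
  then show "\<bar>AZ (T powr (9/10)) ta - sqrt pi * T powr (9/10) * pp ta\<bar> <= (C * exp 7 + 40) * T powr (4/5)"
   unfolding D_def by (simp add: distrib_right)
 qed auto
qed


section \<open>Removing the Gaussian weight\<close>

definition FF :: "real => real" where "FF x = integral {0..x} (%t. (RS_Z t)\<^sup>2)"

lemma Z2_int: "(%t. (RS_Z t)\<^sup>2) integrable_on {a..b}" "set_integrable lborel {a..b} (%t. (RS_Z t)\<^sup>2)"
proof -
 have c: "continuous_on {a..b} (%t. (RS_Z t)\<^sup>2)"
  by (intro continuous_intros continuous_on_subset[OF RS_Z_cont]) auto
 show "(%t. (RS_Z t)\<^sup>2) integrable_on {a..b}" by (rule integrable_continuous_real[OF c])
 show "set_integrable lborel {a..b} (%t. (RS_Z t)\<^sup>2)" by (rule borel_integrable_atLeastAtMost'[OF c])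
qed

lemma FF_diff: "0 <= a ==> a <= b ==> FF b - FF a = integral {a..b} (%t. (RS_Z t)\<^sup>2)"
 unfolding FF_def using Henstock_Kurzweil_Integration.integral_combine[of 0 a b "%t. (RS_Z t)\<^sup>2"] Z2_int(1) by simp

lemma FF_mono: "0 <= a ==> a <= b ==> FF a <= FF b"
 using FF_diff[of a b] Henstock_Kurzweil_Integration.integral_nonneg[OF Z2_int(1), of a b] by simp

lemma nn_Z2: "a <= b ==> 0 <= a ==> c >= 0 ==> (\<integral>\<^sup>+t. ennreal ((RS_Z t)\<^sup>2 * indicator {a..b} t * c) \<partial>lborel) = ennreal ((FF b - FF a) * c)"
proof -
 assume ab: "a <= b" "0 <= a" "c >= 0"
 have i: "integrable lborel (%t. (RS_Z t)\<^sup>2 * indicator {a..b} t * c)"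
  using Z2_int(2)[of a b] unfolding set_integrable_def by (simp add: mult.commute)
 have "(\<integral>\<^sup>+t. ennreal ((RS_Z t)\<^sup>2 * indicator {a..b} t * c) \<partial>lborel) = ennreal (\<integral>t. (RS_Z t)\<^sup>2 * indicator {a..b} t * c \<partial>lborel)"
  by (rule nn_integral_eq_integral[OF i]) (use ab in auto)
 also have "(\<integral>t. (RS_Z t)\<^sup>2 * indicator {a..b} t * c \<partial>lborel) = (LINT t:{a..b}|lborel. (RS_Z t)\<^sup>2) * c"
  unfolding set_lebesgue_integral_def by (simp add: mult.commute)
 also have "(LINT t:{a..b}|lborel. (RS_Z t)\<^sup>2) = FF b - FF a"
  using set_borel_integral_eq_integral(2)[OF Z2_int(2)] FF_diff ab by simp
 finally show ?thesis .
qed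

lemma gg_nonneg: "gg D ta t >= 0" "gg D ta t <= 1" by (simp_all add: gg_def)

lemma gg_commute: "gg D ta t = gg D t ta" by (simp add: gg_def power_divide power2_commute)

lemma gg_measurable_center[measurable]: "(%t. gg D t ta) \<in> borel_measurable borel"
 unfolding gg_commute[of D _ ta] by measurable

lemma gg_measurable_pair[measurable]: "(%x. gg D (fst x) (snd x)) \<in> borel_measurable (lborel \<Otimes>\<^sub>M lborel)"
 unfolding gg_def by measurable

lemma Z2_gg_integrable: "D > 0 ==> integrable lborel (%t. (RS_Z t)\<^sup>2 * gg D ta t)"
 unfolding gg_def by (rule Z2_gauss_integrable)

text \<open>A polynomial bound from the linear growth of Z. It is applied only in tails, where a
  factor exp (-(ln T)^2 / 2) outweighs it.\<close>

lemma Z2_gg_bound: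
 "\<exists>K\<ge>0. \<forall>D ta. D >= 1 & ta >= 1 --> (\<integral>t. (RS_Z t)\<^sup>2 * gg D ta t \<partial>lborel) <= K * (ta\<^sup>2 + D\<^sup>2) * D"
proof -
 obtain K where K: "K >= 1" "!!t. \<bar>RS_Z t\<bar> <= K * (1 + \<bar>t\<bar>)" using RS_Z_bound by blast
 have "(\<integral>t. (RS_Z t)\<^sup>2 * gg D ta t \<partial>lborel) <= 20 * K\<^sup>2 * sqrt pi * (ta\<^sup>2 + D\<^sup>2) * D" if D: "D >= 1" and tau: "ta >= 1" for D ta
 proof -
  let ?b = "%t. 8 * K\<^sup>2 * ta\<^sup>2 * gg D ta t + 4 * K\<^sup>2 * D\<^sup>2 * gg (2*D) ta t"
  have D2: "D > 0" "2*D > 0" using D by auto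
  have bnd: "(RS_Z t)\<^sup>2 * gg D ta t <= ?b t" for t
  proof -
   define y where "y = (t - ta)/D"
   have ty: "t - ta = D * y" using D by (simp add: y_def)
   have y2: "y\<^sup>2 * gg D ta t <= 2 * gg (2*D) ta t"
   proof -
    have "y\<^sup>2 <= 2 * (1 + 3/4 * y\<^sup>2)" using zero_le_power2[of y] by (simp only: distrib_left)
    also have "... <= 2 * exp (3/4 * y\<^sup>2)" by (intro mult_left_mono exp_ge_add_one_self) auto
    finally have "y\<^sup>2 * exp (- y\<^sup>2) <= 2 * exp (3/4 * y\<^sup>2) * exp (- y\<^sup>2)" by (intro mult_right_mono) auto
    also have "... = 2 * exp (- (y\<^sup>2/4))" by (simp add: exp_add[symmetric])
    finally show ?thesis by (simp add: gg_def y_def power_divide power_mult_distrib mult.commute)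
   qed
   have "(RS_Z t)\<^sup>2 <= (K * (1 + \<bar>t\<bar>))\<^sup>2" using K(2)[of t] by (metis abs_ge_zero power2_abs power_mono)
   also have "... <= K\<^sup>2 * (8 * ta\<^sup>2 + 2 * (t - ta)\<^sup>2)"
   proof -
    have "1 + \<bar>t\<bar> <= 2 * ta + \<bar>t - ta\<bar>" using tau by linarith
    then have "(1 + \<bar>t\<bar>)\<^sup>2 <= (2 * ta + \<bar>t - ta\<bar>)\<^sup>2" by (intro power_mono) auto
    also have "... <= 2 * (2 * ta)\<^sup>2 + 2 * \<bar>t - ta\<bar>\<^sup>2" 
    proof -
     have gen: "(x + y)\<^sup>2 <= 2 * x\<^sup>2 + 2 * y\<^sup>2" for x y :: real
      using zero_le_power2[of "x - y"] by (simp add: power2_eq_square algebra_simps)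
     show ?thesis by (rule gen)
    qed
    finally show ?thesis unfolding power_mult_distrib by (intro mult_left_mono) (auto simp: power_mult_distrib)
   qed
   finally have "(RS_Z t)\<^sup>2 * gg D ta t <= K\<^sup>2 * (8 * ta\<^sup>2 + 2 * (t - ta)\<^sup>2) * gg D ta t" by (intro mult_right_mono gg_nonneg)
   also have "... = 8 * K\<^sup>2 * ta\<^sup>2 * gg D ta t + 2 * K\<^sup>2 * D\<^sup>2 * (y\<^sup>2 * gg D ta t)" unfolding ty by (simp add: algebra_simps power_mult_distrib)
   also have "... <= 8 * K\<^sup>2 * ta\<^sup>2 * gg D ta t + 2 * K\<^sup>2 * D\<^sup>2 * (2 * gg (2*D) ta t)" by (intro add_left_mono mult_left_mono y2) auto
   finally show ?thesis by simp
  qed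
  have "(\<integral>t. (RS_Z t)\<^sup>2 * gg D ta t \<partial>lborel) <= (\<integral>t. ?b t \<partial>lborel)"
   by (rule integral_mono[OF Z2_gg_integrable[OF D2(1)] _ bnd]) (intro Bochner_Integration.integrable_add integrable_mult_right gg_integrable D2)
  also have "... = 8 * K\<^sup>2 * ta\<^sup>2 * (sqrt pi * D) + 4 * K\<^sup>2 * D\<^sup>2 * (sqrt pi * (2*D))"
   by (subst Bochner_Integration.integral_add) (intro integrable_mult_right gg_integrable D2, intro integrable_mult_right gg_integrable D2, simp add: gg_integrable(2) D2)
  also have "... = (8 * ta\<^sup>2 + 8 * D\<^sup>2) * (K\<^sup>2 * sqrt pi * D)" by (simp add: algebra_simps)
  also have "... <= (20 * (ta\<^sup>2 + D\<^sup>2)) * (K\<^sup>2 * sqrt pi * D)" using D by (intro mult_right_mono) auto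
  finally show ?thesis by (simp add: mult_ac)
 qed
 then show ?thesis by (intro exI[of _ "20 * K\<^sup>2 * sqrt pi"]) auto
qed

text \<open>The part of the Gaussian outside the window is compared with a Gaussian of width 2 D,
  whose integral is twice as large; this is the factor 2 in front of the exponential.\<close>

lemma gg_window_lower:
 assumes "D > 0" "L >= 0" "a + L * D <= t" "t <= b - L * D"
 shows "sqrt pi * D * (1 - 2 * exp (- L\<^sup>2/2)) <= (\<integral>ta. gg D ta t * indicator {a..b} ta \<partial>lborel)"
proof -
 have D2: "2 * D > 0" using assms by simp
 have i: "integrable lborel (%ta. gg D t ta - exp (- L\<^sup>2/2) * gg (2*D) t ta)"
  by (intro Bochner_Integration.integrable_diff integrable_mult_right gg_integrable D2 assms)
 have "sqrt pi * D * (1 - 2 * exp (- L\<^sup>2/2)) = (\<integral>ta. gg D t ta - exp (- L\<^sup>2/2) * gg (2*D) t ta \<partial>lborel)"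
  by (subst Bochner_Integration.integral_diff) (intro integrable_mult_right gg_integrable D2 assms, intro integrable_mult_right gg_integrable D2 assms, simp add: gg_integrable(2) assms(1) algebra_simps)
 also have "... <= (\<integral>ta. gg D ta t * indicator {a..b} ta \<partial>lborel)"
 proof (rule integral_mono[OF i])
  show "integrable lborel (%ta. gg D ta t * indicator {a..b} ta)"
   unfolding gg_commute[of D _ t] by (rule integrable_real_mult_indicator) (auto intro: gg_integrable assms)
  fix ta :: real
  show "gg D t ta - exp (- L\<^sup>2/2) * gg (2*D) t ta <= gg D ta t * indicator {a..b} ta"
  proof (cases "ta \<in> {a..b}")
   case False
   then have "L * D <= \<bar>ta - t\<bar>" using assms by auto
   from exp_neg_gg[OF this _ assms(1)] assms(1,2) False show ?thesis by simp
  qed (simp add: gg_commute[of D ta t] gg_nonneg)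
 qed
 finally show ?thesis .
qed

lemma AZ_nn: "D > 0 ==> (\<integral>\<^sup>+t. ennreal ((RS_Z t)\<^sup>2 * indicator {1..} t * gg D ta t) \<partial>lborel) = ennreal (AZ D ta)"
proof -
 assume D: "D > 0"
 have i: "integrable lborel (%t. (RS_Z t)\<^sup>2 * indicator {1..} t * gg D ta t)"
  using integrable_mult_indicator[OF _ Z2_gg_integrable[OF D, of ta], of "{1..}"] by (simp add: mult_ac)
 show ?thesis
  unfolding AZ_def set_lebesgue_integral_def
  by (subst nn_integral_eq_integral[OF i]) (auto simp: gg_nonneg mult_ac)
qed

text \<open>The smoothed integrals are integrated over their centres and the order is exchanged.
  Every t in [A, B] then collects almost the full Gaussian mass sqrt pi D, since the centres extend
  beyond [A, B] by L widths.\<close>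

lemma AZ_upper_sandwich:
 assumes "D > 0" "L >= 0" "1 <= A" "A <= B" and L1: "2 * exp (- L\<^sup>2/2) <= 1"
 shows "ennreal ((FF B - FF A) * (sqrt pi * D * (1 - 2 * exp (- L\<^sup>2/2)))) <= (\<integral>\<^sup>+ta. ennreal (AZ D ta) * indicator {A - L*D..B + L*D} ta \<partial>lborel)"
proof -
 let ?I = "{A - L*D..B + L*D}"
 let ?k = "%ta t. (RS_Z t)\<^sup>2 * indicator {1..} t * gg D ta t * indicator ?I ta"
 have km: "(%x. ennreal (?k (fst x) (snd x))) \<in> borel_measurable (lborel \<Otimes>\<^sub>M lborel)" by measurable
 have c0: "sqrt pi * D * (1 - 2 * exp (- L\<^sup>2/2)) >= 0" using assms by simp
 have "ennreal ((FF B - FF A) * (sqrt pi * D * (1 - 2 * exp (- L\<^sup>2/2)))) = (\<integral>\<^sup>+t. ennreal ((RS_Z t)\<^sup>2 * indicator {A..B} t * (sqrt pi * D * (1 - 2 * exp (- L\<^sup>2/2)))) \<partial>lborel)"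
  using assms c0 by (subst nn_Z2) auto
 also have "... <= (\<integral>\<^sup>+t. (\<integral>\<^sup>+ta. ennreal (?k ta t) \<partial>lborel) \<partial>lborel)"
 proof (rule nn_integral_mono)
  fix t :: real
  show "ennreal ((RS_Z t)\<^sup>2 * indicator {A..B} t * (sqrt pi * D * (1 - 2 * exp (- L\<^sup>2/2)))) <= (\<integral>\<^sup>+ta. ennreal (?k ta t) \<partial>lborel)"
  proof (cases "t \<in> {A..B}")
   case True
   have i: "integrable lborel (%ta. gg D ta t * indicator ?I ta)"
    unfolding gg_commute[of D _ t] by (rule integrable_real_mult_indicator) (auto intro: gg_integrable assms)
   have "(\<integral>\<^sup>+ta. ennreal (?k ta t) \<partial>lborel) = (\<integral>\<^sup>+ta. ennreal ((RS_Z t)\<^sup>2 * (gg D ta t * indicator ?I ta)) \<partial>lborel)"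
    using True assms by (simp add: mult.assoc)
   also have "... = ennreal (\<integral>ta. (RS_Z t)\<^sup>2 * (gg D ta t * indicator ?I ta) \<partial>lborel)"
    by (rule nn_integral_eq_integral[OF integrable_mult_right[OF i]]) (auto simp: gg_nonneg)
   also have "... = ennreal ((RS_Z t)\<^sup>2 * (\<integral>ta. gg D ta t * indicator ?I ta \<partial>lborel))" by simp
   also have "... >= ennreal ((RS_Z t)\<^sup>2 * (sqrt pi * D * (1 - 2 * exp (- L\<^sup>2/2))))"
    using True by (intro ennreal_leI mult_left_mono gg_window_lower assms) auto
   finally show ?thesis using True by simp
  qed simp
 qed
 also have "... = (\<integral>\<^sup>+ta. (\<integral>\<^sup>+t. ennreal (?k ta t) \<partial>lborel) \<partial>lborel)"
  by (rule lborel_pair.Fubini') (use km in \<open>simp add: case_prod_beta\<close>)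
 also have "... = (\<integral>\<^sup>+ta. ennreal (AZ D ta) * indicator ?I ta \<partial>lborel)"
 proof (rule nn_integral_cong)
  fix ta :: real
  show "(\<integral>\<^sup>+t. ennreal (?k ta t) \<partial>lborel) = ennreal (AZ D ta) * indicator ?I ta"
   using AZ_nn[OF assms(1), of ta] by (cases "ta \<in> ?I") auto
 qed
 finally show ?thesis .
qed

text \<open>The counterpart of \<open>AZ_upper_sandwich\<close>, with centres kept L widths inside
  [A, B]. A point t of [A, B] collects at most the full mass, and what leaks in from outside [A, B]
  is controlled by the smoothed integral of width 2 D.\<close>

lemma AZ_lower_sandwich:
 assumes "D > 0" "L >= 0" "1 <= A" "A <= B" "A + L*D <= B - L*D" and R: "!!ta. A + L*D <= ta ==> ta <= B - L*D ==> AZ (2*D) ta <= R" "R >= 0"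
 shows "(\<integral>\<^sup>+ta. ennreal (AZ D ta) * indicator {A + L*D..B - L*D} ta \<partial>lborel) <= ennreal ((FF B - FF A) * (sqrt pi * D) + exp (- L\<^sup>2/2) * R * (B - A))"
proof -
 let ?I = "{A + L*D..B - L*D}" and ?e = "exp (- L\<^sup>2/2)"
 let ?k = "%ta t. (RS_Z t)\<^sup>2 * indicator {1..} t * gg D ta t * indicator ?I ta"
 let ?k1 = "%ta t. ennreal ((RS_Z t)\<^sup>2 * indicator {A..B} t * gg D t ta)"
 let ?k2 = "%ta t. ennreal (?e * ((RS_Z t)\<^sup>2 * indicator {1..} t * gg (2*D) ta t) * indicator ?I ta)"
 have m1: "(%x. ?k1 (fst x) (snd x)) \<in> borel_measurable (lborel \<Otimes>\<^sub>M lborel)" unfolding gg_commute[of D _ "fst _"] by measurable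
 have m2: "(%x. ?k2 (fst x) (snd x)) \<in> borel_measurable (lborel \<Otimes>\<^sub>M lborel)" by measurable
 have D2: "2 * D > 0" using assms by simp
 have "(\<integral>\<^sup>+ta. ennreal (AZ D ta) * indicator ?I ta \<partial>lborel) = (\<integral>\<^sup>+ta. (\<integral>\<^sup>+t. ennreal (?k ta t) \<partial>lborel) \<partial>lborel)"
 proof (rule nn_integral_cong)
  fix ta :: real
  show "ennreal (AZ D ta) * indicator ?I ta = (\<integral>\<^sup>+t. ennreal (?k ta t) \<partial>lborel)"
   using AZ_nn[OF assms(1), of ta] by (cases "ta \<in> ?I") auto
 qed
 also have "... <= (\<integral>\<^sup>+ta. (\<integral>\<^sup>+t. ?k1 ta t + ?k2 ta t \<partial>lborel) \<partial>lborel)"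
 proof (intro nn_integral_mono)
  fix ta t :: real
  have "?k ta t <= (RS_Z t)\<^sup>2 * indicator {A..B} t * gg D t ta + ?e * ((RS_Z t)\<^sup>2 * indicator {1..} t * gg (2*D) ta t) * indicator ?I ta"
  proof (cases "t \<in> {A..B}")
   case True
   then have "?k ta t <= (RS_Z t)\<^sup>2 * indicator {A..B} t * gg D t ta"
    using assms by (auto simp: indicator_def gg_commute[of D ta t] gg_nonneg)
   moreover have "0 <= ?e * ((RS_Z t)\<^sup>2 * indicator {1..} t * gg (2*D) ta t) * indicator ?I ta" by (simp add: gg_nonneg)
   ultimately show ?thesis by linarith
  next
   case False
   show ?thesis
   proof (cases "ta \<in> ?I")
    case True
    then have "L * D <= \<bar>t - ta\<bar>" using False assms by auto
    from exp_neg_gg[OF this _ assms(1)] assms(1,2) have "gg D ta t <= ?e * gg (2*D) ta t" by simp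
    then have "(RS_Z t)\<^sup>2 * indicator {1..} t * gg D ta t <= (RS_Z t)\<^sup>2 * indicator {1..} t * (?e * gg (2*D) ta t)"
     by (intro mult_left_mono) auto
    then show ?thesis using True False by (simp add: mult_ac)
   qed (use False in simp)
  qed
  from ennreal_leI[OF this] show "ennreal (?k ta t) <= ?k1 ta t + ?k2 ta t"
   by (subst (asm) ennreal_plus) (simp_all add: gg_nonneg)
 qed
 also have "... = (\<integral>\<^sup>+ta. (\<integral>\<^sup>+t. ?k1 ta t \<partial>lborel) + (\<integral>\<^sup>+t. ?k2 ta t \<partial>lborel) \<partial>lborel)"
  by (intro nn_integral_cong nn_integral_add) measurable
 also have "... = (\<integral>\<^sup>+ta. (\<integral>\<^sup>+t. ?k1 ta t \<partial>lborel) \<partial>lborel) + (\<integral>\<^sup>+ta. (\<integral>\<^sup>+t. ?k2 ta t \<partial>lborel) \<partial>lborel)"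
  using m1 m2 by (intro nn_integral_add lborel.borel_measurable_nn_integral) (simp_all add: case_prod_beta)
 also have "(\<integral>\<^sup>+ta. (\<integral>\<^sup>+t. ?k1 ta t \<partial>lborel) \<partial>lborel) = (\<integral>\<^sup>+t. (\<integral>\<^sup>+ta. ?k1 ta t \<partial>lborel) \<partial>lborel)"
  by (rule lborel_pair.Fubini'[symmetric]) (use m1 in \<open>simp add: case_prod_beta\<close>)
 also have "... = (\<integral>\<^sup>+t. ennreal ((RS_Z t)\<^sup>2 * indicator {A..B} t * (sqrt pi * D)) \<partial>lborel)"
 proof (rule nn_integral_cong)
  fix t :: real
  show "(\<integral>\<^sup>+ta. ?k1 ta t \<partial>lborel) = ennreal ((RS_Z t)\<^sup>2 * indicator {A..B} t * (sqrt pi * D))"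
   using nn_integral_eq_integral[OF integrable_mult_right[OF gg_integrable(1)[OF assms(1), of t], of "(RS_Z t)\<^sup>2 * indicator {A..B} t"]]
   by (simp add: gg_nonneg gg_integrable(2) assms(1))
 qed
 also have "... = ennreal ((FF B - FF A) * (sqrt pi * D))" using assms by (intro nn_Z2) auto
 also have "(\<integral>\<^sup>+ta. (\<integral>\<^sup>+t. ?k2 ta t \<partial>lborel) \<partial>lborel) <= (\<integral>\<^sup>+ta. ennreal (?e * R) * indicator ?I ta \<partial>lborel)"
 proof (rule nn_integral_mono)
  fix ta :: real
  show "(\<integral>\<^sup>+t. ?k2 ta t \<partial>lborel) <= ennreal (?e * R) * indicator ?I ta"
  proof (cases "ta \<in> ?I")
   case True
   have "(\<integral>\<^sup>+t. ?k2 ta t \<partial>lborel) = (\<integral>\<^sup>+t. ennreal ?e * ennreal ((RS_Z t)\<^sup>2 * indicator {1..} t * gg (2*D) ta t) \<partial>lborel)"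
    using True by (simp add: ennreal_mult gg_nonneg)
   also have "... = ennreal ?e * ennreal (AZ (2*D) ta)" unfolding AZ_nn[OF D2, symmetric] by (rule nn_integral_cmult) measurable
   also have "... <= ennreal ?e * ennreal R" using True by (intro mult_left_mono ennreal_leI R) auto
   also have "... = ennreal (?e * R) * indicator ?I ta" using True R(2) by (simp add: ennreal_mult)
   finally show ?thesis .
  qed simp
 qed
 also have "(\<integral>\<^sup>+ta. ennreal (?e * R) * indicator ?I ta \<partial>lborel) = ennreal (?e * R * ((B - L*D) - (A + L*D)))"
  using assms by (subst nn_integral_cmult_indicator) (auto simp: ennreal_mult)
 also have "... <= ennreal (?e * R * (B - A))" using assms by (intro ennreal_leI mult_left_mono) auto
 also have "ennreal ((FF B - FF A) * (sqrt pi * D)) + ... = ennreal ((FF B - FF A) * (sqrt pi * D) + ?e * R * (B - A))"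
  using assms FF_mono[of A B] by (intro ennreal_plus[symmetric]) auto
 finally show ?thesis by (simp add: add_left_mono)
qed


definition F0 :: "real => real" where "F0 t = t * ln t + (2 * euler_mascheroni - 1 - ln (2 * pi)) * t"

lemma F0_deriv: "t > 0 ==> (F0 has_real_derivative pp t) (at t)"
 unfolding F0_def pp_def by (rule derivative_eq_intros refl | simp add: ln_div)+

lemma pp_nn_integral:
 assumes "0 < a" "a <= b" "!!ta. a <= ta ==> ta <= b ==> 0 <= p * pp ta + q"
 shows "(\<integral>\<^sup>+ta. ennreal (p * pp ta + q) * indicator {a..b} ta \<partial>lborel) = ennreal (p * (F0 b - F0 a) + q * (b - a))"
proof -
 have "(\<integral>\<^sup>+ta. ennreal (p * pp ta + q) * indicator {a..b} ta \<partial>lborel) = ennreal ((p * F0 b + q * b) - (p * F0 a + q * a))"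
 proof (rule nn_integral_FTC_Icc)
  show "(%ta. p * pp ta + q) \<in> borel_measurable borel" unfolding pp_def by measurable
  show "((%ta. p * F0 ta + q * ta) has_real_derivative p * pp x + q) (at x)" if "x \<in> {a..b}" for x
  proof -
   have "((%ta. p * F0 ta + q * ta) has_real_derivative p * pp x + q * 1) (at x)"
    using that assms(1) by (intro DERIV_add DERIV_cmult F0_deriv DERIV_ident) auto
   then show ?thesis by simp
  qed
 qed (use assms in auto)
 then show ?thesis by (simp add: algebra_simps)
qed

text \<open>The windows extend over L = ln T Gaussian widths. With this choice exp (-L^2 / 2) is
  smaller than every power of T, while L D remains o(T).\<close>

lemma exp_neg_ln_sq: "\<forall>\<^sub>F T::real in at_top. 2 * exp (- (ln T)\<^sup>2/2) <= 1/2" by real_asymp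

text \<open>The error T^(4/5) of \<open>AZ_approx\<close>, integrated over centres in an interval of
  length O(T) and divided by the mass sqrt pi D, becomes T^(9/10).\<close>

lemma FF_upper:
 "\<exists>C\<ge>0. \<forall>\<^sub>F T in at_top. (FF (2*T) - FF T) * (1 - 2 * exp (- (ln T)\<^sup>2/2))
   <= (F0 (2*T + ln T * T powr (9/10)) - F0 (T - ln T * T powr (9/10))) + C * T powr (9/10)"
proof -
 obtain C T0 where C: "C >= 0" "T0 >= 1" "!!T ta. T >= T0 ==> T/2 <= ta ==> ta <= 3*T ==>
   \<bar>AZ (T powr (9/10)) ta - sqrt pi * T powr (9/10) * pp ta\<bar> <= C * T powr (4/5)"
  using AZ_approx by blast
 have "\<forall>\<^sub>F T::real in at_top. ln T * T powr (9/10) <= T/2" by real_asymp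
 then have "\<forall>\<^sub>F T in at_top. (FF (2*T) - FF T) * (1 - 2 * exp (- (ln T)\<^sup>2/2))
   <= (F0 (2*T + ln T * T powr (9/10)) - F0 (T - ln T * T powr (9/10))) + (2*C/sqrt pi) * T powr (9/10)"
  using exp_neg_ln_sq eventually_ge_at_top[of T0] eventually_ge_at_top[of 1]
 proof eventually_elim
  fix T :: real assume T: "ln T * T powr (9/10) <= T/2" "2 * exp (- (ln T)\<^sup>2/2) <= 1/2" "T0 <= T" "1 <= T"
  define D where "D = T powr (9/10)"
  define L where "L = ln T"
  have D: "D > 0" "L >= 0" "L * D <= T/2" using T by (auto simp: D_def L_def)
  define a where "a = T - L * D"
  define b where "b = 2*T + L * D"
  have ab: "T/2 <= a" "a <= b" "b <= 3*T" "b - a <= 2*T" "a > 0" using D T mult_nonneg_nonneg[of L D] unfolding a_def b_def by linarith+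
  have A: "AZ D ta <= sqrt pi * D * pp ta + C * T powr (4/5)" if "a <= ta" "ta <= b" for ta
   using C(3)[of T ta] T ab that unfolding D_def by (simp add: abs_le_iff)
  have A0: "AZ D ta >= 0" for ta unfolding AZ_def set_lebesgue_integral_def by (intro Bochner_Integration.integral_nonneg) (auto simp: gg_nonneg)
  have "ennreal ((FF (2*T) - FF T) * (sqrt pi * D * (1 - 2 * exp (- L\<^sup>2/2)))) <= (\<integral>\<^sup>+ta. ennreal (AZ D ta) * indicator {a..b} ta \<partial>lborel)"
   unfolding a_def b_def using D T by (intro AZ_upper_sandwich) (auto simp: L_def)
  also have "... <= (\<integral>\<^sup>+ta. ennreal (sqrt pi * D * pp ta + C * T powr (4/5)) * indicator {a..b} ta \<partial>lborel)"
  proof (intro nn_integral_mono)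
   fix ta :: real
   show "ennreal (AZ D ta) * indicator {a..b} ta <= ennreal (sqrt pi * D * pp ta + C * T powr (4/5)) * indicator {a..b} ta"
    using A[of ta] by (cases "ta \<in> {a..b}") (auto intro: ennreal_leI)
  qed
  also have "... = ennreal (sqrt pi * D * (F0 b - F0 a) + C * T powr (4/5) * (b - a))"
   using ab A A0 order_trans by (intro pp_nn_integral) blast+
  finally have le: "ennreal ((FF (2*T) - FF T) * (sqrt pi * D * (1 - 2 * exp (- L\<^sup>2/2)))) <= ennreal (sqrt pi * D * (F0 b - F0 a) + C * T powr (4/5) * (b - a))" .
  \<comment> \<open>Nonnegativity of the right-hand side, needed to leave \<open>ennreal\<close>.
    The smoothed integrals are nonnegative, hence so is the upper bound whose primitive is evaluated
    here.\<close>
  have F0m: "- (C * T powr (4/5) * (b - a)) <= (F0 b - F0 a) * (sqrt pi * D)"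
  proof -
   have "((%x. sqrt pi * D * F0 x + C * T powr (4/5) * x) b) >= ((%x. sqrt pi * D * F0 x + C * T powr (4/5) * x) a)"
   proof (rule DERIV_nonneg_imp_nondecreasing[OF ab(2)], goal_cases)
    case (1 x)
    then have "((%x. sqrt pi * D * F0 x + C * T powr (4/5) * x) has_real_derivative sqrt pi * D * pp x + C * T powr (4/5)) (at x)"
     using DERIV_add[OF DERIV_cmult[OF F0_deriv[of x], of "sqrt pi * D"] DERIV_cmult[OF DERIV_ident, of "C * T powr (4/5)"]] ab by simp
    moreover have "0 <= sqrt pi * D * pp x + C * T powr (4/5)" using A[of x] A0[of x] 1 by linarith
    ultimately show ?case by blast
   qed
   then show ?thesis by (simp add: algebra_simps)
  qed
  have nn: "0 <= sqrt pi * D * (F0 b - F0 a) + C * T powr (4/5) * (b - a)"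
   using F0m by (simp add: mult_ac)
  have "(FF (2*T) - FF T) * (sqrt pi * D * (1 - 2 * exp (- L\<^sup>2/2))) <= sqrt pi * D * (F0 b - F0 a) + C * T powr (4/5) * (b - a)"
   using le nn by (simp add: ennreal_le_iff)
  also have "... <= sqrt pi * D * (F0 b - F0 a) + C * T powr (4/5) * (2*T)"
   using ab C by (intro add_left_mono mult_left_mono) auto
  also have "C * T powr (4/5) * (2*T) = sqrt pi * D * ((2*C/sqrt pi) * T powr (9/10))"
  proof -
   have "T powr (4/5) * T = T powr (9/10) * D" using T powr_add[of T "4/5" 1] powr_add[of T "9/10" "9/10"] unfolding D_def by simp
   then have "2 * C * (T powr (4/5) * T) = 2 * C * (T powr (9/10) * D)" by simp
   then show ?thesis by (simp add: mult_ac)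
  qed
  finally have "(sqrt pi * D) * ((FF (2*T) - FF T) * (1 - 2 * exp (- L\<^sup>2/2))) <= (sqrt pi * D) * ((F0 b - F0 a) + (2*C/sqrt pi) * T powr (9/10))"
   by (simp only: distrib_left mult_ac)
  then show "(FF (2*T) - FF T) * (1 - 2 * exp (- (ln T)\<^sup>2/2)) <= (F0 (2*T + ln T * T powr (9/10)) - F0 (T - ln T * T powr (9/10))) + (2*C/sqrt pi) * T powr (9/10)"
   using D(1) unfolding a_def b_def L_def D_def by simp
 qed
 then show ?thesis using C(1) by (intro exI[of _ "2*C/sqrt pi"]) auto
qed

lemma AZ_poly: "\<exists>K\<ge>0. \<forall>D ta. D >= 1 & ta >= 1 --> AZ D ta <= K * (ta\<^sup>2 + D\<^sup>2) * D"
proof -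
 obtain K where K: "K >= 0" "!!D ta. D >= 1 ==> ta >= 1 ==> (\<integral>t. (RS_Z t)\<^sup>2 * gg D ta t \<partial>lborel) <= K * (ta\<^sup>2 + D\<^sup>2) * D"
  using Z2_gg_bound by blast
 have "AZ D ta <= K * (ta\<^sup>2 + D\<^sup>2) * D" if d: "D >= 1" "ta >= 1" for D ta
 proof -
  have i: "integrable lborel (%t. (RS_Z t)\<^sup>2 * gg D ta t)" using d by (intro Z2_gg_integrable) auto
  have "AZ D ta <= (\<integral>t. (RS_Z t)\<^sup>2 * gg D ta t \<partial>lborel)" unfolding AZ_def set_lebesgue_integral_def
   by (rule integral_mono[OF integrable_mult_indicator[OF _ i] i]) (auto simp: indicator_def gg_nonneg)
  then show ?thesis using K(2)[OF d] by linarith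
 qed
 then show ?thesis using K(1) by blast
qed

text \<open>The term with T^4 is the leakage of \<open>AZ_lower_sandwich\<close>: the polynomial
  bound for the smoothed integral of width 2 D is O(T^3), and the centres range over an interval of
  length at most T.\<close>

lemma FF_lower:
 "\<exists>C\<ge>0. \<forall>\<^sub>F T in at_top. F0 (2*T - ln T * T powr (9/10)) - F0 (T + ln T * T powr (9/10)) - C * T powr (9/10)
   - C * T^4 * exp (- (ln T)\<^sup>2/2) <= FF (2*T) - FF T"
proof -
 obtain C T0 where C: "C >= 0" "T0 >= 1" "!!T ta. T >= T0 ==> T/2 <= ta ==> ta <= 3*T ==>
   \<bar>AZ (T powr (9/10)) ta - sqrt pi * T powr (9/10) * pp ta\<bar> <= C * T powr (4/5)"
  using AZ_approx by blast
 obtain K where K: "K >= 0" "!!D ta. D >= 1 ==> ta >= 1 ==> AZ D ta <= K * (ta\<^sup>2 + D\<^sup>2) * D"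
  using AZ_poly by blast
 define C' where "C' = C + 16 * K"
 have "\<forall>\<^sub>F T::real in at_top. ln T * T powr (9/10) <= T/2" by real_asymp
 moreover have "\<forall>\<^sub>F T::real in at_top. C * T powr (4/5) <= T powr (9/10)" by real_asymp
 moreover have "\<forall>\<^sub>F T::real in at_top. T / (2*pi) >= exp 1" by real_asymp
 ultimately have "\<forall>\<^sub>F T in at_top. F0 (2*T - ln T * T powr (9/10)) - F0 (T + ln T * T powr (9/10)) - C' * T powr (9/10)
   - C' * T^4 * exp (- (ln T)\<^sup>2/2) <= FF (2*T) - FF T"
  using eventually_ge_at_top[of T0] eventually_ge_at_top[of 2]
 proof eventually_elim
  fix T :: real assume T: "ln T * T powr (9/10) <= T/2" "C * T powr (4/5) <= T powr (9/10)" "T / (2*pi) >= exp 1" "T0 <= T" "2 <= T"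
  define D where "D = T powr (9/10)"
  define L where "L = ln T"
  have D: "D >= 1" "L >= 0" "L * D <= T/2" using T by (auto simp: D_def L_def ge_one_powr_ge_zero)
  have DT: "D <= T" unfolding D_def using T powr_mono[of "9/10" 1 T] by simp
  define a where "a = T + L * D"
  define b where "b = 2*T - L * D"
  have LD: "L * D >= 0" using D by simp
  have ab: "T <= a" "a <= b" "b <= 2*T" "b - a <= T" "a > 0" using D T LD unfolding a_def b_def by linarith+
  have A: "sqrt pi * D * pp ta + (- (C * T powr (4/5))) <= AZ D ta" if "a <= ta" "ta <= b" for ta
   using C(3)[of T ta] T ab that unfolding D_def by (simp add: abs_le_iff)
  have p0: "0 <= sqrt pi * D * pp ta + (- (C * T powr (4/5)))" if "a <= ta" "ta <= b" for ta
  proof -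
   have "exp 1 <= ta / (2*pi)" using T(3) ab that by (smt (verit) divide_right_mono pi_gt_zero)
   then have "1 <= ln (ta / (2*pi))" by (smt (verit) exp_gt_zero ln_exp ln_le_cancel_iff)
   then have "1 <= pp ta" unfolding pp_def using euler_mascheroni_pos by linarith
   then have "1 * D * 1 <= sqrt pi * D * pp ta" using D pi_gt3 by (intro mult_mono) auto
   then show ?thesis using T(2) unfolding D_def by simp
  qed
  define R where "R = K * ((2*T)\<^sup>2 + (2*T)\<^sup>2) * (2*T)"
  have R0: "R >= 0" using K T by (simp add: R_def)
  have RB: "AZ (2*D) ta <= R" if "a <= ta" "ta <= b" for ta
  proof -
   have "AZ (2*D) ta <= K * (ta\<^sup>2 + (2*D)\<^sup>2) * (2*D)" using D that ab T by (intro K) auto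
   also have "... <= R" unfolding R_def using D DT that ab T K by (intro mult_mono add_mono power_mono) auto
   finally show ?thesis .
  qed
  have "ennreal (sqrt pi * D * (F0 b - F0 a) + (- (C * T powr (4/5))) * (b - a)) = (\<integral>\<^sup>+ta. ennreal (sqrt pi * D * pp ta + (- (C * T powr (4/5)))) * indicator {a..b} ta \<partial>lborel)"
   using ab p0 by (intro pp_nn_integral[symmetric]) blast+
  also have "... <= (\<integral>\<^sup>+ta. ennreal (AZ D ta) * indicator {a..b} ta \<partial>lborel)"
  proof (intro nn_integral_mono)
   fix ta :: real
   show "ennreal (sqrt pi * D * pp ta + (- (C * T powr (4/5)))) * indicator {a..b} ta <= ennreal (AZ D ta) * indicator {a..b} ta"
   proof (cases "ta \<in> {a..b}")
    case True
    then show ?thesis using A[of ta] by (auto intro: ennreal_leI)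
   qed simp
  qed
  also have "... <= ennreal ((FF (2*T) - FF T) * (sqrt pi * D) + exp (- L\<^sup>2/2) * R * (2*T - T))"
   unfolding a_def b_def using D T R0 RB[unfolded a_def b_def] ab(2)[unfolded a_def b_def] by (intro AZ_lower_sandwich) auto
  finally have "ennreal (sqrt pi * D * (F0 b - F0 a) + (- (C * T powr (4/5))) * (b - a)) <= ennreal ((FF (2*T) - FF T) * (sqrt pi * D) + exp (- L\<^sup>2/2) * R * T)" by simp
  moreover have "0 <= (FF (2*T) - FF T) * (sqrt pi * D) + exp (- L\<^sup>2/2) * R * T"
   using FF_mono[of T "2*T"] D R0 T by (intro add_nonneg_nonneg mult_nonneg_nonneg) auto
  ultimately have 1: "sqrt pi * D * (F0 b - F0 a) - C * T powr (4/5) * (b - a) <= (FF (2*T) - FF T) * (sqrt pi * D) + exp (- L\<^sup>2/2) * R * T"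
   by (simp add: ennreal_le_iff)
  have 2: "C * T powr (4/5) * (b - a) <= sqrt pi * D * (C * T powr (9/10))"
  proof -
   have "C * T powr (4/5) * (b - a) <= C * T powr (4/5) * T" using ab C by (intro mult_left_mono) auto
   also have "... = C * (T powr (9/10) * D)" using T powr_add[of T "4/5" 1] powr_add[of T "9/10" "9/10"] unfolding D_def by simp
   also have "... <= sqrt pi * (C * (T powr (9/10) * D))" using mult_right_mono[of 1 "sqrt pi" "C * (T powr (9/10) * D)"] C D pi_gt3 by simp
   finally show ?thesis by (simp add: mult_ac)
  qed
  have 3: "exp (- L\<^sup>2/2) * R * T <= sqrt pi * D * (16 * K * T^4 * exp (- L\<^sup>2/2))"
  proof -
   have "exp (- L\<^sup>2/2) * R * T = 1 * 1 * (16 * K * T^4 * exp (- L\<^sup>2/2))" by (simp add: R_def power2_eq_square power4_eq_xxxx)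
   also have "... <= sqrt pi * D * (16 * K * T^4 * exp (- L\<^sup>2/2))" using D K pi_gt3 by (intro mult_mono) auto
   finally show ?thesis .
  qed
  have "sqrt pi * D * (F0 b - F0 a - C * T powr (9/10) - 16 * K * T^4 * exp (- L\<^sup>2/2)) <= sqrt pi * D * (FF (2*T) - FF T)"
  proof -
   have gen: "X * (A - B - E) <= X * G" if "X * A - c <= G * X + d" "c <= X * B" "d <= X * E" for A B E G X c d :: real
    using that by (simp add: algebra_simps)
   show ?thesis by (rule gen[OF 1 2 3])
  qed
  then have "F0 b - F0 a - C * T powr (9/10) - 16 * K * T^4 * exp (- L\<^sup>2/2) <= FF (2*T) - FF T" using D by simp
  moreover have "C * T powr (9/10) <= C' * T powr (9/10)" unfolding C'_def using K by (intro mult_right_mono) auto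
  moreover have "16 * K * T^4 * exp (- L\<^sup>2/2) <= C' * T^4 * exp (- L\<^sup>2/2)" unfolding C'_def using C T by (intro mult_right_mono) auto
  ultimately show "F0 (2*T - ln T * T powr (9/10)) - F0 (T + ln T * T powr (9/10)) - C' * T powr (9/10)
   - C' * T^4 * exp (- (ln T)\<^sup>2/2) <= FF (2*T) - FF T"
   unfolding a_def b_def L_def D_def by linarith
 qed
 then show ?thesis using C(1) K(1) by (intro exI[of _ C']) (auto simp: C'_def)
qed

text \<open>An increment of at most (e/3) t from t to 2 t adds up over t = T/2, T/4, ... to at most
  (e/3) T. The induction counts the halvings needed to reach the compact interval [T2, 2 T2], where
  G is bounded.\<close>

lemma dyadic_limit:
 fixes G :: "real => real"
 assumes lim: "((%T. (G (2*T) - G T) / T) \<longlongrightarrow> 0) at_top"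
  and bd: "!!a b. 0 < a ==> \<exists>M. \<forall>x\<in>{a..b}. \<bar>G x\<bar> <= M"
 shows "((%T. G T / T) \<longlongrightarrow> 0) at_top"
proof (rule tendstoI)
 fix e :: real assume e: "e > 0"
 have "\<forall>\<^sub>F T in at_top. \<bar>(G (2*T) - G T) / T\<bar> < e/3" using tendstoD[OF lim, of "e/3"] e by simp
 then obtain T1 where T1: "!!T. T >= T1 ==> \<bar>(G (2*T) - G T) / T\<bar> < e/3" unfolding eventually_at_top_linorder by blast
 define T2 where "T2 = max T1 1"
 obtain M where M: "!!x. T2 <= x ==> x <= 2 * T2 ==> \<bar>G x\<bar> <= M" using bd[of T2 "2*T2"] by (fastforce simp: T2_def)
 have step: "\<bar>G (2*T) - G T\<bar> <= e/3 * T" if "T >= T2" for T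
 proof -
  have "T > 0" "T >= T1" using that by (auto simp: T2_def)
  then show ?thesis using T1[of T] by (simp add: divide_less_eq)
 qed
 have ind: "\<bar>G T\<bar> <= M + e/3 * T" if "T2 <= T" "T <= 2^Suc n * T2" for n T
  using that
 proof (induction n arbitrary: T)
  case 0
  then have "\<bar>G T\<bar> <= M" using M[of T] by simp
  moreover have "e/3 * T >= 0" using 0 e by (auto simp: T2_def)
  ultimately show ?case by linarith
 next
  case (Suc n)
  show ?case
  proof (cases "T <= 2 * T2")
   case True
   then have "\<bar>G T\<bar> <= M" using M[of T] Suc.prems by simp
   moreover have "e/3 * T >= 0" using Suc.prems e by (auto simp: T2_def)
   ultimately show ?thesis by linarith
  next
   case False
   have "\<bar>G (T/2)\<bar> <= M + e/3 * (T/2)" using Suc.prems False by (intro Suc.IH) auto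
   moreover have "\<bar>G T - G (T/2)\<bar> <= e/3 * (T/2)" using False step[of "T/2"] by simp
   moreover have "e/3 * (T/2) + e/3 * (T/2) = e/3 * T" by simp
   ultimately show ?thesis by linarith
  qed
 qed
 have ev: "\<forall>\<^sub>F T::real in at_top. \<bar>M\<bar> < e/3 * T" using e by real_asymp
 have "\<forall>\<^sub>F T in at_top. \<bar>G T / T\<bar> < e"
  using ev eventually_ge_at_top[of T2]
 proof eventually_elim
  fix T :: real assume T: "\<bar>M\<bar> < e/3 * T" "T2 <= T"
  have T0: "T > 0" "T2 >= 1" using T by (auto simp: T2_def)
  obtain n where "T/T2 < 2^n" using real_arch_pow[of 2 "T/T2"] by auto
  then have "T < 2^n * T2" using T0 by (simp add: divide_less_eq)
  moreover have "2^n * T2 <= 2^Suc n * T2" using T0 by simp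
  ultimately have "T <= 2^Suc n * T2" by linarith
  from ind[OF T(2) this] T(1) have "\<bar>G T\<bar> < e * T" using T0 e by (simp add: field_simps)
  then show "\<bar>G T / T\<bar> < e" using T0 by (simp add: divide_less_eq)
 qed
 then show "\<forall>\<^sub>F T in at_top. dist (G T / T) 0 < e" by simp
qed

text \<open>\<open>AZ_approx\<close> is uniform only for centres comparable to T, so the sandwich
  controls the increments from T to 2 T, and \<open>dyadic_limit\<close> assembles them.\<close>

lemma mean_square:
 "((%T. (FF T - F0 T) / T) \<longlongrightarrow> 0) at_top"
proof (rule dyadic_limit)
 obtain C where C: "C >= 0" "\<forall>\<^sub>F T in at_top. (FF (2*T) - FF T) * (1 - 2 * exp (- (ln T)\<^sup>2/2))
   <= (F0 (2*T + ln T * T powr (9/10)) - F0 (T - ln T * T powr (9/10))) + C * T powr (9/10)" using FF_upper by blast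
 obtain C' where C': "C' >= 0" "\<forall>\<^sub>F T in at_top. F0 (2*T - ln T * T powr (9/10)) - F0 (T + ln T * T powr (9/10)) - C' * T powr (9/10)
   - C' * T^4 * exp (- (ln T)\<^sup>2/2) <= FF (2*T) - FF T" using FF_lower by blast
 define u where "u = (%T. (((F0 (2*T + ln T * T powr (9/10)) - F0 (T - ln T * T powr (9/10))) + C * T powr (9/10)) / (1 - 2 * exp (- (ln T)\<^sup>2/2)) - (F0 (2*T) - F0 T)) / T)"
 define l where "l = (%T. (F0 (2*T - ln T * T powr (9/10)) - F0 (T + ln T * T powr (9/10)) - C' * T powr (9/10)
   - C' * T^4 * exp (- (ln T)\<^sup>2/2) - (F0 (2*T) - F0 T)) / T)"
 define k where "k = 2 * euler_mascheroni - 1 - ln (2 * pi)"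
 have u: "(u \<longlongrightarrow> 0) at_top" unfolding u_def F0_def k_def[symmetric] by real_asymp
 have l: "(l \<longlongrightarrow> 0) at_top" unfolding l_def F0_def k_def[symmetric] by real_asymp
 show "((%T. (FF (2*T) - F0 (2*T) - (FF T - F0 T)) / T) \<longlongrightarrow> 0) at_top"
 proof (rule tendsto_sandwich[OF _ _ l u])
  show "\<forall>\<^sub>F T in at_top. l T <= (FF (2*T) - F0 (2*T) - (FF T - F0 T)) / T"
   using C'(2) eventually_gt_at_top[of 0]
  proof eventually_elim
   case (elim T) then show ?case unfolding l_def by (intro divide_right_mono) auto
  qed
  show "\<forall>\<^sub>F T in at_top. (FF (2*T) - F0 (2*T) - (FF T - F0 T)) / T <= u T"
   using C(2) exp_neg_ln_sq eventually_gt_at_top[of 0]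
  proof eventually_elim
   case (elim T)
   have "FF (2*T) - FF T <= ((F0 (2*T + ln T * T powr (9/10)) - F0 (T - ln T * T powr (9/10))) + C * T powr (9/10)) / (1 - 2 * exp (- (ln T)\<^sup>2/2))"
    using elim by (subst pos_le_divide_eq) auto
   then show ?case using elim unfolding u_def by (intro divide_right_mono) auto
  qed
 qed
 fix a b :: real assume a: "0 < a"
 have "continuous_on {a..b} F0" using a F0_deriv by (intro continuous_at_imp_continuous_on) (auto intro!: DERIV_isCont[OF F0_deriv])
 then have "bounded (F0 ` {a..b})" by (intro compact_imp_bounded compact_continuous_image) auto
 then obtain M where M: "\<forall>x\<in>{a..b}. \<bar>F0 x\<bar> <= M" unfolding bounded_iff by auto
 have "\<bar>FF x - F0 x\<bar> <= M + FF b" if "x \<in> {a..b}" for x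
  using bspec[OF M that] FF_mono[of x b] FF_mono[of 0 x] that a by (auto simp: FF_def)
 then show "\<exists>M. \<forall>x\<in>{a..b}. \<bar>FF x - F0 x\<bar> <= M" by blast
qed


section \<open>A lower bound for Gamma on the line Re s = 1/4\<close>

text \<open>Midpoint log-concavity in x of |Gamma(x + iy)| / Gamma(x). It holds factor by factor in
  Euler's limit \<open>Gamma_series\<close>, where with u = m + k it becomes a polynomial inequality
  valid for h <= u. It carries lower bounds from two abscissae to the one halfway between
  them.\<close>

lemma Gamma_norm_midpoint:
 fixes m h y :: real assumes h: "0 < h" "h < m"
 shows "(Gamma m)\<^sup>2 * (norm (Gamma (Complex (m - h) y)) * norm (Gamma (Complex (m + h) y)))
   <= (norm (Gamma (Complex m y)))\<^sup>2 * (Gamma (m - h) * Gamma (m + h))"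
proof -
 let ?S = "%x n. norm (Gamma_series (Complex x y) n)"
 let ?G = "%x n. norm (Gamma_series (complex_of_real x) n)"
 have np: "Complex x y \<notin> \<int>\<^sub>\<le>\<^sub>0" "complex_of_real x \<notin> \<int>\<^sub>\<le>\<^sub>0" if "x > 0" for x using that
  by (auto elim!: nonpos_Ints_cases simp: complex_eq_iff)
 have ns: "norm (Gamma_series z n) = fact n * exp (Re z * ln (real n)) / (\<Prod>k<Suc n. norm (z + of_nat k))" for z :: complex and n
  by (simp add: Gamma_series_def norm_mult norm_divide pochhammer_prod prod_norm[symmetric] lessThan_atLeast0)
 have le: "(?G m n)\<^sup>2 * (?S (m-h) n * ?S (m+h) n) <= (?S m n)\<^sup>2 * (?G (m-h) n * ?G (m+h) n)" for n
 proof -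
  have fac: "norm (Complex (m-h) y + of_nat k) * norm (Complex (m+h) y + of_nat k) * (norm (complex_of_real m + of_nat k))\<^sup>2
    >= norm (complex_of_real (m-h) + of_nat k) * norm (complex_of_real (m+h) + of_nat k) * (norm (Complex m y + of_nat k))\<^sup>2" for k
  proof -
   define u where "u = m + real k"
   have u: "u > h" using h by (simp add: u_def)
   have e: "norm (Complex x y + of_nat k) = sqrt ((x + real k)\<^sup>2 + y\<^sup>2)" "norm (complex_of_real x + of_nat k) = \<bar>x + real k\<bar>" for x
    by (simp add: cmod_def) (metis of_real_add of_real_of_nat_eq norm_of_real)
   have p: "(u - h) * (u + h) >= 0" using u h by simp
   have "((u - h) * (u + h) * (u\<^sup>2 + y\<^sup>2))\<^sup>2 <= (((u - h)\<^sup>2 + y\<^sup>2) * ((u + h)\<^sup>2 + y\<^sup>2)) * (u\<^sup>2)\<^sup>2"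
   proof -
    have "(((u - h)\<^sup>2 + y\<^sup>2) * ((u + h)\<^sup>2 + y\<^sup>2)) * (u\<^sup>2)\<^sup>2 - ((u - h) * (u + h) * (u\<^sup>2 + y\<^sup>2))\<^sup>2
     = y\<^sup>2 * (h\<^sup>2 * u\<^sup>2 * (6 * u\<^sup>2 - 2 * h\<^sup>2)) + (y\<^sup>2)\<^sup>2 * (h\<^sup>2 * (2 * u\<^sup>2 - h\<^sup>2))"
     by (simp add: power2_eq_square algebra_simps)
    moreover have "h\<^sup>2 <= u\<^sup>2" using u h by (intro power_mono) auto
    then have "6 * u\<^sup>2 - 2 * h\<^sup>2 >= 0" "2 * u\<^sup>2 - h\<^sup>2 >= 0" using zero_le_power2[of u] by linarith+
    then have "y\<^sup>2 * (h\<^sup>2 * u\<^sup>2 * (6 * u\<^sup>2 - 2 * h\<^sup>2)) + (y\<^sup>2)\<^sup>2 * (h\<^sup>2 * (2 * u\<^sup>2 - h\<^sup>2)) >= 0" by simp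
    ultimately show ?thesis by linarith
   qed
   then have "(u - h) * (u + h) * (u\<^sup>2 + y\<^sup>2) <= sqrt (((u - h)\<^sup>2 + y\<^sup>2) * ((u + h)\<^sup>2 + y\<^sup>2) * (u\<^sup>2)\<^sup>2)"
    by (rule real_le_rsqrt)
   then have "(u - h) * (u + h) * (u\<^sup>2 + y\<^sup>2) <= sqrt ((u - h)\<^sup>2 + y\<^sup>2) * sqrt ((u + h)\<^sup>2 + y\<^sup>2) * u\<^sup>2"
    by (simp only: real_sqrt_mult real_sqrt_abs) simp
   moreover have e1: "m - h + real k = u - h" "m + h + real k = u + h" "m + real k = u" by (simp_all add: u_def)
   ultimately show ?thesis unfolding e e1 using u h by simp
  qed
  define P where "P = (\<Prod>k<Suc n. norm (Complex (m-h) y + of_nat k)) * (\<Prod>k<Suc n. norm (Complex (m+h) y + of_nat k)) * (\<Prod>k<Suc n. norm (complex_of_real m + of_nat k))\<^sup>2"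
  define Q where "Q = (\<Prod>k<Suc n. norm (complex_of_real (m-h) + of_nat k)) * (\<Prod>k<Suc n. norm (complex_of_real (m+h) + of_nat k)) * (\<Prod>k<Suc n. norm (Complex m y + of_nat k))\<^sup>2"
  have PQ: "Q <= P" unfolding P_def Q_def power2_eq_square prod.distrib[symmetric]
   by (rule prod_mono) (use fac[unfolded power2_eq_square] in auto)
  have nz: "Complex x y + of_nat k ~= 0" "complex_of_real x + of_nat k ~= 0" if "x > 0" for x k
   using that by (auto simp: complex_eq_iff)
  have Q0: "Q > 0" unfolding Q_def using nz(2)[of "m-h"] nz(2)[of "m+h"] nz(1)[of m] h by (intro mult_pos_pos prod_pos zero_less_power) auto
  have e1: "(?G m n)\<^sup>2 * (?S (m-h) n * ?S (m+h) n) = (fact n)^4 * exp (4 * m * ln (real n)) / P"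
  proof -
   have "exp (m * ln (real n)) ^ 2 * (exp ((m - h) * ln (real n)) * exp ((m + h) * ln (real n))) = exp (4 * m * ln (real n))"
    by (simp add: exp_double[symmetric] exp_add[symmetric] algebra_simps)
   then show ?thesis unfolding ns P_def by (simp add: power_divide power_mult_distrib power2_eq_square power4_eq_xxxx mult_ac)
  qed
  have e2: "(?S m n)\<^sup>2 * (?G (m-h) n * ?G (m+h) n) = (fact n)^4 * exp (4 * m * ln (real n)) / Q"
  proof -
   have "exp (m * ln (real n)) ^ 2 * (exp ((m - h) * ln (real n)) * exp ((m + h) * ln (real n))) = exp (4 * m * ln (real n))"
    by (simp add: exp_double[symmetric] exp_add[symmetric] algebra_simps)
   then show ?thesis unfolding ns Q_def by (simp add: power_divide power_mult_distrib power2_eq_square power4_eq_xxxx mult_ac)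
  qed
  show ?thesis unfolding e1 e2 using PQ Q0 by (intro divide_left_mono mult_pos_pos) auto
 qed
 have l1: "?S x \<longlonglongrightarrow> norm (Gamma (Complex x y))" for x by (intro tendsto_norm Gamma_series_LIMSEQ)
 have l2: "?G x \<longlonglongrightarrow> Gamma x" if "x > 0" for x
 proof -
  have "?G x \<longlonglongrightarrow> norm (Gamma (complex_of_real x))" by (intro tendsto_norm Gamma_series_LIMSEQ)
  also have "norm (Gamma (complex_of_real x)) = Gamma x" using that by (simp add: Gamma_complex_of_real Gamma_real_pos less_imp_le)
  finally show ?thesis .
 qed
 show ?thesis
  by (rule LIMSEQ_le[OF tendsto_mult[OF tendsto_power[OF l2] tendsto_mult[OF l1 l1]] tendsto_mult[OF tendsto_power[OF l1] tendsto_mult[OF l2 l2]]])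
    (use h le in auto)
qed

lemma norm_sin_le_exp: "norm (sin (z::complex)) <= exp \<bar>Im z\<bar>"
proof -
 have "norm (sin z) = norm (exp (\<i> * z) - exp (- (\<i> * z))) / 2" by (simp add: sin_exp_eq norm_divide norm_mult)
 also have "... <= (norm (exp (\<i> * z)) + norm (exp (- (\<i> * z)))) / 2" by (intro divide_right_mono norm_triangle_ineq4) auto
 also have "... <= (exp \<bar>Im z\<bar> + exp \<bar>Im z\<bar>) / 2" by (intro divide_right_mono add_mono) auto
 finally show ?thesis by simp
qed

text \<open>The reflection formula determines the modulus only at abscissae congruent to 0 or 1/2
  modulo 1; at 1/4 it merely couples the value with that at 3/4. So 5/4 is taken as the midpoint of
  1 and 3/2 in \<open>Gamma_norm_midpoint\<close>, and the recursion leads down to 1/4. This takes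
  the place of Stirling's formula.\<close>

lemma Gamma_quarter_lower:
 "\<exists>c>0. \<forall>y\<ge>1/2. norm (Gamma (Complex (1/4) y)) >= c * y powr (-1/4) * exp (- (pi * y / 2))"
proof -
 \<comment> \<open>Gamma(5/4)^4 / Gamma(3/2)^2 comes from the squared midpoint inequality, pi^2 from
   two uses of the reflection formula, and 16 from the fourth power of |1/4 + iy| <= 2 y.\<close>
 define q where "q = (Gamma (5/4::real))^4 / (Gamma (3/2))\<^sup>2 * pi\<^sup>2 / 16"
 have q: "q > 0" unfolding q_def by (intro divide_pos_pos mult_pos_pos zero_less_power Gamma_real_pos) auto
 have main: "q * y powr (-1) * exp (- (2 * pi * y)) <= (norm (Gamma (Complex (1/4) y)))^4" if y: "y >= 1/2" for y
 proof -
  have y0: "y > 0" using y by simp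
  define E where "E = exp (- (pi * y))"
  have E: "E > 0" by (simp add: E_def)
  have refl: "norm (Gamma (Complex a y)) * norm (Gamma (Complex (1-a) y)) >= pi * E" if "Complex a y \<notin> \<int>" for a
  proof -
   have "cnj (Gamma (Complex (1-a) y)) = Gamma (Complex (1-a) (-y))" by (simp add: cnj_Gamma complex_cnj)
   then have "norm (Gamma (Complex (1-a) y)) = norm (Gamma (Complex (1-a) (-y)))" by (metis complex_mod_cnj)
   also have "Complex (1-a) (-y) = 1 - Complex a y" by (simp add: complex_eq_iff)
   finally have "norm (Gamma (Complex a y)) * norm (Gamma (Complex (1-a) y)) = norm (Gamma (Complex a y) * Gamma (1 - Complex a y))" by (simp add: norm_mult)
   also have "... = norm (of_real pi / sin (of_real pi * Complex a y))" by (simp only: Gamma_reflection_complex)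
   also have "... = pi / norm (sin (of_real pi * Complex a y))" by (simp add: norm_divide)
   also have "... >= pi / exp (pi * y)"
   proof (rule divide_left_mono)
    show "norm (sin (of_real pi * Complex a y)) <= exp (pi * y)" using norm_sin_le_exp[of "of_real pi * Complex a y"] y0 by simp
    have "sin (of_real pi * Complex a y) ~= 0"
    proof
     assume "sin (of_real pi * Complex a y) = 0"
     then have "Im (of_real pi * Complex a y) = 0" unfolding sin_eq_0 by (auto simp: complex_eq_iff)
     then show False using y0 by simp
    qed
    then show "0 < exp (pi * y) * norm (sin (of_real pi * Complex a y))" by simp
   qed auto
   finally show ?thesis by (simp add: E_def exp_minus divide_inverse)
  qed
  have nI: "Complex a y \<notin> \<int>" for a using y0 by (auto elim!: Ints_cases simp: complex_eq_iff)
  have s: "Gamma (Complex (a + 1) y) = Complex a y * Gamma (Complex a y)" for a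
  proof -
   have "Complex (a + 1) y = Complex a y + 1" by (simp add: complex_eq_iff)
   moreover have "Complex a y ~= 0" using y0 by (simp add: complex_eq_iff)
   moreover have "Complex a y \<notin> \<int>\<^sub>\<le>\<^sub>0" using nI nonpos_Ints_subset_Ints by blast
   ultimately show ?thesis by (simp add: Gamma_plus1)
  qed
  have n: "norm (Complex a y) >= y" for a using abs_Im_le_cmod[of "Complex a y"] y0 by simp
  have g1: "(norm (Gamma (Complex 1 y)))\<^sup>2 >= y * (pi * E)"
  proof -
   have "(norm (Gamma (Complex 1 y)))\<^sup>2 = norm (Complex 0 y) * (norm (Gamma (Complex 0 y)) * norm (Gamma (Complex 1 y)))"
    using s[of 0] by (simp add: power2_eq_square norm_mult)
   also have "... >= y * (pi * E)" using refl[OF nI, of 0] y0 E n[of 0] by (intro mult_mono[of y _ "pi * E"]) auto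
   finally show ?thesis .
  qed
  have g2: "(norm (Gamma (Complex (3/2) y)))\<^sup>2 >= y\<^sup>2 * (pi * E)"
  proof -
   have "(norm (Gamma (Complex (3/2) y)))\<^sup>2 = (norm (Complex (1/2) y))\<^sup>2 * (norm (Gamma (Complex (1/2) y)) * norm (Gamma (Complex (1/2) y)))"
    using s[of "1/2"] by (simp add: power2_eq_square norm_mult)
   also have "... >= y\<^sup>2 * (pi * E)" using refl[OF nI, of "1/2"] y0 E n[of "1/2"] by (intro mult_mono[of "y\<^sup>2" _ "pi * E"] power_mono) auto
   finally show ?thesis .
  qed
  define A where "A = norm (Gamma (Complex (5/4) y))"
  have "((Gamma (5/4))\<^sup>2 * (norm (Gamma (Complex 1 y)) * norm (Gamma (Complex (3/2) y))))\<^sup>2 <= (A\<^sup>2 * (Gamma 1 * Gamma (3/2)))\<^sup>2"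
   using Gamma_norm_midpoint[of "1/4" "5/4" y] by (intro power_mono) (auto simp: A_def)
  then have "(Gamma (5/4))^4 * ((norm (Gamma (Complex 1 y)))\<^sup>2 * (norm (Gamma (Complex (3/2) y)))\<^sup>2) <= A^4 * (Gamma (3/2))\<^sup>2"
   by (simp add: power_mult_distrib)
  moreover have "(Gamma (5/4))^4 * ((y * (pi * E)) * (y\<^sup>2 * (pi * E))) <= (Gamma (5/4))^4 * ((norm (Gamma (Complex 1 y)))\<^sup>2 * (norm (Gamma (Complex (3/2) y)))\<^sup>2)"
   using g1 g2 y0 E by (intro mult_left_mono mult_mono) auto
  ultimately have "(Gamma (5/4))^4 * ((y * (pi * E)) * (y\<^sup>2 * (pi * E))) <= A^4 * (Gamma (3/2))\<^sup>2" by linarith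
  moreover have G32: "(Gamma (3/2::real))\<^sup>2 > 0" by (intro zero_less_power Gamma_real_pos) auto
  ultimately have A4: "16 * q * y^3 * E\<^sup>2 <= A^4"
   unfolding q_def by (simp add: field_simps power2_eq_square power3_eq_cube)
  have "A <= 2 * y * norm (Gamma (Complex (1/4) y))"
  proof -
   have "norm (Complex (1/4) y) <= 1/4 + y" using norm_triangle_ineq[of "of_real (1/4)" "\<i> * of_real y"] y0 by (simp add: Complex_eq norm_mult)
   also have "... <= 2 * y" using y by simp
   finally show ?thesis unfolding A_def using s[of "1/4"] by (simp add: norm_mult mult_right_mono)
  qed
  then have "A^4 <= (2 * y * norm (Gamma (Complex (1/4) y)))^4" by (intro power_mono) (auto simp: A_def)
  also have "... = 16 * y^4 * (norm (Gamma (Complex (1/4) y)))^4" by (simp add: power_mult_distrib)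
  finally have "y^3 * (q * E\<^sup>2) <= y^3 * (y * (norm (Gamma (Complex (1/4) y)))^4)" using A4 by (simp add: power4_eq_xxxx power3_eq_cube mult_ac)
  then have "q * E\<^sup>2 <= y * (norm (Gamma (Complex (1/4) y)))^4" using y0 by simp
  then have "q * E\<^sup>2 / y <= (norm (Gamma (Complex (1/4) y)))^4" using y0 by (simp add: divide_le_eq mult.commute)
  moreover have "q * y powr (-1) * exp (- (2 * pi * y)) = q * E\<^sup>2 / y"
   using y0 by (simp add: E_def exp_double[symmetric] powr_minus divide_inverse mult_ac)
  ultimately show ?thesis by simp
 qed
 show ?thesis
 proof (intro exI[of _ "q powr (1/4)"] conjI allI impI)
  show "0 < q powr (1/4)" using q by simp
  fix y :: real assume y: "1/2 <= y"
  have r: "(x powr a)^4 = x powr (4 * a)" if "x > 0" for x a :: real using that by (simp add: powr_power mult.commute)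
  have e: "exp (- (pi * y / 2))^4 = exp (- (2 * pi * y))" unfolding exp_of_nat_mult[symmetric] by simp
  have "(q powr (1/4) * y powr (-1/4) * exp (- (pi * y / 2)))^4 = q * y powr (-1) * exp (- (2 * pi * y))"
   unfolding power_mult_distrib e using q y by (simp add: r)
  also have "... <= (norm (Gamma (Complex (1/4) y)))^4" by (rule main[OF y])
  finally show "q powr (1/4) * y powr (-1/4) * exp (- (pi * y / 2)) <= norm (Gamma (Complex (1/4) y))"
   by (subst (asm) power_mono_iff) auto
 qed
qed


section \<open>The mean modulus of zeta from below\<close>

lemma gg_shift:
 assumes holo: "f holomorphic_on {s. Im s > 0}" and D: "D > 0"
  and bnd: "!!sg t. 1/2 <= sg ==> sg <= 2 ==> t >= 1 ==> norm (f (Complex sg t)) <= A * (exp (4 * t) * gg D ta t)"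
 shows "set_integrable lborel {1..} (%t. f (Complex (1/2) t))" "set_integrable lborel {1..} (%t. f (Complex 2 t))"
  "norm ((LINT t:{1..}|lborel. f (Complex (1/2) t)) - (LINT t:{1..}|lborel. f (Complex 2 t))) <= 3/2 * (A * (exp 4 * gg D ta 1))"
proof -
 define B where "B = (%t. A * (exp (4 * t) * gg D ta t))"
 have Bi: "set_integrable lborel {1..} B"
  unfolding set_integrable_def B_def gg_def
  by (intro integrable_mult_indicator integrable_mult_right exp_gauss_integrable D) auto
 have Bl: "(B \<longlongrightarrow> 0) at_top"
 proof -
  have "((%t. exp (4 * t) * exp (- ((t - ta) / D)\<^sup>2)) \<longlongrightarrow> 0) at_top" using D by real_asymp
  from tendsto_mult_right_zero[OF this] show ?thesis unfolding B_def gg_def .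
 qed
 have b: "norm (f (Complex sg t)) <= B t" if "1/2 <= sg" "sg <= 2" "t >= 1" for sg t using bnd[OF that] unfolding B_def .
 show "set_integrable lborel {1..} (%t. f (Complex (1/2) t))" by (rule line_shift(1)[OF holo b Bi Bl]) auto
 show "set_integrable lborel {1..} (%t. f (Complex 2 t))" by (rule line_shift(2)[OF holo b Bi Bl, of "1/2"]) auto
 have "norm ((LINT t:{1..}|lborel. f (Complex (1/2) t)) - (LINT t:{1..}|lborel. f (Complex 2 t))) <= (2 - 1/2) * B 1"
  by (rule line_shift(3)[OF holo b Bi Bl]) auto
 then show "norm ((LINT t:{1..}|lborel. f (Complex (1/2) t)) - (LINT t:{1..}|lborel. f (Complex 2 t))) <= 3/2 * (A * (exp 4 * gg D ta 1))"
  by (simp add: B_def)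
qed

text \<open>The Dirichlet series without its leading term 1, bounded termwise by the inverse
  squares.\<close>

lemma zeta_re2: "norm (zeta (Complex 2 t) - 1) <= pi\<^sup>2/6 - 1"
proof -
 let ?f = "%n. 1 / of_nat (Suc n) powr (Complex 2 t)"
 have nf: "norm (?f n) = 1 / (real (Suc n))\<^sup>2" for n
  using norm_powr_real_powr[of "of_nat (Suc n)" "Complex 2 t"] by (simp add: norm_divide)
 have s: "?f sums zeta (Complex 2 t)" using zeta_spec(2)[of "Complex 2 t"] by simp
 have s2: "(%n. 1 / (real (Suc n))\<^sup>2) sums (pi\<^sup>2/6)" using inverse_squares_sums by simp
 have "(%n. ?f (Suc n)) sums (zeta (Complex 2 t) - ?f 0)" using s by (subst sums_Suc_iff) simp
 then have 1: "(%n. ?f (Suc n)) sums (zeta (Complex 2 t) - 1)" by simp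
 have "(%n. 1 / (real (Suc (Suc n)))\<^sup>2) sums (pi\<^sup>2/6 - 1 / (real (Suc 0))\<^sup>2)"
  using s2 by (subst sums_Suc_iff[where f = "%n. 1 / (real (Suc n))\<^sup>2"]) simp
 then have 2: "(%n. norm (?f (Suc n))) sums (pi\<^sup>2/6 - 1)" unfolding nf by simp
 have "norm (\<Sum>n. ?f (Suc n)) <= (\<Sum>n. norm (?f (Suc n)))" by (rule summable_norm) (use 2 in \<open>simp add: sums_iff\<close>)
 then show ?thesis using 1 2 by (simp only: sums_unique[symmetric])
qed

lemma gg_1: "D > 0 ==> gg D ta 1 <= exp (- ((ta - 1)/D)\<^sup>2/2)"
proof -
 have "((1 - ta)/D)\<^sup>2 = ((ta - 1)/D)\<^sup>2" by (simp add: power_divide power2_commute)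
 moreover have "((ta - 1)/D)\<^sup>2 >= 0" by simp
 ultimately show ?thesis unfolding gg_def exp_le_cancel_iff by linarith
qed

lemma gg_left_tail: "D > 0 ==> ta >= 1 ==> t < 1 ==> gg D ta t <= exp (- ((ta - 1)/D)\<^sup>2/2) * gg (2*D) ta t"
 by (rule exp_neg_gg) auto

text \<open>On the line Re s = 2 zeta is close enough to 1 for its Gaussian mean not to vanish. The
  relative error is at most (pi^2/6 - 1) exp (1/4) <= 9/10, which leaves a tenth of the mass. The
  condition D >= 3 ensures ((2 - 1/2)/D)^2 <= 1/4, and thus the factor exp (1/4).\<close>

lemma zeta_abs_mean_lower:
 "\<exists>C\<ge>0. \<forall>D ta. D >= 3 & ta >= 1 --> 1/10 * D - C * D * exp (- ((ta - 1)/D)\<^sup>2/2) <= (LINT t:{1..}|lborel. \<bar>RS_Z t\<bar> * gg D ta t)"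
proof -
 obtain K where K: "K >= 1" "!!s. 1/2 <= Re s ==> Re s <= 2 ==> \<bar>Im s\<bar> >= 1 ==> norm (zeta s) <= K * (1 + \<bar>Im s\<bar>)"
  using zeta_bounds by blast
 define C where "C = 3/2 * (K * exp (9/4) * exp 4) + exp (9/4) * (4 * sqrt pi)"
 have "1/10 * D - C * D * exp (- ((ta - 1)/D)\<^sup>2/2) <= (LINT t:{1..}|lborel. \<bar>RS_Z t\<bar> * gg D ta t)"
  if D3: "D >= 3" and tau: "ta >= 1" for D ta
 proof -
  have D: "D > 0" "2 * D > 0" using D3 by auto
  define s0 where "s0 = Complex (1/2) ta"
  define E where "E = (%s. exp ((s - s0)\<^sup>2 / of_real (D\<^sup>2)))"
  define f where "f = (%s. zeta s * E s)"
  define eps where "eps = exp (- ((ta - 1)/D)\<^sup>2/2)"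
  have nE: "norm (E (Complex sg t)) = exp (((sg - 1/2)/D)\<^sup>2) * gg D ta t" for sg t
   unfolding E_def norm_gauss_line by (simp add: s0_def gg_def)
  have holo: "f holomorphic_on {s. Im s > 0}"
  proof -
   have "zeta holomorphic_on {s. Im s > 0}" by (rule holomorphic_on_subset[OF zeta_spec(1)]) auto
   then show ?thesis unfolding f_def E_def using D by (intro holomorphic_intros) auto
  qed
  have e94: "exp (((sg - 1/2)/D)\<^sup>2) <= exp (9/4)" if "1/2 <= sg" "sg <= 2" for sg
  proof -
   have "((sg - 1/2)/D)\<^sup>2 <= (3/2)\<^sup>2"
    using that D3 by (intro power_mono) (auto simp: divide_le_eq)
   then show ?thesis by (simp add: power2_eq_square)
  qed
  have bnd: "norm (f (Complex sg t)) <= (K * exp (9/4)) * (exp (4 * t) * gg D ta t)" if "1/2 <= sg" "sg <= 2" "t >= 1" for sg t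
  proof -
   have "norm (f (Complex sg t)) <= (K * (1 + t)) * (exp (9/4) * gg D ta t)"
    unfolding f_def norm_mult nE using K(2)[of "Complex sg t"] K(1) that e94[OF that(1,2)] gg_nonneg
    by (intro mult_mono mult_right_mono) auto
   also have "... <= (K * exp (4 * t)) * (exp (9/4) * gg D ta t)"
   proof -
    have "1 + t <= exp (4 * t)" using exp_ge_add_one_self[of "4*t"] that by linarith
    then show ?thesis using K(1) gg_nonneg by (intro mult_right_mono mult_left_mono) auto
   qed
   finally show ?thesis by (simp add: mult_ac)
  qed
  note sh = gg_shift[OF holo D(1) bnd]
  have half: "norm (f (Complex (1/2) t)) = \<bar>RS_Z t\<bar> * gg D ta t" for t
   unfolding f_def norm_mult nE RS_Z_Lam(2) by simp
  have up: "norm (LINT t:{1..}|lborel. f (Complex (1/2) t)) <= (LINT t:{1..}|lborel. \<bar>RS_Z t\<bar> * gg D ta t)"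
   unfolding half[symmetric] using set_integral_norm_bound[OF sh(1)] by simp
  have E_line: "(\<integral>t. E (Complex 2 t) \<partial>lborel) = of_real (sqrt pi * D)"
   using gauss_line[OF D(1), of 2 0 s0] unfolding E_def by simp
  have Em: "(%t. E (Complex 2 t)) \<in> borel_measurable borel" unfolding E_def by measurable
  have Ei: "integrable lborel (%t. E (Complex 2 t))"
  proof (rule bint_dominated[OF integrable_mult_right[OF gg_integrable(1)[OF D(1), of ta], of "exp (9/4)"]])
   show "AE t in lborel. norm (E (Complex 2 t)) <= norm (exp (9/4) * gg D ta t)"
    unfolding nE using e94[of 2] by (intro AE_I2) (auto simp: gg_nonneg abs_mult intro!: mult_right_mono)
  qed (use Em in simp)
  have si: "set_integrable lborel A (%t. E (Complex 2 t))" if "A \<in> sets borel" for A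
   unfolding set_integrable_def using that Ei by (intro integrable_mult_indicator) auto
  have split: "(\<integral>t. E (Complex 2 t) \<partial>lborel) = (LINT t:{1..}|lborel. E (Complex 2 t)) + (LINT t:{..<1}|lborel. E (Complex 2 t))"
  proof -
   have "(LINT t:{1..} \<union> {..<1}|lborel. E (Complex 2 t)) = (LINT t:{1..}|lborel. E (Complex 2 t)) + (LINT t:{..<1}|lborel. E (Complex 2 t))"
    by (rule set_integral_Un[OF _ si si]) auto
   moreover have "{1..} \<union> {..<1} = (UNIV::real set)" by auto
   ultimately show ?thesis by (simp add: set_lebesgue_integral_def)
  qed
  have tail: "norm (LINT t:{..<1}|lborel. E (Complex 2 t)) <= exp (9/4) * eps * (sqrt pi * (2*D))"
  proof -
   have "norm (LINT t:{..<1}|lborel. E (Complex 2 t)) <= (\<integral>t. exp (9/4) * eps * gg (2*D) ta t \<partial>lborel)"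
    unfolding set_lebesgue_integral_def
   proof (rule bint_norm_bound)
    show "integrable lborel (%t. indicator {..<1} t *\<^sub>R E (Complex 2 t))" using si[of "{..<1}"] by (simp add: set_integrable_def)
    show "integrable lborel (%t. exp (9/4) * eps * gg (2*D) ta t)" by (intro integrable_mult_right gg_integrable D)
    fix t :: real
    show "norm (indicator {..<1} t *\<^sub>R E (Complex 2 t)) <= exp (9/4) * eps * gg (2*D) ta t"
    proof (cases "t < 1")
     case True
     have "norm (E (Complex 2 t)) <= exp (9/4) * (eps * gg (2*D) ta t)"
      unfolding nE eps_def using e94[of 2] gg_left_tail[OF D(1) tau True] by (intro mult_mono) (auto simp: gg_nonneg)
     then show ?thesis using True by simp
    qed (simp add: gg_nonneg eps_def)
   qed
   also have "... = exp (9/4) * eps * (sqrt pi * (2*D))" using gg_integrable(2)[OF D(2), of ta] by simp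
   finally show ?thesis .
  qed
  have diff: "norm ((LINT t:{1..}|lborel. f (Complex 2 t)) - (LINT t:{1..}|lborel. E (Complex 2 t))) <= (pi\<^sup>2/6 - 1) * (exp (1/4) * (sqrt pi * D))"
  proof -
   have "(LINT t:{1..}|lborel. f (Complex 2 t)) - (LINT t:{1..}|lborel. E (Complex 2 t)) = (LINT t:{1..}|lborel. f (Complex 2 t) - E (Complex 2 t))"
    by (rule set_integral_diff(2)[OF sh(2) si, symmetric]) auto
   also have "norm ... <= (\<integral>t. (pi\<^sup>2/6 - 1) * (exp (1/4) * gg D ta t) \<partial>lborel)"
    unfolding set_lebesgue_integral_def
   proof (rule bint_norm_bound)
    show "integrable lborel (%t. indicator {1..} t *\<^sub>R (f (Complex 2 t) - E (Complex 2 t)))"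
     using set_integral_diff(1)[OF sh(2) si[of "{1..}"]] by (simp add: set_integrable_def)
    show "integrable lborel (%t. (pi\<^sup>2/6 - 1) * (exp (1/4) * gg D ta t))" by (intro integrable_mult_right gg_integrable D)
    fix t :: real
    have p: "pi\<^sup>2/6 - 1 >= 0" using zeta_re2[of 0] norm_ge_zero order_trans by blast
    have "((2 - 1/2)/D)\<^sup>2 <= (1/2)\<^sup>2" using D3 by (intro power_mono) (auto simp: divide_le_eq)
    then have e: "exp (((2 - 1/2)/D)\<^sup>2) <= exp (1/4)" by (simp add: power2_eq_square)
    have "norm (f (Complex 2 t) - E (Complex 2 t)) = norm (zeta (Complex 2 t) - 1) * norm (E (Complex 2 t))"
     by (simp add: f_def norm_mult[symmetric] algebra_simps)
    also have "... <= (pi\<^sup>2/6 - 1) * (exp (1/4) * gg D ta t)"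
     unfolding nE using zeta_re2[of t] e p by (intro mult_mono mult_right_mono) (auto simp: gg_nonneg)
    finally show "norm (indicator {1..} t *\<^sub>R (f (Complex 2 t) - E (Complex 2 t))) <= (pi\<^sup>2/6 - 1) * (exp (1/4) * gg D ta t)"
     using p by (auto simp: indicator_def gg_nonneg)
   qed
   also have "... = (pi\<^sup>2/6 - 1) * (exp (1/4) * (sqrt pi * D))" using gg_integrable(2)[OF D(1), of ta] by simp
   finally show ?thesis .
  qed
  have num: "(pi\<^sup>2/6 - 1) * exp (1/4) <= 9/10"
  proof -
   have "pi * pi <= 3.15 * 3.15" using pi_approx by (intro mult_mono) auto
   then have "pi\<^sup>2/6 - 1 <= 2/3" by (simp add: power2_eq_square)
   moreover have "exp (1/4::real) <= 27/20"
    using exp_bound[of "1/4::real"] by (simp add: power2_eq_square)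
   ultimately have "(pi\<^sup>2/6 - 1) * exp (1/4) <= 2/3 * (27/20)" by (intro mult_mono) auto
   then show ?thesis by simp
  qed
  have sp: "sqrt pi >= 1" using pi_gt3 by simp
  have sh3: "norm ((LINT t:{1..}|lborel. f (Complex (1/2) t)) - (LINT t:{1..}|lborel. f (Complex 2 t))) <= 3/2 * (K * exp (9/4) * exp 4) * D * eps"
  proof -
   have "3/2 * (K * exp (9/4) * (exp 4 * gg D ta 1)) <= 3/2 * (K * exp (9/4) * (exp 4 * eps))"
    using gg_1[OF D(1), of ta] K(1) unfolding eps_def by (intro mult_left_mono) auto
   also have "... = 3/2 * (K * exp (9/4) * exp 4) * 1 * eps" by simp
   also have "... <= 3/2 * (K * exp (9/4) * exp 4) * D * eps" using K(1) D3 by (intro mult_right_mono mult_left_mono) (auto simp: eps_def)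
   finally show ?thesis using sh(3) by linarith
  qed
  have tri: "norm e <= norm h + norm (h - g) + norm (g - i) + norm j" if "e = i + j" for e g h i j :: complex
  proof -
   have "norm e = norm (h - (h - g) - (g - i) + j)" using that by simp
   then show ?thesis using norm_triangle_ineq[of "h - (h - g) - (g - i)" j] norm_triangle_ineq4[of "h - (h-g)" "g - i"] norm_triangle_ineq4[of h "h - g"] by linarith
  qed
  have "sqrt pi * D = norm (complex_of_real (sqrt pi * D))" using D by (simp only: norm_of_real) simp
  also have "... <= norm (LINT t:{1..}|lborel. f (Complex (1/2) t)) + norm ((LINT t:{1..}|lborel. f (Complex (1/2) t)) - (LINT t:{1..}|lborel. f (Complex 2 t)))
    + norm ((LINT t:{1..}|lborel. f (Complex 2 t)) - (LINT t:{1..}|lborel. E (Complex 2 t))) + norm (LINT t:{..<1}|lborel. E (Complex 2 t))"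
   by (rule tri[OF split[unfolded E_line]])
  also have "... <= (LINT t:{1..}|lborel. \<bar>RS_Z t\<bar> * gg D ta t) + 3/2 * (K * exp (9/4) * exp 4) * D * eps + (pi\<^sup>2/6 - 1) * (exp (1/4) * (sqrt pi * D)) + exp (9/4) * eps * (sqrt pi * (2*D))"
   by (intro add_mono up sh3 diff tail)
  finally have 1: "sqrt pi * D <= (LINT t:{1..}|lborel. \<bar>RS_Z t\<bar> * gg D ta t) + 3/2 * (K * exp (9/4) * exp 4) * D * eps + (pi\<^sup>2/6 - 1) * (exp (1/4) * (sqrt pi * D)) + exp (9/4) * eps * (sqrt pi * (2*D))" .
  have "(pi\<^sup>2/6 - 1) * (exp (1/4) * (sqrt pi * D)) <= 9/10 * (sqrt pi * D)"
   using mult_right_mono[OF num, of "sqrt pi * D"] D by (simp add: mult.assoc)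
  moreover have "1 * D <= sqrt pi * D" using sp D by (intro mult_right_mono) auto
  moreover have "3/2 * (K * exp (9/4) * exp 4) * D * eps + exp (9/4) * eps * (sqrt pi * (2*D)) <= C * D * eps"
  proof -
   have "C * D * eps = 3/2 * (K * exp (9/4) * exp 4) * D * eps + 2 * (exp (9/4) * eps * (sqrt pi * (2*D)))"
    by (simp add: C_def algebra_simps)
   moreover have "exp (9/4) * eps * (sqrt pi * (2*D)) >= 0" using D by (simp add: eps_def)
   ultimately show ?thesis by linarith
  qed
  ultimately show ?thesis using 1 unfolding eps_def by linarith
 qed
 moreover have "C >= 0" unfolding C_def using K(1) by simp
 ultimately show ?thesis by blast
qed


section \<open>The mean of the completed zeta function and the theta series\<close>

text \<open>The modulus of Gamma(s/2) exp (-i phi s) at s = 1/2 + it. It is the positive weight with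
  which Z enters the Gaussian mean of \<open>Lam\<close>.\<close>

definition PP :: "real => real => real" where "PP \<phi> t = norm (Gamma (Complex (1/4) (t/2))) * exp (\<phi> * t)"

text \<open>The analogue of \<open>hh\<close> for the completed zeta function: exp (-i phi s) undoes
  the decay exp (-pi t / 4) of Gamma(s/2) up to exp (-de t) when phi = pi/4 - de.\<close>

definition ff :: "real => real => real => complex => complex" where
 "ff \<phi> D ta s = Lam s * exp (- (\<i> * of_real \<phi>) * s) * exp ((s - Complex (1/2) ta)\<^sup>2 / of_real (D\<^sup>2))"

lemma of_real_powr_exp: "r > 0 ==> complex_of_real r powr z = exp (z * of_real (ln r))"
 by (simp add: powr_def Ln_of_real)

lemma exp_i_powr: "\<bar>a\<bar> < pi ==> exp (\<i> * of_real a) powr z = exp (z * (\<i> * of_real a))"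
 by (simp add: powr_def)

lemma ff_half: "ff \<phi> D ta (Complex (1/2) t) = exp (- (\<i> * of_real (\<phi>/2))) * of_real (pi powr (-1/4) * (PP \<phi> t * RS_Z t * gg D ta t))"
proof -
 have a: "exp (- (\<i> * of_real \<phi>) * Complex (1/2) t) = exp (- (\<i> * of_real (\<phi>/2))) * of_real (exp (\<phi> * t))"
  unfolding exp_of_real[symmetric] exp_add[symmetric] by (rule arg_cong[of _ _ exp]) (simp add: complex_eq_iff)
 have b: "exp ((Complex (1/2) t - Complex (1/2) ta)\<^sup>2 / of_real (D\<^sup>2)) = of_real (gg D ta t)"
 proof -
  have "Complex (1/2) t - Complex (1/2) ta = \<i> * of_real (t - ta)" by (simp add: complex_eq_iff)
  then have "(Complex (1/2) t - Complex (1/2) ta)\<^sup>2 / of_real (D\<^sup>2) = of_real (- ((t - ta)/D)\<^sup>2)"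
   by (simp add: power_mult_distrib power_divide)
  then show ?thesis unfolding gg_def by (simp only: exp_of_real)
 qed
 show ?thesis unfolding ff_def a b RS_Z_Lam(1) PP_def by simp
qed

lemma norm_ff: "norm (ff \<phi> D ta (Complex sg t)) = pi powr (-sg/2) * norm (Gamma (Complex sg t / 2)) * norm (zeta (Complex sg t)) * exp (\<phi> * t) * (exp (((sg - 1/2)/D)\<^sup>2) * gg D ta t)"
proof -
 have "norm (complex_of_real pi powr (- Complex sg t / 2)) = pi powr (-sg/2)"
  using norm_powr_real_powr[of "of_real pi" "- Complex sg t / 2"] by simp
 then show ?thesis unfolding ff_def Lam_def norm_mult norm_gauss_line by (simp add: gg_def)
qed

lemma ff_bound:
 "\<exists>C\<ge>0. \<forall>\<phi> D ta sg t. D >= 1 & 1/2 <= sg & sg <= 2 & (t >= 1 \<or> sg = 2) -->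
  norm (ff \<phi> D ta (Complex sg t)) <= C * ((1 + \<bar>t\<bar>) * exp (\<phi> * t) * gg D ta t)"
proof -
 obtain K where K: "K >= 1" "!!s. 1/2 <= Re s ==> Re s <= 2 ==> \<bar>Im s\<bar> >= 1 ==> norm (zeta s) <= K * (1 + \<bar>Im s\<bar>)"
   "!!t. norm (zeta (Complex 2 t)) <= K * (1 + \<bar>t\<bar>)"
  using zeta_bounds by blast
 obtain G where G: "G >= 0" "!!s. 1/4 <= Re s ==> Re s <= 1 ==> norm (Gamma s) <= G"
  using Gamma_strip_bound[of "1/4" 1] by auto
 have "norm (ff \<phi> D ta (Complex sg t)) <= (G * K * exp (9/4)) * ((1 + \<bar>t\<bar>) * exp (\<phi> * t) * gg D ta t)"
  if D: "D >= 1" and sg: "1/2 <= sg" "sg <= 2" and t: "t >= 1 \<or> sg = 2" for \<phi> D ta sg t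
 proof -
  have z: "norm (zeta (Complex sg t)) <= K * (1 + \<bar>t\<bar>)" using K(2)[of "Complex sg t"] K(3)[of t] sg t by auto
  have g: "norm (Gamma (Complex sg t / 2)) <= G" using sg by (intro G) auto
  have p: "pi powr (-sg/2) <= 1"
   using powr_mono[of "-sg/2" 0 pi] sg pi_gt3 by simp
  have "((sg - 1/2)/D)\<^sup>2 <= (3/2)\<^sup>2" using sg D by (intro power_mono) (auto simp: divide_le_eq)
  then have e: "exp (((sg - 1/2)/D)\<^sup>2) <= exp (9/4)" by (simp add: power2_eq_square)
  have "norm (ff \<phi> D ta (Complex sg t)) <= 1 * G * (K * (1 + \<bar>t\<bar>)) * exp (\<phi> * t) * (exp (9/4) * gg D ta t)"
   unfolding norm_ff using z g p e G K(1) gg_nonneg by (intro mult_mono mult_right_mono) auto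
  then show ?thesis by (simp add: mult_ac)
 qed
 moreover have "0 <= G * K * exp (9/4)" using G K by simp
 ultimately show ?thesis by blast
qed

lemma lborel_integral_half: "(\<integral>t. g (t/2) \<partial>lborel) = 2 * (\<integral>t. g t \<partial>lborel)" for g :: "real => complex"
 using lborel_integral_real_affine[of "1/2" g 0] by (simp add: scaleR_conv_of_real mult.commute[of _ 2])

text \<open>In the variable z = s/2 the factor Gamma(s/2) becomes Gamma(z) and pi^(-s/2) n^(-s)
  becomes (pi n^2)^(-z), so \<open>mellin_gauss_sum\<close> yields a Jacobi theta series with
  argument w exp y. The center and the width of the Gaussian are halved along with s.\<close>

lemma ff_line_2:
 assumes \<phi>: "0 < \<phi>" "\<phi> < pi/4" and D: "D > 0"
 defines "w \<equiv> exp (\<i> * of_real (2 * \<phi>))" and "la \<equiv> %k::nat. pi * (real (Suc k))\<^sup>2"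
 shows "integrable lborel (%t. ff \<phi> D ta (Complex 2 t))"
  "(\<integral>t. ff \<phi> D ta (Complex 2 t) \<partial>lborel) = of_real (sqrt pi * D) *
    (\<integral>y. (\<Sum>k. exp (- of_real (la k) * w * of_real (exp y))) * exp (Complex (1/4) (ta/2) * of_real y - of_real ((D/2*y)\<^sup>2/4)) \<partial>lborel)"
proof -
 have w: "Re w > 0" unfolding w_def using \<phi> by (simp add: Re_exp cos_gt_zero_pi)
 have D2: "D/2 > 0" using D by simp
 have la: "la k > 0" for k by (simp add: la_def)
 have sm: "summable (%k. la k powr (-1))"
 proof -
  have "summable (%k. inverse pi * real (Suc k) powr (-2))" by (intro summable_mult summable_Suc_powr) auto
  moreover have "la k powr (-1) = inverse pi * real (Suc k) powr (-2)" for k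
   by (simp add: la_def powr_minus powr_numeral)
  ultimately show ?thesis by simp
 qed
 let ?s1 = "Complex (1/4) (ta/2)"
 have eq: "ff \<phi> D ta (Complex 2 t) = Gamma (Complex 1 (t/2)) * w powr (- Complex 1 (t/2)) * (\<Sum>k. of_real (la k) powr (- Complex 1 (t/2))) * exp ((Complex 1 (t/2) - ?s1)\<^sup>2 / of_real ((D/2)\<^sup>2))" for t
 proof -
  let ?z = "Complex 1 (t/2)"
  have z2: "Complex 2 t = 2 * ?z" by (simp add: complex_eq_iff)
  have wp: "w powr (- ?z) = exp (- (\<i> * of_real \<phi>) * Complex 2 t)"
   unfolding w_def using \<phi> by (subst exp_i_powr) (auto simp: z2 intro!: arg_cong[of _ _ exp])
  have lp: "of_real (la k) powr (- ?z) = of_real pi powr (- Complex 2 t / 2) * (1 / of_nat (Suc k) powr Complex 2 t)" for k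
  proof -
   have ln: "ln (la k) = ln pi + 2 * ln (real (Suc k))" by (simp add: la_def ln_mult ln_realpow)
   have "1 / of_nat (Suc k) powr Complex 2 t = exp (- (Complex 2 t * of_real (ln (real (Suc k)))))"
    using of_real_powr_exp[of "real (Suc k)" "Complex 2 t"] by (simp add: exp_minus divide_inverse del: of_nat_Suc)
   then show ?thesis unfolding of_real_powr_exp[OF la] of_real_powr_exp[OF pi_gt_zero] ln z2
    by (simp only: exp_add[symmetric]) (rule arg_cong[of _ _ exp], simp add: algebra_simps)
  qed
  have zs: "(%k. of_real pi powr (- Complex 2 t / 2) * (1 / of_nat (Suc k) powr Complex 2 t)) sums (of_real pi powr (- Complex 2 t / 2) * zeta (Complex 2 t))"
   by (intro sums_mult zeta_spec(2)) simp
  have sum: "(\<Sum>k. of_real (la k) powr (- ?z)) = of_real pi powr (- Complex 2 t / 2) * zeta (Complex 2 t)"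
   unfolding lp using zs by (simp only: sums_unique[symmetric])
  have ge: "(Complex 2 t - Complex (1/2) ta)\<^sup>2 / of_real (D\<^sup>2) = (?z - ?s1)\<^sup>2 / of_real ((D/2)\<^sup>2)"
  proof -
   have e: "Complex 2 t - Complex (1/2) ta = 2 * (?z - ?s1)" by (simp add: complex_eq_iff)
   have gen: "(2 * x)\<^sup>2 / of_real (D\<^sup>2) = x\<^sup>2 / of_real ((D/2)\<^sup>2)" for x :: complex
    by (simp add: power_mult_distrib power_divide)
   show ?thesis unfolding e by (rule gen)
  qed
  have "Complex 2 t / 2 = ?z" by (simp add: complex_eq_iff)
  then show ?thesis unfolding ff_def Lam_def ge wp sum by (simp only: mult_ac)
 qed
 note ms = mellin_gauss_sum[OF D2 zero_less_one w la sm, of ?s1]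
 let ?g = "%t. Gamma (Complex 1 t) * w powr (- Complex 1 t) * (\<Sum>k. of_real (la k) powr (- Complex 1 t)) * exp ((Complex 1 t - ?s1)\<^sup>2 / of_real ((D/2)\<^sup>2))"
 have eq': "ff \<phi> D ta (Complex 2 t) = ?g (0 + 1/2 * t)" for t unfolding eq by simp
 show "integrable lborel (%t. ff \<phi> D ta (Complex 2 t))"
  unfolding eq' using lborel_integrable_real_affine[OF ms(1), of "1/2" 0] by simp
 have "(\<integral>t. ff \<phi> D ta (Complex 2 t) \<partial>lborel) = 2 * (\<integral>t. ?g t \<partial>lborel)"
  unfolding eq by (rule lborel_integral_half)
 then show "(\<integral>t. ff \<phi> D ta (Complex 2 t) \<partial>lborel) = of_real (sqrt pi * D) *
    (\<integral>y. (\<Sum>k. exp (- of_real (la k) * w * of_real (exp y))) * exp (Complex (1/4) (ta/2) * of_real y - of_real ((D/2*y)\<^sup>2/4)) \<partial>lborel)"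
  unfolding ms(3) by simp
qed

lemma sin_double_ge: "0 <= de ==> de <= 1/4 ==> sin (2 * de) >= (de::real)"
proof -
 assume d: "0 <= de" "de <= 1/4"
 have "(%x. sin (2*x) - x) 0 <= (%x. sin (2*x) - x) de"
 proof (rule DERIV_nonneg_imp_nondecreasing[OF d(1)], goal_cases)
  case (1 x)
  have "cos (pi/3) <= cos (2*x)" using 1 d pi_gt3 by (intro cos_monotone_0_pi_le) auto
  then have "cos (2*x) * 2 - 1 >= 0" by (simp add: cos_60)
  moreover have "((%x. sin (2*x) - x) has_real_derivative cos (2*x) * 2 - 1) (at x)"
   by (auto intro!: derivative_eq_intros)
  ultimately show ?case by blast
 qed
 then show ?thesis by simp
qed

text \<open>The theta series is estimated trivially, using Re w >= de. Any exponent above 1/2 makes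
  the sum of (n^2)^(-a) converge, and 3/5 still lies below 13/20 = 9/10 - 1/4, which is what the
  comparison in \<open>zero_gap\<close> demands.\<close>

lemma ff_line_2_bound:
 "\<exists>C\<ge>0. \<forall>de D ta. 0 < de & de <= 1/4 & D >= 1 --> norm (\<integral>t. ff (pi/4 - de) D ta (Complex 2 t) \<partial>lborel) <= C * de powr (-3/5)"
proof -
 define la where "la = (%k::nat. pi * (real (Suc k))\<^sup>2)"
 define M where "M = (3/5::real) powr (3/5)"
 have la: "la k > 0" for k by (simp add: la_def)
 have las: "summable (%k. la k powr (-3/5))"
 proof -
  have "summable (%k. pi powr (-3/5) * real (Suc k) powr (-6/5))" by (intro summable_mult summable_Suc_powr) auto
  moreover have "la k powr (-3/5) = pi powr (-3/5) * real (Suc k) powr (-6/5)" for k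
   unfolding la_def by (subst powr_mult) (auto simp: powr_powr simp del: of_nat_Suc simp flip: powr_numeral)
  ultimately show ?thesis by simp
 qed
 define S where "S = (\<Sum>k. la k powr (-3/5))"
 have S0: "S >= 0" unfolding S_def by (intro suminf_nonneg las) auto
 have "norm (\<integral>t. ff (pi/4 - de) D ta (Complex 2 t) \<partial>lborel) <= (pi * 4 * exp 1 * M * S) * de powr (-3/5)"
  if d: "0 < de" "de <= 1/4" and D: "D >= 1" for de D ta
 proof -
  define w where "w = exp (\<i> * of_real (2 * (pi/4 - de)))"
  have "Re w = cos (pi/2 - 2*de)" by (simp add: w_def Re_exp algebra_simps)
  also have "... = sin (2*de)" by (simp add: sin_cos_eq)
  finally have Rew: "Re w >= de" using sin_double_ge[of de] d by simp
  have \<phi>: "0 < pi/4 - de" "pi/4 - de < pi/4" using d pi_gt3 by auto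
  have D0: "D > 0" "D/2 > 0" using D by auto
  let ?T = "%y. (\<Sum>k. exp (- of_real (la k) * w * of_real (exp y)))"
  let ?b = "%y. M * S * de powr (-3/5) * exp (- (7/20) * y - (D/2*y)\<^sup>2/4)"
  have bi: "integrable lborel ?b" by (intro integrable_mult_right gauss_lin(1) D0)
  have Tb: "norm (?T y) <= M * S * de powr (-3/5) * exp (-(3/5) * y)" for y
  proof -
   have t: "norm (exp (- of_real (la k) * w * of_real (exp y))) <= M * de powr (-3/5) * exp (-(3/5) * y) * la k powr (-3/5)" for k
   proof -
    have "norm (exp (- of_real (la k) * w * of_real (exp y))) = exp (- (la k * Re w * exp y))" by simp
    also have "... <= exp (- (la k * de * exp y))" using Rew la[of k] by simp
    also have "... <= M * (la k * de * exp y) powr (-(3/5))"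
     unfolding M_def using la[of k] d by (intro exp_minus_le_powr) auto
    also have "(la k * de * exp y) powr (-(3/5)) = la k powr (-(3/5)) * de powr (-(3/5)) * exp (-(3/5) * y)"
     using la[of k] d by (simp add: powr_mult exp_powr_real mult_ac)
    finally show ?thesis by (simp add: mult_ac)
   qed
   have sb: "summable (%k. M * de powr (-3/5) * exp (-(3/5) * y) * la k powr (-3/5))" by (intro summable_mult las)
   have "summable (%k. norm (exp (- of_real (la k) * w * of_real (exp y))))"
    by (rule summable_comparison_test'[OF sb, of 0]) (use t in auto)
   then have "norm (?T y) <= (\<Sum>k. norm (exp (- of_real (la k) * w * of_real (exp y))))" by (rule summable_norm)
   also have "... <= (\<Sum>k. M * de powr (-3/5) * exp (-(3/5) * y) * la k powr (-3/5))"
    by (rule suminf_le[OF t _ sb]) fact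
   also have "... = M * de powr (-3/5) * exp (-(3/5) * y) * S" unfolding S_def by (rule suminf_mult[OF las])
   finally show ?thesis by (simp add: mult_ac)
  qed
  have nb: "norm (?T y * exp (Complex (1/4) (ta/2) * of_real y - of_real ((D/2*y)\<^sup>2/4))) <= ?b y" for y
  proof -
   have "norm (exp (Complex (1/4) (ta/2) * of_real y - of_real ((D/2*y)\<^sup>2/4))) = exp (1/4 * y - (D/2*y)\<^sup>2/4)" by simp
   then have "norm (?T y * exp (Complex (1/4) (ta/2) * of_real y - of_real ((D/2*y)\<^sup>2/4))) <= (M * S * de powr (-3/5) * exp (-(3/5) * y)) * exp (1/4 * y - (D/2*y)\<^sup>2/4)"
    unfolding norm_mult using Tb[of y] by (simp add: mult_right_mono)
   also have "... = M * S * de powr (-3/5) * (exp (-(3/5) * y) * exp (1/4 * y - (D/2*y)\<^sup>2/4))" by (simp only: mult.assoc)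
   also have "exp (-(3/5) * y) * exp (1/4 * y - (D/2*y)\<^sup>2/4) = exp (- (7/20) * y - (D/2*y)\<^sup>2/4)"
    unfolding exp_add[symmetric] by (rule arg_cong[of _ _ exp]) simp
   finally show ?thesis .
  qed
  have e: "(\<integral>t. ff (pi/4 - de) D ta (Complex 2 t) \<partial>lborel) = of_real (sqrt pi * D) *
    (\<integral>y. ?T y * exp (Complex (1/4) (ta/2) * of_real y - of_real ((D/2*y)\<^sup>2/4)) \<partial>lborel)"
   using ff_line_2(2)[OF \<phi> D0(1), of ta] unfolding la_def w_def .
  have "norm (\<integral>y. ?T y * exp (Complex (1/4) (ta/2) * of_real y - of_real ((D/2*y)\<^sup>2/4)) \<partial>lborel) <= (\<integral>y. ?b y \<partial>lborel)"
  proof (cases "integrable lborel (%y. ?T y * exp (Complex (1/4) (ta/2) * of_real y - of_real ((D/2*y)\<^sup>2/4)))")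
   case True
   then show ?thesis by (rule bint_norm_bound[OF _ bi nb])
  next
   case False
   have "0 <= (\<integral>y. ?b y \<partial>lborel)" using S0 by (intro Bochner_Integration.integral_nonneg) (auto simp: M_def)
   then show ?thesis using False by (simp add: not_integrable_integral_eq)
  qed
  also have "(\<integral>y. ?b y \<partial>lborel) = M * S * de powr (-3/5) * (exp ((-(7/20)/(D/2))\<^sup>2) * sqrt pi * (2/(D/2)))"
   by (subst integral_mult_right_zero, subst gauss_lin(2)[OF D0(2)]) (rule refl)
  also have "... <= M * S * de powr (-3/5) * (exp 1 * sqrt pi * (4/D))"
  proof -
   have "(7/20/(D/2))\<^sup>2 <= 1" using D by (intro power_le_one) (auto simp: divide_le_eq)
   then have "(-(7/20)/(D/2))\<^sup>2 <= 1" by (simp add: power_divide)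
   then show ?thesis using S0 D0 by (intro mult_left_mono mult_right_mono mult_mono) (auto simp: M_def)
  qed
  finally have nI: "norm (\<integral>y. ?T y * exp (Complex (1/4) (ta/2) * of_real y - of_real ((D/2*y)\<^sup>2/4)) \<partial>lborel) <= M * S * de powr (-3/5) * (exp 1 * sqrt pi * (4/D))" .
  have "\<bar>sqrt pi * D\<bar> = sqrt pi * D" using D0 by simp
  then have "norm (\<integral>t. ff (pi/4 - de) D ta (Complex 2 t) \<partial>lborel) <= sqrt pi * D * (M * S * de powr (-3/5) * (exp 1 * sqrt pi * (4/D)))"
   unfolding e norm_mult norm_of_real using mult_left_mono[OF nI, of "sqrt pi * D"] D0 by (simp only: mult_nonneg_nonneg real_sqrt_ge_zero pi_ge_zero order.strict_implies_order)
  also have "... = (sqrt pi * sqrt pi) * 4 * exp 1 * M * S * de powr (-3/5)" using D0 by (simp add: mult_ac)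
  finally show ?thesis by simp
 qed
 moreover have "0 <= pi * 4 * exp 1 * M * S" using S0 by (simp add: M_def)
 ultimately show ?thesis by blast
qed

text \<open>The half-line t >= 1 on Re s = 1/2 is exchanged for the whole line Re s = 2. The segment
  at height 1 and the part t < 1 of that line both lie in the tail of the Gaussian and contribute D
  exp (-((ta - 1)/D)^2 / 2).\<close>

lemma theta_mean_bound:
 "\<exists>C\<ge>0. \<forall>de D ta. 0 < de & de <= 1/4 & D >= 1 & ta >= 1 -->
   set_integrable lborel {1..} (%t. PP (pi/4 - de) t * RS_Z t * gg D ta t) \<and>
   \<bar>LINT t:{1..}|lborel. PP (pi/4 - de) t * RS_Z t * gg D ta t\<bar> <= C * (de powr (-3/5) + D * exp (- ((ta - 1)/D)\<^sup>2/2))"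
proof -
 obtain C1 where C1: "C1 >= 0" "!!\<phi> D ta sg t. D >= 1 ==> 1/2 <= sg ==> sg <= 2 ==> (t >= 1 \<or> sg = 2) ==>
  norm (ff \<phi> D ta (Complex sg t)) <= C1 * ((1 + \<bar>t\<bar>) * exp (\<phi> * t) * gg D ta t)" using ff_bound by blast
 obtain C2 where C2: "C2 >= 0" "!!de D ta. 0 < de ==> de <= 1/4 ==> D >= 1 ==> norm (\<integral>t. ff (pi/4 - de) D ta (Complex 2 t) \<partial>lborel) <= C2 * de powr (-3/5)"
  using ff_line_2_bound by blast
 define p where "p = pi powr (-1/4)"
 have p: "p > 0" by (simp add: p_def)
 define C where "C = (C2 + 3/2 * (C1 * exp 4) + C1 * (2 * exp 1) * (sqrt pi * 2)) / p"
 have "set_integrable lborel {1..} (%t. PP (pi/4 - de) t * RS_Z t * gg D ta t) \<and>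
   \<bar>LINT t:{1..}|lborel. PP (pi/4 - de) t * RS_Z t * gg D ta t\<bar> <= C * (de powr (-3/5) + D * exp (- ((ta - 1)/D)\<^sup>2/2))"
  if d: "0 < de" "de <= 1/4" and D: "D >= 1" and tau: "ta >= 1" for de D ta
 proof -
  define \<phi> where "\<phi> = pi/4 - de"
  have \<phi>: "1/2 <= \<phi>" "\<phi> <= 1" "\<phi> < pi/4" using d pi_gt3 pi_less_4 by (auto simp: \<phi>_def)
  have D0: "D > 0" "2 * D > 0" using D by auto
  define eps where "eps = exp (- ((ta - 1)/D)\<^sup>2/2)"
  let ?f = "ff \<phi> D ta"
  have holo: "?f holomorphic_on {s. Im s > 0}"
  proof -
   have "zeta holomorphic_on {s. Im s > 0}" by (rule holomorphic_on_subset[OF zeta_spec(1)]) auto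
   moreover have "(%s. Gamma (s/2)) holomorphic_on {s. Im s > 0}"
    by (rule holomorphic_Gamma') (auto intro!: holomorphic_intros elim!: nonpos_Ints_cases)
   moreover have "z / 2 \<notin> \<int>\<^sub>\<le>\<^sub>0" if "Im z > 0" for z using that
    by (auto elim!: nonpos_Ints_cases simp: complex_eq_iff)
   ultimately show ?thesis unfolding ff_def Lam_def using D by (intro holomorphic_intros) auto
  qed
  have bnd: "norm (?f (Complex sg t)) <= C1 * (exp (4 * t) * gg D ta t)" if "1/2 <= sg" "sg <= 2" "t >= 1" for sg t
  proof -
   have "(1 + \<bar>t\<bar>) * exp (\<phi> * t) <= exp t * exp (3 * t)"
   proof (rule mult_mono)
    show "1 + \<bar>t\<bar> <= exp t" using exp_ge_add_one_self[of t] that by simp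
    have "\<phi> * t <= 3 * t" using \<phi> that by (intro mult_right_mono) auto
    then show "exp (\<phi> * t) <= exp (3 * t)" by simp
   qed auto
   also have "... = exp (4 * t)" by (simp add: exp_add[symmetric])
   finally have "(1 + \<bar>t\<bar>) * exp (\<phi> * t) * gg D ta t <= exp (4 * t) * gg D ta t" by (intro mult_right_mono gg_nonneg)
   then show ?thesis using C1(2)[of D sg t \<phi> ta] D that C1(1) by (smt (verit) mult_left_mono)
  qed
  note sh = gg_shift[OF holo D0(1) bnd]
  have i2: "integrable lborel (%t. ?f (Complex 2 t))" using \<phi> by (intro ff_line_2(1) D0) auto
  have si: "set_integrable lborel A (%t. ?f (Complex 2 t))" if "A \<in> sets borel" for A
   unfolding set_integrable_def using that i2 by (intro integrable_mult_indicator) auto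
  have split: "(\<integral>t. ?f (Complex 2 t) \<partial>lborel) = (LINT t:{1..}|lborel. ?f (Complex 2 t)) + (LINT t:{..<1}|lborel. ?f (Complex 2 t))"
  proof -
   have "(LINT t:{1..} \<union> {..<1}|lborel. ?f (Complex 2 t)) = (LINT t:{1..}|lborel. ?f (Complex 2 t)) + (LINT t:{..<1}|lborel. ?f (Complex 2 t))"
    by (rule set_integral_Un[OF _ si si]) auto
   moreover have "{1..} \<union> {..<1} = (UNIV::real set)" by auto
   ultimately show ?thesis by (simp add: set_lebesgue_integral_def)
  qed
  have tail: "norm (LINT t:{..<1}|lborel. ?f (Complex 2 t)) <= C1 * (2 * exp 1) * eps * (sqrt pi * (2*D))"
  proof -
   have "norm (LINT t:{..<1}|lborel. ?f (Complex 2 t)) <= (\<integral>t. C1 * (2 * exp 1) * eps * gg (2*D) ta t \<partial>lborel)"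
    unfolding set_lebesgue_integral_def
   proof (rule bint_norm_bound)
    show "integrable lborel (%t. indicator {..<1} t *\<^sub>R ?f (Complex 2 t))" using si[of "{..<1}"] by (simp add: set_integrable_def)
    show "integrable lborel (%t. C1 * (2 * exp 1) * eps * gg (2*D) ta t)" by (intro integrable_mult_right gg_integrable D0)
    fix t :: real
    show "norm (indicator {..<1} t *\<^sub>R ?f (Complex 2 t)) <= C1 * (2 * exp 1) * eps * gg (2*D) ta t"
    proof (cases "t < 1")
     case True
     have "(1 + \<bar>t\<bar>) * exp (\<phi> * t) <= 2 * exp 1"
     proof (cases "t >= 0")
      case True
      have "\<phi> * t <= 1 * 1" using True \<open>t < 1\<close> \<phi> by (intro mult_mono) auto
      then show ?thesis using True \<open>t < 1\<close> by (intro mult_mono) auto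
     next
      case False
      have "1 + \<bar>t\<bar> <= 2 * (1 + \<bar>t\<bar>/2)" by simp
      also have "... <= 2 * exp (\<bar>t\<bar>/2)" by (intro mult_left_mono exp_ge_add_one_self) auto
      finally have a: "1 + \<bar>t\<bar> <= 2 * exp (\<bar>t\<bar>/2)" .
      have "\<phi> * t <= 1/2 * t" using False \<phi> by (intro mult_right_mono_neg) auto
      then have "exp (\<phi> * t) <= exp (- (\<bar>t\<bar>/2))" using False by simp
      with a have "(1 + \<bar>t\<bar>) * exp (\<phi> * t) <= (2 * exp (\<bar>t\<bar>/2)) * exp (- (\<bar>t\<bar>/2))" by (intro mult_mono) auto
      also have "... = 2" by (simp add: exp_minus)
      also have "... <= 2 * exp 1" by simp
      finally show ?thesis .
     qed
     then have "(1 + \<bar>t\<bar>) * exp (\<phi> * t) * gg D ta t <= 2 * exp 1 * (eps * gg (2*D) ta t)"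
      using gg_left_tail[OF D0(1) tau True] unfolding eps_def by (rule mult_mono) (auto simp: gg_nonneg)
     then have "C1 * ((1 + \<bar>t\<bar>) * exp (\<phi> * t) * gg D ta t) <= C1 * (2 * exp 1 * (eps * gg (2*D) ta t))" using C1(1) by (intro mult_left_mono)
     moreover have "norm (?f (Complex 2 t)) <= C1 * ((1 + \<bar>t\<bar>) * exp (\<phi> * t) * gg D ta t)" using D by (intro C1(2)) auto
     ultimately show ?thesis using True by (simp add: mult.assoc)
    qed (use C1(1) in \<open>simp add: gg_nonneg eps_def\<close>)
   qed
   also have "... = C1 * (2 * exp 1) * eps * (sqrt pi * (2*D))" using gg_integrable(2)[OF D0(2), of ta] by simp
   finally show ?thesis .
  qed
  have sh3: "norm ((LINT t:{1..}|lborel. ?f (Complex (1/2) t)) - (LINT t:{1..}|lborel. ?f (Complex 2 t))) <= 3/2 * (C1 * exp 4) * (D * eps)"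
  proof -
   have "3/2 * (C1 * (exp 4 * gg D ta 1)) <= 3/2 * (C1 * (exp 4 * eps))"
    using gg_1[OF D0(1), of ta] C1(1) unfolding eps_def by (intro mult_left_mono) auto
   also have "... = 3/2 * (C1 * exp 4) * (1 * eps)" by simp
   also have "... <= 3/2 * (C1 * exp 4) * (D * eps)" using C1(1) D by (intro mult_right_mono mult_left_mono) (auto simp: eps_def)
   finally show ?thesis using sh(3) by linarith
  qed
  let ?g = "%t. PP \<phi> t * RS_Z t * gg D ta t"
  define q where "q = exp (- (\<i> * of_real (\<phi>/2)))"
  have q: "norm q = 1" "q ~= 0" by (simp_all add: q_def)
  have fh: "?f (Complex (1/2) t) = q * of_real p * of_real (?g t)" for t
   unfolding ff_half q_def p_def by simp
  have gi: "set_integrable lborel {1..} ?g"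
  proof -
   have "set_integrable lborel {1..} (%t. complex_of_real (?g t))"
    using set_integrable_mult_right[OF sh(1), of "1 / (q * of_real p)"] q p unfolding fh by simp
   then have "set_integrable lborel {1..} (%t. Re (complex_of_real (?g t)))"
    unfolding set_integrable_def using integrable_Re by fastforce
   then show ?thesis by simp
  qed
  have eq: "norm (LINT t:{1..}|lborel. ?f (Complex (1/2) t)) = p * \<bar>LINT t:{1..}|lborel. ?g t\<bar>"
  proof -
   have "(LINT t:{1..}|lborel. ?f (Complex (1/2) t)) = q * of_real p * of_real (LINT t:{1..}|lborel. ?g t)"
    unfolding fh by (subst set_integral_mult_right, subst set_integral_complex_of_real) (rule refl)
   then show ?thesis using q p by (simp add: norm_mult)
  qed
  have tri: "norm a <= norm (a - b) + norm e + norm j" if "e = b + j" for a b e j :: complex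
  proof -
   have "norm a = norm ((a - b) + e - j)" using that by simp
   then show ?thesis using norm_triangle_ineq4[of "(a - b) + e" j] norm_triangle_ineq[of "a - b" e] by linarith
  qed
  have c2: "norm (\<integral>t. ?f (Complex 2 t) \<partial>lborel) <= C2 * de powr (-3/5)" unfolding \<phi>_def by (rule C2(2)[OF d D])
  have fin: "p * \<bar>LINT t:{1..}|lborel. ?g t\<bar> <= 3/2 * (C1 * exp 4) * (D * eps) + C2 * de powr (-3/5) + C1 * (2 * exp 1) * eps * (sqrt pi * (2*D))"
   unfolding eq[symmetric] by (rule order_trans[OF tri[OF split] add_mono[OF add_mono[OF sh3 c2] tail]])
  have gen: "x * Y + y * X + z * Y <= (y + x + z) * (X + Y)" if "x >= 0" "y >= 0" "z >= 0" "X >= 0" "Y >= 0" for x y z X Y :: real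
   using that by (simp add: algebra_simps)
  have "p * \<bar>LINT t:{1..}|lborel. ?g t\<bar> <= (p * C) * (de powr (-3/5) + D * eps)"
  proof -
   have "3/2 * (C1 * exp 4) * (D * eps) + C2 * de powr (-3/5) + C1 * (2 * exp 1) * (sqrt pi * 2) * (D * eps) <= (p * C) * (de powr (-3/5) + D * eps)"
    using gen[of "3/2 * (C1 * exp 4)" C2 "C1 * (2 * exp 1) * (sqrt pi * 2)" "de powr (-3/5)" "D * eps"] C1 C2 D p
    unfolding C_def by (simp add: eps_def)
   then show ?thesis using fin by (simp add: mult_ac)
  qed
  then have "\<bar>LINT t:{1..}|lborel. ?g t\<bar> <= C * (de powr (-3/5) + D * eps)" using p by (simp add: mult.assoc)
  then show ?thesis using gi unfolding \<phi>_def eps_def by blast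
 qed
 moreover have "C >= 0" unfolding C_def using C1 C2 p by simp
 ultimately show ?thesis by blast
qed


text \<open>The quantity is the modulus of Gamma(s) w^(-s) with s = 1/4 + it/2 and w = exp (i (pi/2
  - 2 de)). Euler's integral and Re w >= de give a bound uniform in t, intended for points far from
  the centre of the Gaussian.\<close>

lemma PP_upper: "\<exists>C\<ge>0. \<forall>de t. 0 < de & de <= 1/4 --> PP (pi/4 - de) t <= C * de powr (-1/4)"
proof (intro exI[of _ "Gamma (1/4)"] conjI allI impI)
 show "0 <= Gamma (1/4::real)" by (intro Gamma_real_nonneg) auto
 fix de t :: real assume d: "0 < de & de <= 1/4"
 define a where "a = 2 * (pi/4 - de)"
 define w where "w = exp (\<i> * of_real a)"
 let ?s = "Complex (1/4) (t/2)"
 have "Re w = cos (pi/2 - 2*de)" by (simp add: w_def a_def Re_exp algebra_simps)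
 also have "... = sin (2*de)" by (simp add: sin_cos_eq)
 finally have Rew: "Re w >= de" using sin_double_ge[of de] d by simp
 then have Rw: "Re w > 0" using d by linarith
 have wp: "w powr (- ?s) = exp (- ?s * (\<i> * of_real a))"
  unfolding w_def using d pi_gt3 by (intro exp_i_powr) (auto simp: a_def)
 have "PP (pi/4 - de) t = norm (Gamma ?s * w powr (- ?s))"
  unfolding PP_def wp norm_mult by (simp add: a_def mult.commute)
 also have "... = norm (\<integral>y. exp (- w * of_real (exp y)) * exp (?s * of_real y) \<partial>lborel)"
  by (subst Gamma_exp_integral_complex) (use Rw in auto)
 also have "... <= (\<integral>y. norm (exp (- w * of_real (exp y)) * exp (?s * of_real y)) \<partial>lborel)" by (rule integral_norm_bound)
 also have "... = (\<integral>y. exp (- Re w * exp y) * exp (1/4 * y) \<partial>lborel)" by (simp add: norm_mult)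
 also have "... = Gamma (1/4) * Re w powr (-(1/4))" using Rw by (intro Gamma_exp_integral_norm(2)) auto
 also have "... <= Gamma (1/4) * de powr (-(1/4))"
  using Rew d by (intro mult_left_mono powr_mono2' Gamma_real_nonneg) auto
 finally show "PP (pi/4 - de) t <= Gamma (1/4) * de powr (-1/4)" by simp
qed

lemma PP_lower: "\<exists>c>0. \<forall>de t. t >= 1 --> c * t powr (-1/4) * exp (- de * t) <= PP (pi/4 - de) t"
proof -
 obtain c where c: "c > 0" "!!y. y >= 1/2 ==> norm (Gamma (Complex (1/4) y)) >= c * y powr (-1/4) * exp (- (pi * y / 2))"
  using Gamma_quarter_lower by blast
 have "c * t powr (-1/4) * exp (- de * t) <= PP (pi/4 - de) t" if t: "t >= 1" for de t
 proof -
  have "c * t powr (-1/4) * exp (- de * t) = c * t powr (-1/4) * exp (- (pi * (t/2) / 2)) * exp ((pi/4 - de) * t)"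
   unfolding mult.assoc exp_add[symmetric] by (simp add: algebra_simps)
  also have "... <= c * (t/2) powr (-1/4) * exp (- (pi * (t/2) / 2)) * exp ((pi/4 - de) * t)"
   using t c(1) by (intro mult_right_mono mult_left_mono powr_mono2') auto
  also have "... <= norm (Gamma (Complex (1/4) (t/2))) * exp ((pi/4 - de) * t)"
   using t by (intro mult_right_mono c) auto
  finally show ?thesis unfolding PP_def .
 qed
 then show ?thesis using c(1) by blast
qed

text \<open>If \<open>Z\<close> had constant sign near \<open>\<tau>\<close>, then the mean of \<open>\<Lambda>(1/2 + it)\<close> against
  a Gaussian would be as large as that of its modulus, which is at least of order
  \<open>D \<tau>\<^sup>-\<^sup>1\<^sup>/\<^sup>4\<close>; but the theta function only allows \<open>\<tau>\<^sup>3\<^sup>/\<^sup>5\<close>.\<close>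

lemma zero_gap:
 "\<forall>\<^sub>F T in at_top. \<forall>ta. T/2 <= ta & ta <= 3 * T --> (\<exists>t. \<bar>t - ta\<bar> <= ln T * T powr (9/10) & RS_Z t = 0)"
proof -
 obtain C1 where C1: "C1 >= 0" "!!de D ta. 0 < de ==> de <= 1/4 ==> D >= 1 ==> ta >= 1 ==>
   set_integrable lborel {1..} (%t. PP (pi/4 - de) t * RS_Z t * gg D ta t) \<and>
   \<bar>LINT t:{1..}|lborel. PP (pi/4 - de) t * RS_Z t * gg D ta t\<bar> <= C1 * (de powr (-3/5) + D * exp (- ((ta - 1)/D)\<^sup>2/2))"
  using theta_mean_bound by blast
 obtain C2 where C2: "C2 >= 0" "!!D ta. D >= 3 ==> ta >= 1 ==> 1/10 * D - C2 * D * exp (- ((ta - 1)/D)\<^sup>2/2) <= (LINT t:{1..}|lborel. \<bar>RS_Z t\<bar> * gg D ta t)"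
  using zeta_abs_mean_lower by blast
 obtain C3 where C3: "C3 >= 0" "!!de t. 0 < de ==> de <= 1/4 ==> PP (pi/4 - de) t <= C3 * de powr (-1/4)" using PP_upper by blast
 obtain c where c: "c > 0" "!!de t. t >= 1 ==> c * t powr (-1/4) * exp (- de * t) <= PP (pi/4 - de) t" using PP_lower by blast
 obtain K where K: "K >= 0" "!!D ta. D >= 1 ==> ta >= 1 ==> (\<integral>t. (RS_Z t)\<^sup>2 * gg D ta t \<partial>lborel) <= K * (ta\<^sup>2 + D\<^sup>2) * D"
  using Z2_gg_bound by blast
 \<comment> \<open>For 1 <= t <= 4 T and de = 1/T the lower bound of \<open>PP_lower\<close> is at
   least a T^(-1/4).\<close>
 define a where "a = c * 4 powr (-1/4) * exp (-4)"
 have a: "a > 0" using c by (simp add: a_def)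
 define EE where "EE = (%T::real. exp (- ((T/2 - 1)/T powr (9/10))\<^sup>2/2))"
 define RR where "RR = (%T::real. (a * T powr (-1/4) + C3 * T powr (1/4)) * exp (- (ln T)\<^sup>2/2) * (2 * sqrt pi * T + K * (13 * T\<^sup>2) * (2 * T)))"
 have ev1: "\<forall>\<^sub>F T::real in at_top. ln T * T powr (9/10) <= T/4" by real_asymp
 have ev2: "\<forall>\<^sub>F T::real in at_top. T powr (9/10) >= 3" by real_asymp
 have ev3: "\<forall>\<^sub>F T in at_top. C2 * EE T <= 1/20" unfolding EE_def by real_asymp
 have ev4: "\<forall>\<^sub>F T in at_top. RR T <= 1" unfolding RR_def using a by real_asymp
 have ev5: "\<forall>\<^sub>F T in at_top. C1 * (T powr (9/10) * EE T) <= 1" unfolding EE_def by real_asymp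
 \<comment> \<open>The contradiction: T^(3/5) on the left against T^(9/10 - 1/4) = T^(13/20) on the
   right.\<close>
 have ev6: "\<forall>\<^sub>F T::real in at_top. C1 * T powr (3/5) + 2 < a * T powr (-1/4) * (1/20 * T powr (9/10))"
  using a C1(1) by real_asymp
 show ?thesis using ev1 ev2 ev3 ev4 ev5 ev6 eventually_ge_at_top[of 4]
 proof eventually_elim
  fix T :: real
  assume T: "ln T * T powr (9/10) <= T/4" "T powr (9/10) >= 3" "C2 * EE T <= 1/20" "RR T <= 1" "C1 * (T powr (9/10) * EE T) <= 1"
   "C1 * T powr (3/5) + 2 < a * T powr (-1/4) * (1/20 * T powr (9/10))" "4 <= T"
  show "\<forall>ta. T/2 <= ta & ta <= 3 * T --> (\<exists>t. \<bar>t - ta\<bar> <= ln T * T powr (9/10) & RS_Z t = 0)"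
  proof (intro allI impI, rule ccontr)
   fix ta assume tau: "T/2 <= ta & ta <= 3 * T" and no: "\<not> (\<exists>t. \<bar>t - ta\<bar> <= ln T * T powr (9/10) & RS_Z t = 0)"
   define D where "D = T powr (9/10)"
   define L where "L = ln T"
   define de where "de = 1/T"
   define eps where "eps = exp (- L\<^sup>2/2)"
   have D: "D >= 3" "D > 0" "2*D > 0" "D >= 1" "2*D >= 1" using T by (auto simp: D_def)
   have DT: "D <= T" unfolding D_def using T powr_mono[of "9/10" 1 T] by simp
   have L0: "L >= 0" using T by (simp add: L_def)
   have de: "0 < de" "de <= 1/4" using T by (auto simp: de_def)
   have dp: "de powr (-1/4) = T powr (1/4)" "de powr (-3/5) = T powr (3/5)" using T by (simp_all add: de_def powr_def ln_div)
   have tau1: "ta >= 1" using tau T by linarith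
   have nz: "RS_Z t ~= 0" if "\<bar>t - ta\<bar> <= L * D" for t using no that unfolding L_def D_def by blast
   have sgn: "\<exists>sg. (sg = 1 \<or> sg = -1) & (\<forall>t. \<bar>t - ta\<bar> <= L * D --> \<bar>RS_Z t\<bar> = sg * RS_Z t)"
   proof -
    have cn: "connected (RS_Z ` {ta - L*D..ta + L*D})"
     by (intro connected_continuous_image continuous_on_subset[OF RS_Z_cont]) auto
    have n0: "0 \<notin> RS_Z ` {ta - L*D..ta + L*D}"
    proof
     assume "0 \<in> RS_Z ` {ta - L*D..ta + L*D}"
     then obtain t where "RS_Z t = 0" "\<bar>t - ta\<bar> <= L * D" by (auto simp: abs_le_iff)
     with nz show False by blast
    qed
    have in': "RS_Z t \<in> RS_Z ` {ta - L*D..ta + L*D}" if "\<bar>t - ta\<bar> <= L * D" for t using that by (auto simp: abs_le_iff)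
    show ?thesis
    proof (cases "RS_Z ta > 0")
     case True
     have "RS_Z t > 0" if t: "\<bar>t - ta\<bar> <= L * D" for t
     proof (rule ccontr)
      assume "\<not> RS_Z t > 0"
      then have "0 \<in> RS_Z ` {ta - L*D..ta + L*D}"
       using connected_contains_Icc[OF cn in'[OF t] in'[of ta]] True L0 D by auto
      with n0 show False by blast
     qed
     then show ?thesis by (intro exI[of _ 1]) fastforce
    next
     case False
     have "RS_Z t < 0" if t: "\<bar>t - ta\<bar> <= L * D" for t
     proof (rule ccontr)
      assume "\<not> RS_Z t < 0"
      then have "0 \<in> RS_Z ` {ta - L*D..ta + L*D}"
       using connected_contains_Icc[OF cn in'[of ta] in'[OF t]] False L0 D by auto
      with n0 show False by blast
     qed
     then show ?thesis by (intro exI[of _ "-1"]) fastforce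
    qed
   qed
   then obtain sg where sg: "sg = 1 \<or> sg = -1" "!!t. \<bar>t - ta\<bar> <= L * D ==> \<bar>RS_Z t\<bar> = sg * RS_Z t" by blast
   define p where "p = a * T powr (-1/4)"
   have p0: "p > 0" unfolding p_def using a T by simp
   define P where "P = PP (pi/4 - de)"
   define q where "q = C3 * T powr (1/4)"
   have P0: "P t >= 0" for t by (simp add: P_def PP_def)
   have Pq: "P t <= q" for t
    using C3(2)[OF de, of t] unfolding dp P_def q_def .
   have q0: "q >= 0" using C3 by (simp add: q_def)
   have Pp: "p <= P t" if t: "\<bar>t - ta\<bar> <= L * D" for t
   proof -
    have tt: "1 <= t" "t <= 4 * T" using t T(1) tau T(7) unfolding L_def D_def by linarith+
    have "p = c * (4 * T) powr (-1/4) * exp (- 4)" using T by (simp add: p_def a_def powr_mult)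
    also have "... <= c * t powr (-1/4) * exp (- de * t)"
    proof (intro mult_mono)
     show "(4 * T) powr (-1/4) <= t powr (-1/4)" using tt by (intro powr_mono2') auto
     have "de * t <= 4" using tt T by (simp add: de_def divide_le_eq)
     then show "exp (- 4) <= exp (- de * t)" by simp
    qed (use c in auto)
    also have "... <= P t" unfolding P_def using tt by (intro c)
    finally show ?thesis .
   qed
   let ?t = "%t. (p + q) * eps * ((1 + (RS_Z t)\<^sup>2) * gg (2*D) ta t)"
   \<comment> \<open>Inside the window |Z| = sg Z and P >= p. Outside it the Gaussian tail pays for
     the modulus and for the signed term, and |Z| <= 1 + Z^2 reduces both to the mean
     square.\<close>
   have pw: "p * (\<bar>RS_Z t\<bar> * gg D ta t) <= sg * (P t * RS_Z t * gg D ta t) + ?t t" for t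
   proof (cases "\<bar>t - ta\<bar> <= L * D")
    case True
    have "p * (\<bar>RS_Z t\<bar> * gg D ta t) <= P t * (\<bar>RS_Z t\<bar> * gg D ta t)"
     using Pp[OF True] by (intro mult_right_mono) (auto simp: gg_nonneg)
    also have "... = sg * (P t * RS_Z t * gg D ta t)" using sg(2)[OF True] by (simp add: mult_ac)
    finally show ?thesis using p0 q0 by (simp add: eps_def gg_nonneg add_increasing2)
   next
    case False
    have g: "gg D ta t <= eps * gg (2*D) ta t"
     using exp_neg_gg[of "L*D" t ta D] False L0 D unfolding eps_def by simp
    have z: "\<bar>RS_Z t\<bar> <= 1 + (RS_Z t)\<^sup>2"
     using zero_le_power2[of "\<bar>RS_Z t\<bar> - 1/2"] by (simp add: power2_eq_square algebra_simps)
    have h: "\<bar>RS_Z t\<bar> * gg D ta t <= eps * ((1 + (RS_Z t)\<^sup>2) * gg (2*D) ta t)"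
     using mult_mono[OF z g] by (simp add: gg_nonneg mult_ac)
    have "- sg * (P t * RS_Z t * gg D ta t) <= q * (\<bar>RS_Z t\<bar> * gg D ta t)"
    proof -
     have "- sg * RS_Z t <= \<bar>RS_Z t\<bar>" using sg(1) by auto
     then have "P t * (- sg * RS_Z t) * gg D ta t <= P t * \<bar>RS_Z t\<bar> * gg D ta t" using P0 by (intro mult_right_mono mult_left_mono gg_nonneg)
     also have "... <= q * \<bar>RS_Z t\<bar> * gg D ta t" using Pq by (intro mult_right_mono gg_nonneg) auto
     finally show ?thesis by (simp add: mult_ac)
    qed
    then have "p * (\<bar>RS_Z t\<bar> * gg D ta t) - sg * (P t * RS_Z t * gg D ta t) <= (p + q) * (\<bar>RS_Z t\<bar> * gg D ta t)" by (simp add: algebra_simps)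
    also have "... <= (p + q) * (eps * ((1 + (RS_Z t)\<^sup>2) * gg (2*D) ta t))" using p0 q0 by (intro mult_left_mono h) auto
    finally show ?thesis by (simp add: mult.assoc)
   qed
   have i0: "integrable lborel (%t. (1 + (RS_Z t)\<^sup>2) * gg (2*D) ta t)"
    using Bochner_Integration.integrable_add[OF gg_integrable(1)[OF D(3), of ta] Z2_gg_integrable[OF D(3), of ta]] by (simp add: distrib_right)
   have v0: "(\<integral>t. (1 + (RS_Z t)\<^sup>2) * gg (2*D) ta t \<partial>lborel) <= 2 * sqrt pi * T + K * (13 * T\<^sup>2) * (2*T)"
   proof -
    have "(\<integral>t. (1 + (RS_Z t)\<^sup>2) * gg (2*D) ta t \<partial>lborel) = sqrt pi * (2*D) + (\<integral>t. (RS_Z t)\<^sup>2 * gg (2*D) ta t \<partial>lborel)"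
     using Bochner_Integration.integral_add[OF gg_integrable(1)[OF D(3), of ta] Z2_gg_integrable[OF D(3), of ta]] gg_integrable(2)[OF D(3), of ta] by (simp add: distrib_right)
    also have "... <= sqrt pi * (2*D) + K * (ta\<^sup>2 + (2*D)\<^sup>2) * (2*D)" using K(2)[OF D(5) tau1] by simp
    also have "... <= sqrt pi * (2*T) + K * ((3*T)\<^sup>2 + (2*T)\<^sup>2) * (2*T)"
     using DT D tau tau1 K(1) by (intro add_mono mult_mono mult_left_mono power_mono) auto
    finally show ?thesis by (simp add: power_mult_distrib)
   qed
   have i3: "integrable lborel (%t. indicator {1..} t *\<^sub>R ?t t)"
    by (intro integrable_mult_indicator integrable_mult_right i0) auto
   have v3: "(\<integral>t. indicator {1..} t *\<^sub>R ?t t \<partial>lborel) <= RR T"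
   proof -
    have "(\<integral>t. indicator {1..} t *\<^sub>R ?t t \<partial>lborel) <= (\<integral>t. ?t t \<partial>lborel)"
     using p0 q0 by (intro integral_mono i3 integrable_mult_right i0) (auto simp: indicator_def eps_def gg_nonneg)
    also have "... = (p + q) * eps * (\<integral>t. (1 + (RS_Z t)\<^sup>2) * gg (2*D) ta t \<partial>lborel)" by simp
    also have "... <= (p + q) * eps * (2 * sqrt pi * T + K * (13 * T\<^sup>2) * (2*T))"
     using p0 q0 by (intro mult_left_mono v0) (auto simp: eps_def)
    also have "... = RR T" unfolding RR_def p_def q_def eps_def L_def by (simp only: mult_ac)
    finally show ?thesis .
   qed
   have i1: "integrable lborel (%t. indicator {1..} t *\<^sub>R (P t * RS_Z t * gg D ta t))"
    and b1: "\<bar>\<integral>t. indicator {1..} t *\<^sub>R (P t * RS_Z t * gg D ta t) \<partial>lborel\<bar> <= C1 * (de powr (-3/5) + D * exp (- ((ta - 1)/D)\<^sup>2/2))"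
    using C1(2)[OF de D(4) tau1] unfolding P_def set_integrable_def set_lebesgue_integral_def by blast+
   have i2: "integrable lborel (%t. indicator {1..} t *\<^sub>R (\<bar>RS_Z t\<bar> * gg D ta t))"
   proof (rule integrable_mult_indicator)
    show "integrable lborel (%t. \<bar>RS_Z t\<bar> * gg D ta t)"
    proof (rule bint_dominated[OF Bochner_Integration.integrable_add[OF gg_integrable(1)[OF D(2), of ta] Z2_gg_integrable[OF D(2), of ta]]])
     show "AE t in lborel. norm (\<bar>RS_Z t\<bar> * gg D ta t) <= norm (gg D ta t + (RS_Z t)\<^sup>2 * gg D ta t)"
     proof (rule AE_I2)
      fix t :: real
      have z: "\<bar>RS_Z t\<bar> <= 1 + (RS_Z t)\<^sup>2"
       using zero_le_power2[of "\<bar>RS_Z t\<bar> - 1/2"] by (simp add: power2_eq_square algebra_simps)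
      have "\<bar>RS_Z t\<bar> * gg D ta t <= (1 + (RS_Z t)\<^sup>2) * gg D ta t" by (intro mult_right_mono z gg_nonneg)
      then show "norm (\<bar>RS_Z t\<bar> * gg D ta t) <= norm (gg D ta t + (RS_Z t)\<^sup>2 * gg D ta t)"
       by (simp add: distrib_right gg_nonneg abs_mult)
     qed
    qed measurable
   qed auto
   have E: "exp (- ((ta - 1)/D)\<^sup>2/2) <= EE T"
   proof -
    have "((T/2 - 1)/D)\<^sup>2 <= ((ta - 1)/D)\<^sup>2" using tau T D by (intro power_mono divide_right_mono) auto
    then show ?thesis unfolding EE_def D_def by simp
   qed
   have "p * (\<integral>t. indicator {1..} t *\<^sub>R (\<bar>RS_Z t\<bar> * gg D ta t) \<partial>lborel) = (\<integral>t. p * (indicator {1..} t *\<^sub>R (\<bar>RS_Z t\<bar> * gg D ta t)) \<partial>lborel)" by simp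
   also have "... <= (\<integral>t. sg * (indicator {1..} t *\<^sub>R (P t * RS_Z t * gg D ta t)) + indicator {1..} t *\<^sub>R ?t t \<partial>lborel)"
   proof (rule integral_mono)
    fix t :: real
    show "p * (indicator {1..} t *\<^sub>R (\<bar>RS_Z t\<bar> * gg D ta t)) <= sg * (indicator {1..} t *\<^sub>R (P t * RS_Z t * gg D ta t)) + indicator {1..} t *\<^sub>R ?t t"
     using pw[of t] by (cases "t >= 1") auto
   qed (intro Bochner_Integration.integrable_add integrable_mult_right i1 i2 i3)+
   also have "... = sg * (\<integral>t. indicator {1..} t *\<^sub>R (P t * RS_Z t * gg D ta t) \<partial>lborel) + (\<integral>t. indicator {1..} t *\<^sub>R ?t t \<partial>lborel)"
    by (subst Bochner_Integration.integral_add[OF integrable_mult_right[OF i1] i3]) simp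
   also have "... <= C1 * (de powr (-3/5) + D * exp (- ((ta - 1)/D)\<^sup>2/2)) + RR T"
   proof (rule add_mono[OF _ v3])
    show "sg * (\<integral>t. indicator {1..} t *\<^sub>R (P t * RS_Z t * gg D ta t) \<partial>lborel) <= C1 * (de powr (-3/5) + D * exp (- ((ta - 1)/D)\<^sup>2/2))"
     using b1 sg(1) by auto
   qed
   also have "... <= C1 * (T powr (3/5) + D * EE T) + 1"
   proof (intro add_mono mult_left_mono C1(1) T(4) E)
    show "de powr (-3/5) <= T powr (3/5)" by (simp only: dp order_refl)
   qed (use D in auto)
   also have "... <= C1 * T powr (3/5) + 2" using T(5) by (simp add: D_def distrib_left)
   finally have fin: "p * (\<integral>t. indicator {1..} t *\<^sub>R (\<bar>RS_Z t\<bar> * gg D ta t) \<partial>lborel) <= C1 * T powr (3/5) + 2" .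
   have "1/20 * D <= 1/10 * D - C2 * D * exp (- ((ta - 1)/D)\<^sup>2/2)"
   proof -
    have "C2 * exp (- ((ta - 1)/D)\<^sup>2/2) <= 1/20" using mult_left_mono[OF E C2(1)] T(3) by linarith
    then have "(C2 * exp (- ((ta - 1)/D)\<^sup>2/2)) * D <= 1/20 * D" using D by (intro mult_right_mono) auto
    then show ?thesis by (simp add: mult_ac)
   qed
   also have "... <= (\<integral>t. indicator {1..} t *\<^sub>R (\<bar>RS_Z t\<bar> * gg D ta t) \<partial>lborel)"
    using C2(2)[OF D(1) tau1] unfolding set_lebesgue_integral_def .
   finally have "p * (1/20 * D) <= p * (\<integral>t. indicator {1..} t *\<^sub>R (\<bar>RS_Z t\<bar> * gg D ta t) \<partial>lborel)" using p0 by (intro mult_left_mono) auto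
   with fin T(6) show False unfolding p_def D_def by linarith
  qed
 qed
qed


section \<open>Isolated zeros and strict monotonicity\<close>

text \<open>A constant value would be 0, because Z has a zero, but zeta(2) differs from 1 by at most
  pi^2/6 - 1 < 1.\<close>

lemma zeta_nonconstant: "\<not> zeta constant_on (- {1})"
proof
 assume "zeta constant_on (- {1})"
 then obtain v where v: "!!s. s ~= 1 ==> zeta s = v" unfolding constant_on_def by auto
 obtain T where T: "\<forall>ta. T/2 <= ta & ta <= 3 * T --> (\<exists>t. \<bar>t - ta\<bar> <= ln T * T powr (9/10) & RS_Z t = 0)" "T >= 0"
  using eventually_happens'[OF _ eventually_conj[OF zero_gap eventually_ge_at_top[of 0]]] by auto
 have "T/2 <= T & T <= 3 * T" using T(2) by simp
 with T(1) have "\<exists>t. \<bar>t - T\<bar> <= ln T * T powr (9/10) & RS_Z t = 0" by blast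
 then obtain t where "RS_Z t = 0" by blast
 then have "zeta (Complex (1/2) t) = 0" using RS_Z_Lam(2)[of t] by simp
 then have "v = 0" using v[of "Complex (1/2) t"] by (simp add: complex_eq_iff)
 then have "zeta (Complex 2 0) = 0" using v[of "Complex 2 0"] by (simp add: complex_eq_iff)
 then have "1 <= pi\<^sup>2/6 - 1" using zeta_re2[of 0] by simp
 moreover have "pi * pi <= 3.15 * 3.15" using pi_approx by (intro mult_mono) auto
 ultimately show False by (simp add: power2_eq_square)
qed

lemma finite_zeros: "finite {t. a <= t & t <= b & RS_Z t = 0}"
proof -
 let ?K = "Complex (1/2) ` {a..b}"
 have "compact ?K" unfolding Complex_eq by (intro compact_continuous_image continuous_intros) auto
 moreover have "connected (- {1::complex})" by (rule connected_punctured_universe) simp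
 moreover have "?K \<subseteq> - {1}" by (auto simp: complex_eq_iff)
 ultimately have "finite {z\<in>?K. zeta z = 0}"
  using zeta_spec(1) zeta_nonconstant by (intro holomorphic_compact_finite_zeros[of zeta "- {1}"]) auto
 moreover have "Complex (1/2) ` {t. a <= t & t <= b & RS_Z t = 0} \<subseteq> {z\<in>?K. zeta z = 0}"
  using RS_Z_Lam(2) by auto (metis abs_eq_0 norm_eq_zero)
 ultimately have "finite (Complex (1/2) ` {t. a <= t & t <= b & RS_Z t = 0})" by (rule rev_finite_subset)
 then show ?thesis by (rule finite_imageD) (auto simp: inj_on_def)
qed

text \<open>A vanishing integral would make Z zero on a whole interval, against finiteness of its
  zeros. The weight may vanish at the left end, as the difference of two exponentials in
  \<open>GL_strict\<close> does at t = 0.\<close>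

lemma weighted_Z2_pos:
 assumes ab: "a < b" and w: "continuous_on {a..b} w" "!!t. a < t ==> t <= b ==> w t > 0" "w a >= 0"
 shows "integral {a..b} (%t. (RS_Z t)\<^sup>2 * w t) > 0"
proof -
 let ?f = "%t. (RS_Z t)\<^sup>2 * w t"
 have c: "continuous_on {a..b} ?f" by (intro continuous_intros w(1) continuous_on_subset[OF RS_Z_cont]) auto
 have nn: "?f t >= 0" if "t \<in> {a..b}" for t using w(2)[of t] w(3) that by (cases "t = a") auto
 have "\<not> (\<forall>t\<in>{a..b}. ?f t = 0)"
 proof
  assume z: "\<forall>t\<in>{a..b}. ?f t = 0"
  have "RS_Z t = 0" if "a < t" "t <= b" for t using bspec[OF z, of t] w(2)[OF that] that by auto
  then have "{a<..b} \<subseteq> {t. a <= t & t <= b & RS_Z t = 0}" by auto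
  then have "finite {a<..b}" using finite_zeros finite_subset by blast
  then show False using ab by (simp add: infinite_Ioc)
 qed
 then have "integral {a..b} ?f ~= 0" using integral_eq_0_iff[OF c ab nn] by blast
 moreover have "integral {a..b} ?f >= 0"
  by (rule Henstock_Kurzweil_Integration.integral_nonneg[OF integrable_continuous_real[OF c] nn])
 ultimately show ?thesis by simp
qed

lemma FF_strict: "0 <= a ==> a < b ==> FF a < FF b"
proof -
 assume ab: "0 <= a" "a < b"
 have "integral {a..b} (%t. (RS_Z t)\<^sup>2 * 1) > 0" by (rule weighted_Z2_pos[OF ab(2)]) auto
 then show ?thesis using FF_diff[of a b] ab by simp
qed

lemma FF_0: "FF 0 = 0" by (simp add: FF_def)

lemma FF_cont: "continuous_on {0..b} FF"
 unfolding FF_def using indefinite_integral_continuous_1[OF Z2_int(1)] .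

section \<open>The Laplace transform of the square of Z\<close>

lemma FF_approx: "\<epsilon> > 0 ==> \<exists>v0\<ge>1. \<forall>v\<ge>v0. \<bar>FF v - F0 v\<bar> <= \<epsilon> * v"
proof -
 assume e: "\<epsilon> > 0"
 obtain v1 where v1: "!!v. v >= v1 ==> \<bar>(FF v - F0 v) / v\<bar> < \<epsilon>"
  using tendstoD[OF mean_square e] unfolding eventually_at_top_linorder by auto
 have "\<bar>FF v - F0 v\<bar> <= \<epsilon> * v" if "v >= max v1 1" for v
  using v1[of v] that by (simp add: divide_less_eq)
 then show ?thesis by (intro exI[of _ "max v1 1"]) auto
qed

text \<open>The additive constant takes care of bounded v. The estimate can then be integrated from
  0 against exp (-v/T) / T, where the constant contributes O(1) and is negligible after division by
  T.\<close>

lemma FF_approx_all: "\<epsilon> > 0 ==> \<exists>A\<ge>0. \<forall>v>0. \<bar>FF v - F0 v\<bar> <= \<epsilon> * v + A"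
proof -
 assume e: "\<epsilon> > 0"
 obtain v0 where v0: "v0 >= 1" "!!v. v >= v0 ==> \<bar>FF v - F0 v\<bar> <= \<epsilon> * v" using FF_approx[OF e] by blast
 define k where "k = 2 * euler_mascheroni - 1 - ln (2 * pi)"
 define A where "A = FF v0 + (v0 * v0 + 1) + \<bar>k\<bar> * v0"
 have F00: "FF v0 >= 0" using FF_mono[of 0 v0] v0 FF_0 by simp
 have A0: "A >= 0" unfolding A_def using F00 v0 by (intro add_nonneg_nonneg) auto
 have "\<bar>FF v - F0 v\<bar> <= \<epsilon> * v + A" if v: "v > 0" for v
 proof (cases "v >= v0")
  case True then show ?thesis using v0(2)[OF True] A0 by linarith
 next
  case False
  have "v * ln v <= v0 * v0"
  proof -
   have "v * ln v <= v * v" using v ln_le_minus_one[OF v] by (intro mult_left_mono) auto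
   also have "... <= v0 * v0" using v False by (intro mult_mono) auto
   finally show ?thesis .
  qed
  moreover have "- (v * ln v) <= 1"
  proof -
   have "- ln v = ln (1/v)" using v by (simp add: ln_div)
   also have "... <= 1/v - 1" using v by (intro ln_le_minus_one) auto
   finally have "v * (- ln v) <= v * (1/v - 1)" using v by (intro mult_left_mono) auto
   also have "... <= 1" using v by (simp add: right_diff_distrib)
   finally show ?thesis by simp
  qed
  ultimately have "\<bar>v * ln v\<bar> <= v0 * v0 + 1" by (smt (verit) mult_nonneg_nonneg v0(1))
  moreover have "\<bar>k * v\<bar> <= \<bar>k\<bar> * v0" using v False by (simp add: abs_mult mult_left_mono)
  moreover have "F0 v = v * ln v + k * v" by (simp add: F0_def k_def)
  moreover have "0 <= FF v" "FF v <= FF v0" using FF_mono[of 0 v] FF_mono[of v v0] v False FF_0 by auto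
  moreover have "\<epsilon> * v >= 0" using e v by simp
  ultimately show ?thesis unfolding A_def by linarith
 qed
 then show ?thesis using A0 by blast
qed

text \<open>Convexity gives \<open>\<plusminus>h v ln v \<le> v\<^sup>1\<^sup>\<plusminus>\<^sup>h - v\<close>, so the integral below is squeezed between difference
  quotients of \<open>a \<mapsto> \<Gamma>(a) r\<^sup>-\<^sup>a\<close> at \<open>2\<close>.\<close>

lemma ln_exp_integral:
 fixes r :: real assumes r: "r > 0"
 shows "set_integrable lborel {0<..} (%v. v * ln v * exp (- r * v))"
  "(LINT v:{0<..}|lborel. v * ln v * exp (- r * v)) = (1 - euler_mascheroni - ln r) / r\<^sup>2"
proof -
 define \<phi> where "\<phi> = (%a. Gamma a * r powr (-a))"
 let ?f = "%v. v * ln v * exp (- r * v)"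
 let ?p = "%a v. v powr (a - 1) * exp (- r * v)"
 have pi': "set_integrable lborel {0<..} (?p a)" "(LINT v:{0<..}|lborel. ?p a v) = \<phi> a" if "a > 0" for a
  using powr_exp_integral[OF that r] by (simp_all add: \<phi>_def)
 have conv: "h * (v * ln v * exp (- r * v)) <= ?p (2 + h) v - ?p 2 v" if "v > 0" for h v :: real
 proof -
  have "1 + h * ln v <= v powr h" using exp_ge_add_one_self[of "h * ln v"] that by (simp add: powr_def)
  then have "v * (1 + h * ln v) * exp (- r * v) <= v * v powr h * exp (- r * v)" using that by (intro mult_right_mono mult_left_mono) auto
  moreover have "v * v powr h = v powr (2 + h - 1)" using that powr_add[of v 1 h] by simp
  moreover have "v powr (2 - 1) = v" using that by simp
  ultimately show ?thesis by (simp add: algebra_simps)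
 qed
 show fi: "set_integrable lborel {0<..} ?f"
  unfolding set_integrable_def
 proof (rule bint_dominated)
  show "integrable lborel (%v. indicator {0<..} v *\<^sub>R (?p 3 v + ?p 2 v + ?p 2 v + ?p 1 v))"
   using set_integral_add(1)[OF set_integral_add(1)[OF set_integral_add(1)[OF pi'(1)[of 3] pi'(1)[of 2]] pi'(1)[of 2]] pi'(1)[of 1]]
   unfolding set_integrable_def by simp
  show "AE v in lborel. norm (indicator {0<..} v *\<^sub>R ?f v) <= norm (indicator {0<..} v *\<^sub>R (?p 3 v + ?p 2 v + ?p 2 v + ?p 1 v))"
  proof (rule AE_I2)
   fix v :: real
   show "norm (indicator {0<..} v *\<^sub>R ?f v) <= norm (indicator {0<..} v *\<^sub>R (?p 3 v + ?p 2 v + ?p 2 v + ?p 1 v))"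
   proof (cases "v > 0")
    case True
    have p0: "?p a v >= 0" for a by simp
    have "?f v <= ?p 3 v - ?p 2 v" using conv[OF True, of 1] by simp
    moreover have "- ?f v <= ?p 1 v - ?p 2 v" using conv[OF True, of "-1"] by simp
    ultimately have "\<bar>?f v\<bar> <= ?p 3 v + ?p 2 v + ?p 2 v + ?p 1 v" using p0[of 1] p0[of 2] p0[of 3] by (simp only: abs_le_iff) linarith
    then show ?thesis using True by simp
   qed simp
  qed
 qed measurable
 define I where "I = (LINT v:{0<..}|lborel. ?f v)"
 have le: "h * I <= \<phi> (2 + h) - \<phi> 2" if h: "h > -1" for h
 proof -
  have "h * I = (LINT v:{0<..}|lborel. h * ?f v)" unfolding I_def by simp
  also have "... <= (LINT v:{0<..}|lborel. ?p (2 + h) v - ?p 2 v)"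
  proof (rule set_integral_mono)
   show "set_integrable lborel {0<..} (%v. h * ?f v)" by (intro set_integrable_mult_right) (use fi in auto)
   show "set_integrable lborel {0<..} (%v. ?p (2 + h) v - ?p 2 v)" using h by (intro set_integral_diff pi') auto
  qed (use conv in auto)
  also have "... = (LINT v:{0<..}|lborel. ?p (2 + h) v) - (LINT v:{0<..}|lborel. ?p 2 v)"
   using h by (intro set_integral_diff(2) pi'(1)) auto
  also have "... = \<phi> (2 + h) - \<phi> 2"
  proof -
   have a: "2 + h > 0" "(2::real) > 0" using h by auto
   show ?thesis by (simp only: pi'(2)[OF a(1)] pi'(2)[OF a(2)])
  qed
  finally show ?thesis .
 qed
 \<comment> \<open>Gamma'(2) = Digamma 2 = 1 - c: the constant of the final limit enters
   here.\<close>
 have D: "(\<phi> has_real_derivative (1 - euler_mascheroni - ln r) / r\<^sup>2) (at 2)"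
 proof -
  have np: "(2::real) \<notin> \<int>\<^sub>\<le>\<^sub>0" by (auto elim!: nonpos_Ints_cases)
  have dg: "Digamma (2::real) = 1 - euler_mascheroni"
   using Digamma_of_nat[of 1, where 'a=real] by (simp add: harm_expand)
  have g2: "Gamma (2::real) = 1" using Gamma_fact[of 1, where 'a=real] by simp
  have rp: "r powr (-2) = 1 / r\<^sup>2" using r powr_minus_divide[of r 2] powr_numeral[of r "Num.Bit0 Num.One"] by simp
  have pe: "r powr (-a) = exp (- a * ln r)" for a using r by (simp add: powr_def)
  have "((%a. exp (- a * ln r)) has_real_derivative exp (- 2 * ln r) * (- ln r)) (at 2)"
   by (auto intro!: derivative_eq_intros)
  then have dr: "((%a. r powr (-a)) has_real_derivative r powr (-2) * (- ln r)) (at 2)" unfolding pe .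
  have "(\<phi> has_real_derivative Gamma 2 * Digamma 2 * r powr (-2) + r powr (-2) * (- ln r) * Gamma 2) (at 2)"
   unfolding \<phi>_def by (rule DERIV_mult[OF has_field_derivative_Gamma[OF np] dr])
  then show ?thesis unfolding dg g2 rp by (simp add: diff_divide_distrib)
 qed
 have D': "((%h. (\<phi> (2 + h) - \<phi> 2) / h) \<longlongrightarrow> (1 - euler_mascheroni - ln r) / r\<^sup>2) (at 0)"
  using D unfolding DERIV_def by simp
 have "I <= (1 - euler_mascheroni - ln r) / r\<^sup>2"
 proof (rule tendsto_lowerbound[OF tendsto_mono[OF _ D']])
  show "\<forall>\<^sub>F h in at_right 0. I <= (\<phi> (2 + h) - \<phi> 2) / h"
   unfolding eventually_at_right_field by (intro exI[of _ 1]) (use le in \<open>auto simp: pos_le_divide_eq mult.commute\<close>)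
 qed (auto simp: at_le)
 moreover have "I >= (1 - euler_mascheroni - ln r) / r\<^sup>2"
 proof (rule tendsto_upperbound[OF tendsto_mono[OF _ D']])
  show "\<forall>\<^sub>F h in at_left 0. (\<phi> (2 + h) - \<phi> 2) / h <= I"
   unfolding eventually_at_left_field by (intro exI[of _ "-1"]) (use le in \<open>auto simp: neg_divide_le_eq mult.commute\<close>)
 qed (auto simp: at_le)
 ultimately show "(LINT v:{0<..}|lborel. ?f v) = (1 - euler_mascheroni - ln r) / r\<^sup>2" unfolding I_def by linarith
qed

text \<open>The Laplace transform of Z^2 at 1/T. As an \<open>ennreal\<close> it can be rearranged
  by Tonelli before its finiteness is known, which is part of \<open>ZL_asymp\<close>.\<close>

definition ZL :: "real => ennreal" where "ZL T = (\<integral>\<^sup>+t. ennreal ((RS_Z t)\<^sup>2 * exp (- (t / T)) * indicator {0..} t) \<partial>lborel)"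

lemma FF_borel: "(%v. FF v * indicator {0<..} v) \<in> borel_measurable borel"
proof -
 have "(%v. FF (max 0 v)) \<in> borel_measurable borel"
  by (rule borel_measurable_mono) (auto intro!: monoI FF_mono)
 then have "(%v. FF (max 0 v) * indicator {0<..} v) \<in> borel_measurable borel" by measurable
 moreover have "FF (max 0 v) * indicator {0<..} v = FF v * indicator {0<..} v" for v by (auto simp: indicator_def)
 ultimately show ?thesis by simp
qed

text \<open>exp (-t/T) is the integral of exp (-v/T) / T over v >= t; exchanging the integrals
  collects the square of Z over [0, v].\<close>

lemma ZL_FF:
 assumes T: "T > 0"
 shows "ZL T = (\<integral>\<^sup>+v. ennreal (FF v * (exp (- (v/T)) / T) * indicator {0<..} v) \<partial>lborel)"
proof -
 let ?k = "%t v. (RS_Z t)\<^sup>2 * indicator {0..v} t * (exp (- (v/T)) / T)"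
 have km: "(%x. ennreal (?k (fst x) (snd x))) \<in> borel_measurable (lborel \<Otimes>\<^sub>M lborel)"
 proof -
  have e: "?k t v = (RS_Z t)\<^sup>2 * (if 0 <= t & t <= v then 1 else 0) * (exp (- (v/T)) / T)" for t v by (auto simp: indicator_def)
  show ?thesis unfolding e by measurable
 qed
 have inner: "(\<integral>\<^sup>+v. ennreal (?k t v) \<partial>lborel) = ennreal ((RS_Z t)\<^sup>2 * exp (- (t / T)) * indicator {0..} t)" for t
 proof (cases "t >= 0")
  case True
  have "(\<integral>\<^sup>+v. ennreal (exp (- (v/T)) / T) * indicator {t..} v \<partial>lborel) = ennreal (0 - (- exp (- (t/T))))"
  proof (rule nn_integral_FTC_atLeast)
   show "((%v. - exp (- (v/T))) has_real_derivative exp (- (v/T)) / T) (at v)" for v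
    using T by (auto intro!: derivative_eq_intros)
   show "((%v. - exp (- (v/T))) \<longlongrightarrow> 0) at_top" using T by real_asymp
  qed (use T in auto)
  then have w: "(\<integral>\<^sup>+v. ennreal (exp (- (v/T)) / T) * indicator {t..} v \<partial>lborel) = ennreal (exp (- (t/T)))" by simp
  have "(\<integral>\<^sup>+v. ennreal (?k t v) \<partial>lborel) = (\<integral>\<^sup>+v. ennreal ((RS_Z t)\<^sup>2) * (ennreal (exp (- (v/T)) / T) * indicator {t..} v) \<partial>lborel)"
   using T True by (intro nn_integral_cong) (auto simp: indicator_def ennreal_mult[symmetric])
  also have "... = ennreal ((RS_Z t)\<^sup>2) * ennreal (exp (- (t/T)))" unfolding w[symmetric] by (rule nn_integral_cmult) measurable
  finally show ?thesis using True by (simp add: ennreal_mult)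
 qed (auto simp: indicator_def)
 have outer: "(\<integral>\<^sup>+t. ennreal (?k t v) \<partial>lborel) = ennreal (FF v * (exp (- (v/T)) / T) * indicator {0<..} v)" for v
 proof (cases "v > 0")
  case True
  then show ?thesis using nn_Z2[of 0 v "exp (- (v/T)) / T"] T FF_0 by simp
 next
  case False
  have "(\<integral>\<^sup>+t. ennreal (?k t v) \<partial>lborel) = 0"
  proof (cases "v = 0")
   case True
   then show ?thesis using nn_Z2[of 0 0 "1/T"] T by simp
  qed (use False in auto)
  then show ?thesis using False by simp
 qed
 have "ZL T = (\<integral>\<^sup>+t. (\<integral>\<^sup>+v. ennreal (?k t v) \<partial>lborel) \<partial>lborel)" unfolding ZL_def inner ..
 also have "... = (\<integral>\<^sup>+v. (\<integral>\<^sup>+t. ennreal (?k t v) \<partial>lborel) \<partial>lborel)"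
  by (rule lborel_pair.Fubini'[symmetric]) (use km in \<open>simp add: case_prod_beta\<close>)
 finally show ?thesis unfolding outer .
qed

text \<open>By \<open>ZL_FF\<close> the transform is the mean of F under the exponential density
  with mean T. The mean of \<open>F0\<close> is F0(T) + (1 - c) T by \<open>ln_exp_integral\<close>,
  and an error e v + A averages to e T + A.\<close>

lemma ZL_asymp: "\<exists>E. (\<forall>T>0. ZL T = ennreal (E T) & E T >= 0) & ((%T. (E T - (F0 T + (1 - euler_mascheroni) * T)) / T) \<longlongrightarrow> 0) at_top"
proof -
 define k where "k = 2 * euler_mascheroni - 1 - ln (2 * pi)"
 define E where "E = (%T. LINT v:{0<..}|lborel. FF v * (exp (- (v/T)) / T))"
 have main: "set_integrable lborel {0<..} (%v. FF v * (exp (- (v/T)) / T)) & \<bar>E T - (F0 T + (1 - euler_mascheroni) * T)\<bar> <= \<epsilon> * T + A"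
  if A: "!!v. v > 0 ==> \<bar>FF v - F0 v\<bar> <= \<epsilon> * v + A" and T: "T > 0" for A \<epsilon> T
 proof -
  define r where "r = 1/T"
  have r: "r > 0" using T by (simp add: r_def)
  let ?m = "%v. F0 v * (exp (- (v/T)) / T)"
  let ?x = "%v. v powr (2 - 1) * exp (- r * v)"
  let ?o = "%v. v powr (1 - 1) * exp (- r * v)"
  have x: "set_integrable lborel {0<..} ?x" "(LINT v:{0<..}|lborel. ?x v) = T\<^sup>2"
   using powr_exp_integral[of 2 r] r T Gamma_fact[of 1, where 'a=real] by (auto simp: r_def powr_divide powr_minus divide_inverse power_inverse)
  have o: "set_integrable lborel {0<..} ?o" "(LINT v:{0<..}|lborel. ?o v) = T"
   using powr_exp_integral[of 1 r] r T by (auto simp: r_def powr_divide powr_minus divide_inverse)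
  note l = ln_exp_integral[OF r]
  have mi: "set_integrable lborel {0<..} (%v. r * (v * ln v * exp (- r * v)) + r * k * ?x v)"
   by (intro set_integral_add set_integrable_mult_right) (use l x in auto)
  have me: "?m v = r * (v * ln v * exp (- r * v)) + r * k * ?x v" if "v \<in> {0<..}" for v
   using that by (simp add: F0_def k_def r_def algebra_simps add_divide_distrib diff_divide_distrib)
  have "set_integrable lborel {0<..} ?m = set_integrable lborel {0<..} (%v. r * (v * ln v * exp (- r * v)) + r * k * ?x v)"
   by (rule set_integrable_cong) (use me in auto)
  with mi have mi': "set_integrable lborel {0<..} ?m" by (simp only:)
  have mv: "(LINT v:{0<..}|lborel. ?m v) = F0 T + (1 - euler_mascheroni) * T"
  proof -
   have "(LINT v:{0<..}|lborel. ?m v) = (LINT v:{0<..}|lborel. r * (v * ln v * exp (- r * v)) + r * k * ?x v)"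
    by (rule set_lebesgue_integral_cong) (use me in auto)
   also have "... = (LINT v:{0<..}|lborel. r * (v * ln v * exp (- r * v))) + (LINT v:{0<..}|lborel. r * k * ?x v)"
    by (rule set_integral_add(2)) (intro set_integrable_mult_right, use l x in auto)+
   also have "... = r * ((1 - euler_mascheroni - ln r) / r\<^sup>2) + r * k * T\<^sup>2" using l(2) x(2) by simp
   also have "... = F0 T + (1 - euler_mascheroni) * T"
    using T by (simp add: F0_def k_def r_def ln_div power2_eq_square field_simps)
   finally show ?thesis .
  qed
  let ?e = "%v. \<epsilon> * r * ?x v + A * r * ?o v"
  have ei: "set_integrable lborel {0<..} ?e" by (intro set_integral_add set_integrable_mult_right) (use x o in auto)
  have ev: "(LINT v:{0<..}|lborel. ?e v) = \<epsilon> * T + A"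
  proof -
   have "(LINT v:{0<..}|lborel. ?e v) = (LINT v:{0<..}|lborel. \<epsilon> * r * ?x v) + (LINT v:{0<..}|lborel. A * r * ?o v)"
    by (rule set_integral_add(2)) (intro set_integrable_mult_right, use x o in auto)+
   also have "... = \<epsilon> * r * T\<^sup>2 + A * r * T" using x(2) o(2) by simp
   finally show ?thesis using T by (simp add: r_def power2_eq_square)
  qed
  have eb: "\<bar>FF v * (exp (- (v/T)) / T) - ?m v\<bar> <= ?e v" if v: "v > 0" for v
  proof -
   have "\<bar>FF v * (exp (- (v/T)) / T) - ?m v\<bar> = \<bar>FF v - F0 v\<bar> * (exp (- (v/T)) / T)"
    unfolding left_diff_distrib[symmetric] abs_mult using T by simp
   also have "... <= (\<epsilon> * v + A) * (exp (- (v/T)) / T)" using T by (intro mult_right_mono A v) auto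
   also have "... = ?e v" using v T by (simp add: r_def algebra_simps add_divide_distrib)
   finally show ?thesis .
  qed
  have di: "set_integrable lborel {0<..} (%v. FF v * (exp (- (v/T)) / T) - ?m v)"
   unfolding set_integrable_def
  proof (rule bint_dominated[OF ei[unfolded set_integrable_def]])
   have "(%v. (FF v * indicator {0<..} v) * (exp (- (v/T)) / T) - indicator {0<..} v * ?m v) \<in> borel_measurable borel"
    using FF_borel unfolding F0_def by measurable
   then show "(%v. indicat_real {0<..} v *\<^sub>R (FF v * (exp (- (v/T)) / T) - ?m v)) \<in> borel_measurable lborel"
    by (simp add: algebra_simps)
   show "AE v in lborel. norm (indicat_real {0<..} v *\<^sub>R (FF v * (exp (- (v/T)) / T) - ?m v)) <= norm (indicat_real {0<..} v *\<^sub>R ?e v)"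
    by (rule AE_I2) (use eb in \<open>force simp: indicator_def\<close>)
  qed
  have Fi: "set_integrable lborel {0<..} (%v. FF v * (exp (- (v/T)) / T))"
   using set_integral_add(1)[OF di mi'] by simp
  have d: "E T - (F0 T + (1 - euler_mascheroni) * T) = (LINT v:{0<..}|lborel. FF v * (exp (- (v/T)) / T) - ?m v)"
   unfolding E_def mv[symmetric] by (rule set_integral_diff(2)[OF Fi mi', symmetric])
  have nb: "norm (LINT v:{0<..}|lborel. FF v * (exp (- (v/T)) / T) - ?m v) <= (LINT v:{0<..}|lborel. ?e v)"
   unfolding set_lebesgue_integral_def
  proof (rule bint_norm_bound[OF di[unfolded set_integrable_def] ei[unfolded set_integrable_def]])
   fix v :: real
   show "norm (indicat_real {0<..} v *\<^sub>R (FF v * (exp (- (v/T)) / T) - ?m v)) <= indicat_real {0<..} v *\<^sub>R ?e v"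
    using eb[of v] by (cases "v > 0") auto
  qed
  have "\<bar>E T - (F0 T + (1 - euler_mascheroni) * T)\<bar> <= \<epsilon> * T + A" using nb unfolding d[symmetric] ev real_norm_def .
  with Fi show ?thesis by blast
 qed
 show ?thesis
 proof (intro exI[of _ E] conjI allI impI)
  fix T :: real assume T: "0 < T"
  obtain A where "\<forall>v>0. \<bar>FF v - F0 v\<bar> <= 1 * v + A" using FF_approx_all[of 1] by auto
  then have Fi: "set_integrable lborel {0<..} (%v. FF v * (exp (- (v/T)) / T))" using main[of 1 A T] T by blast
  have pos: "FF v >= 0" if "v > 0" for v using FF_mono[of 0 v] FF_0 that by simp
  have "ZL T = (\<integral>\<^sup>+v. ennreal (indicator {0<..} v *\<^sub>R (FF v * (exp (- (v/T)) / T))) \<partial>lborel)"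
   unfolding ZL_FF[OF T] by (simp add: mult.commute)
  also have "... = ennreal (E T)" unfolding E_def set_lebesgue_integral_def
   by (rule nn_integral_eq_integral[OF Fi[unfolded set_integrable_def]]) (use T pos in \<open>auto simp: indicator_def\<close>)
  finally show "ZL T = ennreal (E T)" .
  show "0 <= E T" unfolding E_def set_lebesgue_integral_def
   by (intro Bochner_Integration.integral_nonneg) (use T pos in \<open>auto simp: indicator_def\<close>)
 next
  show "((%T. (E T - (F0 T + (1 - euler_mascheroni) * T)) / T) \<longlongrightarrow> 0) at_top"
  proof (rule tendstoI)
   fix e :: real assume e: "e > 0"
   obtain A where A: "!!v. v > 0 ==> \<bar>FF v - F0 v\<bar> <= e/2 * v + A" using FF_approx_all[of "e/2"] e by auto
   have "\<forall>\<^sub>F T::real in at_top. A < e/2 * T" using e by real_asymp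
   then show "\<forall>\<^sub>F T in at_top. dist ((E T - (F0 T + (1 - euler_mascheroni) * T)) / T) 0 < e"
    using eventually_gt_at_top[of 0]
   proof eventually_elim
    case (elim T)
    then have "\<bar>E T - (F0 T + (1 - euler_mascheroni) * T)\<bar> < e * T" using main[OF A, of T] by linarith
    then show ?case using elim by (simp add: divide_less_eq)
   qed
  qed
 qed
qed


section \<open>The ladder equation at X = 2 T\<close>

definition hgap :: "real => real" where "hgap T = ln T * T powr (9/10)"

text \<open>Over a length O(T^(9/10) ln T) the main term grows by only O(T^(9/10) (ln T)^2), and the
  asymptotic formula errs by o(T) at each end. The stretches between an end of the interval and the
  nearest zeros are thereby negligible.\<close>

lemma short_interval:
 assumes e: "e > 0"
 shows "\<forall>\<^sub>F T in at_top. \<forall>x. T <= x & x <= 2 * T --> FF (x + 3 * hgap T) - FF x <= e * T"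
proof -
 obtain v0 where v0: "v0 >= 1" "!!v. v >= v0 ==> \<bar>FF v - F0 v\<bar> <= e/20 * v" using FF_approx[of "e/20"] e by auto
 define k where "k = 2 * euler_mascheroni - 1 - ln (2 * pi)"
 have ev1: "\<forall>\<^sub>F T::real in at_top. 3 * hgap T <= T" unfolding hgap_def by real_asymp
 have ev2: "\<forall>\<^sub>F T::real in at_top. 3 * hgap T * (ln (3 * T) + 1 + \<bar>k\<bar>) <= e/2 * T" unfolding hgap_def using e by real_asymp
 have ev3: "\<forall>\<^sub>F T::real in at_top. hgap T >= 0" unfolding hgap_def by real_asymp
 show ?thesis using ev1 ev2 ev3 eventually_ge_at_top[of v0]
 proof eventually_elim
  fix T :: real assume T: "3 * hgap T <= T" "3 * hgap T * (ln (3 * T) + 1 + \<bar>k\<bar>) <= e/2 * T" "hgap T >= 0" "v0 <= T"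
  show "\<forall>x. T <= x & x <= 2 * T --> FF (x + 3 * hgap T) - FF x <= e * T"
  proof (intro allI impI)
   fix x assume x: "T <= x & x <= 2 * T"
   define h where "h = 3 * hgap T"
   have h: "h >= 0" "h <= T" using T by (auto simp: h_def)
   have x0: "x > 0" "x >= v0" "x + h <= 3 * T" "T > 0" using x T v0 h by linarith+
   have "x * ln (x + h) - x * ln x <= h"
   proof -
    have "ln (x + h) - ln x <= (x + h - x) / x" using x0 h by (intro ln_diff_le) auto
    then have "x * (ln (x + h) - ln x) <= x * (h / x)" using x0 by (intro mult_left_mono) auto
    then show ?thesis using x0 by (simp add: right_diff_distrib)
   qed
   moreover have "h * ln (x + h) <= h * ln (3 * T)" using x0 h by (intro mult_left_mono) auto
   moreover have "k * h <= h * \<bar>k\<bar>" using h by (simp add: mult.commute mult_left_mono)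
   moreover have "F0 (x + h) - F0 x = (x * ln (x + h) - x * ln x) + h * ln (x + h) + k * h"
    by (simp add: F0_def k_def algebra_simps)
   moreover have "h * (ln (3 * T) + 1 + \<bar>k\<bar>) = h * ln (3 * T) + h + h * \<bar>k\<bar>" by (simp add: algebra_simps)
   ultimately have "F0 (x + h) - F0 x <= e/2 * T" using T(2) unfolding h_def by linarith
   moreover have "\<bar>FF (x + h) - F0 (x + h)\<bar> <= e/20 * (3 * T)"
    using v0(2)[of "x + h"] x0 h e by (smt (verit) mult_left_mono divide_pos_pos)
   moreover have "\<bar>FF x - F0 x\<bar> <= e/20 * (3 * T)"
    using v0(2)[of x] x0 h e by (smt (verit) mult_left_mono divide_pos_pos)
   moreover have "e * T > 0" using e x0 by simp
   moreover have "e/20 * (3 * T) = 3/20 * (e * T)" "e/2 * T = 1/2 * (e * T)" by simp_all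
   ultimately have "FF (x + h) - FF x <= e * T" by linarith
   then show "FF (x + 3 * hgap T) - FF x <= e * T" by (simp add: h_def)
  qed
 qed
qed

text \<open>The left-hand side of \<open>ladder_eq\<close>. It is used at X = 2 T, where the weight
  is exp (-t/T) and X/2 is the value T of the ladder.\<close>

definition GL :: "(real => real) => real => real" where
 "GL \<mu> X = integral {0..\<mu> X} (%t. (RS_Z t)\<^sup>2 * exp (- 2 * t / X))"

lemma Z2_exp_cont: "continuous_on {a..b} (%t. (RS_Z t)\<^sup>2 * exp (- 2 * t / X))"
 by (cases "X = 0") (auto intro!: continuous_intros continuous_on_subset[OF RS_Z_cont])

text \<open>Both the weight and the cut-off grow with X. The case of a nonpositive cut-off for the
  smaller X, where the integral is 0, is treated apart.\<close>

lemma GL_strict: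
 assumes X: "0 < X" "X < X'" and m: "\<mu> X <= \<mu> X'" "\<mu> X' > 0"
 shows "GL \<mu> X < GL \<mu> X'"
proof -
 have e: "continuous_on {a..b} (%t. exp (- 2 * t / Y))" if "Y > 0" for a b Y :: real
  using that by (intro continuous_intros) auto
 have X': "X' > 0" using X by simp
 show ?thesis
 proof (cases "\<mu> X > 0")
  case False
  then have "GL \<mu> X = 0" by (cases "\<mu> X = 0") (auto simp: GL_def)
  moreover have "GL \<mu> X' > 0" unfolding GL_def by (rule weighted_Z2_pos[OF m(2) e[OF X']]) auto
  ultimately show ?thesis by simp
 next
  case True
  let ?g = "%Y t. (RS_Z t)\<^sup>2 * exp (- 2 * t / Y)"
  have i: "?g Y integrable_on {a..b}" for a b Y by (rule integrable_continuous_real[OF Z2_exp_cont])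
  have "0 < integral {0..\<mu> X} (%t. (RS_Z t)\<^sup>2 * (exp (- 2 * t / X') - exp (- 2 * t / X)))"
  proof (rule weighted_Z2_pos[OF True])
   fix t assume "0 < t" "t <= \<mu> X"
   then have "2 * t / X' < 2 * t / X" using X by (intro divide_strict_left_mono) auto
   then show "0 < exp (- 2 * t / X') - exp (- 2 * t / X)" by simp
  qed (use e[OF X(1)] e[OF X'] in \<open>auto intro!: continuous_on_diff\<close>)
  also have "... = integral {0..\<mu> X} (?g X') - integral {0..\<mu> X} (?g X)"
   by (subst Henstock_Kurzweil_Integration.integral_diff[OF i i, symmetric]) (simp add: right_diff_distrib)
  finally have "GL \<mu> X < integral {0..\<mu> X} (?g X')" by (simp add: GL_def)
  also have "integral {0..\<mu> X} (?g X') <= GL \<mu> X'"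
   unfolding GL_def using m by (intro integral_subset_le i) auto
  finally show ?thesis .
 qed
qed

text \<open>Beyond the cut-off M half of the exponent is given up: exp (-t/T) <= exp (-M/(2 T)) exp
  (-t/(2 T)). The tail is thus a small multiple of the Laplace transform at 1/(2 T).\<close>

lemma GL_bounds:
 assumes T: "T > 0" and E: "ZL T = ennreal (E T)" "E T >= 0" "ZL (2*T) = ennreal (E (2*T))" "E (2*T) >= 0" and M: "\<mu> (2*T) > 0"
 shows "GL \<mu> (2*T) <= E T" "E T <= GL \<mu> (2*T) + exp (- (\<mu> (2*T) / (2*T))) * E (2*T)"
proof -
 define M where "M = \<mu> (2*T)"
 have M0: "M > 0" using assms by (simp add: M_def)
 let ?g = "%t. (RS_Z t)\<^sup>2 * exp (- (t / T))"
 have ge: "exp (- 2 * t / (2*T)) = exp (- (t / T))" for t using T by simp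
 have cg: "continuous_on {0..M} ?g" using Z2_exp_cont[of 0 M "2*T"] unfolding ge .
 have G0: "GL \<mu> (2*T) >= 0" unfolding GL_def
  by (rule Henstock_Kurzweil_Integration.integral_nonneg[OF integrable_continuous_real[OF Z2_exp_cont]]) auto
 have si: "set_integrable lborel {0..M} ?g" by (rule borel_integrable_atLeastAtMost'[OF cg])
 have gv: "(LINT t:{0..M}|lborel. ?g t) = GL \<mu> (2*T)"
  unfolding GL_def ge M_def[symmetric] by (rule set_borel_integral_eq_integral(2)[OF si])
 have G: "(\<integral>\<^sup>+t. ennreal (?g t * indicator {0..M} t) \<partial>lborel) = ennreal (GL \<mu> (2*T))"
  unfolding gv[symmetric] set_lebesgue_integral_def
  using nn_integral_eq_integral[OF si[unfolded set_integrable_def]] by (simp add: mult.commute)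
 have le: "ennreal (GL \<mu> (2*T)) <= ZL T" unfolding G[symmetric] ZL_def
  by (intro nn_integral_mono ennreal_leI) (auto simp: indicator_def)
 then show "GL \<mu> (2*T) <= E T" unfolding E(1) using E(2) by (simp add: ennreal_le_iff)
 define q where "q = exp (- (M / (2*T)))"
 have "ZL T <= (\<integral>\<^sup>+t. ennreal (?g t * indicator {0..M} t) + ennreal q * ennreal ((RS_Z t)\<^sup>2 * exp (- (t / (2*T))) * indicator {0..} t) \<partial>lborel)"
  unfolding ZL_def
 proof (rule nn_integral_mono)
  fix t :: real
  have "?g t * indicator {0..} t <= ?g t * indicator {0..M} t + q * ((RS_Z t)\<^sup>2 * exp (- (t / (2*T))) * indicator {0..} t)"
  proof (cases "t > M")
   case True
   have "exp (- (t / T)) = exp (- (t / (2*T))) * exp (- (t / (2*T)))" by (simp add: exp_add[symmetric])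
   also have "... <= q * exp (- (t / (2*T)))"
    using True T by (intro mult_right_mono) (auto simp: q_def intro!: divide_right_mono)
   finally have "(RS_Z t)\<^sup>2 * exp (- (t / T)) <= (RS_Z t)\<^sup>2 * (q * exp (- (t / (2*T))))" by (intro mult_left_mono) auto
   then show ?thesis using True M0 by (simp add: mult_ac)
  next
   case False
   have "0 <= q * ((RS_Z t)\<^sup>2 * exp (- (t / (2*T))) * indicator {0..} t)" by (simp add: q_def)
   then show ?thesis using False by (auto simp: indicator_def)
  qed
  from ennreal_leI[OF this] show "ennreal (?g t * indicator {0..} t) <= ennreal (?g t * indicator {0..M} t) + ennreal q * ennreal ((RS_Z t)\<^sup>2 * exp (- (t / (2*T))) * indicator {0..} t)"
   by (subst (asm) ennreal_plus) (simp_all add: q_def ennreal_mult)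
 qed
 also have "... = (\<integral>\<^sup>+t. ennreal (?g t * indicator {0..M} t) \<partial>lborel) + (\<integral>\<^sup>+t. ennreal q * ennreal ((RS_Z t)\<^sup>2 * exp (- (t / (2*T))) * indicator {0..} t) \<partial>lborel)"
  by (rule nn_integral_add) measurable
 also have "(\<integral>\<^sup>+t. ennreal q * ennreal ((RS_Z t)\<^sup>2 * exp (- (t / (2*T))) * indicator {0..} t) \<partial>lborel) = ennreal q * ZL (2*T)"
  unfolding ZL_def by (rule nn_integral_cmult) measurable
 also have "(\<integral>\<^sup>+t. ennreal (?g t * indicator {0..M} t) \<partial>lborel) + ennreal q * ZL (2*T) = ennreal (GL \<mu> (2*T) + q * E (2*T))"
  unfolding G E(3) using G0 E(4) by (simp add: ennreal_mult q_def)
 finally have "ennreal (E T) <= ennreal (GL \<mu> (2*T) + q * E (2*T))" unfolding E(1) .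
 moreover have "0 <= GL \<mu> (2*T) + q * E (2*T)" using G0 E(4) by (simp add: q_def)
 ultimately have "E T <= GL \<mu> (2*T) + q * E (2*T)" by (simp only: ennreal_le_iff)
 then show "E T <= GL \<mu> (2*T) + exp (- (\<mu> (2*T) / (2*T))) * E (2*T)"
  unfolding q_def M_def .
qed

text \<open>The growth mu(y) >= 7 y ln y makes the tail factor of \<open>GL_bounds\<close> at most
  (2 T)^(-7), whereas the transform it multiplies is O(T ln T).\<close>

lemma GL_asymp:
 assumes mu: "!!y. y > y0 ==> \<mu> y >= 7 * y * ln y"
 shows "((%T. (GL \<mu> (2*T) - FF T) / T) \<longlongrightarrow> 1 - euler_mascheroni) at_top"
proof -
 obtain E where E: "!!T. T > 0 ==> ZL T = ennreal (E T)" "!!T. T > 0 ==> E T >= 0"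
  and El: "((%T. (E T - (F0 T + (1 - euler_mascheroni) * T)) / T) \<longlongrightarrow> 0) at_top"
  using ZL_asymp by blast
 have two: "filterlim (%T::real. 2 * T) at_top at_top" by real_asymp
 have u: "((%T. (E T - FF T) / T) \<longlongrightarrow> 1 - euler_mascheroni) at_top"
 proof (rule Lim_transform_eventually)
  show "((%T. (E T - (F0 T + (1 - euler_mascheroni) * T)) / T - (FF T - F0 T) / T + (1 - euler_mascheroni)) \<longlongrightarrow> 1 - euler_mascheroni) at_top"
   using tendsto_add[OF tendsto_diff[OF El mean_square] tendsto_const[of "1 - euler_mascheroni"]] by simp
  show "\<forall>\<^sub>F T in at_top. (E T - (F0 T + (1 - euler_mascheroni) * T)) / T - (FF T - F0 T) / T + (1 - euler_mascheroni) = (E T - FF T) / T"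
   using eventually_gt_at_top[of 0] by eventually_elim (simp add: field_simps)
 qed
 have t: "((%T. (2 * T) powr (-7) * E (2*T) / T) \<longlongrightarrow> 0) at_top"
 proof (rule Lim_transform_eventually)
  define k where "k = 2 * euler_mascheroni - 1 - ln (2 * pi)"
  have a: "((%T. 2 * (2*T) powr (-7) * ((E (2*T) - (F0 (2*T) + (1 - euler_mascheroni) * (2*T))) / (2*T))) \<longlongrightarrow> 0 * 0) at_top"
   by (rule tendsto_mult[OF _ filterlim_compose[OF El two]]) real_asymp
  have b: "((%T. (2*T) powr (-7) * (F0 (2*T) + (1 - euler_mascheroni) * (2*T)) / T) \<longlongrightarrow> 0) at_top"
   unfolding F0_def k_def[symmetric] by real_asymp
  show "((%T. 2 * (2*T) powr (-7) * ((E (2*T) - (F0 (2*T) + (1 - euler_mascheroni) * (2*T))) / (2*T)) + (2*T) powr (-7) * (F0 (2*T) + (1 - euler_mascheroni) * (2*T)) / T) \<longlongrightarrow> 0) at_top"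
   using tendsto_add[OF a b] by simp
  have gen: "2 * p * ((e - f) / (2 * T)) + p * f / T = p * e / T" for p e f T :: real
   by (cases "T = 0") (simp_all add: field_simps)
  show "\<forall>\<^sub>F T in at_top. 2 * (2*T) powr (-7) * ((E (2*T) - (F0 (2*T) + (1 - euler_mascheroni) * (2*T))) / (2*T)) + (2*T) powr (-7) * (F0 (2*T) + (1 - euler_mascheroni) * (2*T)) / T = (2 * T) powr (-7) * E (2*T) / T"
   by (intro always_eventually allI gen)
 qed
 have l: "((%T. (E T - FF T) / T - (2 * T) powr (-7) * E (2*T) / T) \<longlongrightarrow> 1 - euler_mascheroni) at_top"
  using tendsto_diff[OF u t] by simp
 have bnd: "\<forall>\<^sub>F T in at_top. (E T - FF T) / T - (2 * T) powr (-7) * E (2*T) / T <= (GL \<mu> (2*T) - FF T) / T & (GL \<mu> (2*T) - FF T) / T <= (E T - FF T) / T"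
  using eventually_gt_at_top[of y0] eventually_gt_at_top[of 1]
 proof eventually_elim
  case (elim T)
  have m: "\<mu> (2*T) >= 7 * (2*T) * ln (2*T)" using mu[of "2*T"] elim by linarith
  moreover have "7 * (2*T) * ln (2*T) > 0" using elim by (intro mult_pos_pos) auto
  ultimately have M: "\<mu> (2*T) > 0" by linarith
  note b = GL_bounds[of T E \<mu>, OF _ E(1) E(2) E(1) E(2) M]
  have "7 * ln (2*T) <= \<mu> (2*T) / (2*T)" using m elim by (simp add: pos_le_divide_eq mult_ac)
  then have "exp (- (\<mu> (2*T) / (2*T))) <= (2*T) powr (-7)" using elim by (simp add: powr_def)
  then have "exp (- (\<mu> (2*T) / (2*T))) * E (2*T) <= (2*T) powr (-7) * E (2*T)" using E(2)[of "2*T"] elim by (intro mult_right_mono) auto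
  then have 1: "E T - FF T - (2*T) powr (-7) * E (2*T) <= GL \<mu> (2*T) - FF T" using b elim by simp
  have 2: "GL \<mu> (2*T) - FF T <= E T - FF T" using b elim by simp
  show ?case using divide_right_mono[OF 1, of T] divide_right_mono[OF 2, of T] elim by (simp add: diff_divide_distrib)
 qed
 show ?thesis
  by (rule tendsto_sandwich[OF _ _ l u]) (use bnd in \<open>auto elim: eventually_mono\<close>)
qed

text \<open>Supplies the upper end of the bracket in which the inverse ladder is found: an increase
  of about (1 - c) T, less than 2 T, is reached before 2 T.\<close>

lemma FF_double: "\<forall>\<^sub>F T in at_top. FF (2*T) - FF T >= 2 * T"
proof -
 obtain v0 where v0: "v0 >= 1" "!!v. v >= v0 ==> \<bar>FF v - F0 v\<bar> <= 1 * v" using FF_approx[of 1] by auto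
 define k where "k = 2 * euler_mascheroni - 1 - ln (2 * pi)"
 have "\<forall>\<^sub>F T in at_top. F0 (2*T) - F0 T >= 5 * T" unfolding F0_def k_def[symmetric] by real_asymp
 then show ?thesis using eventually_ge_at_top[of v0]
 proof eventually_elim
  case (elim T)
  then show ?case using v0(2)[of T] v0(2)[of "2*T"] v0(1) by linarith
 qed
qed

text \<open>The ladder equation is read from right to left: X = 2 T is prescribed and b is
  determined by F(b). Strict monotonicity in X makes 2 T the only solution belonging to b, which
  puts b into the domain. Strict monotonicity of F leaves no other point of the domain with ladder
  value T.\<close>

lemma ladder1_inv_spec:
 assumes y0: "y0 >= 0" and mono: "mono_on {y0<..} \<mu>" and T: "2*T > y0" "T > 0" and M: "\<mu> (2*T) > 0"
  and b: "b > 0" "FF b = GL \<mu> (2*T)"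
 shows "ladder1_inv y0 \<mu> T = b"
proof -
 have le: "ladder_eq \<mu> x X \<longleftrightarrow> GL \<mu> X = FF x" for x X by (simp add: ladder_eq_def GL_def FF_def)
 have uniq: "X = 2*T" if "X > y0" "GL \<mu> X = GL \<mu> (2*T)" for X
 proof (rule ccontr)
  assume "X ~= 2*T"
  then consider "X < 2*T" | "X > 2*T" by linarith
  then show False
  proof cases
   case 1
   have "\<mu> X <= \<mu> (2*T)" using mono_onD[OF mono, of X "2*T"] that T 1 by simp
   then show False using GL_strict[of X "2*T" \<mu>] that y0 1 M by simp
  next
   case 2
   have "\<mu> (2*T) <= \<mu> X" using mono_onD[OF mono, of "2*T" X] that T 2 by simp
   then show False using GL_strict[of "2*T" X \<mu>] that T 2 M by simp
  qed
 qed
 have dom: "b \<in> ladder_dom y0 \<mu>" unfolding ladder_dom_def le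
  using b T uniq by (auto intro!: ex1I[of _ "2*T"])
 have lad: "ladder y0 \<mu> b = 2*T" unfolding ladder_def le
  by (rule the_equality) (use b T uniq in auto)
 show ?thesis unfolding ladder1_inv_def the_inv_into_def
 proof (rule the_equality)
  show "b \<in> ladder_dom y0 \<mu> & ladder1 y0 \<mu> b = T" using dom lad by (simp add: ladder1_def)
  fix x assume x: "x \<in> ladder_dom y0 \<mu> & ladder1 y0 \<mu> x = T"
  then have "ladder y0 \<mu> x = 2*T" "x > 0" by (auto simp: ladder1_def ladder_dom_def)
  moreover have "ladder_eq \<mu> x (ladder y0 \<mu> x)"
   using theI'[of "%X. X > y0 & ladder_eq \<mu> x X"] x unfolding ladder_dom_def ladder_def by blast
  ultimately have "FF x = FF b" using b unfolding le by simp
  then show "x = b" using FF_strict[of x b] FF_strict[of b x] \<open>x > 0\<close> b by (metis less_eq_real_def linorder_less_linear order_less_irrefl)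
 qed
qed

section \<open>The sum over consecutive zeros\<close>

text \<open>The telescoped sum depends only on the first and the last zero in (T, b). Any two zeros
  t1 and t2 in the interval bound their positions, so the extreme zeros need not be located.\<close>

lemma zero_sum_bounds:
 assumes b: "b = ladder1_inv y0 \<mu> T" and T: "T >= 0" "T < b"
  and z: "T < t1" "t1 < b" "RS_Z t1 = 0" "T < t2" "t2 < b" "RS_Z t2 = 0"
 shows "FF t2 - FF t1 <= zero_sum y0 \<mu> T" "zero_sum y0 \<mu> T <= FF b - FF T"
proof -
 let ?S = "Z_zeros T b"
 define xs where "xs = sorted_list_of_set ?S"
 have fin: "finite ?S" unfolding Z_zeros_def by (rule finite_subset[OF _ finite_zeros[of T b]]) auto
 have xs: "set xs = ?S" "sorted xs" "length xs = card ?S" using fin by (auto simp: xs_def)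
 define N where "N = card ?S - 1"
 have mem: "t1 \<in> ?S" "t2 \<in> ?S" using z by (auto simp: Z_zeros_def)
 \<comment> \<open>Nonemptiness makes the subtraction in N exact, and then the list has N + 1
   entries.\<close>
 then have "card ?S > 0" using fin by (auto simp: card_gt_0_iff)
 then have len: "length xs = Suc N" using xs by (simp add: N_def)
 have zn: "zero_nth T b n = xs ! (n - 1)" for n by (simp add: zero_nth_def xs_def)
 have inS: "xs ! i \<in> ?S" if "i <= N" for i using that len xs(1) nth_mem[of i xs] by auto
 have pos: "T < xs ! i" "xs ! i < b" if "i <= N" for i using inS[OF that] by (auto simp: Z_zeros_def)
 have "zero_sum y0 \<mu> T = (\<Sum>n = 1..N. integral {zero_nth T b n..zero_nth T b (n + 1)} (%t. (RS_Z t)\<^sup>2))"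
  by (simp add: zero_sum_def b[symmetric] N_def Let_def)
 also have "... = (\<Sum>n = 1..N. FF (zero_nth T b (Suc n)) - FF (zero_nth T b n))"
 proof (rule sum.cong[OF refl])
  fix n assume n: "n \<in> {1..N}"
  have "xs ! (n - 1) <= xs ! n" using xs(2) n len by (intro sorted_nth_mono) auto
  moreover have "0 <= xs ! (n - 1)"
  proof -
   have "n - 1 <= N" using n by auto
   from pos(1)[OF this] T show ?thesis by linarith
  qed
  ultimately show "integral {zero_nth T b n..zero_nth T b (n + 1)} (%t. (RS_Z t)\<^sup>2) = FF (zero_nth T b (Suc n)) - FF (zero_nth T b n)"
   unfolding zn using FF_diff[of "xs ! (n - 1)" "xs ! n"] by simp
 qed
 also have "... = FF (xs ! N) - FF (xs ! 0)"
  using sum_Suc_diff[of 1 N "%n. FF (zero_nth T b n)"] by (simp add: zn)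
 finally have eq: "zero_sum y0 \<mu> T = FF (xs ! N) - FF (xs ! 0)" .
 have ext: "xs ! 0 <= t" "t <= xs ! N" if "t \<in> ?S" for t
 proof -
  obtain i where i: "i < length xs" "xs ! i = t" using \<open>t \<in> ?S\<close> xs(1) by (metis in_set_conv_nth)
  show "xs ! 0 <= t" "t <= xs ! N" using sorted_nth_mono[OF xs(2), of 0 i] sorted_nth_mono[OF xs(2), of i N] i len by auto
 qed
 have "FF t2 <= FF (xs ! N)" using ext(2)[OF mem(2)] z T by (intro FF_mono) auto
 moreover have "FF (xs ! 0) <= FF t1" using ext(1)[OF mem(1)] pos(1)[of 0] T by (intro FF_mono) auto
 ultimately show "FF t2 - FF t1 <= zero_sum y0 \<mu> T" unfolding eq by linarith
 have "FF (xs ! N) <= FF b" using pos[of N] T by (intro FF_mono) auto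
 moreover have "FF T <= FF (xs ! 0)" using pos(1)[of 0] T by (intro FF_mono) auto
 ultimately show "zero_sum y0 \<mu> T <= FF b - FF T" unfolding eq by linarith
qed

text \<open>Compared with F(b) - F(T), the sum omits only the stretches before the first and after
  the last zero. Each amounts to at most e T, because there is a zero within 3 \<open>hgap T\<close>
  of either end.\<close>

lemma zero_sum_limit:
 assumes y0: "y0 >= 0" and mono: "mono_on {y0<..} \<mu>" and mu: "!!y. y > y0 ==> \<mu> y >= 7 * y * ln y"
 shows "((%T. zero_sum y0 \<mu> T / T) \<longlongrightarrow> 1 - euler_mascheroni) at_top"
proof -
 define g where "g = (%T. (GL \<mu> (2*T) - FF T) / T)"
 have g: "(g \<longlongrightarrow> 1 - euler_mascheroni) at_top" unfolding g_def by (rule GL_asymp[OF mu])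
 have c: "0 < (euler_mascheroni::real)" "(euler_mascheroni::real) < 13/22"
  using euler_mascheroni_pos euler_mascheroni_less_13_over_22 by auto
 have key: "\<forall>\<^sub>F T in at_top. g T - 2 * e <= zero_sum y0 \<mu> T / T & zero_sum y0 \<mu> T / T <= g T" if e: "0 < e" "e <= 1/10" for e
 proof -
  \<comment> \<open>The limit 1 - c lies between 9/22 and 1. The lower threshold 1/5 exceeds e <=
    1/10 and forces b beyond T + 3 \<open>hgap T\<close>; the upper threshold 2 keeps b below 2
    T.\<close>
  have g1: "\<forall>\<^sub>F T in at_top. g T > 1/5" using order_tendstoD(1)[OF g, of "1/5"] c by simp
  have g2: "\<forall>\<^sub>F T in at_top. g T < 2" using order_tendstoD(2)[OF g, of 2] c by simp
  have h1: "\<forall>\<^sub>F T in at_top. hgap T > 0" unfolding hgap_def by real_asymp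
  have h2: "\<forall>\<^sub>F T in at_top. 3 * hgap T <= T/2" unfolding hgap_def by real_asymp
  show ?thesis using g1 g2 h1 h2 short_interval[OF e(1)] FF_double zero_gap eventually_gt_at_top[of y0] eventually_gt_at_top[of 1]
  proof eventually_elim
   fix T :: real
   assume gT: "1/5 < g T" "g T < 2" and hT: "0 < hgap T" "3 * hgap T <= T/2"
    and si: "\<forall>x. T <= x & x <= 2 * T --> FF (x + 3 * hgap T) - FF x <= e * T"
    and db: "2 * T <= FF (2*T) - FF T"
    and zg: "\<forall>ta. T/2 <= ta & ta <= 3 * T --> (\<exists>t. \<bar>t - ta\<bar> <= ln T * T powr (9/10) & RS_Z t = 0)"
    and T: "y0 < T" "1 < T"
   have m: "\<mu> (2*T) >= 7 * (2*T) * ln (2*T)" using mu[of "2*T"] T by linarith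
   moreover have "7 * (2*T) * ln (2*T) > 0" using T by (intro mult_pos_pos) auto
   ultimately have M: "\<mu> (2*T) > 0" by linarith
   have GT: "GL \<mu> (2*T) = FF T + g T * T" using T by (simp add: g_def)
   have lo: "FF (T + 3 * hgap T) < GL \<mu> (2*T)"
   proof -
    have "FF (T + 3 * hgap T) <= FF T + e * T" using spec[OF si, of T] T by simp
    also have "... < FF T + g T * T" using gT e T by simp
    finally show ?thesis using GT by simp
   qed
   have hi: "GL \<mu> (2*T) < FF (2*T)"
   proof -
    have "g T * T < 2 * T" using gT T by (intro mult_strict_right_mono) auto
    then show ?thesis using db GT by linarith
   qed
   have "\<exists>b\<ge>T + 3 * hgap T. b <= 2*T & FF b = GL \<mu> (2*T)"
    using lo hi hT T by (intro IVT' continuous_on_subset[OF FF_cont[of "2*T"]]) auto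
   then obtain b where b: "T + 3 * hgap T <= b" "b <= 2*T" "FF b = GL \<mu> (2*T)" by blast
   have b1: "T + 3 * hgap T < b" using b lo by (metis less_eq_real_def order_less_irrefl)
   have inv: "b = ladder1_inv y0 \<mu> T"
    using ladder1_inv_spec[OF y0 mono _ _ M _ b(3)] T y0 b hT by simp
   have ex: "\<exists>t. \<bar>t - ta\<bar> <= hgap T & RS_Z t = 0" if "T/2 <= ta" "ta <= 3 * T" for ta
    using zg that unfolding hgap_def by blast
   \<comment> \<open>The points at distance 2 \<open>hgap T\<close> from the ends are chosen so that
     a zero within \<open>hgap T\<close> of them lies strictly inside (T, b) and within 3
     \<open>hgap T\<close> of the end.\<close>
   obtain t1 where t1: "\<bar>t1 - (T + 2 * hgap T)\<bar> <= hgap T" "RS_Z t1 = 0" using ex[of "T + 2 * hgap T"] hT T by auto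
   obtain t2 where t2: "\<bar>t2 - (b - 2 * hgap T)\<bar> <= hgap T" "RS_Z t2 = 0" using ex[of "b - 2 * hgap T"] b hT T by auto
   have r1: "T < t1" "t1 <= T + 3 * hgap T" "t1 < b" using t1 hT b1 by linarith+
   have r2: "T < t2" "b - 3 * hgap T <= t2" "t2 < b" using t2 hT b1 by linarith+
   have T0: "T >= 0" "T < b" using T b1 hT by linarith+
   note zs = zero_sum_bounds[OF inv T0 r1(1) r1(3) t1(2) r2(1) r2(3) t2(2)]
   have up: "zero_sum y0 \<mu> T <= g T * T" using zs(2) b(3) GT by linarith
   have s1: "FF t1 - FF T <= e * T"
    using spec[OF si, of T] FF_mono[of t1 "T + 3 * hgap T"] r1 T by linarith
   have s2: "FF b - FF t2 <= e * T"
   proof -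
    have "FF (b - 3 * hgap T + 3 * hgap T) - FF (b - 3 * hgap T) <= e * T"
     using spec[OF si, of "b - 3 * hgap T"] b hT by linarith
    then have "FF b - FF (b - 3 * hgap T) <= e * T" by simp
    then show ?thesis using FF_mono[of "b - 3 * hgap T" t2] r2 T b by linarith
   qed
   have "(g T - 2 * e) * T <= zero_sum y0 \<mu> T"
    using zs(1) s1 s2 b(3) GT by (simp add: left_diff_distrib)
   then show "g T - 2 * e <= zero_sum y0 \<mu> T / T & zero_sum y0 \<mu> T / T <= g T"
    using up T by (simp add: pos_le_divide_eq pos_divide_le_eq)
  qed
 qed
 show ?thesis
 proof (rule tendstoI)
  fix e :: real assume e: "e > 0"
  define d where "d = min (e/4) (1/10)"
  have d: "0 < d" "d <= 1/10" "d <= e/4" using e by (auto simp: d_def)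
  have "\<forall>\<^sub>F T in at_top. dist (g T) (1 - euler_mascheroni) < e/4" using tendstoD[OF g, of "e/4"] e by simp
  then show "\<forall>\<^sub>F T in at_top. dist (zero_sum y0 \<mu> T / T) (1 - euler_mascheroni) < e"
   using key[OF d(1,2)]
  proof eventually_elim
   case (elim T) then show ?case using d e unfolding dist_real_def by linarith
  qed
 qed
qed

text \<open>The inequality for the limit is rendered with an existential \<open>L\<close>, so that
  it also asserts convergence. Since the limit always exists and is unique, the statement for given
  x, y, z, m comes down to the ratio of \<open>x ^ m + y ^ m\<close> and \<open>z ^ m\<close> being
  different from 1.\<close>

theorem theorem2:
  fixes \<mu> :: "real \<Rightarrow> real" and y0 :: real
  assumes "y0 \<ge> 0"
    and "smooth_above y0 \<mu>"
    and "mono_on {y0<..} \<mu>"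
    and "filterlim \<mu> at_top at_top"
    and "\<And>y. y > y0 \<Longrightarrow> \<mu> y \<ge> 7 * y * ln y"
  shows
    "(\<forall>(x::nat) (y::nat) (z::nat) (m::nat). x > 0 \<and> y > 0 \<and> z > 0 \<and> m \<ge> 3 \<longrightarrow>
        (\<exists>L :: real.
           ((\<lambda>\<tau>. 1 / \<tau> * zero_sum y0 \<mu>
                 ((real x ^ m + real y ^ m) / real z ^ m * (\<tau> / (1 - euler_mascheroni))))
             \<longlongrightarrow> L) at_top \<and> L \<noteq> 1))
     \<longleftrightarrow>
     \<not> (\<exists>(x::nat) (y::nat) (z::nat) (m::nat). x > 0 \<and> y > 0 \<and> z > 0 \<and> m \<ge> 3 \<and> x ^ m + y ^ m = z ^ m)"
proof -
 define e where "e = 1 - (euler_mascheroni::real)"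
 have e: "e > 0" using euler_mascheroni_less_13_over_22 by (simp add: e_def)
 note zl = zero_sum_limit[OF assms(1,3,5), folded e_def]
 \<comment> \<open>Here e = 1 - c. For T = r ta / e the quotient by ta is the quotient by T times r
   / e, and the factor e of the limit cancels.\<close>
 have lim: "((%ta. 1 / ta * zero_sum y0 \<mu> (r * (ta / e))) \<longlongrightarrow> r) at_top" if r: "r > 0" for r
 proof -
  have "filterlim (%ta::real. r * (ta / e)) at_top at_top" using r e by real_asymp
  from tendsto_mult[OF filterlim_compose[OF zl this] tendsto_const[of "r/e"]]
  have "((%ta. zero_sum y0 \<mu> (r * (ta / e)) / (r * (ta / e)) * (r/e)) \<longlongrightarrow> r) at_top" using e by simp
  moreover have "s / (r * (ta / e)) * (r/e) = 1 / ta * s" for s ta using r e by (cases "ta = 0") (auto simp: field_simps)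
  ultimately show ?thesis by (simp only:)
 qed
 define Q where "Q = (%x y z m :: nat. \<exists>L :: real. ((%ta. 1 / ta * zero_sum y0 \<mu> ((real x ^ m + real y ^ m) / real z ^ m * (ta / e))) \<longlongrightarrow> L) at_top & L ~= 1)"
 have one: "Q x y z m \<longleftrightarrow> x ^ m + y ^ m ~= z ^ m" if p: "x > 0" "y > 0" "z > 0" for x y z m :: nat
 proof -
  define r where "r = (real x ^ m + real y ^ m) / real z ^ m"
  have "r > 0" unfolding r_def using p by (intro divide_pos_pos add_pos_pos zero_less_power) auto
  then have "(\<exists>L. ((%ta. 1 / ta * zero_sum y0 \<mu> (r * (ta / e))) \<longlongrightarrow> L) at_top & L ~= 1) \<longleftrightarrow> r ~= 1"
   using lim[of r] tendsto_unique[OF trivial_limit_at_top_linorder] by blast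
  also have "r ~= 1 \<longleftrightarrow> real (x ^ m + y ^ m) ~= real (z ^ m)" unfolding r_def using p by simp (rule eq_commute)
  finally show ?thesis unfolding Q_def r_def of_nat_eq_iff .
 qed
 have "(\<forall>(x::nat) (y::nat) (z::nat) (m::nat). x > 0 & y > 0 & z > 0 & m >= 3 --> Q x y z m) \<longleftrightarrow>
   \<not> (\<exists>(x::nat) (y::nat) (z::nat) (m::nat). x > 0 & y > 0 & z > 0 & m >= 3 & x ^ m + y ^ m = z ^ m)" (is "?L \<longleftrightarrow> \<not> ?R")
 proof
  assume L: ?L
  show "\<not> ?R"
  proof (rule notI, elim exE conjE)
   fix x y z m :: nat assume h: "x > 0" "y > 0" "z > 0" "m >= 3" "x ^ m + y ^ m = z ^ m"
   from spec[OF spec[OF spec[OF spec[OF L, of x], of y], of z], of m] have "Q x y z m" by (rule mp) (intro conjI h)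
   with one[OF h(1-3), of m] h(5) show False by simp
  qed
 next
  assume "\<not> ?R"
  then have R: "\<forall>(x::nat) (y::nat) (z::nat) (m::nat). \<not> (x > 0 & y > 0 & z > 0 & m >= 3 & x ^ m + y ^ m = z ^ m)" by (simp only: not_ex simp_thms)
  show ?L
  proof (intro allI impI, elim conjE)
   fix x y z m :: nat assume h: "x > 0" "y > 0" "z > 0" "m >= 3"
   have "x ^ m + y ^ m ~= z ^ m"
   proof
    assume e: "x ^ m + y ^ m = z ^ m"
    from spec[OF spec[OF spec[OF spec[OF R, of x], of y], of z], of m] show False by (rule notE) (intro conjI h e)
   qed
   then show "Q x y z m" using one[OF h(1-3), of m] by simp
  qed
 qed
 then show ?thesis unfolding Q_def e_def .
qed

end
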